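(* Let $U\subseteq M$ be open, $l\in\mathbb C^\times$, and let $f:U\to\mathbb C$ be an eigenfunction of the Laplace-Beltrami operator ($-\Delta f=\lambda f$) whose eigenvalue $\lambda\in\mathbb{C}$ is generic, i.e. $\lambda\ne q(q-1)K$ for every $q\in\mathbb Z_+$. Then the $V(l,\mathbf 1)$-module $V^{(2)}_U(l,f)$ is irreducible.
   Context: Geometry: $M$ is a two-dimensional, connected, complete, orientable Riemannian manifold of constant sectional curvature $K\neq0$; $E=\mathbb C\otimes_{\mathbb R}TM$ with complex-linearly extended Levi-Civita connection $\nabla$ and complex-bilinearly extended metric $(\cdot,\cdot)$. Fix $p\in M$, an orthonormal basis $e_1,e_2$ of $T_pM$, and $h_\pm=e_1\mp\sqrt{-1}e_2\in E_p$, so $(h_\pm,h_\pm)=0$, $(h_+,h_-)=2$. $\Pi(T(E))$ is the algebra of parallel sections of $T(E)=\bigoplus_kE^{\otimes k}$, identified by evaluation at $p$ with the subalgebra of the tensor algebra $T(E_p)$ spanned by the words $h_{i_1}\otimes\cdots\otimes h_{i_k}$ with as many $+$ as $-$. $X\in\Pi(E^{\otimes k})$ acts on $C^\infty(U)$ (complex valued) by $g\mapsto(\nabla^kg)(X)$, with $(\nabla^kg)(Z_1,\dots,Z_k)=(\nabla_{Z_1}(\nabla^{k-1}g))(Z_2,\dots,Z_k)$. Eigenfunctions are nonzero. Modes: for a left $T(E_p)$-module $S$ put $F(S)=T(\widehat E_{p,-})\otimes S$, $\widehat E_{p,-}=E_p\otimes t^{-1}\mathbb C[t^{-1}]$. For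 $a\in E_p$: $a(-m)$ ($m>0$) is left multiplication by $a\otimes t^{-m}$; $a(0)$ acts as $1\otimes a$ through $S$; $a(m)$ ($m>0$) kills $1\otimes S$ and satisfies $a(m)b(-n)=b(-n)a(m)+m(a,b)\delta_{m,n}l$. Set $a(x)=\sum_na(n)x^{-n-1}$; normal ordering ${:}\ {:}$ places negative modes first, then positive modes, then zero modes, preserving relative order in each group. $V=V(l,\mathbf 1)$ has basis the words $v=h_{i_1}(-m_1)\cdots h_{i_s}(-m_s)\mathbf 1$ with $m_j\in\mathbb Z_+$ and as many $+$ as $-$; it acts on $F(S)$ by $Y(v,x)={:}\prod_{j=1}^s\frac1{(m_j-1)!}\frac{d^{m_j-1}}{dx^{m_j-1}}h_{i_j}(x){:}=\sum_nv_nx^{-n-1}$ (product in the order $j=1,\dots,s$). $V_U(l,f)$ is the span of all $v_nf$ inside $F(S)$ with $S=T(E_p)\otimes_{\Pi(T(E))}C^\infty(U)$, where $f$ stands for $1\otimes(1\otimes f)$; it is graded by $\mathrm{wt}\,f=0$, each $h_\pm(-t)$ ($t>0$) adding $t$ and each $h_\pm(0)$ adding $0$. Submodules are graded subspaces stable under all $v_n$ ($v\in V,n\in\mathbb Z$); a nonzero module is irreducible if its only submodules are $0$ and itself. Quotients: identify $\pm$ with $\pm1$. For signs $j_1,\dots,j_r$ put $s_q=j_q+\cdots+j_r$ for $q\le r$, $s_{r+1}=0$, and $C_{j_1,\dots,j_r}(\lambda)=\prod_{q:\,|s_q|<|s_{q+1}|}\bigl(-\lambda+|s_{q+1}|(|s_{q+1}|-1)K\bigr)$.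 $V_U^{(1)}(l,f)$ is the quotient of $V_U(l,f)$ by the submodule generated by all $$h_{j_1}(-t_1)\cdots h_{j_k}(-t_k)h_{j_{k+1}}(0)\cdots h_{j_r}(0)f-C_{j_{k+1},\dots,j_r}(\lambda)\,h_{j_1}(-t_1)\cdots h_{j_k}(-t_k)h_{\epsilon}(0)^Nf,$$ where $t_1,\dots,t_k\in\mathbb Z_+$, $\sum_{q=1}^rj_q=0$, $N=|\sum_{q=k+1}^rj_q|$, $\epsilon=\mathrm{sgn}(\sum_{q=k+1}^rj_q)$ (no $h_\epsilon(0)$ if $N=0$). $V_U^{(2)}(l,f)$ is the quotient of $V_U^{(1)}(l,f)$ by the submodule generated by all $$h_{j_1}(-t_1)\cdots h_{j_k}(-t_k)h_{j_{k+1}}(0)\cdots h_{j_r}(0)f-h_{j_{\tau(1)}}(-t_{\tau(1)})\cdots h_{j_{\tau(k)}}(-t_{\tau(k)})h_{j_{k+1}}(0)\cdots h_{j_r}(0)f$$ with $t_1,\dots,t_k\in\mathbb{Z}_+$, $\sum_{q=1}^rj_q=0$, $\tau\in S_k$. *)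

theory Defs
  imports "HOL-Analysis.Analysis" "HOL-Algebra.Module" "HOL-Algebra.AbelCoset"
    "HOL-Combinatorics.Permutations" "HOL-Library.Poly_Mapping"
begin

section \<open>Riemannian surfaces\<close>

subsection \<open>Smooth functions on open subsets of the plane\<close>

definition pd :: "2 \<Rightarrow> (real^2 \<Rightarrow> 'b::real_normed_vector) \<Rightarrow> real^2 \<Rightarrow> 'b" where
  "pd i F x = frechet_derivative F (at x) (axis i 1)"

primrec Ck_on :: "nat \<Rightarrow> (real^2) set \<Rightarrow> (real^2 \<Rightarrow> 'b::real_normed_vector) \<Rightarrow> bool" where
  "Ck_on 0 S F \<longleftrightarrow> continuous_on S F"
| "Ck_on (Suc k) S F \<longleftrightarrow> F differentiable_on S \<and> (\<forall>i. Ck_on k S (pd i F))"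

text \<open>Only meant for open \<open>S\<close>.\<close>

definition smooth_on :: "(real^2) set \<Rightarrow> (real^2 \<Rightarrow> 'b::real_normed_vector) \<Rightarrow> bool" where
  "smooth_on S F \<longleftrightarrow> (\<forall>k. Ck_on k S F)"

subsection \<open>Atlases\<close>

text \<open>The surface is the whole type \<open>'m\<close>; a chart consists of its domain and its coordinate map.\<close>

type_synonym 'm chart = "'m set \<times> ('m \<Rightarrow> real^2)"

abbreviation cdom :: "'m chart \<Rightarrow> 'm set" where "cdom \<equiv> fst"

abbreviation coord :: "'m chart \<Rightarrow> 'm \<Rightarrow> real^2" where "coord \<equiv> snd"

definition cinv :: "'m chart \<Rightarrow> real^2 \<Rightarrow> 'm" where
  "cinv c = inv_into (cdom c) (coord c)"

definition trans_map :: "'m chart \<Rightarrow> 'm chart \<Rightarrow> real^2 \<Rightarrow> real^2" where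
  "trans_map c d = coord d \<circ> cinv c"

definition smooth_atlas :: "'m::topological_space chart set \<Rightarrow> bool" where
  "smooth_atlas A \<longleftrightarrow>
     (\<Union>c\<in>A. cdom c) = UNIV \<and>
     (\<forall>c\<in>A. open (cdom c) \<and> open (coord c ` cdom c) \<and>
        homeomorphism (cdom c) (coord c ` cdom c) (coord c) (cinv c)) \<and>
     (\<forall>c\<in>A. \<forall>d\<in>A. smooth_on (coord c ` (cdom c \<inter> cdom d)) (trans_map c d))"

definition orientable :: "'m::topological_space chart set \<Rightarrow> bool" where
  "orientable A \<longleftrightarrow>
     (\<exists>B. smooth_atlas B \<and> smooth_atlas (A \<union> B) \<and>
        (\<forall>c\<in>B. \<forall>d\<in>B. \<forall>x\<in>coord c ` (cdom c \<inter> cdom d).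
           det (jacobian (trans_map c d) (at x)) > 0))"

text \<open>\<open>G c x\<close> is the Gram matrix of the metric in the chart \<open>c\<close> at the coordinate point \<open>x\<close>.\<close>

locale riemannian_surface =
  fixes A :: "'m::{t2_space,second_countable_topology} chart set"
    and G :: "'m chart \<Rightarrow> real^2 \<Rightarrow> real^2^2"
  assumes atlas: "smooth_atlas A"
    and metric_smooth: "c \<in> A \<Longrightarrow> smooth_on (coord c ` cdom c) (G c)"
    and metric_sym: "\<lbrakk>c \<in> A; x \<in> coord c ` cdom c\<rbrakk> \<Longrightarrow> transpose (G c x) = G c x"
    and metric_pos: "\<lbrakk>c \<in> A; x \<in> coord c ` cdom c; v \<noteq> 0\<rbrakk> \<Longrightarrow> v \<bullet> (G c x *v v) > 0"
    and metric_trans: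
      "\<lbrakk>c \<in> A; d \<in> A; x \<in> coord c ` (cdom c \<inter> cdom d)\<rbrakk> \<Longrightarrow>
         G c x = transpose (jacobian (trans_map c d) (at x)) ** G d (trans_map c d x)
                   ** jacobian (trans_map c d) (at x)"

subsection \<open>Levi-Civita connection and curvature\<close>

text \<open>In this and the following subsection \<open>g\<close> is the Gram matrix of the metric in one chart.
  \<open>christoffel g x k i j\<close> is the Christoffel symbol with upper index \<open>k\<close> and lower indices
  \<open>i\<close>, \<open>j\<close>.\<close>

definition christoffel :: "(real^2 \<Rightarrow> real^2^2) \<Rightarrow> real^2 \<Rightarrow> 2 \<Rightarrow> 2 \<Rightarrow> 2 \<Rightarrow> real" where
  "christoffel g x k i j =
     (1/2) * (\<Sum>m\<in>UNIV. matrix_inv (g x) $ k $ m *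
        (pd i (\<lambda>y. g y $ j $ m) x + pd j (\<lambda>y. g y $ i $ m) x - pd m (\<lambda>y. g y $ i $ j) x))"

text \<open>\<open>riemann g x m i j k\<close> is the \<open>m\<close>-th component of
  \<open>R(\<partial>\<^sub>i,\<partial>\<^sub>j)\<partial>\<^sub>k\<close>, where
  \<open>R(X,Y) = [\<nabla>\<^sub>X,\<nabla>\<^sub>Y] - \<nabla>\<^bsub>[X,Y]\<^esub>\<close>.\<close>

definition riemann :: "(real^2 \<Rightarrow> real^2^2) \<Rightarrow> real^2 \<Rightarrow> 2 \<Rightarrow> 2 \<Rightarrow> 2 \<Rightarrow> 2 \<Rightarrow> real" where
  "riemann g x m i j k =
     pd i (\<lambda>y. christoffel g y m j k) x - pd j (\<lambda>y. christoffel g y m i k) x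
     + (\<Sum>n\<in>UNIV. christoffel g x m i n * christoffel g x n j k
                  - christoffel g x m j n * christoffel g x n i k)"

definition riemann_vec :: "(real^2 \<Rightarrow> real^2^2) \<Rightarrow> real^2 \<Rightarrow> real^2 \<Rightarrow> real^2 \<Rightarrow> real^2 \<Rightarrow> real^2" where
  "riemann_vec g x u v w =
     (\<chi> m. \<Sum>i\<in>UNIV. \<Sum>j\<in>UNIV. \<Sum>k\<in>UNIV. u $ i * v $ j * w $ k * riemann g x m i j k)"

definition gdot :: "(real^2 \<Rightarrow> real^2^2) \<Rightarrow> real^2 \<Rightarrow> real^2 \<Rightarrow> real^2 \<Rightarrow> real" where
  "gdot g x u v = u \<bullet> (g x *v v)"

definition sectional_curvature :: "(real^2 \<Rightarrow> real^2^2) \<Rightarrow> real^2 \<Rightarrow> real^2 \<Rightarrow> real^2 \<Rightarrow> real" where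
  "sectional_curvature g x u v =
     gdot g x (riemann_vec g x u v v) u / (gdot g x u u * gdot g x v v - (gdot g x u v)\<^sup>2)"

definition constant_curvature ::
    "'m chart set \<Rightarrow> ('m chart \<Rightarrow> real^2 \<Rightarrow> real^2^2) \<Rightarrow> real \<Rightarrow> bool" where
  "constant_curvature A G K \<longleftrightarrow>
     (\<forall>c\<in>A. \<forall>x\<in>coord c ` cdom c. \<forall>u v. u \<noteq> v \<and> independent {u, v} \<longrightarrow>
        sectional_curvature (G c) x u v = K)"

text \<open>Completeness is geodesic completeness: every tangent vector is the initial velocity of a
  geodesic defined on the whole real line.\<close>

definition geodesic ::
    "'m::topological_space chart set \<Rightarrow> ('m chart \<Rightarrow> real^2 \<Rightarrow> real^2^2) \<Rightarrow> (real \<Rightarrow> 'm) \<Rightarrow> bool" where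
  "geodesic A G \<gamma> \<longleftrightarrow> continuous_on UNIV \<gamma> \<and>
     (\<forall>c\<in>A. \<forall>t. \<gamma> t \<in> cdom c \<longrightarrow>
        (let y = coord c \<circ> \<gamma>; y' = (\<lambda>s. vector_derivative y (at s)) in
          (y has_vector_derivative y' t) (at t) \<and>
          (y' has_vector_derivative
             (\<chi> k. - (\<Sum>i\<in>UNIV. \<Sum>j\<in>UNIV.
                       christoffel (G c) (y t) k i j * y' t $ i * y' t $ j))) (at t)))"

definition complete_surface ::
    "'m::topological_space chart set \<Rightarrow> ('m chart \<Rightarrow> real^2 \<Rightarrow> real^2^2) \<Rightarrow> bool" where
  "complete_surface A G \<longleftrightarrow>
     (\<forall>c\<in>A. \<forall>q\<in>cdom c. \<forall>v. \<exists>\<gamma>. geodesic A G \<gamma> \<and> \<gamma> 0 = q \<and>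
        ((coord c \<circ> \<gamma>) has_vector_derivative v) (at 0))"

subsection \<open>Covariant derivatives and the Laplace-Beltrami operator\<close>

text \<open>Complex covariant (resp. contravariant) tensor fields of rank \<open>k\<close> in a chart are given by
  their components, indexed by lists of length \<open>k\<close>. The direction of differentiation is the first
  index of \<open>cov_deriv g T\<close>.\<close>

type_synonym tensor_comps = "2 list \<Rightarrow> real^2 \<Rightarrow> complex"

definition cov_deriv :: "(real^2 \<Rightarrow> real^2^2) \<Rightarrow> tensor_comps \<Rightarrow> tensor_comps" where
  "cov_deriv g T = (\<lambda>idx x. case idx of [] \<Rightarrow> 0
     | i # js \<Rightarrow> pd i (T js) x
         - (\<Sum>r<length js. \<Sum>m\<in>UNIV. christoffel g x m i (js ! r) *\<^sub>R T (js[r := m]) x))"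

primrec nabla :: "(real^2 \<Rightarrow> real^2^2) \<Rightarrow> nat \<Rightarrow> (real^2 \<Rightarrow> complex) \<Rightarrow> tensor_comps" where
  "nabla g 0 F = (\<lambda>_. F)"
| "nabla g (Suc k) F = cov_deriv g (nabla g k F)"

definition contra_deriv ::
    "(real^2 \<Rightarrow> real^2^2) \<Rightarrow> 2 \<Rightarrow> tensor_comps \<Rightarrow> tensor_comps" where
  "contra_deriv g i X = (\<lambda>idx x. pd i (X idx) x
     + (\<Sum>r<length idx. \<Sum>m\<in>UNIV. christoffel g x (idx ! r) i m *\<^sub>R X (idx[r := m]) x))"

definition grad :: "(real^2 \<Rightarrow> real^2^2) \<Rightarrow> (real^2 \<Rightarrow> complex) \<Rightarrow> 2 \<Rightarrow> real^2 \<Rightarrow> complex" where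
  "grad g F i x = (\<Sum>j\<in>UNIV. (matrix_inv (g x) $ i $ j) *\<^sub>R pd j F x)"

definition divergence :: "(real^2 \<Rightarrow> real^2^2) \<Rightarrow> (2 \<Rightarrow> real^2 \<Rightarrow> complex) \<Rightarrow> real^2 \<Rightarrow> complex" where
  "divergence g Y x = (\<Sum>i\<in>UNIV. contra_deriv g i (\<lambda>idx. Y (hd idx)) [i] x)"

definition laplace :: "(real^2 \<Rightarrow> real^2^2) \<Rightarrow> (real^2 \<Rightarrow> complex) \<Rightarrow> real^2 \<Rightarrow> complex" where
  "laplace g F = divergence g (grad g F)"

text \<open>Functions on an open set \<open>U\<close> are represented by their extension by zero, so that distinct
  elements of the following set are distinct functions on \<open>U\<close>.\<close>

definition smooth_fun :: "'m chart set \<Rightarrow> 'm set \<Rightarrow> ('m \<Rightarrow> complex) set" where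
  "smooth_fun A U = {h. (\<forall>q. q \<notin> U \<longrightarrow> h q = 0) \<and>
     (\<forall>c\<in>A. smooth_on (coord c ` (cdom c \<inter> U)) (h \<circ> cinv c))}"

definition eigenfunction ::
    "'m chart set \<Rightarrow> ('m chart \<Rightarrow> real^2 \<Rightarrow> real^2^2) \<Rightarrow> 'm set \<Rightarrow> complex \<Rightarrow> ('m \<Rightarrow> complex) \<Rightarrow> bool" where
  "eigenfunction A G U lam f \<longleftrightarrow> f \<in> smooth_fun A U \<and> (\<exists>q\<in>U. f q \<noteq> 0) \<and>
     (\<forall>c\<in>A. \<forall>q\<in>cdom c \<inter> U. - laplace (G c) (f \<circ> cinv c) (coord c q) = lam * f q)"

subsection \<open>Parallel tensor fields and their action on functions\<close>

text \<open>The set of global parallel sections of \<open>E\<^sup>\<otimes>\<^sup>k\<close>, where a section is given by its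
  components in all charts of the atlas.\<close>

definition parallel_sections ::
    "'m chart set \<Rightarrow> ('m chart \<Rightarrow> real^2 \<Rightarrow> real^2^2) \<Rightarrow> nat \<Rightarrow> ('m chart \<Rightarrow> tensor_comps) set" where
  "parallel_sections A G k = {X.
     (\<forall>c\<in>A. \<forall>idx. length idx = k \<longrightarrow> smooth_on (coord c ` cdom c) (X c idx)) \<and>
     (\<forall>c\<in>A. \<forall>d\<in>A. \<forall>x\<in>coord c ` (cdom c \<inter> cdom d). \<forall>idx. length idx = k \<longrightarrow>
        X d idx (trans_map c d x) =
          (\<Sum>jdx | length jdx = k.
             (\<Prod>r<k. jacobian (trans_map c d) (at x) $ (idx ! r) $ (jdx ! r)) *\<^sub>R X c jdx x)) \<and>
     (\<forall>c\<in>A. \<forall>x\<in>coord c ` cdom c. \<forall>i idx. length idx = k \<longrightarrow>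
        contra_deriv (G c) i (X c) idx x = 0)}"

text \<open>The function \<open>h \<mapsto> (\<nabla>\<^sup>k h)(X)\<close> on \<open>U\<close>. The complete contraction does not
  depend on the chart in which it is computed.\<close>

definition section_act ::
    "'m chart set \<Rightarrow> ('m chart \<Rightarrow> real^2 \<Rightarrow> real^2^2) \<Rightarrow> 'm set \<Rightarrow> nat \<Rightarrow> ('m chart \<Rightarrow> tensor_comps)
      \<Rightarrow> ('m \<Rightarrow> complex) \<Rightarrow> 'm \<Rightarrow> complex" where
  "section_act A G U k X h = (\<lambda>q. if q \<in> U then
       (let c = (SOME c. c \<in> A \<and> q \<in> cdom c); x = coord c q in
         \<Sum>idx | length idx = k. nabla (G c) k (h \<circ> cinv c) idx x * X c idx x)
     else 0)"

section \<open>Modules\<close>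

subsection \<open>Complex vector spaces with operators, quotients\<close>

text \<open>Vector spaces are records of type \<open>(complex, 'a) module\<close>; as always for this record type,
  the ring multiplication and unit on \<open>'a\<close> play no role.\<close>

definition complex_field :: "complex ring" where
  "complex_field = \<lparr>carrier = UNIV, mult = (*), one = 1, zero = 0, add = (+)\<rparr>"

definition lspan :: "(complex, 'a, 'x) module_scheme \<Rightarrow> 'a set \<Rightarrow> 'a set" where
  "lspan M X = \<Inter>{W. submodule W complex_field M \<and> X \<subseteq> W}"

definition quot_map ::
    "(complex, 'a, 'x) module_scheme \<Rightarrow> 'a set \<Rightarrow> ('a \<Rightarrow> 'a) \<Rightarrow> 'a set \<Rightarrow> 'a set" where
  "quot_map M H F Q = (\<Union>a\<in>Q. H +>\<^bsub>M\<^esub> F a)"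

definition quot_space :: "(complex, 'a, 'x) module_scheme \<Rightarrow> 'a set \<Rightarrow> (complex, 'a set) module" where
  "quot_space M H = \<lparr>carrier = a_rcosets\<^bsub>M\<^esub> H, mult = undefined, one = undefined,
     zero = H, add = set_add M, smult = (\<lambda>z. quot_map M H (\<lambda>a. z \<odot>\<^bsub>M\<^esub> a))\<rparr>"

subsection \<open>Left modules over the tensor algebra of \<open>E\<^sub>p\<close>\<close>

datatype charge = Pls | Mns

fun cval :: "charge \<Rightarrow> int" where
  "cval Pls = 1" | "cval Mns = -1"

fun opp :: "charge \<Rightarrow> charge" where
  "opp Pls = Mns" | "opp Mns = Pls"

definition charge_sum :: "charge list \<Rightarrow> int" where
  "charge_sum js = sum_list (map cval js)"

text \<open>\<open>T(E\<^sub>p)\<close> is the free algebra on \<open>h\<^sub>+\<close>, \<open>h\<^sub>-\<close>, so that a left module is a vector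
  space with two linear operators \<open>hmul Pls\<close>, \<open>hmul Mns\<close>.\<close>

record 'a tmodule = "(complex, 'a) module" +
  hmul :: "charge \<Rightarrow> 'a \<Rightarrow> 'a"

text \<open>Components of \<open>h\<^sub>\<plusminus> = e\<^sub>1 \<mp> \<i> e\<^sub>2\<close> for tangent vectors given by their components in a
  chart.\<close>

definition hvec :: "real^2 \<Rightarrow> real^2 \<Rightarrow> charge \<Rightarrow> complex^2" where
  "hvec e1 e2 j = (\<chi> a. complex_of_real (e1 $ a) - of_int (cval j) * \<i> * complex_of_real (e2 $ a))"

text \<open>\<open>T(E\<^sub>p) \<otimes>\<^sub>\<complex> C\<^sup>\<infinity>(U)\<close>: finitely supported functions from words in
  \<open>h\<^sub>+\<close>, \<open>h\<^sub>-\<close> to \<open>C\<^sup>\<infinity>(U)\<close>.\<close>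

definition pretensor :: "'m chart set \<Rightarrow> 'm set \<Rightarrow> (charge list \<Rightarrow> 'm \<Rightarrow> complex) tmodule" where
  "pretensor A U = \<lparr>
     carrier = {\<xi>. finite {w. \<xi> w \<noteq> (\<lambda>_. 0)} \<and> (\<forall>w. \<xi> w \<in> smooth_fun A U)},
     mult = undefined, one = undefined,
     zero = (\<lambda>w q. 0), add = (\<lambda>\<xi> \<eta> w q. \<xi> w q + \<eta> w q), smult = (\<lambda>z \<xi> w q. z * \<xi> w q),
     hmul = (\<lambda>j \<xi> w. case w of [] \<Rightarrow> (\<lambda>_. 0) | i # w' \<Rightarrow> if i = j then \<xi> w' else (\<lambda>_. 0))\<rparr>"

definition tens :: "charge list \<Rightarrow> ('m \<Rightarrow> complex) \<Rightarrow> charge list \<Rightarrow> 'm \<Rightarrow> complex" where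
  "tens w h = (\<lambda>w' q. if w' = w then h q else 0)"

text \<open>The elements \<open>uX \<otimes> h - u \<otimes> Xh\<close>, for \<open>u\<close> a word, \<open>X\<close> a homogeneous parallel section
  with value \<open>\<Sum>\<^sub>w a\<^sub>w w\<close> at the base point \<open>p\<close>, and \<open>h\<close> smooth on \<open>U\<close>.
  The orthonormal basis \<open>e1\<close>, \<open>e2\<close> of the tangent space at \<open>p\<close> is given by its components in
  the chart \<open>c0\<close>.\<close>

definition balance_rels ::
    "'m chart set \<Rightarrow> ('m chart \<Rightarrow> real^2 \<Rightarrow> real^2^2) \<Rightarrow> 'm chart \<Rightarrow> 'm \<Rightarrow> real^2 \<Rightarrow> real^2
      \<Rightarrow> 'm set \<Rightarrow> (charge list \<Rightarrow> 'm \<Rightarrow> complex) set" where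
  "balance_rels A G c0 p e1 e2 U =
     {(\<lambda>w' q. (\<Sum>w | length w = k. a w * tens (u @ w) h w' q)
               - tens u (section_act A G U k X h) w' q) | u k X a h.
        X \<in> parallel_sections A G k \<and> h \<in> smooth_fun A U \<and>
        (\<forall>idx. length idx = k \<longrightarrow>
           X c0 idx (coord c0 p) =
             (\<Sum>w | length w = k. a w * (\<Prod>r<k. hvec e1 e2 (w ! r) $ (idx ! r))))}"

definition balance_null ::
    "'m chart set \<Rightarrow> ('m chart \<Rightarrow> real^2 \<Rightarrow> real^2^2) \<Rightarrow> 'm chart \<Rightarrow> 'm \<Rightarrow> real^2 \<Rightarrow> real^2
      \<Rightarrow> 'm set \<Rightarrow> (charge list \<Rightarrow> 'm \<Rightarrow> complex) set" where
  "balance_null A G c0 p e1 e2 U = lspan (pretensor A U) (balance_rels A G c0 p e1 e2 U)"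

text \<open>\<open>T(E\<^sub>p) \<otimes>\<^bsub>\<Pi>(T(E))\<^esub> C\<^sup>\<infinity>(U)\<close> and its element \<open>1 \<otimes> f\<close>.\<close>

definition tensor_module ::
    "'m chart set \<Rightarrow> ('m chart \<Rightarrow> real^2 \<Rightarrow> real^2^2) \<Rightarrow> 'm chart \<Rightarrow> 'm \<Rightarrow> real^2 \<Rightarrow> real^2
      \<Rightarrow> 'm set \<Rightarrow> (charge list \<Rightarrow> 'm \<Rightarrow> complex) set tmodule" where
  "tensor_module A G c0 p e1 e2 U =
     (let T = pretensor A U; R = balance_null A G c0 p e1 e2 U in
       module.extend (quot_space T R) (tmodule.fields (\<lambda>j. quot_map T R (hmul T j))))"

definition one_tensor ::
    "'m chart set \<Rightarrow> ('m chart \<Rightarrow> real^2 \<Rightarrow> real^2^2) \<Rightarrow> 'm chart \<Rightarrow> 'm \<Rightarrow> real^2 \<Rightarrow> real^2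
      \<Rightarrow> 'm set \<Rightarrow> ('m \<Rightarrow> complex) \<Rightarrow> (charge list \<Rightarrow> 'm \<Rightarrow> complex) set" where
  "one_tensor A G c0 p e1 e2 U f = balance_null A G c0 p e1 e2 U +>\<^bsub>pretensor A U\<^esub> tens [] f"

subsection \<open>The space \<open>F(S)\<close> and the modes\<close>

text \<open>The pair \<open>(j, m)\<close> with \<open>m > 0\<close> stands for \<open>h\<^sub>j(-m)\<close>, i.e. for
  \<open>h\<^sub>j \<otimes> t\<^sup>-\<^sup>m\<close>. Elements of \<open>F(S)\<close> are finitely supported functions from words
  in these letters to \<open>S\<close>.\<close>

type_synonym word = "(charge \<times> nat) list"

definition is_word :: "word \<Rightarrow> bool" where
  "is_word u \<longleftrightarrow> (\<forall>(j, m)\<in>set u. m > 0)"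

definition word_wt :: "word \<Rightarrow> nat" where
  "word_wt u = sum_list (map snd u)"

definition fock_space :: "('a, 'x) tmodule_scheme \<Rightarrow> (complex, word \<Rightarrow> 'a) module" where
  "fock_space S = \<lparr>
     carrier = {\<phi>. finite {u. \<phi> u \<noteq> \<zero>\<^bsub>S\<^esub>} \<and> (\<forall>u. \<phi> u \<in> carrier S) \<and>
                    (\<forall>u. \<phi> u \<noteq> \<zero>\<^bsub>S\<^esub> \<longrightarrow> is_word u)},
     mult = undefined, one = undefined,
     zero = (\<lambda>u. \<zero>\<^bsub>S\<^esub>), add = (\<lambda>\<phi> \<psi> u. \<phi> u \<oplus>\<^bsub>S\<^esub> \<psi> u), smult = (\<lambda>z \<phi> u. z \<odot>\<^bsub>S\<^esub> \<phi> u)\<rparr>"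

text \<open>\<open>osc l S j n\<close> is the operator \<open>h\<^sub>j(n)\<close>. For \<open>n > 0\<close> the commutation relations say
  that it deletes in turn every letter \<open>(opp j, n)\<close> of a word, each time with the factor
  \<open>n (h\<^sub>+,h\<^sub>-) l = 2nl\<close> (the letters \<open>(j, n)\<close> do not contribute as
  \<open>(h\<^sub>\<plusminus>,h\<^sub>\<plusminus>) = 0\<close>); hence the coefficient of the result at \<open>u\<close> collects the
  coefficients of all words from which \<open>u\<close> arises by such a deletion.\<close>

definition osc :: "complex \<Rightarrow> ('a, 'x) tmodule_scheme \<Rightarrow> charge \<Rightarrow> int \<Rightarrow> (word \<Rightarrow> 'a) \<Rightarrow> word \<Rightarrow> 'a" where
  "osc l S j n \<phi> = (\<lambda>u.
     if n < 0 then (case u of [] \<Rightarrow> \<zero>\<^bsub>S\<^esub>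
                    | b # u' \<Rightarrow> if b = (j, nat (- n)) then \<phi> u' else \<zero>\<^bsub>S\<^esub>)
     else if n = 0 then hmul S j (\<phi> u)
     else (2 * of_int n * l) \<odot>\<^bsub>S\<^esub>
       (\<Oplus>\<^bsub>S\<^esub>r\<in>{..length u}. \<phi> (take r u @ (opp j, nat n) # drop r u)))"

text \<open>Normal ordered product of the modes \<open>h\<^sub>j(n)\<close>, \<open>(j, n)\<close> running through a list.\<close>

definition nord :: "complex \<Rightarrow> ('a, 'x) tmodule_scheme \<Rightarrow> (charge \<times> int) list \<Rightarrow> (word \<Rightarrow> 'a) \<Rightarrow> word \<Rightarrow> 'a" where
  "nord l S bs = foldr (\<lambda>(j, n). osc l S j n)
     (filter (\<lambda>b. snd b < 0) bs @ filter (\<lambda>b. snd b > 0) bs @ filter (\<lambda>b. snd b = 0) bs)"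

text \<open>The operator \<open>w\<^sub>n\<close> for a basis word \<open>w = h\<^bsub>i1\<^esub>(-m\<^sub>1) \<dots> h\<^bsub>is\<^esub>(-m\<^sub>s)\<one>\<close>.
  As \<open>1/(m-1)!\<close> times the \<open>(m-1)\<close>-st derivative of \<open>x\<^sup>-\<^sup>n\<^sup>-\<^sup>1\<close> is
  \<open>(-n-1 gchoose m-1) x\<^sup>-\<^sup>n\<^sup>-\<^sup>m\<close>, it is a sum over all \<open>n\<^sub>1,\<dots>,n\<^sub>s\<close> with
  \<open>\<Sum>\<^sub>j (n\<^sub>j + m\<^sub>j) = n + 1\<close>. Applied to a given vector, all but finitely many
  normal ordered products vanish; those have to be left out because \<open>finsum\<close> over an infinite set
  is zero by convention.\<close>

definition word_mode ::
    "complex \<Rightarrow> ('a, 'x) tmodule_scheme \<Rightarrow> word \<Rightarrow> int \<Rightarrow> (word \<Rightarrow> 'a) \<Rightarrow> word \<Rightarrow> 'a" where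
  "word_mode l S w n \<phi> =
     (\<Oplus>\<^bsub>fock_space S\<^esub>ns\<in>{ns. length ns = length w \<and>
          (\<Sum>r<length w. ns ! r + int (snd (w ! r))) = n + 1 \<and>
          nord l S (zip (map fst w) ns) \<phi> \<noteq> \<zero>\<^bsub>fock_space S\<^esub>}.
        (\<Prod>r<length w. of_int (- (ns ! r) - 1) gchoose (snd (w ! r) - 1))
          \<odot>\<^bsub>fock_space S\<^esub> nord l S (zip (map fst w) ns) \<phi>)"

subsection \<open>Graded modules for \<open>V(l,\<one>)\<close>\<close>

text \<open>The underlying vector space of \<open>V(l,\<one>)\<close>.\<close>

type_synonym vvec = "word \<Rightarrow>\<^sub>0 complex"

definition V_space :: "vvec set" where
  "V_space = {v. \<forall>w\<in>Poly_Mapping.keys v. is_word w \<and> charge_sum (map fst w) = 0}"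

text \<open>\<open>wt_space M d\<close> is the homogeneous subspace of weight \<open>d\<close>, and \<open>vmode M v n\<close> the operator
  \<open>v\<^sub>n\<close>.\<close>

record 'a vmodule = "(complex, 'a) module" +
  wt_space :: "nat \<Rightarrow> 'a set"
  vmode :: "vvec \<Rightarrow> int \<Rightarrow> 'a \<Rightarrow> 'a"

definition fock_module :: "complex \<Rightarrow> ('a, 'x) tmodule_scheme \<Rightarrow> (word \<Rightarrow> 'a) vmodule" where
  "fock_module l S = module.extend (fock_space S) (vmodule.fields
     (\<lambda>d. {\<phi> \<in> carrier (fock_space S). \<forall>u. \<phi> u \<noteq> \<zero>\<^bsub>S\<^esub> \<longrightarrow> word_wt u = d})
     (\<lambda>v n \<phi>. \<Oplus>\<^bsub>fock_space S\<^esub>w\<in>Poly_Mapping.keys v.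
        Poly_Mapping.lookup v w \<odot>\<^bsub>fock_space S\<^esub> word_mode l S w n \<phi>))"

definition is_submodule :: "'a set \<Rightarrow> 'a vmodule \<Rightarrow> bool" where
  "is_submodule W M \<longleftrightarrow> submodule W complex_field M \<and>
     W = lspan M (\<Union>d. W \<inter> wt_space M d) \<and>
     (\<forall>v\<in>V_space. \<forall>n. \<forall>x\<in>W. vmode M v n x \<in> W)"

definition irreducible_module :: "'a vmodule \<Rightarrow> bool" where
  "irreducible_module M \<longleftrightarrow> carrier M \<noteq> {\<zero>\<^bsub>M\<^esub>} \<and>
     (\<forall>W. is_submodule W M \<longrightarrow> W = {\<zero>\<^bsub>M\<^esub>} \<or> W = carrier M)"

definition generated_submodule :: "'a vmodule \<Rightarrow> 'a set \<Rightarrow> 'a set" where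
  "generated_submodule M X = \<Inter>{W. is_submodule W M \<and> X \<subseteq> W}"

definition quot_module :: "'a vmodule \<Rightarrow> 'a set \<Rightarrow> 'a set vmodule" where
  "quot_module M H = module.extend (quot_space M H) (vmodule.fields
     (\<lambda>d. (\<lambda>x. H +>\<^bsub>M\<^esub> x) ` wt_space M d)
     (\<lambda>v n. quot_map M H (vmode M v n)))"

subsection \<open>\<open>V\<^sub>U(l,f)\<close> and its quotients\<close>

text \<open>In this subsection \<open>S\<close> is a left \<open>T(E\<^sub>p)\<close>-module and \<open>s \<in> S\<close>; the modules of interest are
  those for \<open>S = tensor_module A G c0 p e1 e2 U\<close> and \<open>s = one_tensor A G c0 p e1 e2 U f\<close>.\<close>

definition vac :: "('a, 'x) tmodule_scheme \<Rightarrow> 'a \<Rightarrow> word \<Rightarrow> 'a" where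
  "vac S s = (\<lambda>u. if u = [] then s else \<zero>\<^bsub>S\<^esub>)"

definition VU :: "complex \<Rightarrow> ('a, 'x) tmodule_scheme \<Rightarrow> 'a \<Rightarrow> (word \<Rightarrow> 'a) vmodule" where
  "VU l S s = (let F = fock_module l S;
       C = lspan F {vmode F v n (vac S s) | v n. v \<in> V_space} in
     F\<lparr>carrier := C, wt_space := (\<lambda>d. C \<inter> wt_space F d)\<rparr>)"

text \<open>The element \<open>h\<^bsub>j1\<^esub>(-t\<^sub>1) \<dots> h\<^bsub>jk\<^esub>(-t\<^sub>k) h\<^bsub>jk+1\<^esub>(0) \<dots> h\<^bsub>jr\<^esub>(0)s\<close>.\<close>

definition mode_elt :: "complex \<Rightarrow> ('a, 'x) tmodule_scheme \<Rightarrow> 'a \<Rightarrow> word \<Rightarrow> charge list \<Rightarrow> word \<Rightarrow> 'a" where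
  "mode_elt l S s u z = foldr (\<lambda>(j, t). osc l S j (- int t)) u
     (foldr (\<lambda>j. osc l S j 0) z (vac S s))"

text \<open>Positions are counted from \<open>0\<close>, so that \<open>charge_sum (drop q js)\<close> is \<open>s\<^bsub>q+1\<^esub>\<close>.\<close>

definition Ccoef :: "real \<Rightarrow> complex \<Rightarrow> charge list \<Rightarrow> complex" where
  "Ccoef K lam js =
     (\<Prod>q\<in>{q. q < length js \<and> \<bar>charge_sum (drop q js)\<bar> < \<bar>charge_sum (drop (Suc q) js)\<bar>}.
        - lam + of_int (\<bar>charge_sum (drop (Suc q) js)\<bar> * (\<bar>charge_sum (drop (Suc q) js)\<bar> - 1)) * of_real K)"

text \<open>\<open>h\<^sub>\<epsilon>(0)\<^sup>N\<close> with \<open>N = \<bar>charge_sum z\<bar>\<close> and \<open>\<epsilon> = sgn (charge_sum z)\<close>.\<close>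

definition normal_word :: "charge list \<Rightarrow> charge list" where
  "normal_word z = replicate (nat \<bar>charge_sum z\<bar>) (if charge_sum z > 0 then Pls else Mns)"

definition VU1_rels :: "complex \<Rightarrow> ('a, 'x) tmodule_scheme \<Rightarrow> 'a \<Rightarrow> real \<Rightarrow> complex \<Rightarrow> (word \<Rightarrow> 'a) set" where
  "VU1_rels l S s K lam =
     {mode_elt l S s u z \<ominus>\<^bsub>VU l S s\<^esub>
        Ccoef K lam z \<odot>\<^bsub>VU l S s\<^esub> mode_elt l S s u (normal_word z) | u z.
      is_word u \<and> charge_sum (map fst u @ z) = 0}"

definition VU1_null :: "complex \<Rightarrow> ('a, 'x) tmodule_scheme \<Rightarrow> 'a \<Rightarrow> real \<Rightarrow> complex \<Rightarrow> (word \<Rightarrow> 'a) set" where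
  "VU1_null l S s K lam = generated_submodule (VU l S s) (VU1_rels l S s K lam)"

definition VU1 :: "complex \<Rightarrow> ('a, 'x) tmodule_scheme \<Rightarrow> 'a \<Rightarrow> real \<Rightarrow> complex \<Rightarrow> (word \<Rightarrow> 'a) set vmodule" where
  "VU1 l S s K lam = quot_module (VU l S s) (VU1_null l S s K lam)"

definition VU2_rels :: "complex \<Rightarrow> ('a, 'x) tmodule_scheme \<Rightarrow> 'a \<Rightarrow> real \<Rightarrow> complex \<Rightarrow> (word \<Rightarrow> 'a) set set" where
  "VU2_rels l S s K lam =
     {VU1_null l S s K lam +>\<^bsub>VU l S s\<^esub>
        (mode_elt l S s u z \<ominus>\<^bsub>VU l S s\<^esub> mode_elt l S s (permute_list \<tau> u) z) | u z \<tau>.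
      is_word u \<and> charge_sum (map fst u @ z) = 0 \<and> \<tau> permutes {..<length u}}"

definition VU2 :: "complex \<Rightarrow> ('a, 'x) tmodule_scheme \<Rightarrow> 'a \<Rightarrow> real \<Rightarrow> complex \<Rightarrow> (word \<Rightarrow> 'a) set set vmodule" where
  "VU2 l S s K lam = quot_module (VU1 l S s K lam)
     (generated_submodule (VU1 l S s K lam) (VU2_rels l S s K lam))"

end

theory Submission
  imports Defs "HOL-Combinatorics.Multiset_Permutations"
begin

text \<open>The modes \<open>v\<^sub>n\<close> generate the same operators as the normal ordered products of total charge
  \<open>0\<close>, because the binomial coefficients relating them separate any finite set of products. Modulo
  the two sets of relations, \<open>V\<^sub>U(l,f)\<close> is spanned by vectors \<open>b(u)\<close> indexed by multisets \<open>u\<close> of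
  letters \<open>h\<^sub>j(-m)\<close>. The operator \<open>h\<^bsub>-j\<^esub>(m)h\<^sub>j(0)\<close> removes a letter \<open>h\<^sub>j(-m)\<close> from \<open>b(u)\<close>, up to a
  factor that is nonzero as \<open>l \<noteq> 0\<close> and \<open>\<lambda>\<close> is generic. Hence the operators belonging to the
  letters of a longest word in a nonzero vector lead from this vector to \<open>f\<close>.

  That \<open>f\<close> is not killed by the relations is seen on the map \<open>w \<otimes> g \<mapsto> C\<^sub>w(\<Delta>)g\<close>, where \<open>C\<^sub>w(\<Delta>)\<close>
  arises from \<open>C\<^sub>w(\<lambda>)\<close> by replacing \<open>-\<lambda>\<close> by \<open>\<Delta>\<close>. It respects the tensor product over the parallel
  sections: in a local frame of null vector fields \<open>h\<^sub>\<plusminus>\<close> with \<open>\<nabla>h\<^sub>\<plusminus> = \<plusminus>\<theta>h\<^sub>\<plusminus>\<close>, a parallel section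
  has locally constant coefficients, which vanish for words of nonzero charge since \<open>K \<noteq> 0\<close>, and
  the commutator of \<open>\<nabla>\<^sub>+\<close> and \<open>\<nabla>\<^sub>-\<close> on components of charge \<open>c\<close> is \<open>-2Kc\<close>, whence a word \<open>w\<close> of
  charge \<open>0\<close> acts as \<open>C\<^sub>w(\<Delta>)\<close>.\<close>

section \<open>Complex vector spaces\<close>

text \<open>The kernel of the passage from \<open>V_U(l,f)\<close> to the double quotient is never
  computed. It is only trapped between the two sets of relations and one explicit proper graded
  submodule \<open>W0\<close>, defined by symmetrized coefficients with values in a subspace
  \<open>Z\<close> of \<open>S\<close>. An intersection of graded subspaces or a preimage of one is
  not graded for formal reasons, so irreducibility is shown in a stronger form: every stable
  subspace, graded or not, that strictly contains the kernel is everything. On the geometric side a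
  global null frame need not exist (the sphere has none), so frames are chosen chart by chart. Two
  null frames differ by inverse rescalings of \<open>h_+\<close> and \<open>h_-\<close> and possibly
  by their exchange. Coefficients of charge 0 do not feel the rescaling, and \<open>C_w\<close> is
  invariant under the exchange, so the constants that a parallel section has at \<open>p\<close>
  reach every point although the frame does not. The terms \<open>q(q-1)K\<close> come from the
  commutators: carrying \<nabla>_- inwards past the outer \<open>q-1\<close> of \<open>q\<close>
  factors \<nabla>_+ collects \<open>2K(1 + ... + (q-1))\<close>.\<close>

abbreviation vspace :: "(complex, 'a, 'x) module_scheme \<Rightarrow> bool" where
  "vspace M \<equiv> Module.module complex_field M"

abbreviation lsub :: "'a set \<Rightarrow> (complex, 'a, 'x) module_scheme \<Rightarrow> bool" where
  "lsub W M \<equiv> submodule W complex_field M"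

lemma complex_field_simps [simp]:
  "carrier complex_field = UNIV" "a \<otimes>\<^bsub>complex_field\<^esub> b = a * b" "\<one>\<^bsub>complex_field\<^esub> = 1"
  "\<zero>\<^bsub>complex_field\<^esub> = 0" "a \<oplus>\<^bsub>complex_field\<^esub> b = a + b"
  by (simp_all add: complex_field_def)

lemma cring_complex_field: "cring complex_field"
proof (rule cringI)
  show "abelian_group complex_field"
    by (rule abelian_groupI) (auto intro: exI[of _ "- x" for x] simp: add_eq_0_iff)
  show "comm_monoid complex_field"
    by (rule comm_monoidI) auto
qed (auto simp: algebra_simps)

text \<open>Inverses are demanded as multiples by -1, so that the records below need no negation of
  their own.\<close>

lemma vspaceI:
  fixes M :: "(complex, 'a, 'x) module_scheme"
  assumes zero: "\<zero>\<^bsub>M\<^esub> \<in> carrier M"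
    and add: "\<And>x y. x \<in> carrier M \<Longrightarrow> y \<in> carrier M \<Longrightarrow> x \<oplus>\<^bsub>M\<^esub> y \<in> carrier M"
    and smult: "\<And>a x. x \<in> carrier M \<Longrightarrow> a \<odot>\<^bsub>M\<^esub> x \<in> carrier M"
    and assoc: "\<And>x y z. x \<in> carrier M \<Longrightarrow> y \<in> carrier M \<Longrightarrow> z \<in> carrier M \<Longrightarrow>
      (x \<oplus>\<^bsub>M\<^esub> y) \<oplus>\<^bsub>M\<^esub> z = x \<oplus>\<^bsub>M\<^esub> (y \<oplus>\<^bsub>M\<^esub> z)"
    and comm: "\<And>x y. x \<in> carrier M \<Longrightarrow> y \<in> carrier M \<Longrightarrow> x \<oplus>\<^bsub>M\<^esub> y = y \<oplus>\<^bsub>M\<^esub> x"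
    and l_zero: "\<And>x. x \<in> carrier M \<Longrightarrow> \<zero>\<^bsub>M\<^esub> \<oplus>\<^bsub>M\<^esub> x = x"
    and neg: "\<And>x. x \<in> carrier M \<Longrightarrow> (- 1) \<odot>\<^bsub>M\<^esub> x \<oplus>\<^bsub>M\<^esub> x = \<zero>\<^bsub>M\<^esub>"
    and distr: "\<And>a b x. x \<in> carrier M \<Longrightarrow> (a + b) \<odot>\<^bsub>M\<^esub> x = a \<odot>\<^bsub>M\<^esub> x \<oplus>\<^bsub>M\<^esub> b \<odot>\<^bsub>M\<^esub> x"
    and distl: "\<And>a x y. x \<in> carrier M \<Longrightarrow> y \<in> carrier M \<Longrightarrow>
      a \<odot>\<^bsub>M\<^esub> (x \<oplus>\<^bsub>M\<^esub> y) = a \<odot>\<^bsub>M\<^esub> x \<oplus>\<^bsub>M\<^esub> a \<odot>\<^bsub>M\<^esub> y"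
    and sassoc: "\<And>a b x. x \<in> carrier M \<Longrightarrow> (a * b) \<odot>\<^bsub>M\<^esub> x = a \<odot>\<^bsub>M\<^esub> (b \<odot>\<^bsub>M\<^esub> x)"
    and one: "\<And>x. x \<in> carrier M \<Longrightarrow> 1 \<odot>\<^bsub>M\<^esub> x = x"
  shows "vspace M"
proof (rule moduleI)
  show "abelian_group M"
  proof (rule abelian_groupI)
    show "\<exists>y\<in>carrier M. y \<oplus>\<^bsub>M\<^esub> x = \<zero>\<^bsub>M\<^esub>" if "x \<in> carrier M" for x
      using neg smult that by blast
  qed (use zero add assoc comm l_zero in auto)
qed (use assms cring_complex_field in auto)

lemma vspace_uminus:
  assumes "vspace M" "x \<in> carrier M"
  shows "\<ominus>\<^bsub>M\<^esub> x = (- 1) \<odot>\<^bsub>M\<^esub> x"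
proof -
  interpret Module.module complex_field M by fact
  have "(- 1) \<odot>\<^bsub>M\<^esub> x \<oplus>\<^bsub>M\<^esub> x = (- 1 + 1) \<odot>\<^bsub>M\<^esub> x"
    using smult_l_distr[of "- 1" 1 x] smult_one[of x] assms(2) by simp
  also have "\<dots> = \<zero>\<^bsub>M\<^esub>" using smult_l_null[of x] assms(2) by simp
  finally show ?thesis
    using assms(2) M.minus_equality smult_closed[of "- 1" x] by simp
qed

lemma vspace_smult:
  assumes "vspace M"
  shows "x \<in> carrier M \<Longrightarrow> a \<odot>\<^bsub>M\<^esub> x \<in> carrier M"
    and "x \<in> carrier M \<Longrightarrow> (a + b) \<odot>\<^bsub>M\<^esub> x = a \<odot>\<^bsub>M\<^esub> x \<oplus>\<^bsub>M\<^esub> b \<odot>\<^bsub>M\<^esub> x"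
    and "x \<in> carrier M \<Longrightarrow> y \<in> carrier M \<Longrightarrow> a \<odot>\<^bsub>M\<^esub> (x \<oplus>\<^bsub>M\<^esub> y) = a \<odot>\<^bsub>M\<^esub> x \<oplus>\<^bsub>M\<^esub> a \<odot>\<^bsub>M\<^esub> y"
    and "x \<in> carrier M \<Longrightarrow> (a * b) \<odot>\<^bsub>M\<^esub> x = a \<odot>\<^bsub>M\<^esub> (b \<odot>\<^bsub>M\<^esub> x)"
    and "x \<in> carrier M \<Longrightarrow> 1 \<odot>\<^bsub>M\<^esub> x = x"
    and "x \<in> carrier M \<Longrightarrow> 0 \<odot>\<^bsub>M\<^esub> x = \<zero>\<^bsub>M\<^esub>"
    and "a \<odot>\<^bsub>M\<^esub> \<zero>\<^bsub>M\<^esub> = \<zero>\<^bsub>M\<^esub>"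
proof -
  interpret Module.module complex_field M by fact
  show "x \<in> carrier M \<Longrightarrow> a \<odot>\<^bsub>M\<^esub> x \<in> carrier M" by simp
  show "x \<in> carrier M \<Longrightarrow> (a + b) \<odot>\<^bsub>M\<^esub> x = a \<odot>\<^bsub>M\<^esub> x \<oplus>\<^bsub>M\<^esub> b \<odot>\<^bsub>M\<^esub> x"
    using smult_l_distr[of a b x] by simp
  show "x \<in> carrier M \<Longrightarrow> y \<in> carrier M \<Longrightarrow> a \<odot>\<^bsub>M\<^esub> (x \<oplus>\<^bsub>M\<^esub> y) = a \<odot>\<^bsub>M\<^esub> x \<oplus>\<^bsub>M\<^esub> a \<odot>\<^bsub>M\<^esub> y"
    using smult_r_distr[of a x y] by simp
  show "x \<in> carrier M \<Longrightarrow> (a * b) \<odot>\<^bsub>M\<^esub> x = a \<odot>\<^bsub>M\<^esub> (b \<odot>\<^bsub>M\<^esub> x)"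
    using smult_assoc1[of a b x] by simp
  show "x \<in> carrier M \<Longrightarrow> 1 \<odot>\<^bsub>M\<^esub> x = x" using smult_one[of x] by simp
  show "x \<in> carrier M \<Longrightarrow> 0 \<odot>\<^bsub>M\<^esub> x = \<zero>\<^bsub>M\<^esub>" using smult_l_null[of x] by simp
  show "a \<odot>\<^bsub>M\<^esub> \<zero>\<^bsub>M\<^esub> = \<zero>\<^bsub>M\<^esub>" using smult_r_null[of a] by simp
qed

lemma vspace_minus_zero:
  assumes "vspace M" "x \<in> carrier M"
  shows "x \<ominus>\<^bsub>M\<^esub> \<zero>\<^bsub>M\<^esub> = x"
proof -
  interpret Module.module complex_field M by fact
  show ?thesis using assms by (simp add: a_minus_def vspace_uminus vspace_smult)
qed

lemma lsubI:
  assumes "vspace M" "W \<subseteq> carrier M" "\<zero>\<^bsub>M\<^esub> \<in> W"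
    and "\<And>x y. x \<in> W \<Longrightarrow> y \<in> W \<Longrightarrow> x \<oplus>\<^bsub>M\<^esub> y \<in> W" "\<And>a x. x \<in> W \<Longrightarrow> a \<odot>\<^bsub>M\<^esub> x \<in> W"
  shows "lsub W M"
proof -
  interpret Module.module complex_field M by fact
  show ?thesis
    by (rule submoduleI) (use assms vspace_uminus[OF assms(1)] in auto)
qed

lemma lsubD:
  assumes "vspace M" "lsub W M"
  shows "x \<in> W \<Longrightarrow> x \<in> carrier M" "\<zero>\<^bsub>M\<^esub> \<in> W" "x \<in> W \<Longrightarrow> y \<in> W \<Longrightarrow> x \<oplus>\<^bsub>M\<^esub> y \<in> W"
    and "x \<in> W \<Longrightarrow> a \<odot>\<^bsub>M\<^esub> x \<in> W" "x \<in> W \<Longrightarrow> \<ominus>\<^bsub>M\<^esub> x \<in> W" "x \<in> W \<Longrightarrow> y \<in> W \<Longrightarrow> x \<ominus>\<^bsub>M\<^esub> y \<in> W"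
proof -
  interpret Module.module complex_field M by fact
  note E = submoduleE[OF assms(2)]
  show "x \<in> W \<Longrightarrow> x \<in> carrier M" using E(1) by auto
  show "x \<in> W \<Longrightarrow> y \<in> W \<Longrightarrow> x \<oplus>\<^bsub>M\<^esub> y \<in> W" by (rule E(5))
  show "x \<in> W \<Longrightarrow> a \<odot>\<^bsub>M\<^esub> x \<in> W" using E(4) by auto
  show "x \<in> W \<Longrightarrow> \<ominus>\<^bsub>M\<^esub> x \<in> W" by (rule E(3))
  show "x \<in> W \<Longrightarrow> y \<in> W \<Longrightarrow> x \<ominus>\<^bsub>M\<^esub> y \<in> W" using E(3,5) by (simp add: a_minus_def)
  obtain y where y: "y \<in> W" using E(2) by auto
  then have "0 \<odot>\<^bsub>M\<^esub> y \<in> W" using E(4) by auto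
  moreover have "0 \<odot>\<^bsub>M\<^esub> y = \<zero>\<^bsub>M\<^esub>" using vspace_smult(6)[OF assms(1)] E(1) y by auto
  ultimately show "\<zero>\<^bsub>M\<^esub> \<in> W" by simp
qed

lemma lsub_carrier: "vspace M \<Longrightarrow> lsub (carrier M) M"
  by (rule module.carrier_is_submodule)

lemma lsub_Inter:
  assumes "vspace M" "\<W> \<noteq> {}" "\<And>W. W \<in> \<W> \<Longrightarrow> lsub W M"
  shows "lsub (\<Inter>\<W>) M"
proof (rule lsubI[OF assms(1)])
  show "\<Inter>\<W> \<subseteq> carrier M" using assms(2) lsubD(1)[OF assms(1) assms(3)] by blast
qed (use lsubD[OF assms(1) assms(3)] in auto)

lemma lspan_superset: "X \<subseteq> lspan M X"
  by (auto simp: lspan_def)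

lemma lspan_least: "lsub W M \<Longrightarrow> X \<subseteq> W \<Longrightarrow> lspan M X \<subseteq> W"
  by (auto simp: lspan_def)

lemma lsub_lspan:
  assumes "vspace M" "X \<subseteq> carrier M"
  shows "lsub (lspan M X) M"
  unfolding lspan_def using assms lsub_carrier[OF assms(1)]
  by (intro lsub_Inter) auto

lemma lsub_finsum:
  assumes "vspace M" "lsub W M" "\<And>x. x \<in> B \<Longrightarrow> g x \<in> W"
  shows "finsum M g B \<in> W"
proof -
  interpret Module.module complex_field M by fact
  show ?thesis
    using assms(3) lsubD[OF assms(1,2)]
    by (induction B rule: infinite_finite_induct) (auto simp: M.finsum_infinite)
qed

lemma vspace_carrier_update:
  assumes "vspace M" "lsub W M"
  shows "vspace (M\<lparr>carrier := W\<rparr>)"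
  using submodule.submodule_is_module[OF assms(2,1)] .

definition linop :: "(complex, 'a, 'x) module_scheme \<Rightarrow> ('a \<Rightarrow> 'a) \<Rightarrow> bool" where
  "linop M F \<longleftrightarrow> (\<forall>x\<in>carrier M. F x \<in> carrier M) \<and>
     (\<forall>x\<in>carrier M. \<forall>y\<in>carrier M. F (x \<oplus>\<^bsub>M\<^esub> y) = F x \<oplus>\<^bsub>M\<^esub> F y) \<and>
     (\<forall>a. \<forall>x\<in>carrier M. F (a \<odot>\<^bsub>M\<^esub> x) = a \<odot>\<^bsub>M\<^esub> F x)"

lemma linopD:
  assumes "linop M F"
  shows "x \<in> carrier M \<Longrightarrow> F x \<in> carrier M"
    and "x \<in> carrier M \<Longrightarrow> y \<in> carrier M \<Longrightarrow> F (x \<oplus>\<^bsub>M\<^esub> y) = F x \<oplus>\<^bsub>M\<^esub> F y"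
    and "x \<in> carrier M \<Longrightarrow> F (a \<odot>\<^bsub>M\<^esub> x) = a \<odot>\<^bsub>M\<^esub> F x"
  using assms by (auto simp: linop_def)

lemma linop_zero:
  assumes "vspace M" "linop M F"
  shows "F \<zero>\<^bsub>M\<^esub> = \<zero>\<^bsub>M\<^esub>"
proof -
  interpret Module.module complex_field M by fact
  have "F (0 \<odot>\<^bsub>M\<^esub> \<zero>\<^bsub>M\<^esub>) = 0 \<odot>\<^bsub>M\<^esub> F \<zero>\<^bsub>M\<^esub>"
    by (rule linopD(3)[OF assms(2)]) simp
  then show ?thesis
    using linopD(1)[OF assms(2)] by (simp add: vspace_smult[OF assms(1)])
qed

lemma linop_minus:
  assumes "vspace M" "linop M F" "x \<in> carrier M" "y \<in> carrier M"
  shows "F (x \<ominus>\<^bsub>M\<^esub> y) = F x \<ominus>\<^bsub>M\<^esub> F y"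
  using assms by (simp add: a_minus_def vspace_uminus linopD vspace_smult)

lemma linop_preimage:
  assumes "vspace M" "linop M F" "lsub W M"
  shows "lsub {x \<in> carrier M. F x \<in> W} M"
proof -
  interpret Module.module complex_field M by fact
  show ?thesis
    using lsubD[OF assms(1,3)] linopD[OF assms(2)] linop_zero[OF assms(1,2)]
    by (intro lsubI) (auto simp: assms(1) vspace_smult[OF assms(1)])
qed

lemma linop_comp: "linop M F \<Longrightarrow> linop M H \<Longrightarrow> linop M (\<lambda>x. F (H x))"
  by (simp add: linop_def)

lemma linop_id: "vspace M \<Longrightarrow> linop M (\<lambda>x. x)"
  by (simp add: linop_def)

lemma linop_smult:
  assumes "vspace M" "linop M f"
  shows "linop M (\<lambda>x. a \<odot>\<^bsub>M\<^esub> f x)"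
  using linopD[OF assms(2)]
  by (simp add: linop_def vspace_smult[OF assms(1)])
     (simp add: vspace_smult(4)[OF assms(1), symmetric] mult.commute)

section \<open>Quotients\<close>

context
  fixes M :: "(complex, 'a, 'x) module_scheme" and H
  assumes vM: "vspace M" and sH: "lsub H M"
begin

interpretation M: Module.module complex_field M by (fact vM)

interpretation H: abelian_subgroup H M
proof (rule abelian_subgroupI3)
  show "additive_subgroup H M"
    using sH by (simp add: additive_subgroup_def submodule_def)
qed (rule M.abelian_group_axioms)

lemma quot_space_simps:
  "carrier (quot_space M H) = (\<lambda>x. H +>\<^bsub>M\<^esub> x) ` carrier M"
  "\<zero>\<^bsub>quot_space M H\<^esub> = H +>\<^bsub>M\<^esub> \<zero>\<^bsub>M\<^esub>"
  by (auto simp: quot_space_def A_RCOSETS_def' H.a_subset)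

lemma coset_eq_iff:
  assumes "x \<in> carrier M" "y \<in> carrier M"
  shows "H +>\<^bsub>M\<^esub> x = H +>\<^bsub>M\<^esub> y \<longleftrightarrow> x \<ominus>\<^bsub>M\<^esub> y \<in> H"
proof
  assume "H +>\<^bsub>M\<^esub> x = H +>\<^bsub>M\<^esub> y"
  then have "x \<in> H +>\<^bsub>M\<^esub> y" using H.a_rcos_self assms by metis
  then show "x \<ominus>\<^bsub>M\<^esub> y \<in> H" using H.a_rcos_module assms by (simp add: a_minus_def)
next
  assume "x \<ominus>\<^bsub>M\<^esub> y \<in> H"
  then have "x \<in> H +>\<^bsub>M\<^esub> y" using H.a_rcos_module assms by (simp add: a_minus_def)
  then show "H +>\<^bsub>M\<^esub> x = H +>\<^bsub>M\<^esub> y"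
    using M.a_repr_independence[of x H y] assms H.a_subgroup by simp
qed

lemma quot_space_add:
  assumes "x \<in> carrier M" "y \<in> carrier M"
  shows "(H +>\<^bsub>M\<^esub> x) \<oplus>\<^bsub>quot_space M H\<^esub> (H +>\<^bsub>M\<^esub> y) = H +>\<^bsub>M\<^esub> (x \<oplus>\<^bsub>M\<^esub> y)"
  using assms by (simp add: quot_space_def H.a_rcos_sum)

text \<open>The union in \<open>quot_map\<close> runs over all representatives; as \<open>F\<close>
  maps \<open>H\<close> to itself, they all yield the same coset.\<close>

lemma quot_map_coset:
  assumes F: "linop M F" "\<And>x. x \<in> H \<Longrightarrow> F x \<in> H" and x: "x \<in> carrier M"
  shows "quot_map M H F (H +>\<^bsub>M\<^esub> x) = H +>\<^bsub>M\<^esub> F x"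
proof -
  have "H +>\<^bsub>M\<^esub> F y = H +>\<^bsub>M\<^esub> F x" if "y \<in> H +>\<^bsub>M\<^esub> x" for y
  proof -
    have y: "y \<in> carrier M" using that x H.a_elemrcos_carrier by blast
    then have "y \<ominus>\<^bsub>M\<^esub> x \<in> H" using that x H.a_rcos_module by (simp add: a_minus_def)
    then have "F y \<ominus>\<^bsub>M\<^esub> F x \<in> H" using F x y linop_minus[OF vM] by metis
    then show ?thesis using coset_eq_iff linopD(1)[OF F(1)] x y by blast
  qed
  moreover have "x \<in> H +>\<^bsub>M\<^esub> x" using H.a_rcos_self x by blast
  ultimately show ?thesis unfolding quot_map_def by blast
qed

lemma quot_space_smult:
  assumes "x \<in> carrier M"
  shows "z \<odot>\<^bsub>quot_space M H\<^esub> (H +>\<^bsub>M\<^esub> x) = H +>\<^bsub>M\<^esub> (z \<odot>\<^bsub>M\<^esub> x)"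
  using assms quot_map_coset[OF linop_smult[OF vM linop_id[OF vM]] lsubD(4)[OF vM sH]]
  by (simp add: quot_space_def)

lemma vspace_quot_space: "vspace (quot_space M H)"
proof -
  have ne: "(- 1) \<odot>\<^bsub>M\<^esub> x \<oplus>\<^bsub>M\<^esub> x = \<zero>\<^bsub>M\<^esub>" if "x \<in> carrier M" for x
    using that M.l_neg[OF that] vspace_uminus[OF vM that] by metis
  note S = quot_space_simps quot_space_add quot_space_smult vspace_smult[OF vM]
  show ?thesis
  proof (rule vspaceI, goal_cases)
    case (4 X Y Z)
    then obtain x y z where "x \<in> carrier M" "y \<in> carrier M" "z \<in> carrier M"
      "X = H +>\<^bsub>M\<^esub> x" "Y = H +>\<^bsub>M\<^esub> y" "Z = H +>\<^bsub>M\<^esub> z" unfolding S(1) by blast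
    then show ?case by (simp add: quot_space_add M.a_assoc)
  next
    case (5 X Y)
    then obtain x y where "x \<in> carrier M" "y \<in> carrier M"
      "X = H +>\<^bsub>M\<^esub> x" "Y = H +>\<^bsub>M\<^esub> y" unfolding S(1) by blast
    then show ?case by (simp add: quot_space_add M.a_comm)
  next
    case (7 X)
    then obtain x where "x \<in> carrier M" "X = H +>\<^bsub>M\<^esub> x" unfolding S(1) by blast
    then show ?case by (simp add: quot_space_add quot_space_smult vspace_smult[OF vM] ne S(2))
  qed (auto simp: S)
qed

lemma linop_quot_map:
  assumes F: "linop M F" "\<And>x. x \<in> H \<Longrightarrow> F x \<in> H"
  shows "linop (quot_space M H) (quot_map M H F)"
  unfolding linop_def
  by (auto simp: quot_space_simps(1) quot_space_add quot_space_smult quot_map_coset[OF F]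
      linopD[OF F(1)] vspace_smult[OF vM])

end




section \<open>Modules over V(l,1): stable subspaces and successive quotients\<close>

definition lvm :: "'a vmodule \<Rightarrow> bool" where
  "lvm M \<longleftrightarrow> vspace M \<and> (\<forall>v\<in>V_space. \<forall>n. linop M (vmode M v n)) \<and> (\<forall>d. wt_space M d \<subseteq> carrier M)"

text \<open>Submodules without the grading. Intersections and preimages under quotient maps inherit
  this property at once, so the main argument works with stable subspaces.\<close>

definition stable :: "'a set \<Rightarrow> 'a vmodule \<Rightarrow> bool" where
  "stable W M \<longleftrightarrow> lsub W M \<and> (\<forall>v\<in>V_space. \<forall>n. \<forall>x\<in>W. vmode M v n x \<in> W)"

lemma is_submodule_iff:
  "is_submodule W M \<longleftrightarrow> stable W M \<and> W = lspan M (\<Union>d. W \<inter> wt_space M d)"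
  by (auto simp: is_submodule_def stable_def)

lemma stable_generated:
  assumes "vspace M" "is_submodule W0 M" "X \<subseteq> W0"
  shows "stable (generated_submodule M X) M" "X \<subseteq> generated_submodule M X"
    "generated_submodule M X \<subseteq> W0"
proof -
  have "lsub (generated_submodule M X) M"
    unfolding generated_submodule_def
    by (rule lsub_Inter[OF assms(1)]) (use assms(2,3) in \<open>auto simp only: is_submodule_def\<close>)
  moreover have "vmode M v n x \<in> generated_submodule M X"
    if "v \<in> V_space" "x \<in> generated_submodule M X" for v n x
    using that unfolding generated_submodule_def is_submodule_def by blast
  ultimately show "stable (generated_submodule M X) M" unfolding stable_def by blast
  show "X \<subseteq> generated_submodule M X" "generated_submodule M X \<subseteq> W0"
    using assms(2,3) by (auto simp: generated_submodule_def)
qed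

lemma quot_module_eq:
  "quot_module M H = \<lparr>carrier = carrier (quot_space M H), mult = mult (quot_space M H),
     one = one (quot_space M H), zero = zero (quot_space M H), add = add (quot_space M H),
     smult = smult (quot_space M H), wt_space = (\<lambda>d. (\<lambda>x. H +>\<^bsub>M\<^esub> x) ` wt_space M d),
     vmode = (\<lambda>v n. quot_map M H (vmode M v n))\<rparr>"
  by (simp add: quot_module_def module.extend_def vmodule.fields_def)

lemma vspace_cong:
  assumes "vspace M" "carrier M' = carrier M" "zero M' = zero M" "add M' = add M"
    "smult M' = smult M"
  shows "vspace M'"
proof -
  interpret Module.module complex_field M by fact
  have ne: "(- 1) \<odot>\<^bsub>M\<^esub> x \<oplus>\<^bsub>M\<^esub> x = \<zero>\<^bsub>M\<^esub>" if "x \<in> carrier M" for x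
    using that M.l_neg[OF that] vspace_uminus[OF assms(1) that] by metis
  show ?thesis
    by (rule vspaceI) (simp_all add: assms(2-) vspace_smult[OF assms(1)] M.a_assoc ne, simp add: M.a_comm)
qed

lemma lsub_cong:
  assumes "vspace M" "carrier M' = carrier M" "zero M' = zero M" "add M' = add M"
    "smult M' = smult M"
  shows "lsub W M' \<longleftrightarrow> lsub W M"
proof -
  have v: "vspace M'" by (rule vspace_cong[OF assms])
  show ?thesis
  proof
    assume W: "lsub W M'"
    show "lsub W M"
      using lsubD[OF v W, unfolded assms(2-)] by (intro lsubI[OF assms(1)]) blast+
  next
    assume W: "lsub W M"
    show "lsub W M'"
      using lsubD[OF assms(1) W] by (intro lsubI[OF v]) (unfold assms(2-), blast+)
  qed
qed

lemma linop_cong: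
  assumes "carrier M' = carrier M" "add M' = add M" "smult M' = smult M"
  shows "linop M' F \<longleftrightarrow> linop M F"
  by (simp add: linop_def assms)

lemma lvmD: "lvm M \<Longrightarrow> vspace M" "lvm M \<Longrightarrow> v \<in> V_space \<Longrightarrow> linop M (vmode M v n)"
  "lvm M \<Longrightarrow> wt_space M d \<subseteq> carrier M"
  by (auto simp: lvm_def)

lemma stableD: "stable H M \<Longrightarrow> lsub H M" "stable H M \<Longrightarrow> v \<in> V_space \<Longrightarrow> x \<in> H \<Longrightarrow> vmode M v n x \<in> H"
  by (auto simp: stable_def)

context
  fixes M :: "'a vmodule" and H
  assumes lM: "lvm M" and sH: "stable H M"
begin

lemma quot_module_simps:
  "carrier (quot_module M H) = (\<lambda>x. H +>\<^bsub>M\<^esub> x) ` carrier M"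
  "\<zero>\<^bsub>quot_module M H\<^esub> = H +>\<^bsub>M\<^esub> \<zero>\<^bsub>M\<^esub>"
  "wt_space (quot_module M H) d = (\<lambda>x. H +>\<^bsub>M\<^esub> x) ` wt_space M d"
  using quot_space_simps[OF lvmD(1)[OF lM] stableD(1)[OF sH]] by (simp_all add: quot_module_eq)

lemma quot_module_ops:
  "x \<in> carrier M \<Longrightarrow> y \<in> carrier M \<Longrightarrow>
    (H +>\<^bsub>M\<^esub> x) \<oplus>\<^bsub>quot_module M H\<^esub> (H +>\<^bsub>M\<^esub> y) = H +>\<^bsub>M\<^esub> (x \<oplus>\<^bsub>M\<^esub> y)"
  "x \<in> carrier M \<Longrightarrow> z \<odot>\<^bsub>quot_module M H\<^esub> (H +>\<^bsub>M\<^esub> x) = H +>\<^bsub>M\<^esub> (z \<odot>\<^bsub>M\<^esub> x)"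
  "x \<in> carrier M \<Longrightarrow> v \<in> V_space \<Longrightarrow>
    vmode (quot_module M H) v n (H +>\<^bsub>M\<^esub> x) = H +>\<^bsub>M\<^esub> vmode M v n x"
  using quot_space_add[OF lvmD(1)[OF lM] stableD(1)[OF sH]]
    quot_space_smult[OF lvmD(1)[OF lM] stableD(1)[OF sH]]
    quot_map_coset[OF lvmD(1)[OF lM] stableD(1)[OF sH] lvmD(2)[OF lM] stableD(2)[OF sH]]
  by (simp_all add: quot_module_eq)

lemma lvm_quot_module: "lvm (quot_module M H)"
proof -
  have v: "vspace (quot_module M H)"
    by (rule vspace_cong[OF vspace_quot_space[OF lvmD(1)[OF lM] stableD(1)[OF sH]]])
      (simp_all add: quot_module_eq)
  moreover have "linop (quot_module M H) (vmode (quot_module M H) v n)" if "v \<in> V_space" for v n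
    using linop_quot_map[OF lvmD(1)[OF lM] stableD(1)[OF sH] lvmD(2)[OF lM that] stableD(2)[OF sH that]]
      linop_cong[of "quot_module M H" "quot_space M H"] by (simp add: quot_module_eq)
  ultimately show ?thesis
    using lvmD(3)[OF lM] unfolding lvm_def quot_module_simps by blast
qed

lemma lsub_preimage:
  assumes L: "lsub L (quot_module M H)"
  shows "lsub {x \<in> carrier M. H +>\<^bsub>M\<^esub> x \<in> L} M"
proof -
  note D = lsubD[OF lvmD(1)[OF lvm_quot_module] L]
  have vM: "vspace M" by (rule lvmD(1)[OF lM])
  interpret Module.module complex_field M by (rule vM)
  show ?thesis
  proof (rule lsubI[OF vM])
    fix x y a assume "x \<in> {x \<in> carrier M. H +>\<^bsub>M\<^esub> x \<in> L}"
    then have x: "x \<in> carrier M" "H +>\<^bsub>M\<^esub> x \<in> L" by auto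
    show "a \<odot>\<^bsub>M\<^esub> x \<in> {x \<in> carrier M. H +>\<^bsub>M\<^esub> x \<in> L}"
      using quot_module_ops(2)[of x a] D(4)[OF x(2), of a] x(1) vspace_smult(1)[OF vM] by auto
    assume "y \<in> {x \<in> carrier M. H +>\<^bsub>M\<^esub> x \<in> L}"
    then have y: "y \<in> carrier M" "H +>\<^bsub>M\<^esub> y \<in> L" by auto
    show "x \<oplus>\<^bsub>M\<^esub> y \<in> {x \<in> carrier M. H +>\<^bsub>M\<^esub> x \<in> L}"
      using quot_module_ops(1)[of x y] D(3)[OF x(2) y(2)] x(1) y(1) by auto
  qed (use D(2) in \<open>auto simp: quot_module_simps(2)\<close>)
qed

lemma stable_preimage:
  assumes "stable W (quot_module M H)"
  shows "stable {x \<in> carrier M. H +>\<^bsub>M\<^esub> x \<in> W} M"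
  unfolding stable_def
proof (intro conjI ballI allI)
  show "lsub {x \<in> carrier M. H +>\<^bsub>M\<^esub> x \<in> W} M"
    by (rule lsub_preimage[OF stableD(1)[OF assms]])
  fix v n x assume "v \<in> V_space" "x \<in> {x \<in> carrier M. H +>\<^bsub>M\<^esub> x \<in> W}"
  then show "vmode M v n x \<in> {x \<in> carrier M. H +>\<^bsub>M\<^esub> x \<in> W}"
    using stableD(2)[OF assms, of v "H +>\<^bsub>M\<^esub> x" n] linopD(1)[OF lvmD(2)[OF lM]]
    by (auto simp: quot_module_ops)
qed

text \<open>Gradedness survives because the preimage of the span of the homogeneous classes is a
  subspace containing the homogeneous elements of \<open>W\<close>, hence all of
  \<open>W\<close>.\<close>

lemma is_submodule_image:
  assumes "is_submodule W M"
  shows "is_submodule ((\<lambda>x. H +>\<^bsub>M\<^esub> x) ` W) (quot_module M H)"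
    (is "is_submodule ?W ?Q")
proof -
  have vM: "vspace M" and vQ: "vspace ?Q" using lvmD(1) lM lvm_quot_module by blast+
  interpret Module.module complex_field M by (rule vM)
  have st: "stable W M" and gr: "W = lspan M (\<Union>d. W \<inter> wt_space M d)"
    using assms by (auto simp: is_submodule_iff)
  note D = lsubD[OF vM stableD(1)[OF st]]
  have sub: "lsub ?W ?Q"
  proof (rule lsubI[OF vQ])
    show "?W \<subseteq> carrier ?Q" using D(1) by (auto simp: quot_module_simps)
    show "\<zero>\<^bsub>?Q\<^esub> \<in> ?W" using D(2) by (auto simp: quot_module_simps)
    fix X Y a assume "X \<in> ?W" then obtain x where x: "x \<in> W" "X = H +>\<^bsub>M\<^esub> x" by blast
    then show "a \<odot>\<^bsub>?Q\<^esub> X \<in> ?W" using D by (auto simp: quot_module_ops)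
    assume "Y \<in> ?W" then obtain y where "y \<in> W" "Y = H +>\<^bsub>M\<^esub> y" by blast
    then show "X \<oplus>\<^bsub>?Q\<^esub> Y \<in> ?W" using D x by (auto simp: quot_module_ops)
  qed
  have "stable ?W ?Q"
    unfolding stable_def using sub stableD(2)[OF st] D(1) by (auto simp: quot_module_ops)
  moreover have "lspan ?Q (\<Union>d. ?W \<inter> wt_space ?Q d) \<subseteq> ?W"
    by (rule lspan_least[OF sub]) auto
  moreover have "?W \<subseteq> lspan ?Q (\<Union>d. ?W \<inter> wt_space ?Q d)"
  proof -
    let ?L = "lspan ?Q (\<Union>d. ?W \<inter> wt_space ?Q d)"
    have L: "lsub ?L ?Q"
      using lvmD(3)[OF lvm_quot_module] by (intro lsub_lspan[OF vQ]) blast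
    have "lsub {x \<in> carrier M. H +>\<^bsub>M\<^esub> x \<in> ?L} M"
      by (rule lsub_preimage[OF L])
    moreover have "(\<Union>d. W \<inter> wt_space M d) \<subseteq> {x \<in> carrier M. H +>\<^bsub>M\<^esub> x \<in> ?L}"
      using D(1) lspan_superset[of "\<Union>d. ?W \<inter> wt_space ?Q d" ?Q] by (auto simp: quot_module_simps(3))
    ultimately have "lspan M (\<Union>d. W \<inter> wt_space M d) \<subseteq> {x \<in> carrier M. H +>\<^bsub>M\<^esub> x \<in> ?L}"
      by (rule lspan_least)
    then show ?thesis unfolding gr[symmetric] by auto
  qed
  ultimately show ?thesis unfolding is_submodule_iff by (intro conjI equalityI)
qed

end

text \<open>The double quotient is \<open>M\<close> modulo the preimage \<open>Ker\<close> of the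
  second null space. What is known of \<open>Ker\<close> is that it is stable, contains both sets of
  relations and lies in the proper submodule \<open>W0\<close>; therefore \<open>irr\<close> speaks
  of all such subspaces at once.\<close>

lemma irreducible_quot_quot:
  fixes M :: "'a vmodule"
  assumes lM: "lvm M" and W0: "is_submodule W0 M" and X1: "X1 \<subseteq> W0" and X2: "X2 \<subseteq> W0"
    and ne: "W0 \<noteq> carrier M"
    and irr: "\<And>Ker W x. stable Ker M \<Longrightarrow> X1 \<subseteq> Ker \<Longrightarrow> X2 \<subseteq> Ker \<Longrightarrow> Ker \<subseteq> W0 \<Longrightarrow> stable W M \<Longrightarrow>
      Ker \<subseteq> W \<Longrightarrow> x \<in> W \<Longrightarrow> x \<notin> Ker \<Longrightarrow> W = carrier M"
  shows "irreducible_module (quot_module (quot_module M (generated_submodule M X1))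
     (generated_submodule (quot_module M (generated_submodule M X1))
       ((\<lambda>x. generated_submodule M X1 +>\<^bsub>M\<^esub> x) ` X2)))"
proof -
  define H where "H = generated_submodule M X1"
  define Q where "Q = quot_module M H"
  define p where "p = (\<lambda>x. H +>\<^bsub>M\<^esub> x)"
  define N where "N = generated_submodule Q (p ` X2)"
  define q where "q = (\<lambda>y. N +>\<^bsub>Q\<^esub> y)"
  have vM: "vspace M" using lM by (rule lvmD)
  interpret Module.module complex_field M by (rule vM)
  have sH: "stable H M" and HW: "X1 \<subseteq> H" "H \<subseteq> W0"
    using stable_generated[OF vM W0 X1] by (auto simp: H_def)
  have lQ: "lvm Q" unfolding Q_def by (rule lvm_quot_module[OF lM sH])
  have vQ: "vspace Q" using lQ by (rule lvmD)
  interpret Q: Module.module complex_field Q by (rule vQ)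
  have W0Q: "is_submodule (p ` W0) Q"
    unfolding Q_def p_def by (rule is_submodule_image[OF lM sH W0])
  have sN: "stable N Q" and NW: "p ` X2 \<subseteq> N" "N \<subseteq> p ` W0"
    using stable_generated[OF vQ W0Q image_mono[OF X2, of p]] by (simp_all add: N_def)
  have W0s: "lsub W0 M" using W0 by (simp add: is_submodule_iff stable_def)
  note W0D = lsubD[OF vM W0s]
  have lQ2: "lvm (quot_module Q N)" by (rule lvm_quot_module[OF lQ sN])
  define Ker where "Ker = {x \<in> carrier M. p x \<in> N}"
  have sKer: "stable Ker M"
    unfolding Ker_def p_def by (rule stable_preimage[OF lM sH sN[unfolded Q_def]])
  have pQ: "p x \<in> carrier Q" if "x \<in> carrier M" for x
    using that by (simp add: Q_def quot_module_simps[OF lM sH] p_def)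
  have p_eq: "p x = p y \<longleftrightarrow> x \<ominus>\<^bsub>M\<^esub> y \<in> H" if "x \<in> carrier M" "y \<in> carrier M" for x y
    using coset_eq_iff[OF vM stableD(1)[OF sH]] that by (simp add: p_def)
  have q_zero: "q (p x) = \<zero>\<^bsub>quot_module Q N\<^esub> \<longleftrightarrow> p x \<in> N" if "x \<in> carrier M" for x
    using coset_eq_iff[OF vQ stableD(1)[OF sN] pQ[OF that] Q.zero_closed] pQ[OF that]
    by (simp add: q_def quot_module_simps[OF lQ sN] vspace_minus_zero[OF vQ])
  have carr: "carrier (quot_module Q N) = q ` p ` carrier M"
    using quot_module_simps(1)[OF lQ sN] quot_module_simps(1)[OF lM sH]
    by (simp add: q_def p_def Q_def)
  have HKer: "X1 \<subseteq> Ker"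
  proof
    fix x assume "x \<in> X1"
    then have x: "x \<in> H" "x \<in> carrier M" using HW W0D by blast+
    then have "p x = p \<zero>\<^bsub>M\<^esub>" by (simp add: p_eq vspace_minus_zero[OF vM])
    also have "\<dots> = \<zero>\<^bsub>Q\<^esub>" by (simp add: Q_def quot_module_simps[OF lM sH] p_def)
    finally show "x \<in> Ker" using x lsubD(2)[OF vQ stableD(1)[OF sN]] by (simp add: Ker_def)
  qed
  have X2Ker: "X2 \<subseteq> Ker" using NW(1) X2 W0D by (auto simp: Ker_def)
  \<comment> \<open>An element of \<open>Ker\<close> differs from one of \<open>W0\<close> by an
    element of \<open>H\<close>, and \<open>H\<close> itself lies in \<open>W0\<close>.\<close>
  have KerW: "Ker \<subseteq> W0"
  proof
    fix x assume x: "x \<in> Ker"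
    then obtain y where y: "y \<in> W0" "p x = p y" using NW(2) by (auto simp: Ker_def)
    then have "x \<ominus>\<^bsub>M\<^esub> y \<in> W0" using p_eq x W0D HW(2) by (auto simp: Ker_def)
    then have "(x \<ominus>\<^bsub>M\<^esub> y) \<oplus>\<^bsub>M\<^esub> y \<in> W0" using W0D y by blast
    then show "x \<in> W0" using x y W0D(1) by (simp add: Ker_def a_minus_def M.a_assoc M.l_neg)
  qed
  show ?thesis
    unfolding H_def[symmetric] Q_def[symmetric] p_def[symmetric] N_def[symmetric] irreducible_module_def
  proof (intro conjI allI impI)
    obtain x where x: "x \<in> carrier M" "x \<notin> W0" using ne W0D(1) by blast
    then have "q (p x) \<noteq> \<zero>\<^bsub>quot_module Q N\<^esub>" using q_zero KerW by (auto simp: Ker_def)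
    then show "carrier (quot_module Q N) \<noteq> {\<zero>\<^bsub>quot_module Q N\<^esub>}" using carr x by auto
    fix W assume W: "is_submodule W (quot_module Q N)"
    define W' where "W' = {x \<in> carrier M. q (p x) \<in> W}"
    have sW: "stable W (quot_module Q N)" using W by (simp add: is_submodule_iff)
    have Wc: "W \<subseteq> carrier (quot_module Q N)" "\<zero>\<^bsub>quot_module Q N\<^esub> \<in> W"
      using lsubD(1,2)[OF lvmD(1)[OF lQ2] stableD(1)[OF sW]] by auto
    have "stable {x \<in> carrier M. p x \<in> {y \<in> carrier Q. q y \<in> W}} M"
      unfolding p_def q_def
      by (rule stable_preimage[OF lM sH]) (use stable_preimage[OF lQ sN sW] in \<open>simp add: Q_def\<close>)
    then have sW': "stable W' M" using pQ by (simp add: W'_def cong: conj_cong)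
    have KW': "Ker \<subseteq> W'"
    proof
      fix x assume "x \<in> Ker"
      then have x: "x \<in> carrier M" "p x \<in> N" by (auto simp: Ker_def)
      then have "q (p x) = \<zero>\<^bsub>quot_module Q N\<^esub>" using q_zero by blast
      then show "x \<in> W'" using x Wc(2) by (simp add: W'_def)
    qed
    show "W = {\<zero>\<^bsub>quot_module Q N\<^esub>} \<or> W = carrier (quot_module Q N)"
    proof (cases "W' \<subseteq> Ker")
      case True
      have "w = \<zero>\<^bsub>quot_module Q N\<^esub>" if w: "w \<in> W" for w
      proof -
        obtain x where x: "x \<in> carrier M" "w = q (p x)" using w Wc(1) carr by auto
        then have "x \<in> W'" using w by (simp add: W'_def)
        then have "p x \<in> N" using True by (auto simp: Ker_def)
        then show ?thesis using q_zero x by simp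
      qed
      then show ?thesis using Wc(2) by blast
    next
      case False
      then obtain x where "x \<in> W'" "x \<notin> Ker" by blast
      then have "W' = carrier M" by (rule irr[OF sKer HKer X2Ker KerW sW' KW'])
      then have "x \<in> W'" if "x \<in> carrier M" for x using that by blast
      then have "carrier (quot_module Q N) \<subseteq> W" unfolding carr W'_def by blast
      then show ?thesis using Wc(1) by blast
    qed
  qed
qed

section \<open>The Fock space\<close>

definition tmod :: "('a, 'x) tmodule_scheme \<Rightarrow> bool" where
  "tmod S \<longleftrightarrow> vspace S \<and> (\<forall>j. linop S (hmul S j))"

definition monom_at :: "('a, 'x) tmodule_scheme \<Rightarrow> word \<Rightarrow> 'a \<Rightarrow> word \<Rightarrow> 'a" where
  "monom_at S u x = (\<lambda>v. if v = u then x else \<zero>\<^bsub>S\<^esub>)"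

definition prep :: "('a, 'x) tmodule_scheme \<Rightarrow> charge \<times> nat \<Rightarrow> (word \<Rightarrow> 'a) \<Rightarrow> word \<Rightarrow> 'a" where
  "prep S b \<phi> = (\<lambda>u. case u of [] \<Rightarrow> \<zero>\<^bsub>S\<^esub> | c # u' \<Rightarrow> if c = b then \<phi> u' else \<zero>\<^bsub>S\<^esub>)"

lemma osc_neg: "n < 0 \<Longrightarrow> osc l S j n \<phi> = prep S (j, nat (- n)) \<phi>"
  by (auto simp: osc_def prep_def)

lemma osc_zero: "osc l S j 0 \<phi> = (\<lambda>u. hmul S j (\<phi> u))"
  by (simp add: osc_def)

lemma osc_pos: "n > 0 \<Longrightarrow> osc l S j n \<phi> = (\<lambda>u. (2 * of_int n * l) \<odot>\<^bsub>S\<^esub>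
       (\<Oplus>\<^bsub>S\<^esub>r\<in>{..length u}. \<phi> (take r u @ (opp j, nat n) # drop r u)))"
  by (simp add: osc_def)

lemma fock_simps:
  "carrier (fock_space S) = {\<phi>. finite {u. \<phi> u \<noteq> \<zero>\<^bsub>S\<^esub>} \<and> (\<forall>u. \<phi> u \<in> carrier S) \<and>
                    (\<forall>u. \<phi> u \<noteq> \<zero>\<^bsub>S\<^esub> \<longrightarrow> is_word u)}"
  "\<zero>\<^bsub>fock_space S\<^esub> = (\<lambda>u. \<zero>\<^bsub>S\<^esub>)"
  "\<phi> \<oplus>\<^bsub>fock_space S\<^esub> \<psi> = (\<lambda>u. \<phi> u \<oplus>\<^bsub>S\<^esub> \<psi> u)"
  "z \<odot>\<^bsub>fock_space S\<^esub> \<phi> = (\<lambda>u. z \<odot>\<^bsub>S\<^esub> \<phi> u)"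
  by (simp_all add: fock_space_def)

definition zact :: "('a, 'x) tmodule_scheme \<Rightarrow> 'a \<Rightarrow> charge list \<Rightarrow> 'a" where
  "zact S s z = foldr (hmul S) z s"

text \<open>The charge counts the letters of \<open>u\<close> together with the zero modes applied
  to \<open>s\<close>, so every mode shifts it by its own charge. The sector of charge 0 will be the
  underlying space of \<open>V_U(l,f)\<close>.\<close>

definition sector :: "('a, 'x) tmodule_scheme \<Rightarrow> 'a \<Rightarrow> int \<Rightarrow> (word \<Rightarrow> 'a) set" where
  "sector S s c = lspan (fock_space S)
     {monom_at S u (zact S s z) | u z. is_word u \<and> charge_sum (map fst u @ z) = c}"

lemma charge_sum_simps [simp]:
  "charge_sum [] = 0" "charge_sum (j # js) = cval j + charge_sum js"
  "charge_sum (xs @ ys) = charge_sum xs + charge_sum ys"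
  by (simp_all add: charge_sum_def)

lemma cval_opp [simp]: "cval (opp j) = - cval j"
  by (cases j) auto

lemma opp_opp [simp]: "opp (opp j) = j"
  by (cases j) auto

lemma is_word_simps [simp]:
  "is_word []" "is_word (b # u) \<longleftrightarrow> snd b > 0 \<and> is_word u"
  "is_word (u @ v) \<longleftrightarrow> is_word u \<and> is_word v"
  by (auto simp: is_word_def)

locale fock =
  fixes S :: "('a, 'x) tmodule_scheme" and l :: complex
  assumes tm: "tmod S"
begin

sublocale S: Module.module complex_field S
  using tm by (simp add: tmod_def)

lemma vS: "vspace S" and hm: "linop S (hmul S j)"
  using tm by (simp_all add: tmod_def)

abbreviation "F \<equiv> fock_space S"

lemmas Ssm = vspace_smult[OF vS]

lemma hmul_simps [simp]: "hmul S j \<zero>\<^bsub>S\<^esub> = \<zero>\<^bsub>S\<^esub>" "x \<in> carrier S \<Longrightarrow> hmul S j x \<in> carrier S"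
  using linop_zero[OF vS hm] linopD(1)[OF hm] by auto

lemma smult_zero [simp]: "a \<odot>\<^bsub>S\<^esub> \<zero>\<^bsub>S\<^esub> = \<zero>\<^bsub>S\<^esub>"
  by (rule Ssm(7))

lemma fock_carrierD:
  assumes "\<phi> \<in> carrier F"
  shows "finite {u. \<phi> u \<noteq> \<zero>\<^bsub>S\<^esub>}" "\<phi> u \<in> carrier S" "\<phi> u \<noteq> \<zero>\<^bsub>S\<^esub> \<Longrightarrow> is_word u"
  using assms by (auto simp: fock_simps)

lemma fock_carrierI:
  assumes "finite B" "\<And>u. \<phi> u \<noteq> \<zero>\<^bsub>S\<^esub> \<Longrightarrow> u \<in> B" "\<And>u. \<phi> u \<in> carrier S"
    "\<And>u. \<phi> u \<noteq> \<zero>\<^bsub>S\<^esub> \<Longrightarrow> is_word u"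
  shows "\<phi> \<in> carrier F"
  using assms finite_subset[of "{u. \<phi> u \<noteq> \<zero>\<^bsub>S\<^esub>}" B] by (auto simp: fock_simps)

lemma vF: "vspace F"
proof -
  have ne: "(- 1) \<odot>\<^bsub>S\<^esub> x \<oplus>\<^bsub>S\<^esub> x = \<zero>\<^bsub>S\<^esub>" if "x \<in> carrier S" for x
    using that S.l_neg[OF that] vspace_uminus[OF vS that] by metis
  show ?thesis
  proof (rule vspaceI)
    show "\<zero>\<^bsub>F\<^esub> \<in> carrier F" by (auto simp: fock_simps)
    fix \<phi> a assume p: "\<phi> \<in> carrier F"
    note P = fock_carrierD[OF p]
    show "a \<odot>\<^bsub>F\<^esub> \<phi> \<in> carrier F"
      by (rule fock_carrierI[OF P(1)]) (use P smult_zero[of a] in \<open>auto simp: fock_simps(4) Ssm, metis\<close>)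
    show "\<zero>\<^bsub>F\<^esub> \<oplus>\<^bsub>F\<^esub> \<phi> = \<phi>" "(- 1) \<odot>\<^bsub>F\<^esub> \<phi> \<oplus>\<^bsub>F\<^esub> \<phi> = \<zero>\<^bsub>F\<^esub>"
      "(a + b) \<odot>\<^bsub>F\<^esub> \<phi> = a \<odot>\<^bsub>F\<^esub> \<phi> \<oplus>\<^bsub>F\<^esub> b \<odot>\<^bsub>F\<^esub> \<phi>"
      "(a * b) \<odot>\<^bsub>F\<^esub> \<phi> = a \<odot>\<^bsub>F\<^esub> (b \<odot>\<^bsub>F\<^esub> \<phi>)" "1 \<odot>\<^bsub>F\<^esub> \<phi> = \<phi>" for b
      using P(2) ne by (auto simp: fock_simps(2-) Ssm)
    fix \<psi> assume q: "\<psi> \<in> carrier F"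
    note Q = fock_carrierD[OF q]
    show "\<phi> \<oplus>\<^bsub>F\<^esub> \<psi> \<in> carrier F"
    proof (rule fock_carrierI[OF finite_UnI[OF P(1) Q(1)]])
      fix u assume "(\<phi> \<oplus>\<^bsub>F\<^esub> \<psi>) u \<noteq> \<zero>\<^bsub>S\<^esub>"
      then have "\<phi> u \<noteq> \<zero>\<^bsub>S\<^esub> \<or> \<psi> u \<noteq> \<zero>\<^bsub>S\<^esub>" by (auto simp: fock_simps)
      then show "u \<in> {u. \<phi> u \<noteq> \<zero>\<^bsub>S\<^esub>} \<union> {u. \<psi> u \<noteq> \<zero>\<^bsub>S\<^esub>}" "is_word u" using P Q by auto
    qed (use P Q in \<open>auto simp: fock_simps\<close>)
    show "\<phi> \<oplus>\<^bsub>F\<^esub> \<psi> = \<psi> \<oplus>\<^bsub>F\<^esub> \<phi>" using P(2) Q(2) by (auto simp: fock_simps(2-) S.a_comm)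
    show "a \<odot>\<^bsub>F\<^esub> (\<phi> \<oplus>\<^bsub>F\<^esub> \<psi>) = a \<odot>\<^bsub>F\<^esub> \<phi> \<oplus>\<^bsub>F\<^esub> a \<odot>\<^bsub>F\<^esub> \<psi>"
      using P(2) Q(2) by (auto simp: fock_simps(2-) Ssm)
    fix \<omega> assume "\<omega> \<in> carrier F"
    then show "\<phi> \<oplus>\<^bsub>F\<^esub> \<psi> \<oplus>\<^bsub>F\<^esub> \<omega> = \<phi> \<oplus>\<^bsub>F\<^esub> (\<psi> \<oplus>\<^bsub>F\<^esub> \<omega>)"
      using P(2) Q(2) fock_carrierD(2) by (auto simp: fock_simps(2-) S.a_assoc)
  qed
qed

sublocale F: Module.module complex_field F
  by (rule vF)

lemma linop_prep:
  assumes "snd b > 0"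
  shows "linop F (prep S b)"
  unfolding linop_def
proof (intro conjI ballI allI)
  fix \<phi> assume p: "\<phi> \<in> carrier F"
  note P = fock_carrierD[OF p]
  show "prep S b \<phi> \<in> carrier F"
    by (rule fock_carrierI[OF finite_imageI[OF P(1), of "\<lambda>u. b # u"]])
      (use P assms in \<open>auto simp: prep_def split: list.splits if_splits\<close>)
qed (auto simp: prep_def fock_simps(3,4) fun_eq_iff split: list.splits)

lemma linop_osc_zero: "linop F (osc l S j 0)"
  unfolding linop_def
proof (intro conjI ballI allI)
  fix \<phi> assume p: "\<phi> \<in> carrier F"
  note P = fock_carrierD[OF p]
  show "osc l S j 0 \<phi> \<in> carrier F"
    by (rule fock_carrierI[OF P(1)]) (use P hmul_simps(1)[of j] in \<open>auto simp: osc_zero, metis\<close>)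
qed (auto simp: osc_zero fock_simps fun_eq_iff linopD[OF hm])

text \<open>Up to the factor \<open>2 * m * l\<close> this is, for \<open>b = (j, m)\<close>, the
  mode of index \<open>m\<close> and sign \<open>opp j\<close>: the derivation that deletes the
  letter \<open>b\<close>, read off at the word that remains.\<close>

definition isum :: "charge \<times> nat \<Rightarrow> (word \<Rightarrow> 'a) \<Rightarrow> word \<Rightarrow> 'a" where
  "isum b \<phi> = (\<lambda>u. \<Oplus>\<^bsub>S\<^esub>r\<in>{..length u}. \<phi> (take r u @ b # drop r u))"

lemma osc_isum: "n > 0 \<Longrightarrow> osc l S j n \<phi> = (2 * of_int n * l) \<odot>\<^bsub>F\<^esub> isum (opp j, nat n) \<phi>"
  by (simp add: osc_pos isum_def fock_simps)

lemma isum_nonzeroD: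
  assumes "isum b \<phi> u \<noteq> \<zero>\<^bsub>S\<^esub>"
  shows "\<exists>r\<le>length u. \<phi> (take r u @ b # drop r u) \<noteq> \<zero>\<^bsub>S\<^esub>"
proof (rule ccontr)
  assume "\<not> ?thesis"
  then have "isum b \<phi> u = (\<Oplus>\<^bsub>S\<^esub>r\<in>{..length u}. \<zero>\<^bsub>S\<^esub>)"
    unfolding isum_def by (intro S.finsum_cong') auto
  then show False using assms by simp
qed

lemma linop_isum: "linop F (isum b)"
  unfolding linop_def
proof (intro conjI ballI allI)
  fix \<phi> assume p: "\<phi> \<in> carrier F"
  note P = fock_carrierD[OF p]
  show "isum b \<phi> \<in> carrier F"
  proof (rule fock_carrierI)
    \<comment> \<open>These are the words left over when one letter is deleted from a word in the
      support of \<phi>.\<close>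
    show "finite (\<Union>v\<in>{u. \<phi> u \<noteq> \<zero>\<^bsub>S\<^esub>}. (\<lambda>r. take r v @ drop (Suc r) v) ` {..length v})"
      using P(1) by auto
    fix u
    show "isum b \<phi> u \<in> carrier S" using P(2) by (auto simp: isum_def)
    assume "isum b \<phi> u \<noteq> \<zero>\<^bsub>S\<^esub>"
    then obtain r where r: "r \<le> length u" "\<phi> (take r u @ b # drop r u) \<noteq> \<zero>\<^bsub>S\<^esub>"
      using isum_nonzeroD by blast
    have "is_word (take r u @ b # drop r u)" using P(3) r by blast
    then have "is_word (take r u @ drop r u)" unfolding is_word_simps by blast
    then show "is_word u" by simp
    have "u = take r (take r u @ b # drop r u) @ drop (Suc r) (take r u @ b # drop r u)"
      using r(1) by simp
    moreover have "r \<le> length (take r u @ b # drop r u)" using r(1) by simp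
    ultimately show "u \<in> (\<Union>v\<in>{u. \<phi> u \<noteq> \<zero>\<^bsub>S\<^esub>}. (\<lambda>r. take r v @ drop (Suc r) v) ` {..length v})"
      using r(2) by blast
  qed
  fix a show "isum b (a \<odot>\<^bsub>F\<^esub> \<phi>) = a \<odot>\<^bsub>F\<^esub> isum b \<phi>"
    using P(2) by (auto simp: isum_def fock_simps fun_eq_iff intro!: S.finsum_smult_ldistr[symmetric])
  fix \<psi> assume "\<psi> \<in> carrier F"
  then show "isum b (\<phi> \<oplus>\<^bsub>F\<^esub> \<psi>) = isum b \<phi> \<oplus>\<^bsub>F\<^esub> isum b \<psi>"
    using P(2) fock_carrierD(2)
    by (auto simp: isum_def fock_simps(3) fun_eq_iff intro!: S.finsum_addf)
qed

lemma linop_osc: "linop F (osc l S j n)"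
proof -
  consider "n < 0" | "n = 0" | "n > 0" by linarith
  then show ?thesis
  proof cases
    case 1
    then show ?thesis using linop_prep[of "(j, nat (- n))"] osc_neg[OF 1, of l S j]
      by (simp add: linop_def)
  next
    case 2 then show ?thesis using linop_osc_zero by simp
  next
    case 3
    then show ?thesis using linop_smult[OF vF linop_isum, of "2 * of_int n * l" "(opp j, nat n)"]
      by (simp add: linop_def osc_isum)
  qed
qed

lemma linop_foldr_osc: "linop F (foldr (\<lambda>(j, n). osc l S j n) bs)"
proof (induction bs)
  case Nil then show ?case using linop_id[OF vF] by (simp add: id_def)
next
  case (Cons b bs)
  then show ?case using linop_comp[OF linop_osc Cons] by (cases b) (simp add: comp_def)
qed

lemma linop_nord: "linop F (nord l S bs)"
  unfolding nord_def by (rule linop_foldr_osc)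

text \<open>The commutation relation of an annihilating and a creating mode: insertion at position 0
  must produce the first letter \<open>c\<close> itself, all later positions insert behind
  it.\<close>

lemma isum_prep:
  assumes "\<phi> \<in> carrier F"
  shows "isum b (prep S c \<phi>) = prep S c (isum b \<phi>) \<oplus>\<^bsub>F\<^esub> (if b = c then \<phi> else \<zero>\<^bsub>F\<^esub>)"
proof
  fix u
  note P = fock_carrierD(2)[OF assms]
  have cl: "prep S c \<phi> v \<in> carrier S" for v using P by (auto simp: prep_def split: list.splits)
  show "isum b (prep S c \<phi>) u = (prep S c (isum b \<phi>) \<oplus>\<^bsub>F\<^esub> (if b = c then \<phi> else \<zero>\<^bsub>F\<^esub>)) u"
  proof (cases u)
    case Nil
    then show ?thesis using P by (simp add: isum_def prep_def fock_simps(2,3))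
  next
    case (Cons a v)
    have "isum b (prep S c \<phi>) u = prep S c \<phi> (b # u) \<oplus>\<^bsub>S\<^esub>
        (\<Oplus>\<^bsub>S\<^esub>r\<in>Suc ` {..length v}. prep S c \<phi> (take r u @ b # drop r u))"
      using cl by (simp add: isum_def Cons atMost_Suc_eq_insert_0 S.finsum_insert)
    also have "(\<Oplus>\<^bsub>S\<^esub>r\<in>Suc ` {..length v}. prep S c \<phi> (take r u @ b # drop r u)) =
        (\<Oplus>\<^bsub>S\<^esub>r\<in>{..length v}. prep S c \<phi> (a # take r v @ b # drop r v))"
      using cl by (subst S.finsum_reindex) (auto simp: Cons)
    also have "\<dots> = prep S c (isum b \<phi>) u"
      by (simp add: prep_def isum_def Cons)
    finally show ?thesis
      using P S.a_comm by (auto simp: prep_def fock_simps(2,3) isum_def Cons)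
  qed
qed

section \<open>Charge sectors\<close>

lemma monom_at_carrier [simp]: "is_word u \<Longrightarrow> x \<in> carrier S \<Longrightarrow> monom_at S u x \<in> carrier F"
  by (rule fock_carrierI[of "{u}"]) (auto simp: monom_at_def split: if_splits)

lemma zact_carrier [simp]: "s \<in> carrier S \<Longrightarrow> zact S s z \<in> carrier S"
  by (induction z) (auto simp: zact_def)

lemma prep_monom: "prep S b (monom_at S u x) = monom_at S (b # u) x"
  by (auto simp: prep_def monom_at_def fun_eq_iff split: list.splits)

lemma osc_zero_monom: "osc l S j 0 (monom_at S u x) = monom_at S u (hmul S j x)"
  by (auto simp: osc_zero monom_at_def fun_eq_iff)

lemma isum_Nil: "x \<in> carrier S \<Longrightarrow> isum b (monom_at S [] x) = \<zero>\<^bsub>F\<^esub>"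
  by (auto simp: isum_def monom_at_def fock_simps(2))

context
  fixes s assumes s: "s \<in> carrier S"
begin

lemma mode_elt_eq:
  assumes "is_word u"
  shows "mode_elt l S s u z = monom_at S u (zact S s z)"
proof -
  have "foldr (\<lambda>j. osc l S j 0) z (vac S s) = monom_at S [] (zact S s z)"
  proof (induction z)
    case Nil then show ?case by (simp add: vac_def monom_at_def zact_def)
  next
    case (Cons j z) then show ?case by (simp add: osc_zero_monom zact_def)
  qed
  then show ?thesis
    unfolding mode_elt_def using assms
  proof (induction u)
    case (Cons b u)
    then show ?case by (cases b) (simp add: osc_neg prep_monom)
  qed simp
qed

lemma lsub_sector: "lsub (sector S s c) F"
  unfolding sector_def by (rule lsub_lspan[OF vF]) (use s in auto)

lemma sector_carrier: "sector S s c \<subseteq> carrier F"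
  using lsubD(1)[OF vF lsub_sector] by blast

lemma monom_sector:
  "is_word u \<Longrightarrow> charge_sum (map fst u @ z) = c \<Longrightarrow> monom_at S u (zact S s z) \<in> sector S s c"
  unfolding sector_def by (rule subsetD[OF lspan_superset]) blast

lemma linop_sector:
  assumes f: "linop F f" and W: "lsub W F"
    and "\<And>u z. is_word u \<Longrightarrow> charge_sum (map fst u @ z) = c \<Longrightarrow> f (monom_at S u (zact S s z)) \<in> W"
  assumes p: "\<phi> \<in> sector S s c"
  shows "f \<phi> \<in> W"
proof -
  have "sector S s c \<subseteq> {\<phi> \<in> carrier F. f \<phi> \<in> W}"
    unfolding sector_def using assms(3) s
    by (intro lspan_least linop_preimage[OF vF f W]) auto
  then show ?thesis using p by blast
qed

lemma prep_sector:
  assumes "snd b > 0" "\<phi> \<in> sector S s c"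
  shows "prep S b \<phi> \<in> sector S s (cval (fst b) + c)"
  by (rule linop_sector[OF linop_prep lsub_sector _ assms(2)])
    (use assms(1) in \<open>auto simp: prep_monom intro!: monom_sector\<close>)

lemma isum_monom_sector:
  assumes "is_word u" "charge_sum (map fst u @ z) = c"
  shows "isum b (monom_at S u (zact S s z)) \<in> sector S s (c - cval (fst b))"
  using assms
proof (induction u arbitrary: c)
  case Nil
  then show ?case using lsubD(2)[OF vF lsub_sector] s by (simp add: isum_Nil)
next
  case (Cons a u)
  have 0: "isum b (monom_at S u (zact S s z)) \<in> sector S s (c - cval (fst a) - cval (fst b))"
    using Cons.IH[of "c - cval (fst a)"] Cons.prems by simp
  have 1: "prep S a (isum b (monom_at S u (zact S s z))) \<in> sector S s (c - cval (fst b))"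
    using prep_sector[OF _ 0, of a] Cons.prems(1) by (simp add: algebra_simps)
  have "(if b = a then monom_at S u (zact S s z) else \<zero>\<^bsub>F\<^esub>) \<in> sector S s (c - cval (fst b))"
    using lsubD(2)[OF vF lsub_sector] Cons monom_sector[of u z "c - cval (fst b)"] by auto
  then show ?case
    using isum_prep[of "monom_at S u (zact S s z)" b a] lsubD(3)[OF vF lsub_sector 1] Cons s
    by (simp add: prep_monom)
qed

lemma osc_sector:
  assumes "\<phi> \<in> sector S s c"
  shows "osc l S j n \<phi> \<in> sector S s (cval j + c)"
proof -
  consider "n < 0" | "n = 0" | "n > 0" by linarith
  then show ?thesis
  proof cases
    case 1
    then show ?thesis using prep_sector[OF _ assms, of "(j, nat (- n))"] by (simp add: osc_neg)
  next
    case 2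
    have "osc l S j 0 (monom_at S u (zact S s z)) \<in> sector S s (cval j + c)"
      if "is_word u" "charge_sum (map fst u @ z) = c" for u z
      using monom_sector[of u "j # z" "cval j + c"] that by (simp add: osc_zero_monom zact_def)
    then show ?thesis using 2 linop_sector[OF linop_osc lsub_sector _ assms] by blast
  next
    case 3
    have "isum (opp j, nat n) \<phi> \<in> sector S s (cval j + c)"
    proof (rule linop_sector[OF linop_isum lsub_sector _ assms])
      fix u z assume "is_word u" "charge_sum (map fst u @ z) = c"
      from isum_monom_sector[OF this, of "(opp j, nat n)"]
      show "isum (opp j, nat n) (monom_at S u (zact S s z)) \<in> sector S s (cval j + c)"
        by (simp add: add.commute)
    qed
    then show ?thesis using 3 by (simp add: osc_isum lsubD(4)[OF vF lsub_sector])
  qed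
qed

lemma foldr_osc_sector:
  "\<phi> \<in> sector S s c \<Longrightarrow>
    foldr (\<lambda>(j, n). osc l S j n) bs \<phi> \<in> sector S s (charge_sum (map fst bs) + c)"
proof (induction bs)
  case (Cons b bs)
  then show ?case using osc_sector[OF Cons.IH[OF Cons.prems]] by (cases b) (simp add: add.assoc)
qed simp

text \<open>Normal ordering only rearranges the modes, so the total charge is that of the given
  list.\<close>

lemma nord_sector:
  assumes "\<phi> \<in> sector S s c"
  shows "nord l S bs \<phi> \<in> sector S s (charge_sum (map fst bs) + c)"
proof -
  have "charge_sum (map fst bs) = charge_sum (map fst (filter (\<lambda>b. snd b < 0) bs @
      filter (\<lambda>b. snd b > 0) bs @ filter (\<lambda>b. snd b = 0) bs))"
    by (induction bs) auto
  then show ?thesis using foldr_osc_sector[OF assms] unfolding nord_def by metis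
qed

end


end

section \<open>Modes of basis words\<close>

definition wt_le :: "('a, 'x) tmodule_scheme \<Rightarrow> nat \<Rightarrow> (word \<Rightarrow> 'a) \<Rightarrow> bool" where
  "wt_le S D \<phi> \<longleftrightarrow> \<phi> \<in> carrier (fock_space S) \<and> (\<forall>u. \<phi> u \<noteq> \<zero>\<^bsub>S\<^esub> \<longrightarrow> word_wt u \<le> D)"

lemma word_wt_simps [simp]:
  "word_wt [] = 0" "word_wt (b # u) = snd b + word_wt u" "word_wt (u @ v) = word_wt u + word_wt v"
  by (simp_all add: word_wt_def)

context fock
begin

lemma wt_le_exists:
  assumes "\<phi> \<in> carrier F"
  obtains D where "wt_le S D \<phi>"
proof
  show "wt_le S (Max (word_wt ` {u. \<phi> u \<noteq> \<zero>\<^bsub>S\<^esub>})) \<phi>"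
    using assms fock_carrierD(1)[OF assms] by (auto simp: wt_le_def intro!: Max_ge)
qed

lemma wt_le_osc:
  assumes "wt_le S D \<phi>" "n \<ge> 0"
  shows "wt_le S D (osc l S j n \<phi>)" and "n > int D \<Longrightarrow> osc l S j n \<phi> = \<zero>\<^bsub>F\<^esub>"
proof -
  have p: "\<phi> \<in> carrier F" and D: "\<And>u. \<phi> u \<noteq> \<zero>\<^bsub>S\<^esub> \<Longrightarrow> word_wt u \<le> D"
    using assms(1) by (auto simp: wt_le_def)
  have i: "word_wt u + nat n \<le> D" if i: "isum (opp j, nat n) \<phi> u \<noteq> \<zero>\<^bsub>S\<^esub>" for u
  proof -
    obtain r where "\<phi> (take r u @ (opp j, nat n) # drop r u) \<noteq> \<zero>\<^bsub>S\<^esub>"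
      using isum_nonzeroD[of "(opp j, nat n)" \<phi> u] i by blast
    then have "word_wt (take r u @ (opp j, nat n) # drop r u) \<le> D" by (rule D)
    moreover have "word_wt (take r u @ drop r u) = word_wt (take r u) + word_wt (drop r u)"
      by (rule word_wt_simps)
    ultimately show ?thesis by simp
  qed
  have c: "osc l S j n \<phi> \<in> carrier F" using linopD(1)[OF linop_osc p] .
  have h: "osc l S j n \<phi> u \<noteq> \<zero>\<^bsub>S\<^esub> \<Longrightarrow> word_wt u \<le> D" for u
  proof (cases "n = 0")
    case True
    assume "osc l S j n \<phi> u \<noteq> \<zero>\<^bsub>S\<^esub>"
    then have "\<phi> u \<noteq> \<zero>\<^bsub>S\<^esub>" using True by (auto simp: osc_zero)
    then show ?thesis by (rule D)
  next
    case False
    assume "osc l S j n \<phi> u \<noteq> \<zero>\<^bsub>S\<^esub>"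
    then have "isum (opp j, nat n) \<phi> u \<noteq> \<zero>\<^bsub>S\<^esub>" using False assms(2) by (auto simp: osc_isum fock_simps(4))
    then show ?thesis using i by fastforce
  qed
  then show "wt_le S D (osc l S j n \<phi>)" using c by (simp add: wt_le_def)
  assume n: "n > int D"
  then have "isum (opp j, nat n) \<phi> u = \<zero>\<^bsub>S\<^esub>" for u using i[of u] by linarith
  then show "osc l S j n \<phi> = \<zero>\<^bsub>F\<^esub>" using n by (simp add: osc_isum fock_simps fun_eq_iff)
qed

lemma foldr_osc_wt_le:
  assumes "wt_le S D \<phi>" "\<forall>b\<in>set bs. snd b \<ge> 0"
  shows "wt_le S D (foldr (\<lambda>(j, n). osc l S j n) bs \<phi>)"
    and "b \<in> set bs \<Longrightarrow> snd b > int D \<Longrightarrow> foldr (\<lambda>(j, n). osc l S j n) bs \<phi> = \<zero>\<^bsub>F\<^esub>"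
  using assms(2)
proof (induction bs)
  case Nil
  { case 1 show ?case using assms(1) by simp }
  { case 2 then show ?case by simp }
next
  case (Cons c bs)
  { case 1 then show ?case using wt_le_osc(1)[OF Cons.IH(1)] by (cases c) simp }
  { case 2
    show ?case
    proof (cases "b \<in> set bs")
      case True
      then have "foldr (\<lambda>(j, n). osc l S j n) bs \<phi> = \<zero>\<^bsub>F\<^esub>" using Cons.IH(2) 2 by simp
      then show ?thesis using linop_zero[OF vF linop_osc] by (cases c) simp
    next
      case False
      then show ?thesis using 2 wt_le_osc(2)[OF Cons.IH(1)] by (cases c) simp
    qed }
qed

text \<open>In a normal ordered product the nonnegative modes act first, when the weight is still at
  most \<open>D\<close>; a mode above \<open>D\<close> then finds no letter to delete.\<close>

lemma nord_eq_zero: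
  assumes "wt_le S D \<phi>" "b \<in> set bs" "snd b > int D"
  shows "nord l S bs \<phi> = \<zero>\<^bsub>F\<^esub>"
proof -
  have "foldr (\<lambda>(j, n). osc l S j n) (filter (\<lambda>b. snd b > 0) bs @ filter (\<lambda>b. snd b = 0) bs) \<phi> = \<zero>\<^bsub>F\<^esub>"
    using assms by (intro foldr_osc_wt_le(2)[of D _ _ b]) auto
  then show ?thesis
    using linop_zero[OF vF linop_foldr_osc] by (simp add: nord_def)
qed

definition mode_set :: "word \<Rightarrow> int \<Rightarrow> (word \<Rightarrow> 'a) \<Rightarrow> int list set" where
  "mode_set w n \<phi> = {ns. length ns = length w \<and>
          (\<Sum>r<length w. ns ! r + int (snd (w ! r))) = n + 1 \<and>
          nord l S (zip (map fst w) ns) \<phi> \<noteq> \<zero>\<^bsub>F\<^esub>}"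

definition mode_coef :: "word \<Rightarrow> int list \<Rightarrow> complex" where
  "mode_coef w ns = (\<Prod>r<length w. of_int (- (ns ! r) - 1) gchoose (snd (w ! r) - 1))"

text \<open>Mode numbers above a weight bound of \<phi> make the product vanish, and since the sum
  of the mode numbers is prescribed, the upper bound entails a lower one.\<close>

lemma finite_mode_set:
  assumes "\<phi> \<in> carrier F"
  shows "finite (mode_set w n \<phi>)"
proof -
  obtain D where D: "wt_le S D \<phi>" using wt_le_exists[OF assms] .
  define L where "L = n + 1 - (\<Sum>r<length w. int (snd (w ! r))) - int (length w) * int D"
  have "mode_set w n \<phi> \<subseteq> {ns. set ns \<subseteq> {L..int D} \<and> length ns = length w}"
  proof
    fix ns assume "ns \<in> mode_set w n \<phi>"
    then have len: "length ns = length w" and sm: "(\<Sum>r<length w. ns ! r + int (snd (w ! r))) = n + 1"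
      and nz: "nord l S (zip (map fst w) ns) \<phi> \<noteq> \<zero>\<^bsub>F\<^esub>" by (auto simp: mode_set_def)
    have up: "ns ! r \<le> int D" if "r < length w" for r
    proof (rule ccontr)
      assume "\<not> ns ! r \<le> int D"
      moreover have "(map fst w ! r, ns ! r) \<in> set (zip (map fst w) ns)"
        using that len by (auto simp: set_zip intro!: exI[of _ r])
      ultimately show False using nord_eq_zero[OF D] nz by force
    qed
    have "L \<le> ns ! r" if r: "r < length w" for r
    proof -
      have "(\<Sum>i<length w. ns ! i) = ns ! r + (\<Sum>i\<in>{..<length w} - {r}. ns ! i)"
        using r by (simp add: sum.remove)
      also have "(\<Sum>i\<in>{..<length w} - {r}. ns ! i) \<le> (\<Sum>i\<in>{..<length w} - {r}. int D)"
        using up by (intro sum_mono) auto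
      also have "\<dots> \<le> int (length w) * int D" using r by (simp add: mult_right_mono)
      finally show ?thesis using sm by (simp add: sum.distrib L_def)
    qed
    then show "ns \<in> {ns. set ns \<subseteq> {L..int D} \<and> length ns = length w}"
      using up len by (auto simp: set_conv_nth)
  qed
  then show ?thesis by (rule finite_subset) (intro finite_lists_length_eq, simp)
qed

lemma word_mode_eq:
  "word_mode l S w n \<phi> = (\<Oplus>\<^bsub>F\<^esub>ns\<in>mode_set w n \<phi>. mode_coef w ns \<odot>\<^bsub>F\<^esub> nord l S (zip (map fst w) ns) \<phi>)"
  by (simp add: word_mode_def mode_set_def mode_coef_def)

lemma nord_carrier: "\<phi> \<in> carrier F \<Longrightarrow> nord l S bs \<phi> \<in> carrier F"
  by (rule linopD(1)[OF linop_nord])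

text \<open>The index set of \<open>word_mode\<close> depends on the vector. Enlarging it by
  vanishing products puts the sums for several vectors over one common set, as linearity
  requires.\<close>

lemma word_mode_superset:
  assumes p: "\<phi> \<in> carrier F" and B: "finite B" "mode_set w n \<phi> \<subseteq> B"
    and z: "\<And>ns. ns \<in> B - mode_set w n \<phi> \<Longrightarrow> nord l S (zip (map fst w) ns) \<phi> = \<zero>\<^bsub>F\<^esub>"
  shows "word_mode l S w n \<phi> = (\<Oplus>\<^bsub>F\<^esub>ns\<in>B. mode_coef w ns \<odot>\<^bsub>F\<^esub> nord l S (zip (map fst w) ns) \<phi>)"
  unfolding word_mode_eq
proof (rule F.add.finprod_mono_neutral_cong_left[OF B])
  show "mode_coef w i \<odot>\<^bsub>F\<^esub> nord l S (zip (map fst w) i) \<phi> = \<zero>\<^bsub>F\<^esub>" if "i \<in> B - mode_set w n \<phi>" for i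
    using z[OF that] vspace_smult(7)[OF vF] by simp
qed (use nord_carrier[OF p] vspace_smult(1)[OF vF] in auto)

lemma linop_word_mode: "linop F (word_mode l S w n)"
proof -
  define A where "A = (\<lambda>\<phi>. mode_set w n \<phi>)"
  have fin: "\<phi> \<in> carrier F \<Longrightarrow> finite (A \<phi>)" for \<phi> by (simp add: A_def finite_mode_set)
  have wm: "word_mode l S w n \<phi> = (\<Oplus>\<^bsub>F\<^esub>ns\<in>B. mode_coef w ns \<odot>\<^bsub>F\<^esub> nord l S (zip (map fst w) ns) \<phi>)"
    if "\<phi> \<in> carrier F" "finite B" "A \<phi> \<subseteq> B"
      "\<And>ns. ns \<in> B \<Longrightarrow> length ns = length w \<and> (\<Sum>r<length w. ns ! r + int (snd (w ! r))) = n + 1" for \<phi> B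
    by (rule word_mode_superset) (use that in \<open>auto simp: A_def mode_set_def\<close>)
  have AD: "ns \<in> A \<phi> \<Longrightarrow> length ns = length w \<and> (\<Sum>r<length w. ns ! r + int (snd (w ! r))) = n + 1" for ns \<phi>
    by (simp add: A_def mode_set_def)
  have cl: "\<phi> \<in> carrier F \<Longrightarrow> mode_coef w ns \<odot>\<^bsub>F\<^esub> nord l S (zip (map fst w) ns) \<phi> \<in> carrier F" for ns \<phi>
    by (simp add: vspace_smult(1)[OF vF] nord_carrier)
  show ?thesis unfolding linop_def
  proof (intro conjI ballI allI)
    fix \<phi> assume p: "\<phi> \<in> carrier F"
    show "word_mode l S w n \<phi> \<in> carrier F" unfolding word_mode_eq by (intro F.finsum_closed) (use cl p in auto)
    { fix a
      have q: "a \<odot>\<^bsub>F\<^esub> \<phi> \<in> carrier F" using p by (rule vspace_smult(1)[OF vF])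
      let ?B = "A \<phi> \<union> A (a \<odot>\<^bsub>F\<^esub> \<phi>)"
      have B: "finite ?B" using fin p q by blast
      have "word_mode l S w n (a \<odot>\<^bsub>F\<^esub> \<phi>) =
          (\<Oplus>\<^bsub>F\<^esub>ns\<in>?B. mode_coef w ns \<odot>\<^bsub>F\<^esub> nord l S (zip (map fst w) ns) (a \<odot>\<^bsub>F\<^esub> \<phi>))"
        using wm[OF q B] AD by blast
      also have "\<dots> = (\<Oplus>\<^bsub>F\<^esub>ns\<in>?B. a \<odot>\<^bsub>F\<^esub> (mode_coef w ns \<odot>\<^bsub>F\<^esub> nord l S (zip (map fst w) ns) \<phi>))"
        using cl p by (intro F.finsum_cong') (auto simp: linopD(3)[OF linop_nord] vspace_smult(1)[OF vF] nord_carrier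
            mult.commute simp flip: vspace_smult(4)[OF vF])
      also have "\<dots> = a \<odot>\<^bsub>F\<^esub> (\<Oplus>\<^bsub>F\<^esub>ns\<in>?B. mode_coef w ns \<odot>\<^bsub>F\<^esub> nord l S (zip (map fst w) ns) \<phi>)"
        using cl p B by (intro F.finsum_smult_ldistr[symmetric]) auto
      also have "\<dots> = a \<odot>\<^bsub>F\<^esub> word_mode l S w n \<phi>"
        using wm[OF p B] AD by (metis (no_types, lifting) Un_upper1 Un_iff)
      finally show "word_mode l S w n (a \<odot>\<^bsub>F\<^esub> \<phi>) = a \<odot>\<^bsub>F\<^esub> word_mode l S w n \<phi>" . }
    { fix \<psi> assume q: "\<psi> \<in> carrier F"
      have pq: "\<phi> \<oplus>\<^bsub>F\<^esub> \<psi> \<in> carrier F" using p q by simp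
      let ?B = "A \<phi> \<union> A \<psi> \<union> A (\<phi> \<oplus>\<^bsub>F\<^esub> \<psi>)"
      have B: "finite ?B" using fin p q pq by blast
      have "word_mode l S w n (\<phi> \<oplus>\<^bsub>F\<^esub> \<psi>) =
          (\<Oplus>\<^bsub>F\<^esub>ns\<in>?B. mode_coef w ns \<odot>\<^bsub>F\<^esub> nord l S (zip (map fst w) ns) (\<phi> \<oplus>\<^bsub>F\<^esub> \<psi>))"
        using wm[OF pq B] AD by blast
      also have "\<dots> = (\<Oplus>\<^bsub>F\<^esub>ns\<in>?B. mode_coef w ns \<odot>\<^bsub>F\<^esub> nord l S (zip (map fst w) ns) \<phi> \<oplus>\<^bsub>F\<^esub>
          mode_coef w ns \<odot>\<^bsub>F\<^esub> nord l S (zip (map fst w) ns) \<psi>)"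
        using cl p q by (intro F.finsum_cong') (auto simp: linopD(2)[OF linop_nord] vspace_smult(3)[OF vF] nord_carrier)
      also have "\<dots> = (\<Oplus>\<^bsub>F\<^esub>ns\<in>?B. mode_coef w ns \<odot>\<^bsub>F\<^esub> nord l S (zip (map fst w) ns) \<phi>) \<oplus>\<^bsub>F\<^esub>
          (\<Oplus>\<^bsub>F\<^esub>ns\<in>?B. mode_coef w ns \<odot>\<^bsub>F\<^esub> nord l S (zip (map fst w) ns) \<psi>)"
        using cl p q by (intro F.finsum_addf) auto
      also have "\<dots> = word_mode l S w n \<phi> \<oplus>\<^bsub>F\<^esub> word_mode l S w n \<psi>"
        using wm[OF p B] wm[OF q B] AD by (metis (no_types, lifting) Un_upper1 Un_upper2 Un_iff le_supI1)
      finally show "word_mode l S w n (\<phi> \<oplus>\<^bsub>F\<^esub> \<psi>) = word_mode l S w n \<phi> \<oplus>\<^bsub>F\<^esub> word_mode l S w n \<psi>" . }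
  qed
qed

end

section \<open>Interpolation\<close>

text \<open>Polynomials are generated from binomials because binomials are the coefficients that the
  modes of basis words supply.\<close>

inductive bpoly :: "(complex \<Rightarrow> complex) \<Rightarrow> bool" where
  zero: "bpoly (\<lambda>y. 0)"
| step: "bpoly q \<Longrightarrow> bpoly (\<lambda>y. q y + a * (y gchoose m))"

lemma bpoly_gchoose: "bpoly (\<lambda>y. a * (y gchoose m))"
  using bpoly.step[OF bpoly.zero, of a m] by simp

text \<open>Rests on \<open>y * (y gchoose m) = m * (y gchoose m) + (m + 1) * (y gchoose (m +
  1))\<close>.\<close>

lemma bpoly_mult_linear: "bpoly q \<Longrightarrow> bpoly (\<lambda>y. (a * y + b) * q y)"
proof (induction rule: bpoly.induct)
  case zero then show ?case using bpoly.zero by simp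
next
  case (step q c m)
  have "(a * y + b) * (q y + c * (y gchoose m)) = (a * y + b) * q y
      + (c * (a * of_nat m + b)) * (y gchoose m) + (c * a * of_nat (Suc m)) * (y gchoose Suc m)" for y
  proof -
    have "a * c * (y * (y gchoose m)) =
        a * c * (of_nat m * (y gchoose m) + of_nat (Suc m) * (y gchoose Suc m))"
      by (subst gbinomial_mult_1) simp
    then show ?thesis by (simp only: algebra_simps)
  qed
  then show ?case using bpoly.step[OF bpoly.step[OF step.IH]] by simp
qed

text \<open>A Lagrange polynomial, built up by one normalised linear factor for each further
  node.\<close>

lemma bpoly_delta:
  assumes "finite Y"
  shows "\<exists>q. bpoly q \<and> (\<forall>y\<in>insert y0 Y. q y = (if y = y0 then 1 else 0))"
  using assms
proof (induction Y)
  case empty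
  show ?case using bpoly_gchoose[of 1 0] by (intro exI[of _ "\<lambda>y. 1"]) simp
next
  case (insert z Y)
  then obtain q where q: "bpoly q" "\<forall>y\<in>insert y0 Y. q y = (if y = y0 then 1 else 0)" by blast
  show ?case
  proof (cases "z = y0")
    case True then show ?thesis using q by auto
  next
    case False
    let ?q = "\<lambda>y. (inverse (y0 - z) * y + (- z * inverse (y0 - z))) * q y"
    have "?q y = (y - z) / (y0 - z) * q y" for y by (simp add: divide_inverse algebra_simps)
    then have "?q y = (if y = y0 then 1 else 0)" if "y \<in> insert y0 (insert z Y)" for y
      using that q(2) False by auto
    then show ?thesis using bpoly_mult_linear[OF q(1)] by blast
  qed
qed

lemma linop_finsum:
  assumes "vspace M" "\<And>b. b \<in> B \<Longrightarrow> linop M (f b)"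
  shows "linop M (\<lambda>x. finsum M (\<lambda>b. f b x) B)"
proof -
  interpret Module.module complex_field M by fact
  show ?thesis
  proof (cases "finite B")
    case False
    then show ?thesis by (simp add: linop_def M.finsum_infinite vspace_smult(7)[OF assms(1)])
  next
    case True
    then show ?thesis using assms(2)
    proof (induction B)
      case empty then show ?case by (simp add: linop_def vspace_smult(7)[OF assms(1)])
    next
      case (insert c B)
      then have 1: "linop M (f c)" and 2: "linop M (\<lambda>x. finsum M (\<lambda>b. f b x) B)" by auto
      have eq: "finsum M (\<lambda>b. f b x) (insert c B) = f c x \<oplus>\<^bsub>M\<^esub> finsum M (\<lambda>b. f b x) B" if "x \<in> carrier M" for x
        using insert linopD(1)[OF insert.prems] that by (subst M.finsum_insert) auto
      show ?case
        unfolding linop_def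
      proof (intro conjI ballI allI)
        fix x a assume x: "x \<in> carrier M"
        note l = linopD[OF 1] linopD[OF 2]
        show "finsum M (\<lambda>b. f b x) (insert c B) \<in> carrier M" using l(1,4) x by (simp add: eq)
        show "finsum M (\<lambda>b. f b (a \<odot>\<^bsub>M\<^esub> x)) (insert c B) = a \<odot>\<^bsub>M\<^esub> finsum M (\<lambda>b. f b x) (insert c B)"
          using l x by (simp add: eq vspace_smult[OF assms(1)])
        fix y assume y: "y \<in> carrier M"
        show "finsum M (\<lambda>b. f b (x \<oplus>\<^bsub>M\<^esub> y)) (insert c B) =
            finsum M (\<lambda>b. f b x) (insert c B) \<oplus>\<^bsub>M\<^esub> finsum M (\<lambda>b. f b y) (insert c B)"
          using l x y by (simp add: eq M.a_ac)
      qed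
    qed
  qed
qed

lemma fock_module_simps:
  "carrier (fock_module l S) = carrier (fock_space S)" "add (fock_module l S) = add (fock_space S)"
  "zero (fock_module l S) = zero (fock_space S)" "smult (fock_module l S) = smult (fock_space S)"
  "wt_space (fock_module l S) d = {\<phi> \<in> carrier (fock_space S). \<forall>u. \<phi> u \<noteq> \<zero>\<^bsub>S\<^esub> \<longrightarrow> word_wt u = d}"
  "vmode (fock_module l S) v n \<phi> = (\<Oplus>\<^bsub>fock_space S\<^esub>w\<in>Poly_Mapping.keys v.
        Poly_Mapping.lookup v w \<odot>\<^bsub>fock_space S\<^esub> word_mode l S w n \<phi>)"
  by (simp_all add: fock_module_def module.extend_def vmodule.fields_def)

lemma lspan_cong:
  assumes "vspace M" "carrier M' = carrier M" "zero M' = zero M" "add M' = add M" "smult M' = smult M"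
  shows "lspan M' X = lspan M X"
  unfolding lspan_def using lsub_cong[OF assms] by simp

context fock
begin

lemma finsum_lincomb:
  assumes "finite B" "\<And>b. b \<in> B \<Longrightarrow> x b \<in> carrier F"
  shows "(\<Oplus>\<^bsub>F\<^esub>b\<in>B. (c b + a * d b) \<odot>\<^bsub>F\<^esub> x b) =
    (\<Oplus>\<^bsub>F\<^esub>b\<in>B. c b \<odot>\<^bsub>F\<^esub> x b) \<oplus>\<^bsub>F\<^esub> a \<odot>\<^bsub>F\<^esub> (\<Oplus>\<^bsub>F\<^esub>b\<in>B. d b \<odot>\<^bsub>F\<^esub> x b)"
proof -
  have "(\<Oplus>\<^bsub>F\<^esub>b\<in>B. (c b + a * d b) \<odot>\<^bsub>F\<^esub> x b) = (\<Oplus>\<^bsub>F\<^esub>b\<in>B. c b \<odot>\<^bsub>F\<^esub> x b \<oplus>\<^bsub>F\<^esub> a \<odot>\<^bsub>F\<^esub> (d b \<odot>\<^bsub>F\<^esub> x b))"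
    using assms(2) by (intro F.finsum_cong') (auto simp: vspace_smult[OF vF])
  also have "\<dots> = (\<Oplus>\<^bsub>F\<^esub>b\<in>B. c b \<odot>\<^bsub>F\<^esub> x b) \<oplus>\<^bsub>F\<^esub> (\<Oplus>\<^bsub>F\<^esub>b\<in>B. a \<odot>\<^bsub>F\<^esub> (d b \<odot>\<^bsub>F\<^esub> x b))"
    using assms(2) by (intro F.finsum_addf) (auto simp: vspace_smult[OF vF])
  also have "(\<Oplus>\<^bsub>F\<^esub>b\<in>B. a \<odot>\<^bsub>F\<^esub> (d b \<odot>\<^bsub>F\<^esub> x b)) = a \<odot>\<^bsub>F\<^esub> (\<Oplus>\<^bsub>F\<^esub>b\<in>B. d b \<odot>\<^bsub>F\<^esub> x b)"
    using assms by (intro F.finsum_smult_ldistr[symmetric]) (auto simp: vspace_smult[OF vF])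
  finally show ?thesis .
qed

text \<open>The binomials are replaced by Lagrange polynomials one coordinate at a time, each
  replacement being a linear combination of memberships already known. In the end the coefficients
  are the indicator of \<open>b0\<close>, which \<open>inj\<close> separates from the other
  points.\<close>

lemma interpolation:
  fixes y :: "'i \<Rightarrow> nat \<Rightarrow> complex"
  assumes W: "lsub W F" and fin: "finite B" and x: "\<And>b. b \<in> B \<Longrightarrow> x b \<in> carrier F"
    and H: "\<And>m :: nat \<Rightarrow> nat. (\<Oplus>\<^bsub>F\<^esub>b\<in>B. (\<Prod>r<k. y b r gchoose m r) \<odot>\<^bsub>F\<^esub> x b) \<in> W"
    and b0: "b0 \<in> B" and inj: "\<And>b. b \<in> B \<Longrightarrow> (\<And>r. r < k \<Longrightarrow> y b r = y b0 r) \<Longrightarrow> b = b0"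
  shows "x b0 \<in> W"
proof -
  note D = lsubD[OF vF W]
  have lc: "(\<Oplus>\<^bsub>F\<^esub>b\<in>B. (c b + a * d b) \<odot>\<^bsub>F\<^esub> x b) \<in> W"
    if "(\<Oplus>\<^bsub>F\<^esub>b\<in>B. c b \<odot>\<^bsub>F\<^esub> x b) \<in> W" "(\<Oplus>\<^bsub>F\<^esub>b\<in>B. d b \<odot>\<^bsub>F\<^esub> x b) \<in> W" for c d a
    using that D by (simp add: finsum_lincomb[OF fin x])
  have st: "(\<Oplus>\<^bsub>F\<^esub>b\<in>B. (R b * q (y b i)) \<odot>\<^bsub>F\<^esub> x b) \<in> W"
    if "bpoly q" "\<And>m. (\<Oplus>\<^bsub>F\<^esub>b\<in>B. (R b * (y b i gchoose m)) \<odot>\<^bsub>F\<^esub> x b) \<in> W" for R q i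
    using that(1)
  proof (induction rule: bpoly.induct)
    case zero
    have "(\<Oplus>\<^bsub>F\<^esub>b\<in>B. (R b * 0) \<odot>\<^bsub>F\<^esub> x b) = (\<Oplus>\<^bsub>F\<^esub>b\<in>B. \<zero>\<^bsub>F\<^esub>)"
      using x by (intro F.finsum_cong') (auto simp: vspace_smult[OF vF])
    then show ?case using D(2) by simp
  next
    case (step q a m)
    then show ?case using lc[OF step.IH that(2)[of m], of a] by (simp add: algebra_simps)
  qed
  have "\<forall>r. \<exists>p. bpoly p \<and> (\<forall>z\<in>insert (y b0 r) ((\<lambda>b. y b r) ` B). p z = (if z = y b0 r then 1 else 0))"
    using bpoly_delta[OF finite_imageI[OF fin]] by blast
  from choice[OF this] obtain q where q: "\<And>r. bpoly (q r)"
    "\<And>r z. z \<in> insert (y b0 r) ((\<lambda>b. y b r) ` B) \<Longrightarrow> q r z = (if z = y b0 r then 1 else 0)"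
    by blast
  \<comment> \<open>Coordinates below \<open>i\<close> already carry Lagrange polynomials, the
    others still carry binomials.\<close>
  have claim: "(\<Oplus>\<^bsub>F\<^esub>b\<in>B. (\<Prod>r<k. if r < i then q r (y b r) else y b r gchoose m r) \<odot>\<^bsub>F\<^esub> x b) \<in> W"
    if "i \<le> k" for i and m :: "nat \<Rightarrow> nat"
    using that
  proof (induction i arbitrary: m)
    case 0 then show ?case using H by simp
  next
    case (Suc i)
    define R where "R b = (\<Prod>r\<in>{..<k} - {i}. if r < i then q r (y b r) else y b r gchoose m r)" for b
    have 1: "(\<Prod>r<k. if r < i then q r (y b r) else y b r gchoose (m(i := j)) r) = R b * (y b i gchoose j)" for b j
    proof -
      have "(\<Prod>r\<in>{..<k} - {i}. if r < i then q r (y b r) else y b r gchoose (m(i := j)) r) = R b"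
        unfolding R_def by (intro prod.cong) auto
      then show ?thesis using Suc.prems by (subst prod.remove[of _ i]) (simp_all add: mult.commute)
    qed
    have 2: "(\<Prod>r<k. if r < Suc i then q r (y b r) else y b r gchoose m r) = R b * q i (y b i)" for b
    proof -
      have "(\<Prod>r\<in>{..<k} - {i}. if r < Suc i then q r (y b r) else y b r gchoose m r) = R b"
        unfolding R_def by (intro prod.cong) auto
      then show ?thesis using Suc.prems by (subst prod.remove[of _ i]) (simp_all add: mult.commute)
    qed
    have "(\<Oplus>\<^bsub>F\<^esub>b\<in>B. (R b * (y b i gchoose j)) \<odot>\<^bsub>F\<^esub> x b) \<in> W" for j
      using Suc.IH[of "m(i := j)"] Suc.prems unfolding 1 by simp
    then show ?case unfolding 2 by (rule st[OF q(1)])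
  qed
  have "(\<Prod>r<k. if r < k then q r (y b r) else y b r gchoose 0) = (if b = b0 then 1 else 0)" if "b \<in> B" for b
  proof -
    have "(\<Prod>r<k. if r < k then q r (y b r) else y b r gchoose 0) = (\<Prod>r<k. if y b r = y b0 r then 1 else 0)"
      using q(2) that by (intro prod.cong) auto
    also have "\<dots> = (if \<forall>r<k. y b r = y b0 r then 1 else 0)" by (auto intro!: prod.neutral)
    finally show ?thesis using inj[OF that] by auto
  qed
  then have "(\<Oplus>\<^bsub>F\<^esub>b\<in>B. (\<Prod>r<k. if r < k then q r (y b r) else y b r gchoose 0) \<odot>\<^bsub>F\<^esub> x b) =
      (\<Oplus>\<^bsub>F\<^esub>b\<in>B. if b0 = b then x b else \<zero>\<^bsub>F\<^esub>)"
    using x by (intro F.finsum_cong') (auto simp: vspace_smult[OF vF])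
  also have "\<dots> = x b0" using x by (intro F.finsum_singleton[OF b0 fin]) auto
  finally show ?thesis using claim[of k "\<lambda>_. 0"] by simp
qed

text \<open>The binomial coefficients in the modes of basis words separate the finitely many normal
  ordered products that do not kill \<open>\<phi>\<close>.\<close>

lemma nord_in_submodule:
  assumes W: "lsub W F" and p: "\<phi> \<in> carrier F"
    and H: "\<And>w n. is_word w \<Longrightarrow> charge_sum (map fst w) = charge_sum (map fst bs) \<Longrightarrow> word_mode l S w n \<phi> \<in> W"
  shows "nord l S bs \<phi> \<in> W"
proof -
  define js where "js = map fst bs"
  define ns0 where "ns0 = map snd bs"
  define k where "k = length bs"
  define B where "B = {ns. length ns = k \<and> (\<Sum>r<k. ns ! r) = (\<Sum>r<k. ns0 ! r) \<and>
     nord l S (zip js ns) \<phi> \<noteq> \<zero>\<^bsub>F\<^esub>}"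
  have bs: "bs = zip js ns0" by (simp add: js_def ns0_def zip_map_fst_snd)
  \<comment> \<open>The signs are those of \<open>bs\<close>, the mode numbers of the word vary with
    \<open>m\<close>, and \<open>N m\<close> moves along with them. Thus one and the same index set
    \<open>B\<close> occurs for every \<open>m\<close> and only the binomial coefficients
    change.\<close>
  define w where "w = (\<lambda>m :: nat \<Rightarrow> nat. zip js (map (\<lambda>r. Suc (m r)) [0..<k]))"
  define N where "N = (\<lambda>m :: nat \<Rightarrow> nat. (\<Sum>r<k. ns0 ! r) + (\<Sum>r<k. int (Suc (m r))) - 1)"
  have len: "length js = k" "length (w m) = k" "map fst (w m) = js" for m
    by (simp_all add: js_def k_def w_def)
  have wr: "r < k \<Longrightarrow> snd (w m ! r) = Suc (m r)" for r m by (simp add: w_def len)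
  have ms: "mode_set (w m) (N m) \<phi> = B" for m
    by (auto simp: mode_set_def B_def len wr N_def sum.distrib)
  have fin: "finite B" using finite_mode_set[OF p, of "w (\<lambda>_. 0)"] ms by metis
  have iw: "is_word (w m)" for m by (auto simp: is_word_def w_def set_zip)
  show ?thesis
  proof (cases "ns0 \<in> B")
    case False
    then have "nord l S bs \<phi> = \<zero>\<^bsub>F\<^esub>" unfolding bs by (simp add: B_def k_def ns0_def)
    then show ?thesis using lsubD(2)[OF vF W] by simp
  next
    case True
    have "nord l S (zip js ns0) \<phi> \<in> W"
    proof (rule interpolation[OF W fin _ _ True, where y = "\<lambda>ns r. of_int (- (ns ! r) - 1)" and k = k])
      fix m :: "nat \<Rightarrow> nat"
      have "word_mode l S (w m) (N m) \<phi> \<in> W" by (rule H) (simp_all add: iw len js_def)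
      moreover have "mode_coef (w m) ns = (\<Prod>r<k. of_int (- (ns ! r) - 1) gchoose m r)" for ns
        by (simp add: mode_coef_def len wr)
      ultimately show "(\<Oplus>\<^bsub>F\<^esub>b\<in>B. (\<Prod>r<k. of_int (- (b ! r) - 1) gchoose m r) \<odot>\<^bsub>F\<^esub> nord l S (zip js b) \<phi>) \<in> W"
        by (simp only: word_mode_eq ms len)
    next
      fix ns assume "ns \<in> B" "\<And>r. r < k \<Longrightarrow> complex_of_int (- (ns ! r) - 1) = of_int (- (ns0 ! r) - 1)"
      then show "ns = ns0" by (intro nth_equalityI) (auto simp: B_def ns0_def k_def)
    qed (rule nord_carrier[OF p])
    then show ?thesis by (simp add: bs)
  qed
qed

abbreviation "FM \<equiv> fock_module l S"

lemma linop_vmode: "linop F (vmode FM v n)"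
proof -
  have "linop F (\<lambda>\<phi>. \<Oplus>\<^bsub>F\<^esub>w\<in>Poly_Mapping.keys v. Poly_Mapping.lookup v w \<odot>\<^bsub>F\<^esub> word_mode l S w n \<phi>)"
    by (intro linop_finsum[OF vF] linop_smult[OF vF linop_word_mode])
  then show ?thesis by (simp add: fock_module_simps linop_def)
qed

lemma vmode_in_submodule:
  assumes W: "lsub W F" and v: "v \<in> V_space"
    and H: "\<And>bs. charge_sum (map fst bs) = 0 \<Longrightarrow> nord l S bs \<phi> \<in> W"
  shows "vmode FM v n \<phi> \<in> W"
  unfolding fock_module_simps
proof (rule lsub_finsum[OF vF W])
  fix w assume w: "w \<in> Poly_Mapping.keys v"
  have "word_mode l S w n \<phi> \<in> W"
    unfolding word_mode_eq
  proof (rule lsub_finsum[OF vF W])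
    fix ns assume "ns \<in> mode_set w n \<phi>"
    then have "map fst (zip (map fst w) ns) = map fst w" by (simp add: mode_set_def)
    then have "nord l S (zip (map fst w) ns) \<phi> \<in> W" using v w by (intro H) (simp add: V_space_def)
    then show "mode_coef w ns \<odot>\<^bsub>F\<^esub> nord l S (zip (map fst w) ns) \<phi> \<in> W" by (rule lsubD(4)[OF vF W])
  qed
  then show "Poly_Mapping.lookup v w \<odot>\<^bsub>F\<^esub> word_mode l S w n \<phi> \<in> W" by (rule lsubD(4)[OF vF W])
qed

text \<open>A single word is itself a vector of \<open>V\<close>, so closure under all
  \<open>v_n\<close> includes the modes of words, to which the interpolation applies.\<close>

lemma nord_in_vmode_closed:
  assumes W: "lsub W F" and p: "\<phi> \<in> carrier F"
    and H: "\<And>v n. v \<in> V_space \<Longrightarrow> vmode FM v n \<phi> \<in> W" and c: "charge_sum (map fst bs) = 0"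
  shows "nord l S bs \<phi> \<in> W"
proof (rule nord_in_submodule[OF W p])
  fix w n assume w: "is_word w" "charge_sum (map fst w) = charge_sum (map fst bs)"
  have "vmode FM (Poly_Mapping.single w 1) n \<phi> \<in> W"
    by (rule H) (use w c in \<open>simp add: V_space_def\<close>)
  then show "word_mode l S w n \<phi> \<in> W"
    using linopD(1)[OF linop_word_mode p] by (simp add: fock_module_simps vspace_smult[OF vF])
qed

section \<open>The space V_U(l,f) as the sector of charge 0\<close>

context
  fixes s assumes s: "s \<in> carrier S"
begin

lemma vac_eq: "vac S s = monom_at S [] (zact S s [])"
  by (simp add: vac_def monom_at_def zact_def)

lemma vac_sector: "vac S s \<in> sector S s 0"
  unfolding vac_eq by (rule monom_sector[OF s]) auto

lemma nord_sector_zero: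
  assumes "\<phi> \<in> sector S s 0" "charge_sum (map fst bs) = 0"
  shows "nord l S bs \<phi> \<in> sector S s 0"
  using nord_sector[OF s assms(1), of bs] assms(2) by simp

text \<open>Creating modes followed by zero modes already stand in normal order, so monomials arise
  from \<open>vac\<close> by normal ordered products.\<close>

lemma nord_vac:
  assumes "is_word u"
  shows "nord l S (map (\<lambda>(j, t). (j, - int t)) u @ map (\<lambda>j. (j, 0)) z) (vac S s) = monom_at S u (zact S s z)"
proof -
  have 1: "filter (\<lambda>b. snd b < 0) (map (\<lambda>(j, t). (j, - int t)) u) = map (\<lambda>(j, t). (j, - int t)) u"
    "filter (\<lambda>b. snd b > 0) (map (\<lambda>(j, t). (j, - int t)) u) = []"
    "filter (\<lambda>b. snd b = 0) (map (\<lambda>(j, t). (j, - int t)) u) = []"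
    using assms by (induction u) auto
  have 2: "filter (\<lambda>b :: charge \<times> int. snd b < 0) (map (\<lambda>j. (j, 0)) z) = []"
    "filter (\<lambda>b :: charge \<times> int. snd b > 0) (map (\<lambda>j. (j, 0)) z) = []"
    "filter (\<lambda>b :: charge \<times> int. snd b = 0) (map (\<lambda>j. (j, 0)) z) = map (\<lambda>j. (j, 0)) z"
    by (auto simp: filter_empty_conv)
  show ?thesis
    unfolding mode_elt_eq[OF s assms, symmetric] nord_def mode_elt_def filter_append 1 2
    by (simp add: foldr_map comp_def split_def)
qed

lemma VU_simps:
  "add (VU l S s) = add F" "zero (VU l S s) = zero F" "smult (VU l S s) = smult F"
  "vmode (VU l S s) = vmode FM" "wt_space (VU l S s) d = carrier (VU l S s) \<inter> wt_space FM d"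
  by (simp_all add: VU_def Let_def fock_module_simps)

text \<open>Products of charge 0 preserve the sector, and by \<open>nord_vac\<close> they reach each
  of its spanning monomials from \<open>vac\<close>.\<close>

lemma VU_carrier: "carrier (VU l S s) = sector S s 0"
proof -
  let ?X = "{vmode FM v n (vac S s) | v n. v \<in> V_space}"
  have "carrier (VU l S s) = lspan FM ?X" by (simp add: VU_def Let_def)
  also have "\<dots> = lspan F ?X" by (rule lspan_cong[OF vF]) (simp_all only: fock_module_simps)
  finally have C: "carrier (VU l S s) = lspan F ?X" .
  have vc: "vac S s \<in> carrier F" using vac_sector sector_carrier[OF s] by blast
  have L: "lsub (lspan F ?X) F"
    by (rule lsub_lspan[OF vF]) (use linopD(1)[OF linop_vmode vc] in blast)
  have "lspan F ?X \<subseteq> sector S s 0"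
  proof (rule lspan_least[OF lsub_sector[OF s]], clarify)
    fix v n assume "v \<in> V_space"
    then show "vmode FM v n (vac S s) \<in> sector S s 0"
      by (rule vmode_in_submodule[OF lsub_sector[OF s]]) (rule nord_sector_zero[OF vac_sector])
  qed
  moreover have "sector S s 0 \<subseteq> lspan F ?X"
    unfolding sector_def
  proof (rule lspan_least[OF L], clarify)
    fix u z assume u: "is_word u" and c: "charge_sum (map fst u @ z) = 0"
    have "nord l S (map (\<lambda>(j, t). (j, - int t)) u @ map (\<lambda>j. (j, 0)) z) (vac S s) \<in> lspan F ?X"
    proof (rule nord_in_vmode_closed[OF L vc])
      show "vmode FM v n (vac S s) \<in> lspan F ?X" if "v \<in> V_space" for v n
        using that by (intro subsetD[OF lspan_superset]) blast
      show "charge_sum (map fst (map (\<lambda>(j, t). (j, - int t)) u @ map (\<lambda>j. (j, 0)) z)) = 0"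
        using c by (simp add: comp_def split_def)
    qed
    then show "monom_at S u (zact S s z) \<in> lspan F ?X" by (simp add: nord_vac[OF u])
  qed
  ultimately show ?thesis using C by blast
qed

lemma lsub_VU: "lsub W (VU l S s) \<longleftrightarrow> lsub W F \<and> W \<subseteq> sector S s 0"
proof -
  have v: "vspace (VU l S s)"
    by (rule vspace_cong[OF vspace_carrier_update[OF vF lsub_sector[OF s, of 0]]])
      (simp_all add: VU_simps VU_carrier)
  show ?thesis
  proof (intro iffI conjI; (elim conjE)?)
    assume W: "lsub W (VU l S s)"
    note D = lsubD[OF v W, unfolded VU_simps VU_carrier]
    show "W \<subseteq> sector S s 0" using D(1) by blast
    then show "lsub W F" using D(2-4) sector_carrier[OF s] by (intro lsubI[OF vF]) blast+
  next
    assume W: "lsub W F" "W \<subseteq> sector S s 0"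
    show "lsub W (VU l S s)"
      using lsubD[OF vF W(1)] W(2) by (intro lsubI[OF v]) (unfold VU_simps VU_carrier, blast+)
  qed
qed

lemma vspace_VU: "vspace (VU l S s)"
  by (rule vspace_cong[OF vspace_carrier_update[OF vF lsub_sector[OF s, of 0]]])
    (simp_all add: VU_simps VU_carrier)

lemma vmode_sector:
  assumes "v \<in> V_space" "\<phi> \<in> sector S s 0"
  shows "vmode FM v n \<phi> \<in> sector S s 0"
  by (rule vmode_in_submodule[OF lsub_sector[OF s] assms(1)]) (rule nord_sector_zero[OF assms(2)])

lemma lvm_VU: "lvm (VU l S s)"
proof -
  have "linop (VU l S s) (vmode FM v n)" if "v \<in> V_space" for v n
    using vmode_sector[OF that] linopD(2,3)[OF linop_vmode] sector_carrier[OF s]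
    unfolding linop_def VU_simps VU_carrier by blast
  then show ?thesis using vspace_VU by (auto simp: lvm_def VU_simps)
qed

text \<open>This criterion lets the sequel work with normal ordered products of charge 0 in place of
  the modes \<open>v_n\<close>.\<close>

lemma stable_VU:
  "stable W (VU l S s) \<longleftrightarrow> lsub W F \<and> W \<subseteq> sector S s 0 \<and>
     (\<forall>bs. charge_sum (map fst bs) = 0 \<longrightarrow> (\<forall>\<phi>\<in>W. nord l S bs \<phi> \<in> W))"
proof (intro iffI; (elim conjE)?)
  assume "stable W (VU l S s)"
  then have W: "lsub W F" "W \<subseteq> sector S s 0"
    and st: "\<And>v n \<phi>. v \<in> V_space \<Longrightarrow> \<phi> \<in> W \<Longrightarrow> vmode FM v n \<phi> \<in> W"
    unfolding stable_def lsub_VU VU_simps by blast+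
  then show "lsub W F \<and> W \<subseteq> sector S s 0 \<and>
     (\<forall>bs. charge_sum (map fst bs) = 0 \<longrightarrow> (\<forall>\<phi>\<in>W. nord l S bs \<phi> \<in> W))"
    using nord_in_vmode_closed[OF W(1) lsubD(1)[OF vF W(1)] st] by blast
next
  assume W: "lsub W F" "W \<subseteq> sector S s 0"
    and st: "\<forall>bs. charge_sum (map fst bs) = 0 \<longrightarrow> (\<forall>\<phi>\<in>W. nord l S bs \<phi> \<in> W)"
  then show "stable W (VU l S s)"
    unfolding stable_def lsub_VU VU_simps using vmode_in_submodule[OF W(1)] by blast
qed

lemma VU_minus:
  assumes "\<phi> \<in> sector S s 0" "\<psi> \<in> sector S s 0"
  shows "\<phi> \<ominus>\<^bsub>VU l S s\<^esub> \<psi> = \<phi> \<ominus>\<^bsub>F\<^esub> \<psi>"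
proof -
  have "\<psi> \<in> carrier F" using assms(2) sector_carrier[OF s] by blast
  then show ?thesis
    using vspace_uminus[OF vspace_VU, of \<psi>] vspace_uminus[OF vF, of \<psi>] assms
    by (simp add: a_minus_def VU_simps VU_carrier)
qed

end

end

section \<open>Symmetrized coefficients\<close>

lemma (in abelian_monoid) finsum_swap:
  assumes "finite A" "finite B" "\<And>a b. a \<in> A \<Longrightarrow> b \<in> B \<Longrightarrow> f a b \<in> carrier G"
  shows "(\<Oplus>a\<in>A. \<Oplus>b\<in>B. f a b) = (\<Oplus>b\<in>B. \<Oplus>a\<in>A. f a b)"
  using assms(1,3)
proof (induction A)
  case (insert x A)
  have "(\<Oplus>b\<in>B. \<Oplus>a\<in>insert x A. f a b) = (\<Oplus>b\<in>B. f x b \<oplus> (\<Oplus>a\<in>A. f a b))"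
    using insert by (intro finsum_cong') auto
  also have "\<dots> = (\<Oplus>b\<in>B. f x b) \<oplus> (\<Oplus>b\<in>B. \<Oplus>a\<in>A. f a b)"
    using insert by (intro finsum_addf) auto
  also have "(\<Oplus>b\<in>B. \<Oplus>a\<in>A. f a b) = (\<Oplus>a\<in>A. \<Oplus>b\<in>B. f a b)" using insert by simp
  finally show ?case using insert by simp
qed simp

lemma finsum_linop:
  assumes "vspace M" "linop M f" "\<And>x. x \<in> B \<Longrightarrow> g x \<in> carrier M"
  shows "f (\<Oplus>\<^bsub>M\<^esub>x\<in>B. g x) = (\<Oplus>\<^bsub>M\<^esub>x\<in>B. f (g x))"
proof -
  interpret Module.module complex_field M by fact
  show ?thesis
    using assms(3) linopD[OF assms(2)] linop_zero[OF assms(1,2)]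
    by (induction B rule: infinite_finite_induct) (auto simp: M.finsum_infinite Pi_def)
qed

lemma finsum_smult_const:
  assumes "vspace M" "finite B" "x \<in> carrier M"
  shows "(\<Oplus>\<^bsub>M\<^esub>b\<in>B. c b \<odot>\<^bsub>M\<^esub> x) = (\<Sum>b\<in>B. c b) \<odot>\<^bsub>M\<^esub> x"
proof -
  interpret Module.module complex_field M by fact
  show ?thesis
    using assms(2,3) by (induction B) (auto simp: vspace_smult[OF assms(1)] Pi_def)
qed

text \<open>The coefficient at \<mu> of the image of \<phi> when the letters are made to commute,
  that is, in the symmetric algebra tensored with \<open>S\<close>.\<close>

definition symsum :: "('a, 'x) tmodule_scheme \<Rightarrow> (word \<Rightarrow> 'a) \<Rightarrow> (charge \<times> nat) multiset \<Rightarrow> 'a" where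
  "symsum S \<phi> \<mu> = (\<Oplus>\<^bsub>S\<^esub>u\<in>permutations_of_multiset \<mu>. \<phi> u)"

lemma pom_iff: "u \<in> permutations_of_multiset \<mu> \<longleftrightarrow> mset u = \<mu>"
  by (simp add: permutations_of_multiset_def)

context fock
begin

lemma symsum_closed: "\<phi> \<in> carrier F \<Longrightarrow> symsum S \<phi> \<mu> \<in> carrier S"
  unfolding symsum_def by (intro S.finsum_closed) (auto dest: fock_carrierD(2))

lemma symsum_add:
  "\<phi> \<in> carrier F \<Longrightarrow> \<psi> \<in> carrier F \<Longrightarrow> symsum S (\<phi> \<oplus>\<^bsub>F\<^esub> \<psi>) \<mu> = symsum S \<phi> \<mu> \<oplus>\<^bsub>S\<^esub> symsum S \<psi> \<mu>"
  unfolding symsum_def fock_simps(3) by (intro S.finsum_addf) (auto dest: fock_carrierD(2))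

lemma symsum_smult:
  "\<phi> \<in> carrier F \<Longrightarrow> symsum S (a \<odot>\<^bsub>F\<^esub> \<phi>) \<mu> = a \<odot>\<^bsub>S\<^esub> symsum S \<phi> \<mu>"
  unfolding symsum_def fock_simps(4)
  by (intro S.finsum_smult_ldistr[symmetric]) (auto dest: fock_carrierD(2))

lemma symsum_monom:
  assumes "x \<in> carrier S"
  shows "symsum S (monom_at S u x) \<mu> = (if mset u = \<mu> then x else \<zero>\<^bsub>S\<^esub>)"
proof (cases "mset u = \<mu>")
  case True
  have "symsum S (monom_at S u x) \<mu> = (\<Oplus>\<^bsub>S\<^esub>v\<in>permutations_of_multiset \<mu>. if u = v then x else \<zero>\<^bsub>S\<^esub>)"
    unfolding symsum_def by (intro S.finsum_cong') (use assms in \<open>auto simp: monom_at_def\<close>)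
  also have "\<dots> = x"
    using True assms by (intro S.finsum_singleton[of u _ "\<lambda>_. x"]) (auto simp: pom_iff)
  finally show ?thesis using True by simp
next
  case False
  have "symsum S (monom_at S u x) \<mu> = (\<Oplus>\<^bsub>S\<^esub>v\<in>permutations_of_multiset \<mu>. \<zero>\<^bsub>S\<^esub>)"
    unfolding symsum_def by (intro S.finsum_cong') (use False in \<open>auto simp: monom_at_def pom_iff\<close>)
  then show ?thesis using False by simp
qed

lemma symsum_prep:
  assumes "\<phi> \<in> carrier F"
  shows "symsum S (prep S b \<phi>) \<mu> = (if b \<in># \<mu> then symsum S \<phi> (\<mu> - {#b#}) else \<zero>\<^bsub>S\<^esub>)"
proof -
  note P = fock_carrierD(2)[OF assms]
  let ?A = "if b \<in># \<mu> then (\<lambda>u. b # u) ` permutations_of_multiset (\<mu> - {#b#}) else {}"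
  have "symsum S (prep S b \<phi>) \<mu> = (\<Oplus>\<^bsub>S\<^esub>u\<in>?A. prep S b \<phi> u)"
    unfolding symsum_def
  proof (rule S.add.finprod_mono_neutral_cong_right)
    show "?A \<subseteq> permutations_of_multiset \<mu>" by (auto simp: pom_iff)
    fix u assume u: "u \<in> permutations_of_multiset \<mu> - ?A"
    show "prep S b \<phi> u = \<zero>\<^bsub>S\<^esub>"
    proof (rule ccontr)
      assume "prep S b \<phi> u \<noteq> \<zero>\<^bsub>S\<^esub>"
      then obtain v where "u = b # v" by (auto simp: prep_def split: list.splits if_splits)
      then show False using u by (auto simp: pom_iff)
    qed
  qed (use P in \<open>auto simp: prep_def split: list.splits\<close>)
  also have "\<dots> = (if b \<in># \<mu> then symsum S \<phi> (\<mu> - {#b#}) else \<zero>\<^bsub>S\<^esub>)"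
  proof (cases "b \<in># \<mu>")
    case True
    have "(\<Oplus>\<^bsub>S\<^esub>u\<in>(\<lambda>u. b # u) ` permutations_of_multiset (\<mu> - {#b#}). prep S b \<phi> u) =
        (\<Oplus>\<^bsub>S\<^esub>u\<in>permutations_of_multiset (\<mu> - {#b#}). prep S b \<phi> (b # u))"
      by (rule S.finsum_reindex) (use P in \<open>auto simp: prep_def\<close>)
    then show ?thesis using True by (simp add: symsum_def prep_def)
  qed simp
  finally show ?thesis .
qed

lemma symsum_osc_zero:
  assumes "\<phi> \<in> carrier F"
  shows "symsum S (osc l S j 0 \<phi>) \<mu> = hmul S j (symsum S \<phi> \<mu>)"
  unfolding symsum_def osc_zero
  by (rule finsum_linop[OF vS hm, symmetric]) (rule fock_carrierD(2)[OF assms])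

text \<open>A word over the multiset \<open>\<mu> + {#b#}\<close> arises by inserting \<open>b\<close> in as many ways as it
  contains \<open>b\<close>.\<close>

lemma symsum_isum:
  assumes "\<phi> \<in> carrier F"
  shows "symsum S (isum b \<phi>) \<mu> = of_nat (count \<mu> b + 1) \<odot>\<^bsub>S\<^esub> symsum S \<phi> (\<mu> + {#b#})"
proof -
  note P = fock_carrierD(2)[OF assms]
  define k where "k = size \<mu>"
  let ?A = "permutations_of_multiset \<mu>" and ?B = "permutations_of_multiset (\<mu> + {#b#})"
  have lenA: "length u = k" if "u \<in> ?A" for u using that by (auto simp: pom_iff k_def)
  have lenB: "length v = Suc k" if "v \<in> ?B" for v
    using that size_mset[of v] by (simp add: pom_iff k_def)
  \<comment> \<open>For a fixed position \<open>r\<close>, inserting \<open>b\<close> there is a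
    bijection from the orderings of \<mu> onto those orderings of \<open>\<mu> + {#b#}\<close> that
    carry \<open>b\<close> at \<open>r\<close>.\<close>
  have 1: "(\<Oplus>\<^bsub>S\<^esub>u\<in>?A. \<phi> (take r u @ b # drop r u)) =
      (\<Oplus>\<^bsub>S\<^esub>v\<in>?B. (if v ! r = b then 1 else 0) \<odot>\<^bsub>S\<^esub> \<phi> v)" if r: "r \<le> k" for r
  proof -
    let ?f = "\<lambda>u. take r u @ b # drop r u"
    have inj: "inj_on ?f ?A"
      by (rule inj_on_inverseI[where g = "\<lambda>v. take r v @ drop (Suc r) v"]) (use lenA r in auto)
    have im: "?f ` ?A = {v \<in> ?B. v ! r = b}"
    proof (intro equalityI subsetI)
      fix v assume "v \<in> ?f ` ?A"
      then obtain u where u: "u \<in> ?A" "v = ?f u" by blast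
      have "mset (take r u) + mset (drop r u) = mset u" by (metis append_take_drop_id mset_append)
      then show "v \<in> {v \<in> ?B. v ! r = b}" using u r lenA[OF u(1)] by (auto simp: pom_iff nth_append)
    next
      fix v assume "v \<in> {v \<in> ?B. v ! r = b}"
      then have v: "v \<in> ?B" "v ! r = b" by auto
      let ?u = "take r v @ drop (Suc r) v"
      have len: "length v = Suc k" using lenB v by blast
      have dv: "take r v @ b # drop (Suc r) v = v" using id_take_nth_drop[of r v] r len v(2) by simp
      then have "add_mset b (mset ?u) = mset v" by (metis mset_append mset.simps(2) union_mset_add_mset_right)
      then have "mset ?u = \<mu>" using v(1) by (simp add: pom_iff)
      moreover have "?f ?u = v" using dv r len by simp
      ultimately show "v \<in> ?f ` ?A" by (metis (mono_tags, lifting) image_eqI pom_iff)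
    qed
    have "(\<Oplus>\<^bsub>S\<^esub>u\<in>?A. \<phi> (?f u)) = (\<Oplus>\<^bsub>S\<^esub>v\<in>?f ` ?A. \<phi> v)"
      by (rule S.finsum_reindex[symmetric]) (use P inj in auto)
    also have "\<dots> = (\<Oplus>\<^bsub>S\<^esub>v\<in>?B. (if v ! r = b then 1 else 0) \<odot>\<^bsub>S\<^esub> \<phi> v)"
      unfolding im by (rule S.add.finprod_mono_neutral_cong_left) (use P in \<open>auto simp: Ssm\<close>)
    finally show ?thesis .
  qed
  have "symsum S (isum b \<phi>) \<mu> = (\<Oplus>\<^bsub>S\<^esub>u\<in>?A. \<Oplus>\<^bsub>S\<^esub>r\<in>{..k}. \<phi> (take r u @ b # drop r u))"
    unfolding symsum_def isum_def by (rule S.finsum_cong') (use P lenA in auto)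
  also have "\<dots> = (\<Oplus>\<^bsub>S\<^esub>r\<in>{..k}. \<Oplus>\<^bsub>S\<^esub>u\<in>?A. \<phi> (take r u @ b # drop r u))"
    by (rule S.finsum_swap) (use P in auto)
  also have "\<dots> = (\<Oplus>\<^bsub>S\<^esub>r\<in>{..k}. \<Oplus>\<^bsub>S\<^esub>v\<in>?B. (if v ! r = b then 1 else 0) \<odot>\<^bsub>S\<^esub> \<phi> v)"
    by (rule S.finsum_cong') (use P 1 in \<open>auto simp: Ssm\<close>)
  also have "\<dots> = (\<Oplus>\<^bsub>S\<^esub>v\<in>?B. \<Oplus>\<^bsub>S\<^esub>r\<in>{..k}. (if v ! r = b then 1 else 0) \<odot>\<^bsub>S\<^esub> \<phi> v)"
    by (rule S.finsum_swap) (use P in \<open>auto simp: Ssm\<close>)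
  also have "\<dots> = (\<Oplus>\<^bsub>S\<^esub>v\<in>?B. of_nat (count \<mu> b + 1) \<odot>\<^bsub>S\<^esub> \<phi> v)"
  proof (rule S.finsum_cong')
    fix v assume v: "v \<in> ?B"
    have "(\<Sum>r\<le>k. if v ! r = b then 1 else 0 :: complex) = of_nat (card {r \<in> {..k}. v ! r = b})"
      by (simp add: sum.If_cases Int_def)
    also have "{r \<in> {..k}. v ! r = b} = {r. r < length v \<and> b = v ! r}" using lenB[OF v] by auto
    also have "card \<dots> = count (mset v) b" by (simp add: count_mset count_list_eq_length_filter length_filter_conv_card)
    finally show "(\<Oplus>\<^bsub>S\<^esub>r\<in>{..k}. (if v ! r = b then 1 else 0) \<odot>\<^bsub>S\<^esub> \<phi> v) = of_nat (count \<mu> b + 1) \<odot>\<^bsub>S\<^esub> \<phi> v"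
      using v P by (simp add: finsum_smult_const[OF vS] pom_iff)
  qed (use P in \<open>auto simp: Ssm\<close>)
  also have "\<dots> = of_nat (count \<mu> b + 1) \<odot>\<^bsub>S\<^esub> symsum S \<phi> (\<mu> + {#b#})"
    unfolding symsum_def by (rule S.finsum_smult_ldistr[symmetric]) (use P in auto)
  finally show ?thesis .
qed

text \<open>The kernel of the map from \<open>F(S)\<close> to the symmetric algebra tensored with
  \<open>S\<close> modulo \<open>Z\<close>. All modes descend to that space, which makes the kernel
  stable.\<close>

definition symker :: "'a set \<Rightarrow> (word \<Rightarrow> 'a) set" where
  "symker Z = {\<phi> \<in> carrier F. \<forall>\<mu>. symsum S \<phi> \<mu> \<in> Z}"

context
  fixes Z assumes Z: "lsub Z S" "\<And>j x. x \<in> Z \<Longrightarrow> hmul S j x \<in> Z"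
begin

lemma lsub_symker: "lsub (symker Z) F"
proof (rule lsubI[OF vF])
  have "symsum S \<zero>\<^bsub>F\<^esub> \<mu> = \<zero>\<^bsub>S\<^esub>" for \<mu> by (simp add: symsum_def fock_simps(2))
  then show "\<zero>\<^bsub>F\<^esub> \<in> symker Z" using lsubD(2)[OF vS Z(1)] by (simp add: symker_def)
qed (auto simp: symker_def symsum_add symsum_smult lsubD[OF vS Z(1)] vspace_smult[OF vF])

lemma osc_symker:
  assumes "\<phi> \<in> symker Z"
  shows "osc l S j n \<phi> \<in> symker Z"
proof -
  have p: "\<phi> \<in> carrier F" and s: "\<And>\<mu>. symsum S \<phi> \<mu> \<in> Z" using assms by (auto simp: symker_def)
  note D = lsubD[OF vS Z(1)]
  have c: "osc l S j n \<phi> \<in> carrier F" by (rule linopD(1)[OF linop_osc p])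
  have i: "isum b \<phi> \<in> carrier F" for b by (rule linopD(1)[OF linop_isum p])
  consider "n < 0" | "n = 0" | "n > 0" by linarith
  then have "symsum S (osc l S j n \<phi>) \<mu> \<in> Z" for \<mu>
  proof cases
    case 1 then show ?thesis using s D(2) by (simp add: osc_neg symsum_prep[OF p])
  next
    case 2 then show ?thesis using s Z(2) by (simp add: symsum_osc_zero[OF p])
  next
    case 3
    then show ?thesis using s D(4) by (simp add: osc_isum symsum_smult[OF i] symsum_isum[OF p])
  qed
  then show ?thesis using c by (simp add: symker_def)
qed

lemma nord_symker: "\<phi> \<in> symker Z \<Longrightarrow> nord l S bs \<phi> \<in> symker Z"
proof -
  have "foldr (\<lambda>(j, n). osc l S j n) bs \<phi> \<in> symker Z" if "\<phi> \<in> symker Z" for bs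
    using that by (induction bs) (auto intro: osc_symker)
  then show "\<phi> \<in> symker Z \<Longrightarrow> nord l S bs \<phi> \<in> symker Z" unfolding nord_def by blast
qed

lemma finsum_apply:
  assumes "finite B" "\<And>b. b \<in> B \<Longrightarrow> f b \<in> carrier F"
  shows "(\<Oplus>\<^bsub>F\<^esub>b\<in>B. f b) u = (\<Oplus>\<^bsub>S\<^esub>b\<in>B. f b u)"
  using assms fock_carrierD(2)
  by (induction B) (auto simp: fock_simps(2) Pi_def, simp add: fock_simps(3))

lemma is_submodule_symker:
  assumes s: "s \<in> carrier S"
  shows "is_submodule (symker Z \<inter> sector S s 0) (VU l S s)"
proof -
  let ?W = "symker Z \<inter> sector S s 0" and ?V = "VU l S s"
  have Ws: "lsub ?W F"
    using lsub_Inter[OF vF, of "{symker Z, sector S s 0}"] lsub_symker lsub_sector[OF s, of 0] by auto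
  have st: "stable ?W ?V"
    unfolding stable_VU[OF s] using Ws nord_symker nord_sector_zero[OF s] by blast
  let ?L = "lspan ?V (\<Union>d. ?W \<inter> wt_space ?V d)"
  have L: "lsub ?L ?V"
    by (rule lsub_lspan[OF vspace_VU[OF s]]) (use lvmD(3)[OF lvm_VU[OF s]] in blast)
  have LF: "lsub ?L F" using L lsub_VU[OF s] by blast
  have "?L \<subseteq> ?W" by (rule lspan_least[OF stableD(1)[OF st]]) blast
  moreover have "?W \<subseteq> ?L"
  proof
    fix \<phi> assume "\<phi> \<in> ?W"
    then have ps: "\<phi> \<in> sector S s 0" and p: "\<phi> \<in> carrier F" and sy: "\<And>\<mu>. symsum S \<phi> \<mu> \<in> Z"
      by (auto simp: symker_def)
    note P = fock_carrierD[OF p]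
    \<comment> \<open>The projection to weight \<open>d\<close>. The weight of a word depends only
      on its multiset of letters, so the projection keeps a symmetrized coefficient or replaces it
      by zero.\<close>
    define c where "c d \<psi> = (\<lambda>u. if word_wt u = d then \<psi> u else \<zero>\<^bsub>S\<^esub>)" for d and \<psi> :: "word \<Rightarrow> 'a"
    have lc: "linop F (c d)" for d
      unfolding linop_def
    proof (intro conjI ballI allI)
      fix \<psi> assume "\<psi> \<in> carrier F"
      note Q = fock_carrierD[OF this]
      show "c d \<psi> \<in> carrier F"
        by (rule fock_carrierI[OF Q(1)]) (use Q in \<open>auto simp: c_def split: if_splits\<close>)
    qed (auto simp: c_def fock_simps(3,4))
    have cs: "c d \<phi> \<in> sector S s 0" for d
    proof (rule linop_sector[OF s lc lsub_sector[OF s] _ ps])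
      fix u z assume u: "is_word u" "charge_sum (map fst u @ z) = 0"
      have "c d (monom_at S u (zact S s z)) = (if word_wt u = d then monom_at S u (zact S s z) else \<zero>\<^bsub>F\<^esub>)"
        by (auto simp: c_def monom_at_def fock_simps(2))
      then show "c d (monom_at S u (zact S s z)) \<in> sector S s 0"
        using monom_sector[OF s u] lsubD(2)[OF vF lsub_sector[OF s]] by simp
    qed
    have "symsum S (c d \<phi>) \<mu> \<in> Z" for d \<mu>
    proof (cases "sum_mset (image_mset snd \<mu>) = d")
      case True
      then have "symsum S (c d \<phi>) \<mu> = symsum S \<phi> \<mu>"
        unfolding symsum_def by (intro S.finsum_cong') (use P in \<open>auto simp: c_def pom_iff word_wt_def sum_mset_sum_list[symmetric]\<close>)
      then show ?thesis using sy by simp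
    next
      case False
      then have "symsum S (c d \<phi>) \<mu> = (\<Oplus>\<^bsub>S\<^esub>u\<in>permutations_of_multiset \<mu>. \<zero>\<^bsub>S\<^esub>)"
        unfolding symsum_def by (intro S.finsum_cong') (use P in \<open>auto simp: c_def pom_iff word_wt_def sum_mset_sum_list[symmetric]\<close>)
      then show ?thesis using lsubD(2)[OF vS Z(1)] by simp
    qed
    then have cW: "c d \<phi> \<in> ?W" for d
      using cs linopD(1)[OF lc p] by (simp add: symker_def)
    have "c d \<phi> \<in> wt_space ?V d" for d
      using cW[of d] linopD(1)[OF lc p, of d] by (auto simp: VU_simps[OF s] VU_carrier[OF s] fock_module_simps c_def split: if_splits)
    then have cL: "c d \<phi> \<in> ?L" for d
      using cW by (intro subsetD[OF lspan_superset]) blast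
    obtain D where D: "wt_le S D \<phi>" using wt_le_exists[OF p] .
    have "\<phi> = (\<Oplus>\<^bsub>F\<^esub>d\<in>{..D}. c d \<phi>)"
    proof
      fix u
      have "(\<Oplus>\<^bsub>F\<^esub>d\<in>{..D}. c d \<phi>) u = (\<Oplus>\<^bsub>S\<^esub>d\<in>{..D}. if word_wt u = d then \<phi> u else \<zero>\<^bsub>S\<^esub>)"
        by (subst finsum_apply) (use linopD(1)[OF lc p] in \<open>auto simp: c_def\<close>)
      also have "\<dots> = \<phi> u"
      proof (cases "word_wt u \<le> D")
        case True
        then show ?thesis using P(2) by (intro S.finsum_singleton[of "word_wt u" _ "\<lambda>_. \<phi> u"]) auto
      next
        case False
        then have "\<phi> u = \<zero>\<^bsub>S\<^esub>" using D by (auto simp: wt_le_def)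
        then have "(if word_wt u = d then \<phi> u else \<zero>\<^bsub>S\<^esub>) = \<zero>\<^bsub>S\<^esub>" for d by simp
        then show ?thesis using \<open>\<phi> u = \<zero>\<^bsub>S\<^esub>\<close> by simp
      qed
      finally show "\<phi> u = (\<Oplus>\<^bsub>F\<^esub>d\<in>{..D}. c d \<phi>) u" by simp
    qed
    also have "\<dots> \<in> ?L" by (rule lsub_finsum[OF vF LF cL])
    finally show "\<phi> \<in> ?L" .
  qed
  ultimately show ?thesis using st unfolding is_submodule_iff by blast
qed

end

end

section \<open>Congruence modulo a subspace\<close>

definition eqm :: "(complex, 'a, 'x) module_scheme \<Rightarrow> 'a set \<Rightarrow> 'a \<Rightarrow> 'a \<Rightarrow> bool" where
  "eqm M H x y \<longleftrightarrow> x \<in> carrier M \<and> y \<in> carrier M \<and> x \<ominus>\<^bsub>M\<^esub> y \<in> H"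

context
  fixes M :: "(complex, 'a, 'x) module_scheme" and H
  assumes vM: "vspace M" and sH: "lsub H M"
begin

interpretation Module.module complex_field M by (rule vM)

lemma eqm_coset: "eqm M H x y \<longleftrightarrow> x \<in> carrier M \<and> y \<in> carrier M \<and> H +>\<^bsub>M\<^esub> x = H +>\<^bsub>M\<^esub> y"
  using coset_eq_iff[OF vM sH] by (auto simp: eqm_def)

lemma eqm_refl: "x \<in> carrier M \<Longrightarrow> eqm M H x x"
  by (simp add: eqm_coset)

lemma eqm_sym: "eqm M H x y \<Longrightarrow> eqm M H y x"
  by (simp add: eqm_coset)

lemma eqm_trans [trans]: "eqm M H x y \<Longrightarrow> eqm M H y z \<Longrightarrow> eqm M H x z"
  by (simp add: eqm_coset)

lemma eqm_add: "eqm M H x y \<Longrightarrow> eqm M H x' y' \<Longrightarrow> eqm M H (x \<oplus>\<^bsub>M\<^esub> x') (y \<oplus>\<^bsub>M\<^esub> y')"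
  by (simp add: eqm_coset flip: quot_space_add[OF vM sH])

lemma eqm_linop:
  assumes "linop M f" "\<And>x. x \<in> H \<Longrightarrow> f x \<in> H" "eqm M H x y"
  shows "eqm M H (f x) (f y)"
  using assms(3) linopD(1)[OF assms(1)] linop_minus[OF vM assms(1), of x y] assms(2)
  by (auto simp: eqm_def) (metis)

lemma eqm_smult: "eqm M H x y \<Longrightarrow> eqm M H (a \<odot>\<^bsub>M\<^esub> x) (a \<odot>\<^bsub>M\<^esub> y)"
  by (rule eqm_linop[OF linop_smult[OF vM linop_id[OF vM]]]) (rule lsubD(4)[OF vM sH])

lemma eqm_mem:
  assumes "eqm M H x y" "lsub W M" "H \<subseteq> W"
  shows "x \<in> W \<longleftrightarrow> y \<in> W"
proof -
  have *: "y' \<in> W \<Longrightarrow> x' \<in> W" if "eqm M H x' y'" for x' y'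
  proof -
    assume y: "y' \<in> W"
    have xy: "x' \<in> carrier M" "y' \<in> carrier M" "x' \<ominus>\<^bsub>M\<^esub> y' \<in> W" using that assms(3) by (auto simp: eqm_def)
    then have "(x' \<ominus>\<^bsub>M\<^esub> y') \<oplus>\<^bsub>M\<^esub> y' \<in> W" using lsubD(3)[OF vM assms(2)] y by blast
    then show ?thesis using xy by (simp add: a_minus_def M.a_assoc M.l_neg)
  qed
  show ?thesis using *[OF assms(1)] *[OF eqm_sym[OF assms(1)]] by blast
qed

lemma eqm_zero_iff: "x \<in> carrier M \<Longrightarrow> eqm M H x \<zero>\<^bsub>M\<^esub> \<longleftrightarrow> x \<in> H"
  by (simp add: eqm_def vspace_minus_zero[OF vM])

lemma eqm_finsum:
  assumes "finite B" "\<And>b. b \<in> B \<Longrightarrow> eqm M H (f b) (g b)"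
  shows "eqm M H (finsum M f B) (finsum M g B)"
  using assms
proof (induction B)
  case (insert b B)
  have "f \<in> insert b B \<rightarrow> carrier M" "g \<in> insert b B \<rightarrow> carrier M" using insert.prems by (auto simp: eqm_def)
  then show ?case using insert eqm_add[of "f b" "g b"] by simp
qed (simp add: eqm_refl)

end

section \<open>Irreducibility\<close>

definition nw :: "int \<Rightarrow> charge list" where
  "nw c = replicate (nat \<bar>c\<bar>) (if c > 0 then Pls else Mns)"

lemma normal_word_nw: "normal_word z = nw (charge_sum z)"
  by (simp add: normal_word_def nw_def)

lemma charge_sum_nw [simp]: "charge_sum (nw c) = c"
proof -
  have "charge_sum (replicate n j) = int n * cval j" for n j
    by (induction n) (simp_all add: algebra_simps)
  then show ?thesis by (simp add: nw_def)
qed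

text \<open>Every factor belongs to a place where the absolute charge drops from some
  \<open>q\<close>, which is then at least 1; the factor is
  \<open>- lam + q * (q - 1) * K\<close>.\<close>

lemma Ccoef_nonzero:
  assumes "\<And>q::nat. q \<ge> 1 \<Longrightarrow> lam \<noteq> of_nat q * (of_nat q - 1) * complex_of_real K"
  shows "Ccoef K lam z \<noteq> 0"
proof -
  have "- lam + of_int (\<bar>c\<bar> * (\<bar>c\<bar> - 1)) * complex_of_real K \<noteq> 0" if "\<bar>c'\<bar> < \<bar>c\<bar>" for c c' :: int
  proof -
    have "1 \<le> nat \<bar>c\<bar>" using that by linarith
    from assms[OF this] show ?thesis by (auto simp: of_nat_nat)
  qed
  then show ?thesis unfolding Ccoef_def by (subst prod_zero_iff) auto
qed

text \<open>\<open>Z\<close> is the geometric input: a submodule over \<open>T(E_p)\<close> that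
  contains the differences by which zero mode words are brought to normal form, but not
  \<open>s\<close>. It witnesses that the relations do not kill \<open>f\<close>.\<close>

locale irr = fock +
  fixes s Z K lam
  assumes s: "s \<in> carrier S" and Z: "lsub Z S" "\<And>j x. x \<in> Z \<Longrightarrow> hmul S j x \<in> Z" and sZ: "s \<notin> Z"
    and rel: "\<And>z. zact S s z \<ominus>\<^bsub>S\<^esub> Ccoef K lam z \<odot>\<^bsub>S\<^esub> zact S s (normal_word z) \<in> Z"
    and gen: "\<And>q::nat. q \<ge> 1 \<Longrightarrow> lam \<noteq> of_nat q * (of_nat q - 1) * complex_of_real K"
    and l0: "l \<noteq> 0"
begin

abbreviation "V \<equiv> VU l S s"
abbreviation "V0 \<equiv> sector S s 0"
abbreviation "e u z \<equiv> monom_at S u (zact S s z)"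

lemma monom_at_minus:
  assumes "x \<in> carrier S" "y \<in> carrier S" "is_word u"
  shows "monom_at S u (x \<ominus>\<^bsub>S\<^esub> y) = monom_at S u x \<ominus>\<^bsub>F\<^esub> monom_at S u y"
proof
  fix v
  have "monom_at S u y \<in> carrier F" using assms by simp
  then show "monom_at S u (x \<ominus>\<^bsub>S\<^esub> y) v = (monom_at S u x \<ominus>\<^bsub>F\<^esub> monom_at S u y) v"
    using assms by (simp add: a_minus_def vspace_uminus[OF vF] vspace_uminus[OF vS] fock_simps(3,4) monom_at_def)
qed

lemma smult_monom: "a \<odot>\<^bsub>F\<^esub> monom_at S u x = monom_at S u (a \<odot>\<^bsub>S\<^esub> x)"
  by (auto simp: monom_at_def fock_simps(4))

text \<open>The proper graded submodule that bounds the kernel of the double quotient from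
  above.\<close>

definition "W0 = symker Z \<inter> V0"

definition "X1 = VU1_rels l S s K lam"

text \<open>Representatives in \<open>V\<close> of the relations of the second quotient, so that
  both sets of relations live in one space.\<close>

definition "X2 = {mode_elt l S s u z \<ominus>\<^bsub>V\<^esub> mode_elt l S s (permute_list \<tau> u) z | u z \<tau>.
      is_word u \<and> charge_sum (map fst u @ z) = 0 \<and> \<tau> permutes {..<length u}}"

lemma e_sector: "is_word u \<Longrightarrow> charge_sum (map fst u) + charge_sum z = 0 \<Longrightarrow> e u z \<in> V0"
  by (rule monom_sector[OF s]) auto

lemma V0D: "\<phi> \<in> V0 \<Longrightarrow> \<phi> \<in> carrier F"
  using sector_carrier[OF s] by blast

lemma permute_word:
  assumes "\<tau> permutes {..<length u}"
  shows "mset (permute_list \<tau> u) = mset u" "is_word (permute_list \<tau> u) = is_word u"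
    "charge_sum (map fst (permute_list \<tau> u)) = charge_sum (map fst u)"
proof -
  show m: "mset (permute_list \<tau> u) = mset u" using assms by (rule mset_permute_list)
  then show "is_word (permute_list \<tau> u) = is_word u"
    unfolding is_word_def by (metis set_mset_mset)
  have "charge_sum (map fst v) = sum_mset (image_mset (\<lambda>b. cval (fst b)) (mset v))" for v :: word
    by (simp add: charge_sum_def comp_def sum_mset_sum_list[symmetric])
  then show "charge_sum (map fst (permute_list \<tau> u)) = charge_sum (map fst u)" using m by simp
qed

lemma charge_cong: "mset u = mset v \<Longrightarrow> charge_sum (map fst u) = charge_sum (map fst v)"
  for u v :: word
  by (rule mset_eq_permutation[of u v]) (auto simp: permute_word)

lemma word_cong: "mset u = mset v \<Longrightarrow> is_word u = is_word v"
  unfolding is_word_def by (metis set_mset_mset)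

lemma X1_iff:
  "x \<in> X1 \<longleftrightarrow> (\<exists>u z. is_word u \<and> charge_sum (map fst u) + charge_sum z = 0 \<and>
     x = e u z \<ominus>\<^bsub>F\<^esub> Ccoef K lam z \<odot>\<^bsub>F\<^esub> e u (normal_word z))"
proof -
  have "mode_elt l S s u z \<ominus>\<^bsub>V\<^esub> Ccoef K lam z \<odot>\<^bsub>V\<^esub> mode_elt l S s u (normal_word z) =
    e u z \<ominus>\<^bsub>F\<^esub> Ccoef K lam z \<odot>\<^bsub>F\<^esub> e u (normal_word z)"
    if "is_word u" "charge_sum (map fst u) + charge_sum z = 0" for u z
    using that VU_minus[OF s e_sector[of u z], of "Ccoef K lam z \<odot>\<^bsub>F\<^esub> e u (normal_word z)"]
      lsubD(4)[OF vF lsub_sector[OF s] e_sector[of u "normal_word z"]]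
    by (simp add: mode_elt_eq[OF s] VU_simps[OF s] normal_word_nw)
  then show ?thesis unfolding X1_def VU1_rels_def by force
qed

lemma X2_iff:
  "x \<in> X2 \<longleftrightarrow> (\<exists>u v z. is_word u \<and> charge_sum (map fst u) + charge_sum z = 0 \<and> mset v = mset u \<and>
     x = e u z \<ominus>\<^bsub>F\<^esub> e v z)"
proof -
  have *: "mode_elt l S s u z \<ominus>\<^bsub>V\<^esub> mode_elt l S s (permute_list \<tau> u) z = e u z \<ominus>\<^bsub>F\<^esub> e (permute_list \<tau> u) z"
    if "is_word u" "charge_sum (map fst u) + charge_sum z = 0" "\<tau> permutes {..<length u}" for u z \<tau>
    using that VU_minus[OF s e_sector[of u z] e_sector[of "permute_list \<tau> u" z]]
    by (simp add: mode_elt_eq[OF s] permute_word)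
  show ?thesis
  proof
    assume "x \<in> X2"
    then obtain u z \<tau> where u: "is_word u" "charge_sum (map fst u) + charge_sum z = 0" "\<tau> permutes {..<length u}"
      "x = e u z \<ominus>\<^bsub>F\<^esub> e (permute_list \<tau> u) z"
      unfolding X2_def using * by force
    then show "\<exists>u v z. is_word u \<and> charge_sum (map fst u) + charge_sum z = 0 \<and> mset v = mset u \<and>
     x = e u z \<ominus>\<^bsub>F\<^esub> e v z" using permute_word(1)[OF u(3)] by blast
  next
    assume "\<exists>u v z. is_word u \<and> charge_sum (map fst u) + charge_sum z = 0 \<and> mset v = mset u \<and>
     x = e u z \<ominus>\<^bsub>F\<^esub> e v z"
    then obtain u v z where u: "is_word u" "charge_sum (map fst u) + charge_sum z = 0" "mset v = mset u"
     "x = e u z \<ominus>\<^bsub>F\<^esub> e v z" by blast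
    obtain \<tau> where t: "\<tau> permutes {..<length u}" "permute_list \<tau> u = v"
      using mset_eq_permutation[OF u(3)] by blast
    have "x = mode_elt l S s u z \<ominus>\<^bsub>V\<^esub> mode_elt l S s (permute_list \<tau> u) z"
      using *[OF u(1,2) t(1)] u(4) t(2) by simp
    moreover have "charge_sum (map fst u @ z) = 0" using u(2) by simp
    ultimately show "x \<in> X2" unfolding X2_def using u(1) t(1) by blast
  qed
qed

lemma symsum_minus:
  assumes "\<phi> \<in> carrier F" "\<psi> \<in> carrier F"
  shows "symsum S (\<phi> \<ominus>\<^bsub>F\<^esub> \<psi>) \<mu> = symsum S \<phi> \<mu> \<ominus>\<^bsub>S\<^esub> symsum S \<psi> \<mu>"
  using assms symsum_closed
  by (simp add: a_minus_def vspace_uminus[OF vF] vspace_uminus[OF vS] symsum_add symsum_smult vspace_smult(1)[OF vF])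

lemma X1_W0: "X1 \<subseteq> W0"
proof
  fix x assume "x \<in> X1"
  then obtain u z where u: "is_word u" "charge_sum (map fst u) + charge_sum z = 0"
    and x: "x = e u z \<ominus>\<^bsub>F\<^esub> Ccoef K lam z \<odot>\<^bsub>F\<^esub> e u (normal_word z)" by (auto simp: X1_iff)
  have E: "e u z \<in> V0" "Ccoef K lam z \<odot>\<^bsub>F\<^esub> e u (normal_word z) \<in> V0"
    using u by (auto intro!: e_sector lsubD(4)[OF vF lsub_sector[OF s]] simp: normal_word_nw)
  have xV: "x \<in> V0" unfolding x by (rule lsubD(6)[OF vF lsub_sector[OF s] E])
  have "x = monom_at S u (zact S s z \<ominus>\<^bsub>S\<^esub> Ccoef K lam z \<odot>\<^bsub>S\<^esub> zact S s (normal_word z))"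
    unfolding x smult_monom by (rule monom_at_minus[symmetric]) (use s u in \<open>auto simp: Ssm\<close>)
  then have "symsum S x \<mu> \<in> Z" for \<mu>
    using rel[of z] lsubD(1,2)[OF vS Z(1)] by (simp add: symsum_monom)
  then show "x \<in> W0" using xV V0D by (auto simp: W0_def symker_def)
qed

lemma X2_W0: "X2 \<subseteq> W0"
proof
  fix x assume "x \<in> X2"
  then obtain u v z where u: "is_word u" "charge_sum (map fst u) + charge_sum z = 0" "mset v = mset u"
     and x: "x = e u z \<ominus>\<^bsub>F\<^esub> e v z" by (auto simp: X2_iff)
  have E: "e u z \<in> V0" "e v z \<in> V0"
    using u charge_cong[OF u(3)] word_cong[OF u(3)] by (auto intro!: e_sector)
  have xV: "x \<in> V0" unfolding x by (rule lsubD(6)[OF vF lsub_sector[OF s] E])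
  have "symsum S x \<mu> = \<zero>\<^bsub>S\<^esub>" for \<mu>
    unfolding x symsum_minus[OF V0D[OF E(1)] V0D[OF E(2)]]
    using s u(3) by (simp add: symsum_monom a_minus_def S.r_neg)
  then show "x \<in> W0" using xV V0D lsubD(2)[OF vS Z(1)] by (auto simp: W0_def symker_def)
qed

lemma W0_sub: "is_submodule W0 V"
  unfolding W0_def by (rule is_submodule_symker[OF Z s])

text \<open>The symmetrized coefficient of \<open>vac\<close> at the empty multiset is
  \<open>s\<close>, which \<open>Z\<close> omits.\<close>

lemma vac_W0: "vac S s \<notin> W0"
proof
  assume "vac S s \<in> W0"
  then have "symsum S (vac S s) {#} \<in> Z" by (simp add: W0_def symker_def)
  moreover have "symsum S (vac S s) {#} = s"
    using symsum_monom[of s "[]" "{#}"] s by (simp add: vac_eq[OF s] zact_def)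
  ultimately show False using sZ by simp
qed


text \<open>The vector \<open>b(u)\<close> of the overview: its zero modes are the normal word that
  compensates the charge of \<open>u\<close>.\<close>

definition "bb u = e u (nw (- charge_sum (map fst u)))"

text \<open>The zero mode supplies the charge that the deletion of \<open>b\<close> takes away, so
  the product has charge 0 and preserves submodules.\<close>

definition "lower b \<phi> = nord l S [(opp (fst b), int (snd b)), (fst b, 0)] \<phi>"

lemma linop_lower: "linop F (lower b)"
  using linop_nord unfolding lower_def[abs_def] by blast

lemma lower_eq:
  assumes "snd b > 0"
  shows "lower b \<phi> = (2 * of_nat (snd b) * l) \<odot>\<^bsub>F\<^esub> isum b (osc l S (fst b) 0 \<phi>)"
  using assms by (simp add: lower_def nord_def osc_isum)

text \<open>\<open>N v\<close> counts the positions at which inserting \<open>b\<close> into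
  \<open>v\<close> yields \<open>u\<close>. As natural numbers these cannot cancel when the
  monomials of the various \<open>v\<close> become congruent.\<close>

lemma isum_monom:
  assumes u: "is_word u" and y: "y \<in> carrier S"
  obtains N :: "word \<Rightarrow> nat" where
    "isum b (monom_at S u y) = (\<Oplus>\<^bsub>F\<^esub>v\<in>{v. mset v = mset u - {#b#}}. of_nat (N v) \<odot>\<^bsub>F\<^esub> monom_at S v y)"
    "b \<in> set u \<Longrightarrow> (\<Sum>v\<in>{v. mset v = mset u - {#b#}}. N v) \<noteq> 0"
    "b \<notin> set u \<Longrightarrow> isum b (monom_at S u y) = \<zero>\<^bsub>F\<^esub>"
proof
  define P where "P = {v. mset v = mset u - {#b#}}"
  define N where "N v = card {r \<in> {..length v}. take r v @ b # drop r v = u}" for v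
  have finP: "finite P"
    using finite_permutations_of_multiset[of "mset u - {#b#}"] by (simp add: P_def permutations_of_multiset_def)
  have wP: "is_word v" if "v \<in> P" for v
  proof -
    have "set v \<subseteq> set u" using that by (auto simp: P_def dest!: arg_cong[of _ _ set_mset] in_diffD)
    then show ?thesis using u by (auto simp: is_word_def)
  qed
  have ev: "isum b (monom_at S u y) v = of_nat (N v) \<odot>\<^bsub>S\<^esub> y" for v
  proof -
    have "isum b (monom_at S u y) v = (\<Oplus>\<^bsub>S\<^esub>r\<in>{..length v}. (if take r v @ b # drop r v = u then 1 else 0) \<odot>\<^bsub>S\<^esub> y)"
      unfolding isum_def by (rule S.finsum_cong') (use y in \<open>auto simp: monom_at_def Ssm\<close>)
    also have "\<dots> = (\<Sum>r\<le>length v. if take r v @ b # drop r v = u then 1 else 0) \<odot>\<^bsub>S\<^esub> y"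
      by (rule finsum_smult_const[OF vS]) (use y in auto)
    also have "(\<Sum>r\<le>length v. if take r v @ b # drop r v = u then 1 else 0 :: complex) = of_nat (N v)"
      by (simp add: sum.If_cases Int_def N_def)
    finally show ?thesis .
  qed
  have ins: "b \<in> set u \<and> v \<in> P" if "N v \<noteq> 0" for v
  proof -
    from that have "{r \<in> {..length v}. take r v @ b # drop r v = u} \<noteq> {}" unfolding N_def by auto
    then obtain r where r: "r \<le> length v" "take r v @ b # drop r v = u" by blast
    have "mset u = add_mset b (mset (take r v) + mset (drop r v))" unfolding r(2)[symmetric] by simp
    also have "mset (take r v) + mset (drop r v) = mset v" by (metis append_take_drop_id mset_append)
    finally have m: "mset u = add_mset b (mset v)" .
    have "b \<in> set_mset (mset u)" unfolding m by simp
    then have "b \<in> set u" by (simp only: set_mset_mset)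
    then show ?thesis using m by (simp add: P_def)
  qed
  show "isum b (monom_at S u y) = (\<Oplus>\<^bsub>F\<^esub>v\<in>P. of_nat (N v) \<odot>\<^bsub>F\<^esub> monom_at S v y)"
  proof
    fix v
    have "(\<Oplus>\<^bsub>F\<^esub>v\<in>P. of_nat (N v) \<odot>\<^bsub>F\<^esub> monom_at S v y) v = (\<Oplus>\<^bsub>S\<^esub>w\<in>P. (of_nat (N w) \<odot>\<^bsub>F\<^esub> monom_at S w y) v)"
      by (rule finsum_apply[OF Z finP]) (use wP y in \<open>auto intro!: vspace_smult(1)[OF vF]\<close>)
    also have "\<dots> = (\<Oplus>\<^bsub>S\<^esub>w\<in>P. if v = w then of_nat (N w) \<odot>\<^bsub>S\<^esub> y else \<zero>\<^bsub>S\<^esub>)"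
      by (rule S.finsum_cong') (use y in \<open>auto simp: fock_simps(4) monom_at_def Ssm\<close>)
    also have "\<dots> = of_nat (N v) \<odot>\<^bsub>S\<^esub> y"
    proof (cases "v \<in> P")
      case True then show ?thesis using finP y by (intro S.finsum_singleton) (auto simp: Ssm)
    next
      case False
      then have "(\<Oplus>\<^bsub>S\<^esub>w\<in>P. if v = w then of_nat (N w) \<odot>\<^bsub>S\<^esub> y else \<zero>\<^bsub>S\<^esub>) = (\<Oplus>\<^bsub>S\<^esub>w\<in>P. \<zero>\<^bsub>S\<^esub>)"
        by (intro S.finsum_cong') auto
      moreover have "N v = 0" using ins[of v] False by blast
      ultimately show ?thesis using y by (simp add: Ssm)
    qed
    finally show "isum b (monom_at S u y) v = (\<Oplus>\<^bsub>F\<^esub>v\<in>P. of_nat (N v) \<odot>\<^bsub>F\<^esub> monom_at S v y) v"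
      by (simp add: ev)
  qed
  { assume "b \<in> set u"
    then obtain p q where pq: "u = p @ b # q" by (auto simp: in_set_conv_decomp)
    have "p @ q \<in> P" by (simp add: P_def pq)
    moreover have "length p \<in> {r \<in> {..length (p @ q)}. take r (p @ q) @ b # drop r (p @ q) = u}" by (simp add: pq)
    then have "{r \<in> {..length (p @ q)}. take r (p @ q) @ b # drop r (p @ q) = u} \<noteq> {}" by blast
    then have "N (p @ q) \<noteq> 0" unfolding N_def by (subst card_eq_0_iff) simp
    ultimately show "(\<Sum>v\<in>P. N v) \<noteq> 0" using finP by auto }
  { assume "b \<notin> set u"
    then have "N v = 0" for v using ins by blast
    then have "isum b (monom_at S u y) v = \<zero>\<^bsub>S\<^esub>" for v using y by (simp add: ev Ssm)
    then show "isum b (monom_at S u y) = \<zero>\<^bsub>F\<^esub>" by (auto simp: fock_simps(2)) }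
qed

context
  fixes Ker assumes Ker: "stable Ker V" and XK: "X1 \<subseteq> Ker" "X2 \<subseteq> Ker"
begin

lemma KF: "lsub Ker F" and KV: "Ker \<subseteq> V0"
  and Knord: "charge_sum (map fst bs) = 0 \<Longrightarrow> \<phi> \<in> Ker \<Longrightarrow> nord l S bs \<phi> \<in> Ker"
  using Ker unfolding stable_VU[OF s] by blast+

abbreviation eqK (infix "\<approx>" 50) where "eqK \<equiv> eqm F Ker"

lemmas q_trans [trans] = eqm_trans[OF vF KF]
lemmas q_refl = eqm_refl[OF vF KF]
lemmas q_sym = eqm_sym[OF vF KF]
lemmas q_smult = eqm_smult[OF vF KF]
lemmas q_add = eqm_add[OF vF KF]

lemma e_normal:
  assumes "is_word u" "charge_sum (map fst u) + charge_sum z = 0"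
  shows "e u z \<approx> Ccoef K lam z \<odot>\<^bsub>F\<^esub> bb u"
proof -
  have "e u z \<ominus>\<^bsub>F\<^esub> Ccoef K lam z \<odot>\<^bsub>F\<^esub> e u (normal_word z) \<in> X1"
    unfolding X1_iff using assms by blast
  then have "e u z \<ominus>\<^bsub>F\<^esub> Ccoef K lam z \<odot>\<^bsub>F\<^esub> e u (normal_word z) \<in> Ker" using XK(1) by blast
  moreover have "- charge_sum (map fst u) = charge_sum z" using assms(2) by linarith
  then have "bb u = e u (normal_word z)" by (simp only: bb_def normal_word_nw)
  ultimately show ?thesis
    using assms s by (simp add: eqm_def vspace_smult(1)[OF vF])
qed

lemma e_perm:
  assumes "is_word u" "charge_sum (map fst u) + charge_sum z = 0" "mset v = mset u"
  shows "e u z \<approx> e v z"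
proof -
  have "e u z \<ominus>\<^bsub>F\<^esub> e v z \<in> X2" unfolding X2_iff using assms by blast
  then show ?thesis using assms XK(2) s word_cong[OF assms(3)] by (auto simp: eqm_def)
qed

lemma bb_V0: "is_word u \<Longrightarrow> bb u \<in> V0"
  unfolding bb_def by (rule e_sector) auto

lemma bb_F: "is_word u \<Longrightarrow> bb u \<in> carrier F"
  by (rule V0D[OF bb_V0])

lemma bb_perm: "is_word u \<Longrightarrow> mset v = mset u \<Longrightarrow> bb u \<approx> bb v"
  using e_perm[of u "nw (- charge_sum (map fst u))" v] charge_cong[of v u] by (simp add: bb_def)

text \<open>The words left after deleting \<open>b\<close> are permutations of each other, hence
  congruent. The factor consists of \<open>2 * m * l\<close>, the number of possible deletions and
  \<open>Ccoef\<close> of the new zero mode word, which is nonzero for generic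
  \<open>lam\<close>.\<close>

lemma lower_bb:
  assumes u: "is_word u" and b: "snd b > 0"
  shows "b \<in> set u \<Longrightarrow> \<exists>\<kappa>. \<kappa> \<noteq> 0 \<and> lower b (bb u) \<approx> \<kappa> \<odot>\<^bsub>F\<^esub> bb (remove1 b u)"
    and "b \<notin> set u \<Longrightarrow> lower b (bb u) \<in> Ker"
proof -
  define z where "z = fst b # nw (- charge_sum (map fst u))"
  define P where "P = {v. mset v = mset u - {#b#}}"
  have yc: "zact S s z \<in> carrier S" using s by simp
  have lo: "lower b (bb u) = (2 * of_nat (snd b) * l) \<odot>\<^bsub>F\<^esub> isum b (e u z)"
    by (simp add: lower_eq[OF b] bb_def osc_zero_monom z_def zact_def)
  obtain N :: "word \<Rightarrow> nat" where N: "isum b (e u z) = (\<Oplus>\<^bsub>F\<^esub>v\<in>P. of_nat (N v) \<odot>\<^bsub>F\<^esub> e v z)"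
    "b \<in> set u \<Longrightarrow> (\<Sum>v\<in>P. N v) \<noteq> 0" "b \<notin> set u \<Longrightarrow> isum b (e u z) = \<zero>\<^bsub>F\<^esub>"
    unfolding P_def by (rule isum_monom[OF u yc, of b]) blast
  show "lower b (bb u) \<in> Ker" if "b \<notin> set u"
    using N(3)[OF that] lsubD(2)[OF vF KF] by (simp add: lo vspace_smult[OF vF])
  assume bu: "b \<in> set u"
  have finP: "finite P"
    using finite_permutations_of_multiset[of "mset u - {#b#}"] by (simp add: P_def permutations_of_multiset_def)
  have ur: "mset (remove1 b u) = mset u - {#b#}" by simp
  have wr: "is_word (remove1 b u)" using u set_remove1_subset[of b u] by (auto simp: is_word_def)
  have "mset u = mset (b # remove1 b u)" using bu by simp
  then have "charge_sum (map fst u) = cval (fst b) + charge_sum (map fst (remove1 b u))"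
    using charge_cong[of u "b # remove1 b u"] by simp
  then have cr: "charge_sum (map fst (remove1 b u)) + charge_sum z = 0" by (simp add: z_def)
  have "isum b (e u z) \<approx> (\<Oplus>\<^bsub>F\<^esub>v\<in>P. of_nat (N v) \<odot>\<^bsub>F\<^esub> e (remove1 b u) z)"
    unfolding N(1)
  proof (rule eqm_finsum[OF vF KF finP q_smult])
    fix v assume "v \<in> P"
    then have "mset v = mset (remove1 b u)" by (simp add: P_def)
    from q_sym[OF e_perm[OF wr cr this]] show "e v z \<approx> e (remove1 b u) z" .
  qed
  also have "(\<Oplus>\<^bsub>F\<^esub>v\<in>P. of_nat (N v) \<odot>\<^bsub>F\<^esub> e (remove1 b u) z) = (\<Sum>v\<in>P. of_nat (N v)) \<odot>\<^bsub>F\<^esub> e (remove1 b u) z"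
    by (rule finsum_smult_const[OF vF finP]) (use wr s in simp)
  also have "\<dots> \<approx> (\<Sum>v\<in>P. of_nat (N v)) \<odot>\<^bsub>F\<^esub> (Ccoef K lam z \<odot>\<^bsub>F\<^esub> bb (remove1 b u))"
    by (rule q_smult[OF e_normal[OF wr cr]])
  finally have "lower b (bb u) \<approx>
      (2 * of_nat (snd b) * l) \<odot>\<^bsub>F\<^esub> ((\<Sum>v\<in>P. of_nat (N v)) \<odot>\<^bsub>F\<^esub> (Ccoef K lam z \<odot>\<^bsub>F\<^esub> bb (remove1 b u)))"
    unfolding lo by (rule q_smult)
  also have "\<dots> = (2 * of_nat (snd b) * l * (of_nat (\<Sum>v\<in>P. N v) * Ccoef K lam z)) \<odot>\<^bsub>F\<^esub> bb (remove1 b u)"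
    using bb_F[OF wr] by (simp add: vspace_smult[OF vF])
  finally have "lower b (bb u) \<approx>
      (2 * of_nat (snd b) * l * (of_nat (\<Sum>v\<in>P. N v) * Ccoef K lam z)) \<odot>\<^bsub>F\<^esub> bb (remove1 b u)" .
  moreover have "2 * of_nat (snd b) * l * (of_nat (\<Sum>v\<in>P. N v) * Ccoef K lam z) \<noteq> 0"
    using b l0 N(2)[OF bu] Ccoef_nonzero[OF gen, of z] by (simp del: of_nat_sum)
  ultimately show "\<exists>\<kappa>. \<kappa> \<noteq> 0 \<and> lower b (bb u) \<approx> \<kappa> \<odot>\<^bsub>F\<^esub> bb (remove1 b u)" by blast
qed

definition "lowers us \<phi> = fold lower us \<phi>"

lemma linop_lowers: "linop F (lowers us)"
proof (induction us)
  case Nil then show ?case using linop_id[OF vF] by (simp add: lowers_def linop_def)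
next
  case (Cons b us)
  then show ?case using linop_comp[OF Cons linop_lower[of b]] by (simp add: lowers_def linop_def)
qed

lemma lowers_stable:
  assumes "\<And>bs \<phi>. charge_sum (map fst bs) = 0 \<Longrightarrow> \<phi> \<in> W \<Longrightarrow> nord l S bs \<phi> \<in> W" "\<phi> \<in> W"
  shows "lowers us \<phi> \<in> W"
proof -
  have "lower b \<psi> \<in> W" if "\<psi> \<in> W" for b \<psi>
    unfolding lower_def by (rule assms(1)) (use that in auto)
  then show ?thesis using assms(2) unfolding lowers_def by (induction us arbitrary: \<phi>) auto
qed

lemma lowers_cong: "\<phi> \<approx> \<psi> \<Longrightarrow> lowers us \<phi> \<approx> lowers us \<psi>"
  by (rule eqm_linop[OF vF KF linop_lowers lowers_stable[OF Knord]])

text \<open>Each operator removes its letter, or leads into \<open>Ker\<close> if the letter is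
  absent. As \<open>u\<close> is not longer than \<open>us\<close>, no letter is ever absent only if
  \<open>us\<close> uses up exactly the letters of \<open>u\<close>.\<close>

lemma lowers_bb:
  assumes "is_word u" "is_word us" "length u \<le> length us"
  shows "mset u \<noteq> mset us \<Longrightarrow> lowers us (bb u) \<in> Ker"
    and "mset u = mset us \<Longrightarrow> \<exists>\<kappa>. \<kappa> \<noteq> 0 \<and> lowers us (bb u) \<approx> \<kappa> \<odot>\<^bsub>F\<^esub> vac S s"
  using assms
proof (induction us arbitrary: u)
  case Nil
  { case 1 then show ?case by simp }
  { case 2
    have "bb [] = vac S s" by (simp add: bb_def vac_eq[OF s] nw_def)
    then show ?case using 2 q_refl[OF V0D[OF vac_sector[OF s]]] V0D[OF vac_sector[OF s]]
      by (intro exI[of _ 1]) (simp add: lowers_def vspace_smult[OF vF]) }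
next
  case (Cons b us)
  have rw: "is_word (remove1 b u)" if "is_word u" for u using that set_remove1_subset[of b u] by (auto simp: is_word_def)
  have st: "lowers (b # us) (bb u) = lowers us (lower b (bb u))" for u by (simp add: lowers_def)
  { case 1
    show ?case
    proof (cases "b \<in> set u")
      case False
      then show ?thesis unfolding st using 1 by (intro lowers_stable[OF Knord] lower_bb(2)) auto
    next
      case True
      have w: "is_word u" "snd b > 0" "is_word us" using 1 by simp_all
      obtain \<kappa> where k: "lower b (bb u) \<approx> \<kappa> \<odot>\<^bsub>F\<^esub> bb (remove1 b u)"
        using lower_bb(1)[OF w(1,2) True] by blast
      have "mset u = add_mset b (mset (remove1 b u))" using True by simp
      then have "mset (remove1 b u) \<noteq> mset us" using 1(1) by (metis mset.simps(2))
      moreover have "length (remove1 b u) \<le> length us" using 1(4) True by (simp add: length_remove1)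
      ultimately have "lowers us (bb (remove1 b u)) \<in> Ker"
        by (rule Cons.IH(1)[OF _ rw[OF w(1)] w(3)])
      then have "lowers us (\<kappa> \<odot>\<^bsub>F\<^esub> bb (remove1 b u)) \<in> Ker"
        using linopD(3)[OF linop_lowers bb_F[OF rw[OF w(1)]]] lsubD(4)[OF vF KF] by simp
      then show ?thesis unfolding st using eqm_mem[OF vF KF lowers_cong[OF k] KF] by blast
    qed }
  { case 2
    have w: "is_word u" "snd b > 0" "is_word us" using 2 by simp_all
    have "b \<in># mset u" using 2(1) by simp
    then have True: "b \<in> set u" by simp
    obtain \<kappa> where k: "\<kappa> \<noteq> 0" "lower b (bb u) \<approx> \<kappa> \<odot>\<^bsub>F\<^esub> bb (remove1 b u)"
      using lower_bb(1)[OF w(1,2) True] by blast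
    have m: "mset (remove1 b u) = mset us" using 2(1) by simp
    have "length (remove1 b u) \<le> length us" using 2(4) True by (simp add: length_remove1)
    then obtain \<kappa>' where k': "\<kappa>' \<noteq> 0" "lowers us (bb (remove1 b u)) \<approx> \<kappa>' \<odot>\<^bsub>F\<^esub> vac S s"
      using Cons.IH(2)[OF m rw[OF w(1)] w(3)] by blast
    have "lowers (b # us) (bb u) \<approx> lowers us (\<kappa> \<odot>\<^bsub>F\<^esub> bb (remove1 b u))"
      unfolding st by (rule lowers_cong[OF k(2)])
    also have "\<dots> = \<kappa> \<odot>\<^bsub>F\<^esub> lowers us (bb (remove1 b u))"
      by (rule linopD(3)[OF linop_lowers bb_F[OF rw[OF w(1)]]])
    also have "\<dots> \<approx> \<kappa> \<odot>\<^bsub>F\<^esub> (\<kappa>' \<odot>\<^bsub>F\<^esub> vac S s)" by (rule q_smult[OF k'(2)])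
    also have "\<dots> = (\<kappa> * \<kappa>') \<odot>\<^bsub>F\<^esub> vac S s"
      using V0D[OF vac_sector[OF s]] by (simp add: vspace_smult[OF vF])
    finally show ?case using k(1) k'(1) by (intro exI[of _ "\<kappa> * \<kappa>'"]) simp }
qed

text \<open>Lists may repeat words, and a vector may have several expressions; the induction that
  follows is on the length of the list.\<close>

primrec lcomb :: "(complex \<times> word) list \<Rightarrow> word \<Rightarrow> 'a" where
  "lcomb [] = \<zero>\<^bsub>F\<^esub>"
| "lcomb (p # L) = (fst p \<odot>\<^bsub>F\<^esub> bb (snd p)) \<oplus>\<^bsub>F\<^esub> lcomb L"

abbreviation "wlist L \<equiv> \<forall>p\<in>set L. is_word (snd p)"

lemma lcomb_V0: "wlist L \<Longrightarrow> lcomb L \<in> V0"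
  by (induction L) (auto intro!: lsubD[OF vF lsub_sector[OF s]] bb_V0)

lemma lcomb_F: "wlist L \<Longrightarrow> lcomb L \<in> carrier F"
  by (rule V0D[OF lcomb_V0])

lemma lcomb_append: "wlist L \<Longrightarrow> wlist L' \<Longrightarrow> lcomb (L @ L') = lcomb L \<oplus>\<^bsub>F\<^esub> lcomb L'"
  by (induction L) (auto simp: lcomb_F F.a_assoc bb_F vspace_smult(1)[OF vF])

lemma lcomb_filter:
  "wlist L \<Longrightarrow> lcomb L = lcomb (filter Q L) \<oplus>\<^bsub>F\<^esub> lcomb (filter (\<lambda>p. \<not> Q p) L)"
proof (induction L)
  case (Cons p L)
  let ?x = "fst p \<odot>\<^bsub>F\<^esub> bb (snd p)" and ?y = "lcomb (filter Q L)" and ?z = "lcomb (filter (\<lambda>p. \<not> Q p) L)"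
  have "?x \<in> carrier F" "?y \<in> carrier F" "?z \<in> carrier F"
    using Cons.prems by (auto intro!: lcomb_F bb_F vspace_smult(1)[OF vF])
  then show ?case using Cons by (auto simp: F.a_assoc F.a_lcomm)
qed simp

lemma lcomb_smult:
  assumes "wlist L"
  shows "a \<odot>\<^bsub>F\<^esub> lcomb L = lcomb (map (\<lambda>p. (a * fst p, snd p)) L)"
  using assms by (induction L) (auto simp: vspace_smult[OF vF] bb_F lcomb_F)

text \<open>The first relations make each spanning monomial congruent to a multiple of some
  \<open>bb u\<close>, and the vectors congruent to combinations form a subspace.\<close>

lemma lcomb_exists:
  assumes "\<phi> \<in> V0"
  obtains L where "wlist L" "\<phi> \<approx> lcomb L"
proof -
  let ?W = "{\<phi>. \<exists>L. wlist L \<and> \<phi> \<approx> lcomb L}"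
  have "V0 \<subseteq> ?W"
    unfolding sector_def
  proof (rule lspan_least)
    show "lsub ?W F"
    proof (rule lsubI[OF vF])
      show "?W \<subseteq> carrier F" by (auto simp: eqm_def)
      show "\<zero>\<^bsub>F\<^esub> \<in> ?W" by (rule CollectI, rule exI[of _ "[]"]) (simp add: q_refl)
      fix \<phi> a assume "\<phi> \<in> ?W"
      then obtain L where L: "wlist L" "\<phi> \<approx> lcomb L" by blast
      show "a \<odot>\<^bsub>F\<^esub> \<phi> \<in> ?W"
        using q_smult[OF L(2), of a] L(1)
        by (intro CollectI exI[of _ "map (\<lambda>p. (a * fst p, snd p)) L"]) (auto simp: lcomb_smult)
      fix \<psi> assume "\<psi> \<in> ?W"
      then obtain L' where L': "wlist L'" "\<psi> \<approx> lcomb L'" by blast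
      show "\<phi> \<oplus>\<^bsub>F\<^esub> \<psi> \<in> ?W"
        using q_add[OF L(2) L'(2)] L(1) L'(1)
        by (intro CollectI exI[of _ "L @ L'"]) (auto simp: lcomb_append)
    qed
    show "{e u z |u z. is_word u \<and> charge_sum (map fst u @ z) = 0} \<subseteq> ?W"
    proof clarify
      fix u z assume u: "is_word u" "charge_sum (map fst u @ z) = 0"
      then have "e u z \<approx> Ccoef K lam z \<odot>\<^bsub>F\<^esub> bb u" by (intro e_normal) auto
      also have "\<dots> = lcomb [(Ccoef K lam z, u)]" using u(1) by (simp add: bb_F vspace_smult(1)[OF vF])
      finally show "\<exists>L. wlist L \<and> e u z \<approx> lcomb L" using u(1) by (intro exI[of _ "[(Ccoef K lam z, u)]"]) auto
    qed
  qed
  then show ?thesis using assms that by blast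
qed

lemma lcomb_same:
  assumes "is_word u0" "\<forall>p\<in>set L. mset (snd p) = mset u0"
  shows "lcomb L \<approx> sum_list (map fst L) \<odot>\<^bsub>F\<^esub> bb u0"
  using assms(2)
proof (induction L)
  case Nil then show ?case using bb_F[OF assms(1)] by (simp add: q_refl vspace_smult[OF vF])
next
  case (Cons p L)
  have "fst p \<odot>\<^bsub>F\<^esub> bb (snd p) \<approx> fst p \<odot>\<^bsub>F\<^esub> bb u0"
    using Cons.prems by (intro q_smult q_sym[OF bb_perm[OF assms(1)]]) auto
  then show ?case using q_add[OF _ Cons.IH] Cons.prems bb_F[OF assms(1)]
    by (simp add: vspace_smult[OF vF])
qed

text \<open>The words of maximal length in a combination survive the lowering operators belonging to one
  of them only if they are permutations of it.\<close>

lemma lcomb_vac: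
  assumes W: "lsub W F" "Ker \<subseteq> W" "\<And>bs \<phi>. charge_sum (map fst bs) = 0 \<Longrightarrow> \<phi> \<in> W \<Longrightarrow> nord l S bs \<phi> \<in> W"
  shows "wlist L \<Longrightarrow> lcomb L \<in> W \<Longrightarrow> lcomb L \<in> Ker \<or> vac S s \<in> W"
proof (induction L rule: length_induct)
  case (1 L)
  note D = lsubD[OF vF W(1)] and DK = lsubD[OF vF KF]
  show ?case
  proof (cases "L = []")
    case True then show ?thesis using DK(2) by simp
  next
    case False
    define m where "m = Max ((\<lambda>p. length (snd p)) ` set L)"
    have "m \<in> (\<lambda>p. length (snd p)) ` set L" unfolding m_def by (rule Max_in) (use False in auto)
    then obtain p0 where p0: "p0 \<in> set L" "length (snd p0) = m" by auto
    have mx: "length (snd p) \<le> length (snd p0)" if "p \<in> set L" for p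
      unfolding p0(2) m_def by (rule Max_ge) (use that in auto)
    define u0 where "u0 = snd p0"
    have w0: "is_word u0" using 1(2) p0(1) by (simp add: u0_def)
    let ?L1 = "filter (\<lambda>p. mset (snd p) = mset u0) L" and ?L2 = "filter (\<lambda>p. mset (snd p) \<noteq> mset u0) L"
    define a where "a = sum_list (map fst ?L1)"
    have w12: "wlist ?L1" "wlist ?L2" using 1(2) by auto
    have "lcomb ?L1 \<oplus>\<^bsub>F\<^esub> lcomb ?L2 \<approx> a \<odot>\<^bsub>F\<^esub> bb u0 \<oplus>\<^bsub>F\<^esub> lcomb ?L2"
      unfolding a_def using w12 by (intro q_add lcomb_same[OF w0] q_refl lcomb_F) auto
    then have LL: "lcomb L \<approx> a \<odot>\<^bsub>F\<^esub> bb u0 \<oplus>\<^bsub>F\<^esub> lcomb ?L2"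
      unfolding lcomb_filter[OF 1(2), of "\<lambda>p. mset (snd p) = mset u0"] .
    \<comment> \<open>If the total coefficient of the class of \<open>u0\<close> cancels, this class
      is dropped and the shorter list falls under the induction hypothesis. Otherwise the lowering
      operators of \<open>u0\<close> send all other terms into \<open>Ker\<close> and this class to
      a nonzero multiple of \<open>vac\<close>.\<close>
    show ?thesis
    proof (cases "a = 0")
      case True
      then have L2: "lcomb L \<approx> lcomb ?L2" using LL lcomb_F[OF w12(2)] bb_F[OF w0] by (simp add: vspace_smult[OF vF])
      have "length ?L2 < length L"
        by (rule length_filter_less[OF p0(1)]) (simp add: u0_def)
      then have "lcomb ?L2 \<in> W \<Longrightarrow> lcomb ?L2 \<in> Ker \<or> vac S s \<in> W" using 1(1) w12(2) by blast
      then show ?thesis using eqm_mem[OF vF KF L2 W(1,2)] eqm_mem[OF vF KF L2 KF] 1(3) by blast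
    next
      case False
      obtain \<kappa> where k: "\<kappa> \<noteq> 0" "lowers u0 (bb u0) \<approx> \<kappa> \<odot>\<^bsub>F\<^esub> vac S s"
        using lowers_bb(2)[OF w0 w0] by blast
      have l2: "lowers u0 (lcomb L') \<in> Ker" if "set L' \<subseteq> set ?L2" for L'
        using that
      proof (induction L')
        case Nil then show ?case using DK(2) linop_zero[OF vF linop_lowers] by simp
      next
        case (Cons p L')
        have p: "p \<in> set L" "mset (snd p) \<noteq> mset u0" "set L' \<subseteq> set ?L2" using Cons.prems by auto
        have wp: "is_word (snd p)" using p(1) 1(2) by blast
        have "wlist L'" using p(3) 1(2) by auto
        note cl = lcomb_F[OF this] vspace_smult(1)[OF vF bb_F[OF wp]]
        have "lowers u0 (bb (snd p)) \<in> Ker"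
          using mx[OF p(1)] p(2) by (intro lowers_bb(1) wp w0) (auto simp: u0_def)
        then show ?case using Cons.IH[OF p(3)] cl
          by (simp add: linopD(2)[OF linop_lowers] linopD(3)[OF linop_lowers bb_F[OF wp]] DK)
      qed
      have cl: "a \<odot>\<^bsub>F\<^esub> bb u0 \<in> carrier F" "lcomb ?L2 \<in> carrier F" "vac S s \<in> carrier F"
        using bb_F[OF w0] lcomb_F[OF w12(2)] V0D[OF vac_sector[OF s]] by (auto simp: vspace_smult[OF vF])
      have "lowers u0 (lcomb L) \<approx> lowers u0 (a \<odot>\<^bsub>F\<^esub> bb u0 \<oplus>\<^bsub>F\<^esub> lcomb ?L2)" by (rule lowers_cong[OF LL])
      also have "\<dots> = a \<odot>\<^bsub>F\<^esub> lowers u0 (bb u0) \<oplus>\<^bsub>F\<^esub> lowers u0 (lcomb ?L2)"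
        using cl bb_F[OF w0] by (simp add: linopD(2,3)[OF linop_lowers])
      also have "\<dots> \<approx> a \<odot>\<^bsub>F\<^esub> (\<kappa> \<odot>\<^bsub>F\<^esub> vac S s) \<oplus>\<^bsub>F\<^esub> \<zero>\<^bsub>F\<^esub>"
        using l2[of ?L2] linopD(1)[OF linop_lowers cl(2), of u0]
        by (intro q_add q_smult k(2)) (auto simp: eqm_zero_iff[OF vF KF])
      also have "\<dots> = (a * \<kappa>) \<odot>\<^bsub>F\<^esub> vac S s" using cl by (simp add: vspace_smult[OF vF])
      finally have "(a * \<kappa>) \<odot>\<^bsub>F\<^esub> vac S s \<in> W"
        using eqm_mem[OF vF KF _ W(1,2)] lowers_stable[OF W(3) 1(3)] by blast
      then have "inverse (a * \<kappa>) \<odot>\<^bsub>F\<^esub> ((a * \<kappa>) \<odot>\<^bsub>F\<^esub> vac S s) \<in> W" by (rule D(4))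
      then have "(inverse (a * \<kappa>) * (a * \<kappa>)) \<odot>\<^bsub>F\<^esub> vac S s \<in> W"
        using vspace_smult(4)[OF vF cl(3)] by metis
      moreover have "inverse (a * \<kappa>) * (a * \<kappa>) = 1" by (rule left_inverse) (use False k(1) in simp)
      ultimately show ?thesis using vspace_smult(5)[OF vF cl(3)] by simp
    qed
  qed
qed

text \<open>Once \<open>vac\<close> lies in \<open>W\<close>, all spanning monomials do by
  \<open>nord_vac\<close>.\<close>

lemma stable_top:
  assumes W: "stable W V" "Ker \<subseteq> W" and x: "x \<in> W" "x \<notin> Ker"
  shows "W = V0"
proof -
  have WF: "lsub W F" "W \<subseteq> V0" and Wn: "\<And>bs \<phi>. charge_sum (map fst bs) = 0 \<Longrightarrow> \<phi> \<in> W \<Longrightarrow> nord l S bs \<phi> \<in> W"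
    using W(1) unfolding stable_VU[OF s] by blast+
  obtain L where L: "wlist L" "x \<approx> lcomb L" using lcomb_exists[of x] x(1) WF(2) by blast
  have "lcomb L \<in> W" "lcomb L \<notin> Ker"
    using eqm_mem[OF vF KF L(2) WF(1) W(2)] eqm_mem[OF vF KF L(2) KF] x by auto
  then have vac: "vac S s \<in> W" using lcomb_vac[OF WF(1) W(2) Wn L(1)] by blast
  have "V0 \<subseteq> W"
    unfolding sector_def
  proof (rule lspan_least[OF WF(1)], clarify)
    fix u z assume u: "is_word u" and c: "charge_sum (map fst u @ z) = 0"
    have "nord l S (map (\<lambda>(j, t). (j, - int t)) u @ map (\<lambda>j. (j, 0)) z) (vac S s) \<in> W"
      by (rule Wn[OF _ vac]) (use c in \<open>simp add: comp_def split_def\<close>)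
    then show "e u z \<in> W" by (simp add: nord_vac[OF s u])
  qed
  then show ?thesis using WF(2) by blast
qed

end

theorem irreducible_VU2: "irreducible_module (VU2 l S s K lam)"
proof -
  have eq: "VU2_rels l S s K lam = (\<lambda>x. generated_submodule V X1 +>\<^bsub>V\<^esub> x) ` X2"
    unfolding VU2_rels_def X2_def VU1_null_def X1_def by blast
  have "irreducible_module (quot_module (quot_module V (generated_submodule V X1))
     (generated_submodule (quot_module V (generated_submodule V X1))
       ((\<lambda>x. generated_submodule V X1 +>\<^bsub>V\<^esub> x) ` X2)))"
  proof (rule irreducible_quot_quot[OF lvm_VU[OF s] W0_sub X1_W0 X2_W0])
    show "W0 \<noteq> carrier V" using vac_W0 vac_sector[OF s] by (auto simp: VU_carrier[OF s])
    fix Ker W x assume "stable Ker V" "X1 \<subseteq> Ker" "X2 \<subseteq> Ker" "stable W V" "Ker \<subseteq> W" "x \<in> W" "x \<notin> Ker"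
    then show "W = carrier V" unfolding VU_carrier[OF s] by (rule stable_top)
  qed
  then show ?thesis
    unfolding VU2_def eq unfolding VU1_def VU1_null_def X1_def[symmetric] .
qed

end

section \<open>Calculus on the plane\<close>

lemma pd_eqI: "(F has_derivative D) (at x) \<Longrightarrow> pd i F x = D (axis i 1)"
  unfolding pd_def by (metis frechet_derivative_at)

lemma has_derivative_cong_open:
  assumes "open S" "x \<in> S" "\<And>y. y \<in> S \<Longrightarrow> F y = G y"
  shows "(F has_derivative D) (at x) \<longleftrightarrow> (G has_derivative D) (at x)"
  using has_derivative_transform_within_open[of F D x UNIV S G]
    has_derivative_transform_within_open[of G D x UNIV S F] assms by auto

lemma pd_cong:
  assumes "open S" "x \<in> S" "\<And>y. y \<in> S \<Longrightarrow> F y = G y"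
  shows "pd i F x = pd i G x"
  using has_derivative_cong_open[OF assms] unfolding pd_def frechet_derivative_def by simp

lemma differentiable_on_open: "open S \<Longrightarrow> F differentiable_on S \<longleftrightarrow> (\<forall>x\<in>S. F differentiable at x)"
  by (rule differentiable_on_eq_differentiable_at)

lemma pd_add:
  assumes "F differentiable at x" "G differentiable at x"
  shows "pd i (\<lambda>y. F y + G y) x = pd i F x + pd i G x"
  using has_derivative_add[OF assms[unfolded frechet_derivative_works]]
  by (subst pd_eqI) (auto simp: pd_def)

lemma pd_const [simp]: "pd i (\<lambda>y. c) x = 0"
  by (subst pd_eqI[OF has_derivative_const]) simp

lemma pd_linear:
  assumes "bounded_linear L" "F differentiable at x"
  shows "pd i (\<lambda>y. L (F y)) x = L (pd i F x)"
  using bounded_linear.has_derivative[OF assms(1) assms(2)[unfolded frechet_derivative_works]]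
  by (subst pd_eqI) (auto simp: pd_def)

lemma pd_bilinear:
  assumes "bounded_bilinear b" "F differentiable at x" "G differentiable at x"
  shows "pd i (\<lambda>y. b (F y) (G y)) x = b (F x) (pd i G x) + b (pd i F x) (G x)"
  using bounded_bilinear.FDERIV[OF assms(1) assms(2,3)[unfolded frechet_derivative_works]]
  by (subst pd_eqI) (auto simp: pd_def)

lemma pd_mult:
  fixes F G :: "real^2 \<Rightarrow> 'a::real_normed_algebra"
  assumes "F differentiable at x" "G differentiable at x"
  shows "pd i (\<lambda>y. F y * G y) x = F x * pd i G x + pd i F x * G x"
  by (rule pd_bilinear[OF bounded_bilinear_mult assms])

lemma pd_sum:
  assumes "\<And>a. a \<in> B \<Longrightarrow> F a differentiable at x"
  shows "pd i (\<lambda>y. \<Sum>a\<in>B. F a y) x = (\<Sum>a\<in>B. pd i (F a) x)"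
proof -
  have "((\<lambda>y. \<Sum>a\<in>B. F a y) has_derivative (\<lambda>h. \<Sum>a\<in>B. frechet_derivative (F a) (at x) h)) (at x)"
    using assms by (intro has_derivative_sum) (simp add: frechet_derivative_works[symmetric])
  then show ?thesis by (subst pd_eqI) (auto simp: pd_def)
qed

lemma pd_diff:
  assumes "F differentiable at x" "G differentiable at x"
  shows "pd i (\<lambda>y. F y - G y) x = pd i F x - pd i G x"
  using has_derivative_diff[OF assms[unfolded frechet_derivative_works]]
  by (subst pd_eqI) (auto simp: pd_def)

lemma pd_cmult:
  fixes F :: "real^2 \<Rightarrow> 'a::real_normed_algebra"
  assumes "F differentiable at x"
  shows "pd i (\<lambda>y. c * F y) x = c * pd i F x"
  by (rule pd_linear[OF bounded_linear_mult_right assms])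

lemma frechet_pd:
  assumes "F differentiable at x"
  shows "frechet_derivative F (at x) v = (\<Sum>j\<in>UNIV. v $ j *\<^sub>R pd j F x)"
proof -
  have l: "linear (frechet_derivative F (at x))"
    using assms linear_frechet_derivative by blast
  have "v = (\<Sum>j\<in>UNIV. v $ j *\<^sub>R axis j 1)"
    by (simp add: vec_eq_iff axis_def sum.If_cases UNIV_2 forall_2)
  then have "frechet_derivative F (at x) v = frechet_derivative F (at x) (\<Sum>j\<in>UNIV. v $ j *\<^sub>R axis j 1)"
    by simp
  also have "\<dots> = (\<Sum>j\<in>UNIV. v $ j *\<^sub>R pd j F x)"
    by (simp add: linear_sum[OF l] linear_scale[OF l] pd_def)
  finally show ?thesis .
qed

lemma has_derivative_pd:
  assumes "F differentiable at x"
  shows "(F has_derivative (\<lambda>v. \<Sum>j\<in>UNIV. v $ j *\<^sub>R pd j F x)) (at x)"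
proof -
  have "frechet_derivative F (at x) = (\<lambda>v. \<Sum>j\<in>UNIV. v $ j *\<^sub>R pd j F x)"
    using frechet_pd[OF assms] by (rule ext)
  then show ?thesis using assms unfolding frechet_derivative_works by metis
qed

lemma pd_compose:
  assumes "\<tau> differentiable at x" "F differentiable at (\<tau> x)"
  shows "pd i (\<lambda>y. F (\<tau> y)) x = (\<Sum>j\<in>UNIV. pd i \<tau> x $ j *\<^sub>R pd j F (\<tau> x))"
proof -
  have "((\<lambda>y. F (\<tau> y)) has_derivative (\<lambda>v. \<Sum>j\<in>UNIV. frechet_derivative \<tau> (at x) v $ j *\<^sub>R pd j F (\<tau> x))) (at x)"
    using has_derivative_compose[OF assms(1)[unfolded frechet_derivative_works] has_derivative_pd[OF assms(2)]] .
  then show ?thesis by (subst pd_eqI) (auto simp: pd_def)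
qed

subsection \<open>Closure properties of smooth functions\<close>

lemma Ck_cong:
  assumes "open S" "\<And>y. y \<in> S \<Longrightarrow> F y = G y"
  shows "Ck_on k S F \<longleftrightarrow> Ck_on k S G"
  using assms(2)
proof (induction k arbitrary: F G)
  case 0 then show ?case using continuous_on_cong[OF refl, of S F G] by auto
next
  case (Suc k)
  have "F differentiable_on S \<longleftrightarrow> G differentiable_on S"
    unfolding differentiable_on_open[OF assms(1)] differentiable_def
    using has_derivative_cong_open[OF assms(1), of _ F G] Suc.prems by blast
  moreover have "Ck_on k S (pd i F) = Ck_on k S (pd i G)" for i
    by (rule Suc.IH) (rule pd_cong[OF assms(1)], use Suc.prems in auto)
  ultimately show ?case by simp
qed

lemma Ck_SucD: "Ck_on (Suc k) S F \<Longrightarrow> Ck_on k S F"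
  by (induction k arbitrary: F) (auto simp: differentiable_imp_continuous_on)

lemma Ck_subset: "Ck_on k S F \<Longrightarrow> T \<subseteq> S \<Longrightarrow> Ck_on k T F"
  by (induction k arbitrary: F) (auto intro: continuous_on_subset differentiable_on_subset)

text \<open>Partial derivatives may be replaced by formulas valid on \<open>S\<close>; each closure
  property below then follows from its differentiation rule by induction on
  \<open>k\<close>.\<close>

lemma Ck_SucI:
  assumes "open S" "\<And>x. x \<in> S \<Longrightarrow> F differentiable at x"
    "\<And>i x. x \<in> S \<Longrightarrow> pd i F x = P i x" "\<And>i. Ck_on k S (P i)"
  shows "Ck_on (Suc k) S F"
  using assms Ck_cong[OF assms(1), of "pd i F" "P i" k for i] by (simp add: differentiable_on_open)

lemma Ck_diff: "open S \<Longrightarrow> Ck_on (Suc k) S F \<Longrightarrow> x \<in> S \<Longrightarrow> F differentiable at x"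
  by (simp add: differentiable_on_open)

lemma Ck_const: "Ck_on k S (\<lambda>y. c)"
proof (induction k arbitrary: c)
  case (Suc k)
  have "pd i (\<lambda>y. c) = (\<lambda>y. 0)" for i by (rule ext) simp
  then show ?case using Suc by simp
qed simp

lemma Ck_add:
  assumes S: "open S"
  shows "Ck_on k S F \<Longrightarrow> Ck_on k S G \<Longrightarrow> Ck_on k S (\<lambda>y. F y + G y)"
proof (induction k arbitrary: F G)
  case 0 then show ?case by (simp add: continuous_on_add)
next
  case (Suc k)
  show ?case
    by (rule Ck_SucI[OF S _ pd_add])
      (use Suc Ck_diff[OF S Suc.prems(1)] Ck_diff[OF S Suc.prems(2)] in \<open>auto intro!: differentiable_add\<close>)
qed

lemma Ck_linear:
  assumes S: "open S" and L: "bounded_linear L"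
  shows "Ck_on k S F \<Longrightarrow> Ck_on k S (\<lambda>y. L (F y))"
proof (induction k arbitrary: F)
  case 0 then show ?case by (simp add: bounded_linear.continuous_on[OF L])
next
  case (Suc k)
  have "(\<lambda>y. L (F y)) differentiable at x" if "x \<in> S" for x
    using bounded_linear.has_derivative[OF L] Ck_diff[OF S Suc.prems that] unfolding differentiable_def by blast
  then show ?case
    by (rule Ck_SucI[OF S _ pd_linear[OF L]]) (use Suc Ck_diff[OF S Suc.prems] in auto)
qed

lemma Ck_bilinear:
  assumes S: "open S" and b: "bounded_bilinear b"
  shows "Ck_on k S F \<Longrightarrow> Ck_on k S G \<Longrightarrow> Ck_on k S (\<lambda>y. b (F y) (G y))"
proof (induction k arbitrary: F G)
  case 0 then show ?case by (simp add: bounded_bilinear.continuous_on[OF b])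
next
  case (Suc k)
  have "(\<lambda>y. b (F y) (G y)) differentiable at x" if "x \<in> S" for x
    using bounded_bilinear.FDERIV[OF b] Ck_diff[OF S Suc.prems(1) that] Ck_diff[OF S Suc.prems(2) that]
    unfolding differentiable_def by blast
  then show ?case
  proof (rule Ck_SucI[OF S _ pd_bilinear[OF b]])
    show "Ck_on k S (\<lambda>x. b (F x) (pd i G x) + b (pd i F x) (G x))" for i
      using Suc.prems Ck_SucD[OF Suc.prems(1)] Ck_SucD[OF Suc.prems(2)]
      by (intro Ck_add[OF S] Suc.IH) auto
  qed (use Ck_diff[OF S Suc.prems(1)] Ck_diff[OF S Suc.prems(2)] in auto)
qed

lemma pd_inverse:
  fixes F :: "real^2 \<Rightarrow> 'a::real_normed_field"
  assumes "F differentiable at x" "F x \<noteq> 0"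
  shows "(\<lambda>y. inverse (F y)) differentiable at x"
    "pd i (\<lambda>y. inverse (F y)) x = - (inverse (F x) * pd i F x * inverse (F x))"
proof -
  note d = Deriv.has_derivative_inverse[OF assms(2) assms(1)[unfolded frechet_derivative_works]]
  show "(\<lambda>y. inverse (F y)) differentiable at x" using d unfolding differentiable_def by blast
  show "pd i (\<lambda>y. inverse (F y)) x = - (inverse (F x) * pd i F x * inverse (F x))"
    by (subst pd_eqI[OF d]) (simp add: pd_def)
qed

lemma Ck_inverse:
  fixes F :: "real^2 \<Rightarrow> 'a::real_normed_field"
  assumes S: "open S" and nz: "\<And>x. x \<in> S \<Longrightarrow> F x \<noteq> 0"
  shows "Ck_on k S F \<Longrightarrow> Ck_on k S (\<lambda>y. inverse (F y))"
proof (induction k)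
  case 0 then show ?case using nz by (auto intro: continuous_on_inverse)
next
  case (Suc k)
  note bl = Ck_bilinear[OF S bounded_bilinear_mult]
  show ?case
  proof (rule Ck_SucI[OF S pd_inverse(1) pd_inverse(2)])
    show "Ck_on k S (\<lambda>x. - (inverse (F x) * pd i F x * inverse (F x)))" for i
      using Suc.prems Suc.IH[OF Ck_SucD[OF Suc.prems]]
      by (intro Ck_linear[OF S bounded_linear_minus[OF bounded_linear_ident]] bl) auto
  qed (use Ck_diff[OF S Suc.prems] nz in auto)
qed

lemma Ck_sqrt:
  fixes F :: "real^2 \<Rightarrow> real"
  assumes S: "open S" and nz: "\<And>x. x \<in> S \<Longrightarrow> F x > 0"
  shows "Ck_on k S F \<Longrightarrow> Ck_on k S (\<lambda>y. sqrt (F y))"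
proof (induction k)
  case 0 then show ?case by (auto intro: continuous_intros)
next
  case (Suc k)
  have d: "((\<lambda>y. sqrt (F y)) has_derivative (\<lambda>h. frechet_derivative F (at x) h * (inverse (sqrt (F x)) / 2))) (at x)"
    if x: "x \<in> S" for x
    using has_derivative_real_sqrt[OF nz[OF x] Ck_diff[OF S Suc.prems x, unfolded frechet_derivative_works]]
    by (simp add: field_simps)
  show ?case
  proof (rule Ck_SucI[OF S])
    show "(\<lambda>y. sqrt (F y)) differentiable at x" if "x \<in> S" for x using d[OF that] unfolding differentiable_def by blast
    show "pd i (\<lambda>y. sqrt (F y)) x = pd i F x * (inverse (sqrt (F x)) * (1/2))" if "x \<in> S" for i x
      by (subst pd_eqI[OF d[OF that]]) (simp add: pd_def)
    have "Ck_on k S (\<lambda>y. inverse (sqrt (F y)))"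
      using Suc.IH[OF Ck_SucD[OF Suc.prems]] nz by (intro Ck_inverse[OF S]) (auto, fastforce)
    then show "Ck_on k S (\<lambda>x. pd i F x * (inverse (sqrt (F x)) * (1/2)))" for i
      using Suc.prems by (intro Ck_bilinear[OF S bounded_bilinear_mult] Ck_const) auto
  qed
qed

lemma Ck_sum:
  assumes S: "open S" and "\<And>a. a \<in> B \<Longrightarrow> Ck_on k S (F a)"
  shows "Ck_on k S (\<lambda>y. \<Sum>a\<in>B. F a y)"
  using assms(2) by (induction B rule: infinite_finite_induct) (auto intro: Ck_const Ck_add[OF S])

lemma Ck_compose:
  fixes \<tau> :: "real^2 \<Rightarrow> real^2"
  assumes S: "open S" and T: "open T" and im: "\<And>x. x \<in> S \<Longrightarrow> \<tau> x \<in> T"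
  shows "Ck_on k S \<tau> \<Longrightarrow> Ck_on k T F \<Longrightarrow> Ck_on k S (\<lambda>y. F (\<tau> y))"
proof (induction k arbitrary: F)
  case 0
  then show ?case using im by (auto intro: continuous_on_compose2)
next
  case (Suc k)
  have dt: "\<tau> differentiable at x" "F differentiable at (\<tau> x)" if "x \<in> S" for x
    using Ck_diff[OF S Suc.prems(1) that] Ck_diff[OF T Suc.prems(2) im[OF that]] .
  show ?case
  proof (rule Ck_SucI[OF S _ pd_compose])
    show "(\<lambda>y. F (\<tau> y)) differentiable at x" if "x \<in> S" for x
      using has_derivative_compose[OF dt(1)[OF that, unfolded frechet_derivative_works]
          dt(2)[OF that, unfolded frechet_derivative_works]] unfolding differentiable_def by blast
    show "Ck_on k S (\<lambda>x. \<Sum>j\<in>UNIV. pd i \<tau> x $ j *\<^sub>R pd j F (\<tau> x))" for i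
      using Suc.prems Ck_SucD[OF Suc.prems(1)]
      by (intro Ck_sum[OF S] Ck_bilinear[OF S bounded_bilinear_scaleR] Suc.IH
          Ck_linear[OF S bounded_linear_vec_nth]) auto
  qed (use dt in auto)
qed

lemma smooth_diff: "open S \<Longrightarrow> smooth_on S F \<Longrightarrow> x \<in> S \<Longrightarrow> F differentiable at x"
  using Ck_diff[of S 0 F x] by (simp add: smooth_on_def del: Ck_on.simps)

lemma smooth_pd: "smooth_on S F \<Longrightarrow> smooth_on S (pd i F)"
  unfolding smooth_on_def by (metis Ck_on.simps(2))

lemma smooth_continuous: "smooth_on S F \<Longrightarrow> continuous_on S F"
  unfolding smooth_on_def by (metis Ck_on.simps(1))

lemma smooth_cong: "open S \<Longrightarrow> (\<And>y. y \<in> S \<Longrightarrow> F y = G y) \<Longrightarrow> smooth_on S F \<longleftrightarrow> smooth_on S G"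
  unfolding smooth_on_def using Ck_cong[of S F G] by simp

lemma smooth_subset: "smooth_on S F \<Longrightarrow> T \<subseteq> S \<Longrightarrow> smooth_on T F"
  unfolding smooth_on_def using Ck_subset by blast

lemma smooth_const: "smooth_on S (\<lambda>y. c)"
  by (simp add: smooth_on_def Ck_const)

lemma smooth_add: "open S \<Longrightarrow> smooth_on S F \<Longrightarrow> smooth_on S G \<Longrightarrow> smooth_on S (\<lambda>y. F y + G y)"
  by (simp add: smooth_on_def Ck_add)

lemma smooth_linear: "open S \<Longrightarrow> bounded_linear L \<Longrightarrow> smooth_on S F \<Longrightarrow> smooth_on S (\<lambda>y. L (F y))"
  by (simp add: smooth_on_def Ck_linear)

lemma smooth_minus: "open S \<Longrightarrow> smooth_on S F \<Longrightarrow> smooth_on S (\<lambda>y. - F y)"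
  by (rule smooth_linear[OF _ bounded_linear_minus[OF bounded_linear_ident]])

lemma smooth_subtract: "open S \<Longrightarrow> smooth_on S F \<Longrightarrow> smooth_on S G \<Longrightarrow> smooth_on S (\<lambda>y. F y - G y)"
  using smooth_add[OF _ _ smooth_minus, of S F G] by simp

lemma smooth_mult:
  fixes F G :: "real^2 \<Rightarrow> 'a::real_normed_algebra"
  shows "open S \<Longrightarrow> smooth_on S F \<Longrightarrow> smooth_on S G \<Longrightarrow> smooth_on S (\<lambda>y. F y * G y)"
  by (simp add: smooth_on_def Ck_bilinear[OF _ bounded_bilinear_mult])

lemma smooth_inverse:
  fixes F :: "real^2 \<Rightarrow> 'a::real_normed_field"
  shows "open S \<Longrightarrow> (\<And>x. x \<in> S \<Longrightarrow> F x \<noteq> 0) \<Longrightarrow> smooth_on S F \<Longrightarrow> smooth_on S (\<lambda>y. inverse (F y))"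
  by (simp add: smooth_on_def Ck_inverse)

lemma smooth_sqrt:
  "open S \<Longrightarrow> (\<And>x. x \<in> S \<Longrightarrow> F x > 0) \<Longrightarrow> smooth_on S F \<Longrightarrow> smooth_on S (\<lambda>y. sqrt (F y))"
  by (simp add: smooth_on_def Ck_sqrt)

lemma smooth_sum:
  "open S \<Longrightarrow> (\<And>a. a \<in> B \<Longrightarrow> smooth_on S (F a)) \<Longrightarrow> smooth_on S (\<lambda>y. \<Sum>a\<in>B. F a y)"
  by (simp add: smooth_on_def Ck_sum)

lemma smooth_compose:
  fixes \<tau> :: "real^2 \<Rightarrow> real^2"
  shows "open S \<Longrightarrow> open T \<Longrightarrow> (\<And>x. x \<in> S \<Longrightarrow> \<tau> x \<in> T) \<Longrightarrow> smooth_on S \<tau> \<Longrightarrow> smooth_on T F \<Longrightarrow>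
    smooth_on S (\<lambda>y. F (\<tau> y))"
  by (simp add: smooth_on_def Ck_compose)

lemma smooth_of_real: "open S \<Longrightarrow> smooth_on S F \<Longrightarrow> smooth_on S (\<lambda>y. complex_of_real (F y))"
  by (rule smooth_linear[OF _ bounded_linear_of_real])

lemma pd_of_real: "F differentiable at x \<Longrightarrow> pd i (\<lambda>y. complex_of_real (F y)) x = of_real (pd i F x)"
  by (rule pd_linear[OF bounded_linear_of_real])

lemma smooth_nth: "open S \<Longrightarrow> smooth_on S F \<Longrightarrow> smooth_on S (\<lambda>y. F y $ i)"
  by (rule smooth_linear[OF _ bounded_linear_vec_nth])


subsection \<open>Symmetry of second derivatives\<close>

lemma DERIV_line:
  fixes f :: "real^2 \<Rightarrow> real"
  assumes "f differentiable at (z + s *\<^sub>R axis i 1)"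
  shows "((\<lambda>s. f (z + s *\<^sub>R axis i 1)) has_real_derivative pd i f (z + s *\<^sub>R axis i 1)) (at s)"
proof -
  have "((\<lambda>s. z + s *\<^sub>R axis i 1) has_derivative (\<lambda>h. h *\<^sub>R axis i 1)) (at s)"
    by (auto intro!: derivative_eq_intros)
  from has_derivative_compose[OF this assms[unfolded frechet_derivative_works]]
  have "((\<lambda>s. f (z + s *\<^sub>R axis i 1)) has_derivative
      (\<lambda>h. frechet_derivative f (at (z + s *\<^sub>R axis i 1)) (h *\<^sub>R axis i 1))) (at s)" .
  moreover have "frechet_derivative f (at (z + s *\<^sub>R axis i 1)) (h *\<^sub>R axis i 1)
      = pd i f (z + s *\<^sub>R axis i 1) * h" for h
    using linear_scale[OF linear_frechet_derivative[OF assms], of h "axis i 1"] by (simp add: pd_def)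
  ultimately show ?thesis by (simp add: has_field_derivative_def)
qed

text \<open>The mean value theorem twice: along direction \<open>i\<close> for the increment in
  direction \<open>j\<close>, then along \<open>j\<close> for \<open>pd i f\<close>. The bound
  \<open>2 * h < d\<close> keeps the parallelogram inside the ball.\<close>

lemma second_difference:
  fixes f :: "real^2 \<Rightarrow> real"
  assumes sm: "smooth_on (ball x d) f" and h: "0 < h" "2 * h < d"
  shows "\<exists>y\<in>ball x d. f (x + h *\<^sub>R axis i 1 + h *\<^sub>R axis j 1) - f (x + h *\<^sub>R axis i 1)
     - f (x + h *\<^sub>R axis j 1) + f x = h * h * pd j (pd i f) y"
proof -
  have mem: "x + s *\<^sub>R axis i 1 + t *\<^sub>R axis j 1 \<in> ball x d" if "0 \<le> s" "s \<le> h" "0 \<le> t" "t \<le> h" for s t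
  proof -
    have "norm (s *\<^sub>R axis i 1 + t *\<^sub>R axis j 1 :: real^2) \<le> s + t"
      using norm_triangle_ineq[of "s *\<^sub>R axis i 1 :: real^2" "t *\<^sub>R axis j 1"] that by (simp add: norm_axis_1)
    then have "norm (s *\<^sub>R axis i 1 + t *\<^sub>R axis j 1 :: real^2) < d" using that h by linarith
    then have "norm (t *\<^sub>R axis j 1 + s *\<^sub>R axis i 1 :: real^2) < d" by (simp only: add.commute)
    then show ?thesis by (simp add: dist_norm norm_minus_commute add.assoc)
  qed
  have df: "F differentiable at (x + s *\<^sub>R axis i 1 + t *\<^sub>R axis j 1)"
    if "smooth_on (ball x d) F" "0 \<le> s" "s \<le> h" "0 \<le> t" "t \<le> h" for F :: "real^2 \<Rightarrow> real" and s t
    using smooth_diff[OF open_ball that(1) mem] that by blast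
  define \<phi> where "\<phi> s = f (x + h *\<^sub>R axis j 1 + s *\<^sub>R axis i 1) - f (x + s *\<^sub>R axis i 1)" for s
  have "DERIV \<phi> s :> pd i f (x + h *\<^sub>R axis j 1 + s *\<^sub>R axis i 1) - pd i f (x + s *\<^sub>R axis i 1)"
    if "0 \<le> s" "s \<le> h" for s
    unfolding \<phi>_def using df[OF sm that, of h] df[OF sm that, of 0] h
    by (intro DERIV_diff DERIV_line) (simp_all add: add_ac)
  from MVT2[OF h(1) this] obtain s where s: "0 < s" "s < h"
    "\<phi> h - \<phi> 0 = (h - 0) * (pd i f (x + h *\<^sub>R axis j 1 + s *\<^sub>R axis i 1) - pd i f (x + s *\<^sub>R axis i 1))"
    by blast
  have "DERIV (\<lambda>t. pd i f (x + s *\<^sub>R axis i 1 + t *\<^sub>R axis j 1)) t :> pd j (pd i f) (x + s *\<^sub>R axis i 1 + t *\<^sub>R axis j 1)"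
    if "0 \<le> t" "t \<le> h" for t
    using df[OF smooth_pd[OF sm] _ _ that, of s] s by (intro DERIV_line) auto
  from MVT2[OF h(1) this] obtain t where t: "0 < t" "t < h"
    "pd i f (x + s *\<^sub>R axis i 1 + h *\<^sub>R axis j 1) - pd i f (x + s *\<^sub>R axis i 1 + 0 *\<^sub>R axis j 1)
      = (h - 0) * pd j (pd i f) (x + s *\<^sub>R axis i 1 + t *\<^sub>R axis j 1)"
    by blast
  have "\<phi> h - \<phi> 0 = h * (h * pd j (pd i f) (x + s *\<^sub>R axis i 1 + t *\<^sub>R axis j 1))"
    using s(3) t(3) by (simp add: add_ac)
  then have "f (x + h *\<^sub>R axis i 1 + h *\<^sub>R axis j 1) - f (x + h *\<^sub>R axis i 1)
     - f (x + h *\<^sub>R axis j 1) + f x = h * h * pd j (pd i f) (x + s *\<^sub>R axis i 1 + t *\<^sub>R axis j 1)"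
    by (simp add: \<phi>_def add_ac)
  then show ?thesis using mem[of s t] s t by (intro bexI[of _ "x + s *\<^sub>R axis i 1 + t *\<^sub>R axis j 1"]) auto
qed

text \<open>The second difference is symmetric in \<open>i\<close> and \<open>j\<close>, so the two
  mixed derivatives agree at two points near \<open>x\<close>; continuity transfers this to
  \<open>x\<close>.\<close>

lemma pd_commute_real:
  fixes f :: "real^2 \<Rightarrow> real"
  assumes S: "open S" and sm: "smooth_on S f" and x: "x \<in> S"
  shows "pd i (pd j f) x = pd j (pd i f) x"
proof (rule ccontr)
  assume ne: "pd i (pd j f) x \<noteq> pd j (pd i f) x"
  define e where "e = dist (pd i (pd j f) x) (pd j (pd i f) x) / 2"
  have e: "e > 0" using ne by (simp add: e_def)
  have "\<exists>d>0. \<forall>y\<in>S. dist y x < d \<longrightarrow> dist (F y) (F x) < e" if "smooth_on S F" for F :: "real^2 \<Rightarrow> real"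
    using smooth_continuous[OF that] x e unfolding continuous_on_iff by blast
  from this[OF smooth_pd[OF smooth_pd[OF sm]], of i j] this[OF smooth_pd[OF smooth_pd[OF sm]], of j i]
  obtain d1 d2 where d: "d1 > 0" "\<And>y. y \<in> S \<Longrightarrow> dist y x < d1 \<Longrightarrow> dist (pd i (pd j f) y) (pd i (pd j f) x) < e"
    "d2 > 0" "\<And>y. y \<in> S \<Longrightarrow> dist y x < d2 \<Longrightarrow> dist (pd j (pd i f) y) (pd j (pd i f) x) < e"
    by blast
  obtain d3 where d3: "d3 > 0" "ball x d3 \<subseteq> S" using S x by (meson openE)
  define d0 where "d0 = min d1 (min d2 d3)"
  have d0: "d0 > 0" "ball x d0 \<subseteq> S" using d d3 by (auto simp: d0_def)
  note sb = smooth_subset[OF sm d0(2)]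
  have h: "0 < d0 / 3" "2 * (d0 / 3) < d0" using d0 by auto
  obtain y where y: "y \<in> ball x d0" "f (x + (d0/3) *\<^sub>R axis i 1 + (d0/3) *\<^sub>R axis j 1) - f (x + (d0/3) *\<^sub>R axis i 1)
     - f (x + (d0/3) *\<^sub>R axis j 1) + f x = d0/3 * (d0/3) * pd j (pd i f) y"
    using second_difference[OF sb h, of i j] by blast
  obtain z where z: "z \<in> ball x d0" "f (x + (d0/3) *\<^sub>R axis j 1 + (d0/3) *\<^sub>R axis i 1) - f (x + (d0/3) *\<^sub>R axis j 1)
     - f (x + (d0/3) *\<^sub>R axis i 1) + f x = d0/3 * (d0/3) * pd i (pd j f) z"
    using second_difference[OF sb h, of j i] by blast
  have "f (x + (d0/3) *\<^sub>R axis i 1 + (d0/3) *\<^sub>R axis j 1) = f (x + (d0/3) *\<^sub>R axis j 1 + (d0/3) *\<^sub>R axis i 1)"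
    by (simp add: add_ac)
  then have "d0/3 * (d0/3) * pd j (pd i f) y = d0/3 * (d0/3) * pd i (pd j f) z" using y(2) z(2) by linarith
  then have eq: "pd j (pd i f) y = pd i (pd j f) z" using d0(1) by simp
  have "dist (pd j (pd i f) y) (pd j (pd i f) x) < e" "dist (pd i (pd j f) z) (pd i (pd j f) x) < e"
    using d(2)[of z] d(4)[of y] y(1) z(1) d0(2) by (auto simp: d0_def dist_commute)
  then show False
    using eq dist_triangle[of "pd i (pd j f) x" "pd j (pd i f) x" "pd i (pd j f) z"]
    by (simp add: e_def dist_commute)
qed

lemma pd_commute:
  fixes f :: "real^2 \<Rightarrow> complex"
  assumes S: "open S" and sm: "smooth_on S f" and x: "x \<in> S"
  shows "pd i (pd j f) x = pd j (pd i f) x"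
proof -
  have L: "L (pd i (pd j f) x) = pd i (pd j (\<lambda>y. L (f y))) x" if "bounded_linear L" for i j and L :: "complex \<Rightarrow> real"
  proof -
    have "pd i (\<lambda>y. L (pd j f y)) x = L (pd i (pd j f) x)"
      by (rule pd_linear[OF that smooth_diff[OF S smooth_pd[OF sm] x]])
    moreover have "pd i (\<lambda>y. L (pd j f y)) x = pd i (pd j (\<lambda>y. L (f y))) x"
      by (rule pd_cong[OF S x]) (rule pd_linear[OF that smooth_diff[OF S sm], symmetric])
    ultimately show ?thesis by simp
  qed
  show ?thesis
    by (rule complex_eqI; subst (1 2) L[OF bounded_linear_Re] L[OF bounded_linear_Im];
      rule pd_commute_real[OF S smooth_linear[OF S _ sm] x], simp add: bounded_linear_Re bounded_linear_Im)
qed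

section \<open>Null frames\<close>

lemma UNIV_charge: "(UNIV :: charge set) = {Pls, Mns}"
  using charge.exhaust by auto

lemma sum_charge: "(\<Sum>a\<in>UNIV. f a) = f Pls + f Mns" for f :: "charge \<Rightarrow> 'b::comm_monoid_add"
  by (simp add: UNIV_charge)

text \<open>One-sided inverses of 2x2 matrices are two-sided; \<open>D\<close> is the determinant of
  the left factor.\<close>

lemma inverse_2x2:
  fixes h1 :: complex
  assumes "h1 * e1 + h2 * e2 = 1" "k1 * f1 + k2 * f2 = 1" "k1 * e1 + k2 * e2 = 0" "h1 * f1 + h2 * f2 = 0"
  shows "h1 * e1 + k1 * f1 = 1" "h2 * e2 + k2 * f2 = 1" "h1 * e2 + k1 * f2 = 0" "h2 * e1 + k2 * f1 = 0"
proof -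
  define D where "D = h1 * k2 - h2 * k1"
  have "D * (e1 * f2 - e2 * f1) =
      (h1 * e1 + h2 * e2) * (k1 * f1 + k2 * f2) - (h1 * f1 + h2 * f2) * (k1 * e1 + k2 * e2)"
    by (simp add: D_def algebra_simps)
  then have D: "D \<noteq> 0" using assms by auto
  have "D * e1 = k2 * (h1 * e1 + h2 * e2) - h2 * (k1 * e1 + k2 * e2)"
    "D * e2 = h1 * (k1 * e1 + k2 * e2) - k1 * (h1 * e1 + h2 * e2)"
    "D * f1 = k2 * (h1 * f1 + h2 * f2) - h2 * (k1 * f1 + k2 * f2)"
    "D * f2 = h1 * (k1 * f1 + k2 * f2) - k1 * (h1 * f1 + h2 * f2)"
    by (simp_all add: D_def algebra_simps)
  then have e: "D * e1 = k2" "D * e2 = - k1" "D * f1 = - h2" "D * f2 = h1" using assms by auto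
  have "D * (h1 * e1 + k1 * f1) = h1 * (D * e1) + k1 * (D * f1)"
    "D * (h2 * e2 + k2 * f2) = h2 * (D * e2) + k2 * (D * f2)"
    "D * (h1 * e2 + k1 * f2) = h1 * (D * e2) + k1 * (D * f2)"
    "D * (h2 * e1 + k2 * f1) = h2 * (D * e1) + k2 * (D * f1)"
    by (simp_all add: algebra_simps)
  then have "D * (h1 * e1 + k1 * f1) = D * 1" "D * (h2 * e2 + k2 * f2) = D * 1"
    "D * (h1 * e2 + k1 * f2) = D * 0" "D * (h2 * e1 + k2 * f1) = D * 0"
    unfolding e by (simp_all add: D_def algebra_simps)
  then show "h1 * e1 + k1 * f1 = 1" "h2 * e2 + k2 * f2 = 1" "h1 * e2 + k1 * f2 = 0" "h2 * e1 + k2 * f1 = 0"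
    using D by (metis mult_cancel_left)+
qed

text \<open>\<open>H a\<close> extends \<open>h\<^sub>\<plusminus>\<close> to a complex vector field, given by its components in
  a chart with Gram matrix \<open>g\<close>; \<open>eta\<close> is the dual frame, \<open>nH i a\<close> the covariant derivative of
  \<open>H a\<close>, \<open>th\<close> the connection form (\<open>nH_eq\<close>) and \<open>Omega\<close> its exterior derivative.\<close>

locale null_frame =
  fixes Om :: "(real^2) set" and g :: "real^2 \<Rightarrow> real^2^2" and H :: "charge \<Rightarrow> 2 \<Rightarrow> real^2 \<Rightarrow> complex"
  assumes op: "open Om" and gsm: "smooth_on Om g"
    and gsym: "x \<in> Om \<Longrightarrow> transpose (g x) = g x"
    and Hsm: "smooth_on Om (H a i)"
    and Hn: "x \<in> Om \<Longrightarrow> (\<Sum>i\<in>UNIV. \<Sum>j\<in>UNIV. complex_of_real (g x $ i $ j) * H a i x * H b j x)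
      = (if a = b then 0 else 2)"
begin

definition gc :: "2 \<Rightarrow> 2 \<Rightarrow> real^2 \<Rightarrow> complex" where
  "gc i j x = complex_of_real (g x $ i $ j)"

definition dt :: "real^2 \<Rightarrow> complex" where
  "dt x = H Pls 1 x * H Mns 2 x - H Pls 2 x * H Mns 1 x"

text \<open>The factor 1/2 and the index \<open>opp a\<close> reflect that \<open>h_+\<close> and
  \<open>h_-\<close> are null and pair to 2.\<close>

definition eta :: "charge \<Rightarrow> 2 \<Rightarrow> real^2 \<Rightarrow> complex" where
  "eta a j x = (1/2) * (\<Sum>k\<in>UNIV. gc j k x * H (opp a) k x)"

definition Gam :: "2 \<Rightarrow> 2 \<Rightarrow> 2 \<Rightarrow> real^2 \<Rightarrow> complex" where
  "Gam k i j x = complex_of_real (christoffel g x k i j)"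

definition nH :: "2 \<Rightarrow> charge \<Rightarrow> 2 \<Rightarrow> real^2 \<Rightarrow> complex" where
  "nH i a k x = pd i (H a k) x + (\<Sum>m\<in>UNIV. Gam k i m x * H a m x)"

definition th :: "2 \<Rightarrow> real^2 \<Rightarrow> complex" where
  "th i x = (\<Sum>j\<in>UNIV. nH i Pls j x * eta Pls j x)"

lemma g_sym: "x \<in> Om \<Longrightarrow> g x $ i $ j = g x $ j $ i"
  using gsym[of x] by (simp add: transpose_def vec_eq_iff)

lemma gc_sym: "x \<in> Om \<Longrightarrow> gc i j x = gc j i x"
  using g_sym by (simp add: gc_def)

lemma Hn_gc: "x \<in> Om \<Longrightarrow> (\<Sum>i\<in>UNIV. \<Sum>j\<in>UNIV. gc i j x * H a i x * H b j x) = (if a = b then 0 else 2)"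
  using Hn by (simp add: gc_def)

text \<open>The Gram matrix of the frame has determinant \<open>0 * 0 - 2 * 2\<close>, and this is
  the determinant of the metric times the squared determinant of the frame.\<close>

lemma det_relation:
  assumes x: "x \<in> Om"
  shows "(gc 1 1 x * gc 2 2 x - gc 1 2 x * gc 1 2 x) * (dt x * dt x) = - 4"
proof -
  let ?E = "\<lambda>a b. \<Sum>i\<in>UNIV. \<Sum>j\<in>UNIV. gc i j x * H a i x * H b j x"
  have "(gc 1 1 x * gc 2 2 x - gc 1 2 x * gc 1 2 x) * (dt x * dt x) = ?E Pls Pls * ?E Mns Mns - ?E Pls Mns * ?E Pls Mns"
    by (simp add: sum_2 dt_def gc_sym[OF x, of 2 1] algebra_simps)
  then show ?thesis using Hn_gc[OF x] by simp
qed

lemma dt_nz: "x \<in> Om \<Longrightarrow> dt x \<noteq> 0"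
  using det_relation[of x] by auto

lemma dual:
  assumes x: "x \<in> Om"
  shows "(\<Sum>i\<in>UNIV. H b i x * eta a i x) = (if a = b then 1 else 0)"
proof -
  have "(\<Sum>i\<in>UNIV. H b i x * eta a i x) = (1/2) * (\<Sum>i\<in>UNIV. \<Sum>j\<in>UNIV. gc i j x * H b i x * H (opp a) j x)"
    by (simp add: eta_def sum_2 algebra_simps)
  also have "\<dots> = (if a = b then 1 else 0)"
    unfolding Hn_gc[OF x] by (cases a; cases b) auto
  finally show ?thesis .
qed

lemma complete:
  assumes x: "x \<in> Om"
  shows "(\<Sum>a\<in>UNIV. H a i x * eta a j x) = (if i = j then 1 else 0)"
proof -
  note I = inverse_2x2[of "H Pls 1 x" "eta Pls 1 x" "H Pls 2 x" "eta Pls 2 x"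
      "H Mns 1 x" "eta Mns 1 x" "H Mns 2 x" "eta Mns 2 x"]
  have "\<forall>i j. (\<Sum>a\<in>UNIV. H a i x * eta a j x) = (if i = j then 1 else 0)"
    using I dual[OF x, of Pls Pls] dual[OF x, of Mns Mns] dual[OF x, of Mns Pls] dual[OF x, of Pls Mns]
    by (simp add: sum_2 sum_charge forall_2)
  then show ?thesis by blast
qed

lemma lower_eta: "x \<in> Om \<Longrightarrow> (\<Sum>m\<in>UNIV. gc m i x * H a m x) = 2 * eta (opp a) i x"
  by (cases a) (simp_all add: eta_def gc_sym sum_2)

subsection \<open>Christoffel symbols\<close>

lemma det_g: "x \<in> Om \<Longrightarrow> det (g x) \<noteq> 0"
proof
  assume x: "x \<in> Om" and "det (g x) = 0"
  then have "g x $ 1 $ 1 * g x $ 2 $ 2 - g x $ 1 $ 2 * g x $ 1 $ 2 = 0"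
    by (simp add: det_2 g_sym[OF x, of 2 1])
  then have "complex_of_real (g x $ 1 $ 1 * g x $ 2 $ 2 - g x $ 1 $ 2 * g x $ 1 $ 2) = 0" by simp
  then have "gc 1 1 x * gc 2 2 x - gc 1 2 x * gc 1 2 x = 0" by (simp add: gc_def)
  then show False using det_relation[OF x] by simp
qed

lemma g_inv:
  assumes x: "x \<in> Om"
  shows "(\<Sum>k\<in>UNIV. g x $ n $ k * matrix_inv (g x) $ k $ m) = (if n = m then 1 else 0)"
proof -
  have "g x ** matrix_inv (g x) = mat 1"
    using det_g[OF x] someI_ex[of "\<lambda>B. g x ** B = mat 1 \<and> B ** g x = mat 1"]
    unfolding matrix_inv_def invertible_det_nz[symmetric] invertible_def by blast
  then have "(g x ** matrix_inv (g x)) $ n $ m = mat 1 $ n $ m" by simp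
  then show ?thesis by (simp add: matrix_matrix_mult_def mat_def)
qed

text \<open>With the inverse metric written in the frame, smoothness of the Christoffel symbols and
  the trace in the Laplacian can be read off from the frame.\<close>

lemma ginv_eq:
  assumes x: "x \<in> Om"
  shows "complex_of_real (matrix_inv (g x) $ k $ m) = (1/2) * (\<Sum>a\<in>UNIV. H a k x * H (opp a) m x)"
proof -
  let ?v = "\<lambda>k. complex_of_real (matrix_inv (g x) $ k $ m)"
  have gi: "(\<Sum>n\<in>UNIV. gc j n x * ?v n) = (if j = m then 1 else 0)" for j
    using arg_cong[OF g_inv[OF x, of j m], of complex_of_real] by (simp add: gc_def)
  have "?v k = (\<Sum>n\<in>UNIV. (\<Sum>a\<in>UNIV. H a k x * eta a n x) * ?v n)"
    unfolding complete[OF x] using exhaust_2[of k] by (auto simp: sum_2)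
  also have "\<dots> = (1/2) * (\<Sum>a\<in>UNIV. H a k x * (\<Sum>j\<in>UNIV. H (opp a) j x * (\<Sum>n\<in>UNIV. gc j n x * ?v n)))"
    by (simp add: eta_def sum_2 sum_charge gc_sym[OF x, of 2 1] algebra_simps)
  also have "\<dots> = (1/2) * (\<Sum>a\<in>UNIV. H a k x * H (opp a) m x)"
    unfolding gi using exhaust_2[of m] by (auto simp: sum_2 sum_charge)
  finally show ?thesis .
qed

lemma gsm_nth: "smooth_on Om (\<lambda>y. g y $ i $ j)"
  by (rule smooth_nth[OF op smooth_nth[OF op gsm]])

lemma gc_smooth: "smooth_on Om (gc i j)"
  unfolding gc_def[abs_def] by (rule smooth_of_real[OF op gsm_nth])

lemma pd_gc: "x \<in> Om \<Longrightarrow> pd n (gc i j) x = complex_of_real (pd n (\<lambda>y. g y $ i $ j) x)"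
  unfolding gc_def[abs_def] by (rule pd_of_real[OF smooth_diff[OF op gsm_nth]])

lemma pd_gc_sym: "x \<in> Om \<Longrightarrow> pd n (gc i j) x = pd n (gc j i) x"
  by (rule pd_cong[OF op]) (auto intro: gc_sym)

lemmas sm_rules = smooth_add[OF op] smooth_subtract[OF op] smooth_minus[OF op] smooth_mult[OF op]
  smooth_sum[OF op] smooth_const smooth_pd Hsm gc_smooth

lemma eta_smooth: "smooth_on Om (eta a j)"
  unfolding eta_def[abs_def] by (intro sm_rules)

lemma Gam_smooth: "smooth_on Om (Gam k i j)"
proof -
  have "smooth_on Om (\<lambda>x. (1/2) * (\<Sum>m\<in>UNIV. ((1/2) * (\<Sum>a\<in>UNIV. H a k x * H (opp a) m x)) *
      (pd i (gc j m) x + pd j (gc i m) x - pd m (gc i j) x)))"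
    by (intro sm_rules)
  moreover have "(1/2) * (\<Sum>m\<in>UNIV. ((1/2) * (\<Sum>a\<in>UNIV. H a k x * H (opp a) m x)) *
      (pd i (gc j m) x + pd j (gc i m) x - pd m (gc i j) x)) = Gam k i j x" if "x \<in> Om" for x
    unfolding ginv_eq[OF that, symmetric] pd_gc[OF that] Gam_def christoffel_def
    by (simp add: sum_2)
  ultimately show ?thesis using smooth_cong[OF op, of _ "Gam k i j"] by (metis (no_types, lifting))
qed

lemma Gam_sym:
  assumes x: "x \<in> Om"
  shows "Gam k i j x = Gam k j i x"
proof -
  have "pd m (\<lambda>y. g y $ i $ j) x = pd m (\<lambda>y. g y $ j $ i) x" for m
    by (rule pd_cong[OF op x]) (rule g_sym)
  then show ?thesis by (simp add: Gam_def christoffel_def add.commute)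
qed

lemma lower_Gam:
  assumes x: "x \<in> Om"
  shows "(\<Sum>k\<in>UNIV. gc n k x * Gam k i j x) = (1/2) * (pd i (gc j n) x + pd j (gc i n) x - pd n (gc i j) x)"
proof -
  define p where "p m = pd i (\<lambda>y. g y $ j $ m) x + pd j (\<lambda>y. g y $ i $ m) x - pd m (\<lambda>y. g y $ i $ j) x" for m
  have "(\<Sum>k\<in>UNIV. g x $ n $ k * christoffel g x k i j)
      = (1/2) * (\<Sum>m\<in>UNIV. (\<Sum>k\<in>UNIV. g x $ n $ k * matrix_inv (g x) $ k $ m) * p m)"
    by (simp add: christoffel_def p_def[symmetric] sum_2 algebra_simps)
  also have "\<dots> = (1/2) * p n"
    unfolding g_inv[OF x] using exhaust_2[of n] by (auto simp: sum_2)
  finally have 1: "(\<Sum>k\<in>UNIV. g x $ n $ k * christoffel g x k i j) = (1/2) * p n" .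
  have "(\<Sum>k\<in>UNIV. gc n k x * Gam k i j x) = complex_of_real (\<Sum>k\<in>UNIV. g x $ n $ k * christoffel g x k i j)"
    by (simp add: gc_def Gam_def)
  also have "\<dots> = (1/2) * (pd i (gc j n) x + pd j (gc i n) x - pd n (gc i j) x)"
    unfolding 1 by (simp add: p_def pd_gc[OF x])
  finally show ?thesis .
qed

text \<open>Metric compatibility of the Levi-Civita connection: in the sum of the two lowered
  Christoffel symbols all but one derivative of the metric cancel.\<close>

lemma compat:
  assumes x: "x \<in> Om"
  shows "pd i (gc j k) x = (\<Sum>m\<in>UNIV. gc k m x * Gam m i j x) + (\<Sum>m\<in>UNIV. gc j m x * Gam m i k x)"
  unfolding lower_Gam[OF x] by (simp add: pd_gc_sym[OF x, of _ k j] algebra_simps)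

subsection \<open>The connection form\<close>

lemmas sd = smooth_diff[OF op]

lemma metric_nH:
  assumes x: "x \<in> Om"
  shows "(\<Sum>j\<in>UNIV. \<Sum>k\<in>UNIV. gc j k x * (nH i a j x * H b k x + H a j x * nH i b k x)) = 0"
proof -
  have d: "(\<lambda>y. gc j k y * H a j y * H b k y) differentiable at x"
    "(\<lambda>y. gc j k y * H a j y) differentiable at x" for j k
    by (rule sd[OF _ x], intro sm_rules)+
  have ds: "(\<lambda>y. \<Sum>k\<in>UNIV. gc j k y * H a j y * H b k y) differentiable at x" for j
    by (rule sd[OF _ x], intro sm_rules)
  have "pd i (\<lambda>y. \<Sum>j\<in>UNIV. \<Sum>k\<in>UNIV. gc j k y * H a j y * H b k y) x = pd i (\<lambda>y. if a = b then 0 else 2) x"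
    by (rule pd_cong[OF op x Hn_gc])
  then have "0 = pd i (\<lambda>y. \<Sum>j\<in>UNIV. \<Sum>k\<in>UNIV. gc j k y * H a j y * H b k y) x" by simp
  also have "\<dots> = (\<Sum>j\<in>UNIV. \<Sum>k\<in>UNIV. (gc j k x * H a j x) * pd i (H b k) x +
      (gc j k x * pd i (H a j) x + pd i (gc j k) x * H a j x) * H b k x)"
    by (simp only: pd_sum[OF d(1)] pd_sum[OF ds] pd_mult[OF d(2) sd[OF Hsm x]] pd_mult[OF sd[OF gc_smooth x] sd[OF Hsm x]])
  also have "\<dots> = (\<Sum>j\<in>UNIV. \<Sum>k\<in>UNIV. gc j k x * (nH i a j x * H b k x + H a j x * nH i b k x))"
    unfolding compat[OF x] nH_def by (simp add: sum_2 gc_sym[OF x, of 2 1] algebra_simps)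
  finally show ?thesis by simp
qed

text \<open>The pairings of the frame are constant, so \<open>q\<close> is antisymmetric. Hence the
  derivative of a null field has no component along its partner, and the two diagonal entries are
  opposite.\<close>

lemma nH_eta:
  assumes x: "x \<in> Om"
  shows "(\<Sum>j\<in>UNIV. nH i a j x * eta b j x) = (if a = b then of_int (cval a) * th i x else 0)"
proof -
  define q where "q a b = (\<Sum>j\<in>UNIV. \<Sum>k\<in>UNIV. gc j k x * nH i a j x * H b k x)" for a b
  have s: "q a b + q b a = 0" for a b
    using metric_nH[OF x, of i a b] by (simp add: q_def sum_2 gc_sym[OF x, of 2 1] algebra_simps)
  have e: "(\<Sum>j\<in>UNIV. nH i a j x * eta b j x) = q a (opp b) / 2" for a b
    by (simp add: q_def eta_def sum_2 algebra_simps)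
  have t: "th i x = q Pls Mns / 2" using e[of Pls Pls] by (simp add: th_def)
  show ?thesis
  proof -
    have "q Pls Pls = 0" "q Mns Mns = 0" "q Mns Pls = - q Pls Mns"
      using s[of Pls Pls] s[of Mns Mns] s[of Mns Pls] by (simp_all add: eq_neg_iff_add_eq_0)
    then show ?thesis unfolding e t by (cases a; cases b) simp_all
  qed
qed

lemma nH_eq:
  assumes x: "x \<in> Om"
  shows "nH i a k x = of_int (cval a) * th i x * H a k x"
proof -
  have "nH i a k x = (\<Sum>j\<in>UNIV. (\<Sum>b\<in>UNIV. H b k x * eta b j x) * nH i a j x)"
    unfolding complete[OF x] using exhaust_2[of k] by (auto simp: sum_2)
  also have "\<dots> = (\<Sum>b\<in>UNIV. H b k x * (\<Sum>j\<in>UNIV. nH i a j x * eta b j x))"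
    by (simp add: sum_2 sum_charge algebra_simps)
  also have "\<dots> = of_int (cval a) * th i x * H a k x"
    unfolding nH_eta[OF x] by (cases a) (simp_all add: sum_charge)
  finally show ?thesis .
qed

lemma pd_H:
  "x \<in> Om \<Longrightarrow> pd i (H a m) x = of_int (cval a) * th i x * H a m x - (\<Sum>k\<in>UNIV. Gam m i k x * H a k x)"
  using nH_eq[of x i a m] by (simp add: nH_def algebra_simps)

text \<open>Differentiating the constant pairings with the frame shows that the defect
  \<open>r\<close> is annihilated by both fields \<open>H b\<close>, and these span.\<close>

lemma pd_eta:
  assumes x: "x \<in> Om"
  shows "pd i (eta a m) x = (\<Sum>k\<in>UNIV. Gam k i m x * eta a k x) - of_int (cval a) * th i x * eta a m x"
proof -
  define r where "r m = pd i (eta a m) x - (\<Sum>k\<in>UNIV. Gam k i m x * eta a k x) + of_int (cval a) * th i x * eta a m x" for m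
  have r0: "(\<Sum>m\<in>UNIV. H b m x * r m) = 0" for b
  proof -
    have d: "(\<lambda>y. H b m y * eta a m y) differentiable at x" for m
      by (rule sd[OF _ x], intro sm_rules eta_smooth)
    have "pd i (\<lambda>y. \<Sum>m\<in>UNIV. H b m y * eta a m y) x = pd i (\<lambda>y. if a = b then 1 else 0) x"
      by (rule pd_cong[OF op x dual])
    then have "0 = (\<Sum>m\<in>UNIV. H b m x * pd i (eta a m) x + pd i (H b m) x * eta a m x)"
      by (simp add: pd_sum[OF d] pd_mult[OF sd[OF Hsm x] sd[OF eta_smooth x]])
    also have "\<dots> = (\<Sum>m\<in>UNIV. H b m x * r m) +
        (of_int (cval b) - of_int (cval a)) * th i x * (\<Sum>m\<in>UNIV. H b m x * eta a m x)"
      unfolding pd_H[OF x] r_def by (simp add: sum_2 algebra_simps)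
    also have "(of_int (cval b) - of_int (cval a)) * th i x * (\<Sum>m\<in>UNIV. H b m x * eta a m x) = 0"
      unfolding dual[OF x] by auto
    finally show ?thesis by simp
  qed
  have "r m = (\<Sum>n\<in>UNIV. (\<Sum>b\<in>UNIV. H b n x * eta b m x) * r n)"
    unfolding complete[OF x] using exhaust_2[of m] by (auto simp: sum_2)
  also have "\<dots> = (\<Sum>b\<in>UNIV. eta b m x * (\<Sum>n\<in>UNIV. H b n x * r n))"
    by (simp add: sum_2 sum_charge algebra_simps)
  finally have "r m = 0" unfolding r0 by simp
  then show ?thesis by (simp add: r_def algebra_simps)
qed

lemma th_smooth: "smooth_on Om (th i)"
  unfolding th_def[abs_def] nH_def[abs_def] by (intro sm_rules eta_smooth Gam_smooth)

definition Omega :: "real^2 \<Rightarrow> complex" where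
  "Omega x = pd 1 (th 2) x - pd 2 (th 1) x"

subsection \<open>Curvature\<close>

text \<open>This is the equality of the mixed second derivatives of \<open>H a m\<close>, with the
  first derivatives substituted from \<open>pd_H\<close>: the frame fields are eigenvectors of the
  curvature.\<close>

lemma riemann_H:
  assumes x: "x \<in> Om"
  shows "(\<Sum>k\<in>UNIV. complex_of_real (riemann g x m 1 2 k) * H a k x) = of_int (cval a) * Omega x * H a m x"
proof -
  have pdG: "complex_of_real (pd i (\<lambda>y. christoffel g y m j k) x) = pd i (Gam m j k) x" for i j k
  proof -
    have "smooth_on Om (\<lambda>y. Re (Gam m j k y))" by (rule smooth_linear[OF op bounded_linear_Re Gam_smooth])
    then have "smooth_on Om (\<lambda>y. christoffel g y m j k)" by (simp add: Gam_def)
    from pd_of_real[OF sd[OF this x]] show ?thesis by (simp add: Gam_def[abs_def])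
  qed
  have pp: "pd i (pd j (H a m)) x = of_int (cval a) * (th j x * pd i (H a m) x + pd i (th j) x * H a m x)
      - (\<Sum>k\<in>UNIV. Gam m j k x * pd i (H a k) x + pd i (Gam m j k) x * H a k x)" for i j
  proof -
    have d: "(\<lambda>y. Gam m j k y * H a k y) differentiable at x"
      "(\<lambda>y. of_int (cval a) * th j y * H a m y) differentiable at x"
      "(\<lambda>y. \<Sum>k\<in>UNIV. Gam m j k y * H a k y) differentiable at x"
      "(\<lambda>y. th j y * H a m y) differentiable at x" for k
      by (rule sd[OF _ x], intro sm_rules Gam_smooth th_smooth)+
    have "pd i (pd j (H a m)) x = pd i (\<lambda>y. of_int (cval a) * th j y * H a m y - (\<Sum>k\<in>UNIV. Gam m j k y * H a k y)) x"
      by (rule pd_cong[OF op x pd_H])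
    also have "\<dots> = pd i (\<lambda>y. of_int (cval a) * (th j y * H a m y)) x - (\<Sum>k\<in>UNIV. pd i (\<lambda>y. Gam m j k y * H a k y) x)"
    proof -
      have "(\<lambda>y. of_int (cval a) * (th j y * H a m y)) = (\<lambda>y. of_int (cval a) * th j y * H a m y)"
        by (simp only: mult.assoc)
      then show ?thesis by (simp only: pd_diff[OF d(2,3)] pd_sum[OF d(1)])
    qed
    also have "\<dots> = of_int (cval a) * (th j x * pd i (H a m) x + pd i (th j) x * H a m x)
      - (\<Sum>k\<in>UNIV. Gam m j k x * pd i (H a k) x + pd i (Gam m j k) x * H a k x)"
      by (simp only: pd_cmult[OF d(4)] pd_mult[OF sd[OF th_smooth x] sd[OF Hsm x]] pd_mult[OF sd[OF Gam_smooth x] sd[OF Hsm x]])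
    finally show ?thesis .
  qed
  have "(\<Sum>k\<in>UNIV. complex_of_real (riemann g x m 1 2 k) * H a k x) - of_int (cval a) * Omega x * H a m x
      = pd 2 (pd 1 (H a m)) x - pd 1 (pd 2 (H a m)) x"
    unfolding pp unfolding pd_H[OF x] riemann_def
    by (simp add: pdG Gam_def[symmetric] sum_2 Omega_def algebra_simps)
  then show ?thesis using pd_commute[OF op Hsm x, of 1 2 a m] by simp
qed

text \<open>\<open>dt\<close> is the value of the coordinate area form on the frame, so the left
  side is the curvature form evaluated on \<open>H Pls\<close> and \<open>H Mns\<close>; the factor
  2 stems from their pairing.\<close>

lemma curvature_Omega:
  assumes x: "x \<in> Om" and K: "sectional_curvature g x (axis 1 1) (axis 2 1) = K"
  shows "Omega x * dt x = 2 * complex_of_real K"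
proof -
  have r: "complex_of_real (riemann g x m 1 2 2) = Omega x * (H Pls m x * eta Pls 2 x - H Mns m x * eta Mns 2 x)" for m
  proof -
    have "complex_of_real (riemann g x m 1 2 2) =
        (\<Sum>k\<in>UNIV. (\<Sum>a\<in>UNIV. H a k x * eta a 2 x) * complex_of_real (riemann g x m 1 2 k))"
      unfolding complete[OF x] by (simp add: sum_2)
    also have "\<dots> = (\<Sum>a\<in>UNIV. eta a 2 x * (\<Sum>k\<in>UNIV. complex_of_real (riemann g x m 1 2 k) * H a k x))"
      by (simp add: sum_2 sum_charge algebra_simps)
    also have "\<dots> = Omega x * (H Pls m x * eta Pls 2 x - H Mns m x * eta Mns 2 x)"
      unfolding riemann_H[OF x] by (simp add: sum_charge algebra_simps)
    finally show ?thesis .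
  qed
  have ax: "axis (1::2) (1::real) $ 1 = 1" "axis (1::2) (1::real) $ 2 = 0"
    "axis (2::2) (1::real) $ 1 = 0" "axis (2::2) (1::real) $ 2 = 1" by (simp_all add: axis_def)
  have rv: "riemann_vec g x (axis 1 1) (axis 2 1) (axis 2 1) $ m = riemann g x m 1 2 2" for m
    by (simp add: riemann_vec_def sum_2 axis_def)
  have dg: "g x $ 1 $ 1 * g x $ 2 $ 2 - (g x $ 1 $ 2)\<^sup>2 \<noteq> 0"
    using det_g[OF x] by (simp add: det_2 g_sym[OF x, of 2 1] power2_eq_square)
  have "gdot g x (riemann_vec g x (axis 1 1) (axis 2 1) (axis 2 1)) (axis 1 1) =
      K * (g x $ 1 $ 1 * g x $ 2 $ 2 - (g x $ 1 $ 2)\<^sup>2)"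
    using K dg unfolding sectional_curvature_def
    by (simp add: gdot_def inner_vec_def matrix_vector_mult_def sum_2 ax divide_eq_eq g_sym[OF x, of 2 1] power2_eq_square)
  then have "(\<Sum>m\<in>UNIV. g x $ m $ 1 * riemann g x m 1 2 2) = K * (g x $ 1 $ 1 * g x $ 2 $ 2 - (g x $ 1 $ 2)\<^sup>2)"
    by (simp add: gdot_def inner_vec_def matrix_vector_mult_def sum_2 ax rv mult.commute)
  from arg_cong[OF this, of complex_of_real]
  have 1: "(\<Sum>m\<in>UNIV. gc m 1 x * complex_of_real (riemann g x m 1 2 2)) =
      of_real K * (gc 1 1 x * gc 2 2 x - gc 1 2 x * gc 1 2 x)"
    by (simp add: gc_def power2_eq_square)
  have "(\<Sum>m\<in>UNIV. gc m 1 x * complex_of_real (riemann g x m 1 2 2)) = Omega x *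
      ((\<Sum>m\<in>UNIV. gc m 1 x * H Pls m x) * eta Pls 2 x - (\<Sum>m\<in>UNIV. gc m 1 x * H Mns m x) * eta Mns 2 x)"
    unfolding r by (simp add: sum_2 algebra_simps)
  also have "\<dots> = Omega x * (2 * (eta Mns 1 x * eta Pls 2 x - eta Pls 1 x * eta Mns 2 x))"
    unfolding lower_eta[OF x] by (simp add: algebra_simps)
  finally have 2: "of_real K * (gc 1 1 x * gc 2 2 x - gc 1 2 x * gc 1 2 x) =
      Omega x * (2 * (eta Mns 1 x * eta Pls 2 x - eta Pls 1 x * eta Mns 2 x))" using 1 by simp
  \<comment> \<open>The determinants of a frame and of its dual are inverse to each other; the sign
    comes from the order of the rows.\<close>
  have 3: "dt x * (eta Mns 1 x * eta Pls 2 x - eta Pls 1 x * eta Mns 2 x) = - 1"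
  proof -
    have "dt x * (eta Mns 1 x * eta Pls 2 x - eta Pls 1 x * eta Mns 2 x) =
       (\<Sum>i\<in>UNIV. H Pls i x * eta Mns i x) * (\<Sum>i\<in>UNIV. H Mns i x * eta Pls i x)
       - (\<Sum>i\<in>UNIV. H Pls i x * eta Pls i x) * (\<Sum>i\<in>UNIV. H Mns i x * eta Mns i x)"
      by (simp add: dt_def sum_2 algebra_simps)
    then show ?thesis unfolding dual[OF x] by simp
  qed
  have "of_real K * ((gc 1 1 x * gc 2 2 x - gc 1 2 x * gc 1 2 x) * (dt x * dt x)) =
      Omega x * dt x * 2 * (dt x * (eta Mns 1 x * eta Pls 2 x - eta Pls 1 x * eta Mns 2 x))"
    using arg_cong[OF 2, of "\<lambda>z. z * (dt x * dt x)"] by (simp only: mult_ac)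
  then have "of_real K * (- 4) = Omega x * dt x * 2 * (- 1)" unfolding 3 det_relation[OF x] .
  then show ?thesis by simp
qed

end

section \<open>Contractions of tensors with a frame\<close>

lemma sum_lists_Suc:
  fixes f :: "'b list \<Rightarrow> 'c::comm_monoid_add"
  assumes "finite (UNIV :: 'b set)"
  shows "(\<Sum>idx | length idx = Suc k. f idx) = (\<Sum>i\<in>UNIV. \<Sum>js | length js = k. f (i # js))"
proof -
  have "{idx :: 'b list. length idx = Suc k} = (\<lambda>(i, js). i # js) ` (UNIV \<times> {js. length js = k})"
    by (auto simp: length_Suc_conv image_iff)
  moreover have "inj_on (\<lambda>(i, js). i # js) (UNIV \<times> {js :: 'b list. length js = k})" by (auto simp: inj_on_def)
  ultimately have "(\<Sum>idx | length idx = Suc k. f idx) = (\<Sum>(i, js)\<in>UNIV \<times> {js. length js = k}. f (i # js))"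
    by (simp only: sum.reindex o_def split_def)
  then show ?thesis by (simp add: sum.cartesian_product)
qed

text \<open>Components of \<open>T\<close> in the frame \<open>E\<close>, recursive in the word
  because covariant differentiation adds its index at the front.\<close>

fun con :: "(charge \<Rightarrow> 2 \<Rightarrow> real^2 \<Rightarrow> complex) \<Rightarrow> tensor_comps \<Rightarrow> charge list \<Rightarrow> real^2 \<Rightarrow> complex" where
  "con E T [] x = T [] x"
| "con E T (a # w) x = (\<Sum>i\<in>UNIV. E a i x * con E (\<lambda>js. T (i # js)) w x)"

lemma con_closed:
  "con E T w x = (\<Sum>idx | length idx = length w. T idx x * (\<Prod>r<length w. E (w ! r) (idx ! r) x))"
proof (induction w arbitrary: T)
  case (Cons a w)
  show ?case
    by (simp add: Cons sum_lists_Suc prod.lessThan_Suc_shift sum_distrib_left mult_ac del: prod.lessThan_Suc)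
qed simp

lemma con_cong:
  "(\<And>idx. length idx = length w \<Longrightarrow> T idx x = U idx x) \<Longrightarrow> con E T w x = con E U w x"
  by (simp add: con_closed)

lemma con_add: "con E (\<lambda>js x. T js x + U js x) w x = con E T w x + con E U w x"
  by (simp add: con_closed sum.distrib distrib_right)

lemma con_cmult: "con E (\<lambda>js x. c x * T js x) w x = c x * con E T w x"
  by (simp add: con_closed sum_distrib_left mult.assoc)

lemma con_sum: "con E (\<lambda>js x. \<Sum>m\<in>B. T m js x) w x = (\<Sum>m\<in>B. con E (T m) w x)"
  by (simp add: con_closed sum_distrib_right) (rule sum.swap)

lemma con_smooth:
  assumes "open Om" "\<And>a i. smooth_on Om (E a i)" "\<And>idx. length idx = length w \<Longrightarrow> smooth_on Om (T idx)"
  shows "smooth_on Om (con E T w)"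
  using assms(3)
proof (induction w arbitrary: T)
  case Nil
  then show ?case using smooth_cong[OF assms(1), of "con E T []" "T []"] by simp
next
  case (Cons a w)
  have "smooth_on Om (\<lambda>x. \<Sum>i\<in>UNIV. E a i x * con E (\<lambda>js. T (i # js)) w x)"
    by (intro smooth_sum smooth_mult assms(1,2) Cons.IH Cons.prems) simp
  then show ?case by simp
qed

text \<open>The common form of both covariant derivatives: \<open>B\<close> is built from the
  Christoffel symbols for contravariant indices and from their negatives for covariant ones.\<close>

definition gD :: "(2 \<Rightarrow> 2 \<Rightarrow> 2 \<Rightarrow> real^2 \<Rightarrow> complex) \<Rightarrow> tensor_comps \<Rightarrow> 2 \<Rightarrow> tensor_comps" where
  "gD B T i idx x = pd i (T idx) x + (\<Sum>r<length idx. \<Sum>m\<in>UNIV. B (idx ! r) i m x * T (idx[r := m]) x)"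

lemma gD_Cons:
  "gD B T i (k # js) x = gD B (\<lambda>js. T (k # js)) i js x + (\<Sum>m\<in>UNIV. B k i m x * T (m # js) x)"
  unfolding gD_def by (simp add: sum.lessThan_Suc_shift del: sum.lessThan_Suc)

text \<open>For a frame \<open>E\<close> that is parallel up to the factors \<open>\<sigma> * cval a\<close>, covariant differentiation
  of a tensor becomes differentiation of its components, corrected by their charge.\<close>

lemma con_gD:
  assumes op: "open Om" and E: "\<And>a i. smooth_on Om (E a i)" and x: "x \<in> Om"
    and pdE: "\<And>a m. pd i (E a m) x = (\<Sum>k\<in>UNIV. B k i m x * E a k x) + \<sigma> * of_int (cval a) * E a m x"
    and T: "\<And>idx. length idx = length w \<Longrightarrow> smooth_on Om (T idx)"
  shows "con E (gD B T i) w x = pd i (con E T w) x - \<sigma> * of_int (charge_sum w) * con E T w x"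
  using T
proof (induction w arbitrary: T)
  case Nil
  then show ?case using pd_cong[OF op x, of "con E T []" "T []"] by (simp add: gD_def)
next
  case (Cons a w)
  let ?T = "\<lambda>k js. T (k # js)"
  have T': "length idx = length w \<Longrightarrow> smooth_on Om (?T k idx)" for k idx using Cons.prems by simp
  have cs: "smooth_on Om (con E (?T k) w)" for k by (rule con_smooth[OF op E T'])
  have d: "E a k differentiable at x" "con E (?T k) w differentiable at x"
    "(\<lambda>x. E a k x * con E (?T k) w x) differentiable at x" for k
    using smooth_diff[OF op E x] smooth_diff[OF op cs x]
      smooth_diff[OF op smooth_mult[OF op E cs] x] by auto
  have 1: "con E (\<lambda>js. gD B T i (k # js)) w x =
      pd i (con E (?T k) w) x - \<sigma> * of_int (charge_sum w) * con E (?T k) w x + (\<Sum>m\<in>UNIV. B k i m x * con E (?T m) w x)" for k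
  proof -
    have "(\<lambda>js. gD B T i (k # js)) = (\<lambda>js x. gD B (?T k) i js x + (\<Sum>m\<in>UNIV. B k i m x * ?T m js x))"
      by (intro ext) (rule gD_Cons)
    then show ?thesis by (simp only: con_add con_sum con_cmult Cons.IH[OF T'])
  qed
  have "con E T (a # w) = (\<lambda>x. \<Sum>k\<in>UNIV. E a k x * con E (?T k) w x)" by (rule ext) simp
  then have 2: "pd i (con E T (a # w)) x =
      (\<Sum>k\<in>UNIV. E a k x * pd i (con E (?T k) w) x + pd i (E a k) x * con E (?T k) w x)"
    by (simp add: pd_sum[OF d(3)] pd_mult[OF d(1,2)])
  show ?case
    unfolding 2 unfolding con.simps 1 pdE by (simp add: sum_2 algebra_simps)
qed

lemma gD_smooth:
  assumes "open Om" "\<And>k i m. smooth_on Om (B k i m)" "\<And>idx. length idx = n \<Longrightarrow> smooth_on Om (T idx)" "length idx = n"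
  shows "smooth_on Om (gD B T i idx)"
  unfolding gD_def[abs_def]
  by (intro smooth_add smooth_sum smooth_mult smooth_pd assms(1,2,3)) (use assms(4) in auto)

text \<open>Inserting the completeness relation at every index turns a contraction over coordinates
  into one over a frame and its dual.\<close>

lemma pairing:
  assumes "\<And>i j. (\<Sum>a\<in>UNIV. E a i x * E' a j x) = (if i = j then 1 else 0)"
  shows "(\<Sum>idx | length idx = k. T idx x * X idx x) = (\<Sum>w | length w = k. con E T w x * con E' X w x)"
proof (induction k arbitrary: T X)
  case (Suc k)
  have fc: "finite (UNIV :: charge set)" by (simp add: UNIV_charge)
  let ?c = "\<lambda>i w. con E (\<lambda>js. T (i # js)) w x" and ?d = "\<lambda>j w. con E' (\<lambda>js. X (j # js)) w x"
  have "(\<Sum>w | length w = Suc k. con E T w x * con E' X w x) =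
      (\<Sum>a\<in>UNIV. \<Sum>w | length w = k. (\<Sum>i\<in>UNIV. E a i x * ?c i w) * (\<Sum>j\<in>UNIV. E' a j x * ?d j w))"
    by (simp add: sum_lists_Suc[OF fc])
  also have "\<dots> = (\<Sum>w | length w = k. \<Sum>a\<in>UNIV. (\<Sum>i\<in>UNIV. E a i x * ?c i w) * (\<Sum>j\<in>UNIV. E' a j x * ?d j w))"
    by (rule sum.swap)
  also have "\<dots> = (\<Sum>w | length w = k. \<Sum>i\<in>UNIV. \<Sum>j\<in>UNIV. (\<Sum>a\<in>UNIV. E a i x * E' a j x) * (?c i w * ?d j w))"
    by (intro sum.cong refl) (simp add: sum_2 sum_charge algebra_simps)
  also have "\<dots> = (\<Sum>w | length w = k. \<Sum>i\<in>UNIV. ?c i w * ?d i w)"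
  proof -
    have "(\<Sum>j\<in>UNIV. (if i = j then 1 else 0) * F j) = F i" for i :: 2 and F :: "2 \<Rightarrow> complex"
      using exhaust_2[of i] by (auto simp: sum_2)
    then show ?thesis unfolding assms by simp
  qed
  also have "\<dots> = (\<Sum>i\<in>UNIV. \<Sum>w | length w = k. ?c i w * ?d i w)" by (rule sum.swap)
  also have "\<dots> = (\<Sum>i\<in>UNIV. \<Sum>js | length js = k. T (i # js) x * X (i # js) x)"
    by (intro sum.cong refl) (rule Suc[symmetric])
  finally show ?case by (simp add: sum_lists_Suc)
qed simp

section \<open>Iterated covariant derivatives\<close>

text \<open>\<open>opP K L w\<close> is \<open>Ccoef\<close> with the operator \<open>L\<close> in place of \<open>- lam\<close>.\<close>

primrec opP :: "real \<Rightarrow> (('x \<Rightarrow> complex) \<Rightarrow> 'x \<Rightarrow> complex) \<Rightarrow> charge list \<Rightarrow> ('x \<Rightarrow> complex) \<Rightarrow> 'x \<Rightarrow> complex" where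
  "opP K L [] u = u"
| "opP K L (a # w) u = (if \<bar>cval a + charge_sum w\<bar> < \<bar>charge_sum w\<bar>
     then (\<lambda>x. L (opP K L w u) x + of_int (\<bar>charge_sum w\<bar> * (\<bar>charge_sum w\<bar> - 1)) * of_real K * opP K L w u x)
     else opP K L w u)"

context null_frame
begin

text \<open>The covariant derivative along \<open>H a\<close> of a component of charge
  \<open>c\<close>, on which the connection form acts by the scalar \<open>c\<close>.\<close>

definition st :: "charge \<Rightarrow> int \<Rightarrow> (real^2 \<Rightarrow> complex) \<Rightarrow> real^2 \<Rightarrow> complex" where
  "st a c u x = (\<Sum>i\<in>UNIV. H a i x * (pd i u x - of_int c * th i x * u x))"

primrec act :: "charge list \<Rightarrow> (real^2 \<Rightarrow> complex) \<Rightarrow> real^2 \<Rightarrow> complex" where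
  "act [] u = u"
| "act (a # w) u = st a (charge_sum w) (act w u)"

text \<open>The index \<open>- 1\<close> is the charge after \<nabla>_- has acted. On functions the
  opposite order gives the same operator, as the commutator vanishes in charge 0.\<close>

definition lapl :: "(real^2 \<Rightarrow> complex) \<Rightarrow> real^2 \<Rightarrow> complex" where
  "lapl u = st Pls (- 1) (st Mns 0 u)"

lemma st_smooth: "smooth_on Om u \<Longrightarrow> smooth_on Om (st a c u)"
  unfolding st_def[abs_def] by (intro sm_rules th_smooth)

lemma act_smooth: "smooth_on Om u \<Longrightarrow> smooth_on Om (act w u)"
  by (induction w) (auto intro: st_smooth)

lemma lapl_smooth: "smooth_on Om u \<Longrightarrow> smooth_on Om (lapl u)"
  unfolding lapl_def by (intro st_smooth)

lemma st_cong: "(\<And>y. y \<in> Om \<Longrightarrow> u y = v y) \<Longrightarrow> x \<in> Om \<Longrightarrow> st a c u x = st a c v x"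
  using pd_cong[OF op, of x u v] by (simp add: st_def)

lemma st_lincomb:
  assumes "smooth_on Om u" "smooth_on Om v" "x \<in> Om"
  shows "st a c (\<lambda>x. u x + z * v x) x = st a c u x + z * st a c v x"
proof -
  have "pd i (\<lambda>x. u x + z * v x) x = pd i u x + z * pd i v x" for i
    using pd_add[OF sd[OF assms(1,3)], of "\<lambda>x. z * v x"] pd_cmult[OF sd[OF assms(2,3)]]
      sd[OF smooth_mult[OF op smooth_const assms(2)] assms(3)] by simp
  then show ?thesis by (simp add: st_def sum_2 algebra_simps)
qed

lemma act_lincomb:
  assumes "smooth_on Om u" "smooth_on Om v"
  shows "x \<in> Om \<Longrightarrow> act w (\<lambda>x. u x + z * v x) x = act w u x + z * act w v x"
proof (induction w arbitrary: x)
  case (Cons a w)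
  then show ?case
    using st_cong[of "act w (\<lambda>x. u x + z * v x)" "\<lambda>x. act w u x + z * act w v x"]
      st_lincomb[OF act_smooth[OF assms(1)] act_smooth[OF assms(2)]] by simp
qed simp

text \<open>The derivative of the inner frame field \<open>H b\<close> yields the Christoffel term
  and, through the connection form, cancels the shift of the charge by \<open>cval b\<close>. What
  remains is a contracted second covariant derivative.\<close>

lemma st_st:
  fixes c :: int
  assumes u: "smooth_on Om u" and x: "x \<in> Om"
  defines "v \<equiv> \<lambda>j y. pd j u y - of_int c * th j y * u y"
  shows "st a (cval b + c) (st b c u) x = (\<Sum>i\<in>UNIV. \<Sum>j\<in>UNIV. H a i x * H b j x *
     (pd i (v j) x - of_int c * th i x * v j x - (\<Sum>m\<in>UNIV. Gam m i j x * v m x)))"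
proof -
  have vs: "smooth_on Om (v j)" for j unfolding v_def by (intro sm_rules th_smooth u)
  have d: "(\<lambda>y. H b j y * v j y) differentiable at x" for j
    by (rule sd[OF _ x], intro sm_rules vs)
  have st: "st b c u = (\<lambda>y. \<Sum>j\<in>UNIV. H b j y * v j y)" by (simp add: st_def[abs_def] v_def)
  have 1: "pd i (st b c u) x = (\<Sum>j\<in>UNIV. H b j x * pd i (v j) x + pd i (H b j) x * v j x)" for i
    unfolding st by (simp add: pd_sum[OF d] pd_mult[OF sd[OF Hsm x] sd[OF vs x]])
  show ?thesis
    unfolding st_def[of a] 1 unfolding st pd_H[OF x] by (simp add: sum_2 algebra_simps)
qed

text \<open>In the contracted second derivatives all terms symmetric in the two indices cancel; what
  is left is the exterior derivative of \<open>th\<close>, evaluated on the frame.\<close>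

lemma commutator_Omega:
  assumes u: "smooth_on Om u" and x: "x \<in> Om"
  shows "st Pls (c - 1) (st Mns c u) x - st Mns (c + 1) (st Pls c u) x = - of_int c * Omega x * dt x * u x"
proof -
  define v where "v = (\<lambda>j y. pd j u y - of_int c * th j y * u y)"
  have pv: "pd i (v j) x = pd i (pd j u) x - of_int c * (th j x * pd i u x + pd i (th j) x * u x)" for i j
  proof -
    have d: "(\<lambda>y. of_int c * (th j y * u y)) differentiable at x" "(\<lambda>y. th j y * u y) differentiable at x"
      by (rule sd[OF _ x], intro sm_rules th_smooth u)+
    have "v j = (\<lambda>y. pd j u y - of_int c * (th j y * u y))" by (simp add: v_def mult.assoc)
    then show ?thesis
      by (simp add: pd_diff[OF sd[OF smooth_pd[OF u] x] d(1)] pd_cmult[OF d(2)]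
          pd_mult[OF sd[OF th_smooth x] sd[OF u x]])
  qed
  have s1: "st Pls (c - 1) (st Mns c u) x = (\<Sum>i\<in>UNIV. \<Sum>j\<in>UNIV. H Pls i x * H Mns j x *
     (pd i (v j) x - of_int c * th i x * v j x - (\<Sum>m\<in>UNIV. Gam m i j x * v m x)))"
    using st_st[OF u x, of Pls Mns c] by (simp add: v_def)
  have s2: "st Mns (c + 1) (st Pls c u) x = (\<Sum>i\<in>UNIV. \<Sum>j\<in>UNIV. H Mns i x * H Pls j x *
     (pd i (v j) x - of_int c * th i x * v j x - (\<Sum>m\<in>UNIV. Gam m i j x * v m x)))"
    using st_st[OF u x, of Mns Pls c] by (simp add: v_def add.commute)
  show ?thesis
    unfolding s1 s2 pv unfolding v_def
    by (simp add: sum_2 Gam_sym[OF x, of _ 2 1] pd_commute[OF op u x, of 2 1] Omega_def dt_def algebra_simps)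
qed

lemma lapl_opp:
  assumes u: "smooth_on Om u" and x: "x \<in> Om"
  shows "st Mns 1 (st Pls 0 u) x = lapl u x"
  using commutator_Omega[OF u x, of 0] by (simp add: lapl_def)

text \<open>The inverse metric is the symmetrized product of \<open>H Pls\<close> and
  \<open>H Mns\<close>, so the divergence of the gradient is the mean of the two orders of
  differentiation, which agree.\<close>

lemma laplace_lapl:
  assumes u: "smooth_on Om u" and x: "x \<in> Om"
  shows "laplace g u x = lapl u x"
proof -
  define v where "v a = st (opp a) 0 u" for a
  have vs: "smooth_on Om (v a)" for a unfolding v_def by (rule st_smooth[OF u])
  have gr: "grad g u i y = (1/2) * (\<Sum>a\<in>UNIV. H a i y * v a y)" if y: "y \<in> Om" for i y
    by (simp add: grad_def scaleR_conv_of_real ginv_eq[OF y] v_def st_def sum_2 sum_charge algebra_simps)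
  have d: "(\<lambda>y. \<Sum>a\<in>UNIV. H a i y * v a y) differentiable at x" "(\<lambda>y. H a i y * v a y) differentiable at x" for i a
    by (rule sd[OF _ x], intro sm_rules vs)+
  have pg: "pd i (grad g u i) x = (1/2) * (\<Sum>a\<in>UNIV. H a i x * pd i (v a) x + pd i (H a i) x * v a x)" for i
  proof -
    have "pd i (grad g u i) x = pd i (\<lambda>y. (1/2) * (\<Sum>a\<in>UNIV. H a i y * v a y)) x"
      by (rule pd_cong[OF op x gr])
    also have "\<dots> = (1/2) * pd i (\<lambda>y. \<Sum>a\<in>UNIV. H a i y * v a y) x" by (rule pd_cmult[OF d(1)])
    finally show ?thesis
      by (simp only: pd_sum[OF d(2)] pd_mult[OF sd[OF Hsm x] sd[OF vs x]])
  qed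
  have "laplace g u x = (\<Sum>i\<in>UNIV. pd i (grad g u i) x + (\<Sum>m\<in>UNIV. Gam i i m x * grad g u m x))"
    by (simp add: laplace_def divergence_def contra_deriv_def scaleR_conv_of_real Gam_def)
  also have "\<dots> = (1/2) * (\<Sum>a\<in>UNIV. \<Sum>i\<in>UNIV. H a i x * (pd i (v a) x + of_int (cval a) * th i x * v a x))"
    unfolding pg gr[OF x] pd_H[OF x] by (simp add: sum_2 sum_charge algebra_simps)
  also have "\<dots> = (1/2) * (st Pls (- 1) (st Mns 0 u) x + st Mns 1 (st Pls 0 u) x)"
    by (simp add: v_def st_def[of Pls "- 1"] st_def[of Mns 1] sum_charge)
  finally show ?thesis unfolding lapl_opp[OF u x] by (simp add: lapl_def)
qed

lemma nabla_smooth: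
  assumes "smooth_on Om u"
  shows "length idx = k \<Longrightarrow> smooth_on Om (nabla g k u idx)"
proof (induction k arbitrary: idx)
  case 0 then show ?case using assms by simp
next
  case (Suc k)
  then obtain i js where idx: "idx = i # js" "length js = k" by (auto simp: length_Suc_conv)
  have "nabla g (Suc k) u idx = gD (\<lambda>k i m x. - Gam m i k x) (nabla g k u) i js"
    by (rule ext) (simp add: idx cov_deriv_def gD_def Gam_def scaleR_conv_of_real sum_negf)
  moreover have "smooth_on Om (gD (\<lambda>k i m x. - Gam m i k x) (nabla g k u) i js)"
    by (rule gD_smooth[OF op _ Suc.IH idx(2)]) (auto intro: smooth_minus[OF op Gam_smooth])
  ultimately show ?case by simp
qed

text \<open>By \<open>con_gD\<close>, each further covariant derivative is corrected by the charge
  of the remaining word times \<open>th\<close>, exactly as in \<open>st\<close>.\<close>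

lemma con_nabla:
  assumes u: "smooth_on Om u"
  shows "x \<in> Om \<Longrightarrow> con H (nabla g (length w) u) w x = act w u x"
proof (induction w arbitrary: x)
  case (Cons a w)
  note x = Cons.prems
  have "con H (\<lambda>js. nabla g (length (a # w)) u (i # js)) w x = pd i (act w u) x - th i x * of_int (charge_sum w) * act w u x" for i
  proof -
    have "con H (\<lambda>js. nabla g (length (a # w)) u (i # js)) w x = con H (gD (\<lambda>k i m x. - Gam m i k x) (nabla g (length w) u) i) w x"
      by (rule con_cong) (simp add: cov_deriv_def gD_def Gam_def scaleR_conv_of_real sum_negf)
    also have "\<dots> = pd i (con H (nabla g (length w) u) w) x - th i x * of_int (charge_sum w) * con H (nabla g (length w) u) w x"
      by (rule con_gD[OF op Hsm x _ nabla_smooth[OF u]]) (auto simp: pd_H[OF x] sum_negf)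
    also have "pd i (con H (nabla g (length w) u) w) x = pd i (act w u) x"
      by (rule pd_cong[OF op x Cons.IH])
    finally show ?thesis using Cons.IH[OF x] by simp
  qed
  then show ?case by (simp only: con.simps act.simps st_def) (simp add: mult_ac)
qed simp

end

locale const_frame = null_frame +
  fixes K :: real
  assumes curv: "x \<in> Om \<Longrightarrow> Omega x * dt x = 2 * complex_of_real K"
begin

lemma commutator:
  assumes u: "smooth_on Om u" and x: "x \<in> Om"
  shows "st Pls (c - 1) (st Mns c u) x - st Mns (c + 1) (st Pls c u) x = - 2 * of_real K * of_int c * u x"
proof -
  have "of_int c * Omega x * dt x * u x = of_int c * (Omega x * dt x) * u x" by (simp only: mult.assoc)
  then show ?thesis using commutator_Omega[OF u x, of c] curv[OF x] by (simp add: mult_ac)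
qed

text \<open>Carrying \<open>st (opp b)\<close> inwards past \<open>n\<close> of the
  \<open>n + 1\<close> derivatives costs \<open>2 * K\<close> times the absolute charge each time.
  The total \<open>2K(1 + ... + n) = n(n + 1)K\<close> is the origin of the constants in
  \<open>Ccoef\<close>.\<close>

lemma lowering:
  assumes u: "smooth_on Om u" and x: "x \<in> Om"
  shows "st (opp b) (int (Suc n) * cval b) (act (replicate (Suc n) b) u) x =
    act (replicate n b) (\<lambda>x. lapl u x + of_nat (Suc n * n) * of_real K * u x) x"
  using x
proof (induction n arbitrary: x)
  case 0
  then show ?case using lapl_opp[OF u] by (cases b) (simp_all add: lapl_def)
next
  case (Suc n)
  define p where "p = act (replicate (Suc n) b) u"
  have ps: "smooth_on Om p" unfolding p_def by (rule act_smooth[OF u])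
  have cr: "charge_sum (replicate m b) = int m * cval b" for m by (induction m) (simp_all add: algebra_simps)
  \<comment> \<open>One formula for both signs; in the case used, \<open>c * cval b\<close> is the
    absolute charge.\<close>
  have comm: "st (opp b) (c + cval b) (st b c p) x = st b (c - cval b) (st (opp b) c p) x
     + 2 * of_real K * of_int (c * cval b) * p x" for c
    using commutator[OF ps Suc.prems, of c] by (cases b) (simp_all add: algebra_simps)
  have "st (opp b) (int (Suc (Suc n)) * cval b) (act (replicate (Suc (Suc n)) b) u) x =
      st (opp b) (int (Suc n) * cval b + cval b) (st b (int (Suc n) * cval b) p) x"
    by (simp only: p_def replicate.simps(2)[of "Suc n"] act.simps cr) (simp add: algebra_simps)
  also have "\<dots> = st b (int (Suc n) * cval b - cval b) (st (opp b) (int (Suc n) * cval b) p) x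
     + 2 * of_real K * of_nat (Suc n) * p x"
    unfolding comm by (cases b) simp_all
  also have "st b (int (Suc n) * cval b - cval b) (st (opp b) (int (Suc n) * cval b) p) x =
      st b (int n * cval b) (act (replicate n b) (\<lambda>x. lapl u x + of_nat (Suc n * n) * of_real K * u x)) x"
  proof -
    have "int (Suc n) * cval b - cval b = int n * cval b" by (simp add: algebra_simps)
    then show ?thesis unfolding p_def using st_cong[OF Suc.IH Suc.prems] by simp
  qed
  also have "\<dots> = act (replicate (Suc n) b) (\<lambda>x. lapl u x + of_nat (Suc n * n) * of_real K * u x) x"
    by (simp add: cr)
  also have "\<dots> + 2 * of_real K * of_nat (Suc n) * p x =
     act (replicate (Suc n) b) (\<lambda>x. (lapl u x + of_nat (Suc n * n) * of_real K * u x) + (2 * of_real K * of_nat (Suc n)) * u x) x"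
    unfolding p_def
    by (rule act_lincomb[symmetric, OF _ u Suc.prems]) (intro sm_rules lapl_smooth u)
  also have "(\<lambda>x. (lapl u x + of_nat (Suc n * n) * of_real K * u x) + (2 * of_real K * of_nat (Suc n)) * u x) =
     (\<lambda>x. lapl u x + of_nat (Suc (Suc n) * Suc n) * of_real K * u x)"
    by (simp add: algebra_simps)
  finally show ?case .
qed

lemma opP_smooth: "smooth_on Om u \<Longrightarrow> smooth_on Om (opP K lapl w u)"
  by (induction w) (auto intro!: sm_rules lapl_smooth)

text \<open>As \<open>w\<close> is read from the right, a sign leading away from charge 0 prolongs
  the normal word, while one leading back is absorbed by \<open>lowering\<close> and contributes a
  factor of \<open>opP\<close>.\<close>

lemma act_opP:
  assumes u: "smooth_on Om u"
  shows "x \<in> Om \<Longrightarrow> act w u x = act (nw (charge_sum w)) (opP K lapl w u) x"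
proof (induction w arbitrary: x)
  case Nil then show ?case by (simp add: nw_def)
next
  case (Cons a w)
  define c where "c = charge_sum w"
  define v where "v = opP K lapl w u"
  have vs: "smooth_on Om v" unfolding v_def by (rule opP_smooth[OF u])
  have 1: "act (a # w) u x = st a c (act (nw c) v) x"
    using st_cong[OF Cons.IH Cons.prems] by (simp add: c_def v_def)
  show ?case
  proof (cases "\<bar>cval a + c\<bar> < \<bar>c\<bar>")
    case False
    then have "nw (cval a + c) = a # nw c"
    proof -
      have "nat \<bar>cval a + c\<bar> = Suc (nat \<bar>c\<bar>)" "(if cval a + c > 0 then Pls else Mns) = a"
        "c \<noteq> 0 \<Longrightarrow> (if c > 0 then Pls else Mns) = a" using False by (cases a; simp)+
      then show ?thesis unfolding nw_def by (cases "c = 0") simp_all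
    qed
    then show ?thesis unfolding 1 using False by (simp add: c_def v_def)
  next
    case True
    define n where "n = nat \<bar>c\<bar> - 1"
    have c0: "c \<noteq> 0" using True by auto
    have n: "nat \<bar>c\<bar> = Suc n" using c0 by (simp add: n_def)
    have ab: "(if c > 0 then Pls else Mns) = opp a" using True by (cases a) auto
    have c: "c = int (Suc n) * cval (opp a)" using True n by (cases a) auto
    have nwc: "nw c = replicate (Suc n) (opp a)" unfolding nw_def n ab ..
    have nw': "nw (cval a + c) = replicate n (opp a)"
    proof -
      have "nat \<bar>cval a + c\<bar> = n" using c by (cases a) (auto simp: algebra_simps)
      moreover have "n = 0 \<or> (if cval a + c > 0 then Pls else Mns) = opp a" using c by (cases a) auto
      ultimately show ?thesis unfolding nw_def by auto
    qed
    have "act (a # w) u x = st (opp (opp a)) (int (Suc n) * cval (opp a)) (act (replicate (Suc n) (opp a)) v) x"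
      unfolding 1 nwc by (simp only: c[symmetric] opp_opp)
    also have "\<dots> = act (replicate n (opp a)) (\<lambda>x. lapl v x + of_nat (Suc n * n) * of_real K * v x) x"
      by (rule lowering[OF vs Cons.prems])
    also have "of_nat (Suc n * n) = (of_int (\<bar>c\<bar> * (\<bar>c\<bar> - 1)) :: complex)"
    proof -
      have "\<bar>c\<bar> = int (Suc n)" using n by linarith
      then show ?thesis by (simp add: algebra_simps)
    qed
    finally show ?thesis using True by (simp add: c_def[symmetric] v_def[symmetric] nw')
  qed
qed

lemma act_zero:
  "smooth_on Om u \<Longrightarrow> x \<in> Om \<Longrightarrow> charge_sum w = 0 \<Longrightarrow> act w u x = opP K lapl w u x"
  using act_opP[of u x w] by (simp add: nw_def)

end

section \<open>Existence and transport of null frames\<close>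

text \<open>The vector \<open>(z, a)\<close> is null for the complexified metric if
  \<open>z * z + 2 * b * z + a * d = 0\<close>, which has the roots
  \<open>- b \<plusminus> \<i> * \<delta>\<close>. Their vectors pair to
  \<open>2 * a * \<delta> * \<delta>\<close>, and the scalar \<open>s\<close> normalises this to
  2.\<close>

lemma null_frame_exists:
  assumes op: "open Om" and gsm: "smooth_on Om g"
    and sym: "\<And>x. x \<in> Om \<Longrightarrow> transpose (g x) = g x"
    and pos: "\<And>x v. x \<in> Om \<Longrightarrow> v \<noteq> 0 \<Longrightarrow> v \<bullet> (g x *v v) > 0"
  shows "\<exists>H. null_frame Om g H"
proof -
  define a b d where "a x = g x $ 1 $ 1" and "b x = g x $ 1 $ 2" and "d x = g x $ 2 $ 2" for x
  have sm: "smooth_on Om a" "smooth_on Om b" "smooth_on Om d"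
    unfolding a_def[abs_def] b_def[abs_def] d_def[abs_def] by (intro smooth_nth op gsm)+
  have s21: "g x $ 2 $ 1 = b x" if "x \<in> Om" for x
    using arg_cong[OF sym[OF that], of "\<lambda>m. m $ 1 $ 2"] by (simp add: transpose_def b_def)
  have ap: "a x > 0" if "x \<in> Om" for x
  proof -
    have "(axis 1 1 :: real^2) $ 1 \<noteq> 0" by (simp add: axis_def)
    then have "(axis 1 1 :: real^2) \<noteq> 0" by auto
    from pos[OF that this] show ?thesis
      by (simp add: inner_vec_def matrix_vector_mult_def sum_2 axis_def a_def)
  qed
  have dp: "a x * d x - b x * b x > 0" if x: "x \<in> Om" for x
  proof -
    \<comment> \<open>The vector \<open>(- b, a)\<close> is orthogonal to the first axis; its square
      is \<open>a\<close> times the determinant.\<close>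
    define v where "v = (\<chi> i::2. if i = 1 then - b x else a x)"
    have "v $ 2 \<noteq> 0" using ap[OF x] by (simp add: v_def)
    then have "v \<noteq> 0" by auto
    from pos[OF x this] have "a x * (a x * d x - b x * b x) > 0"
      by (simp add: inner_vec_def matrix_vector_mult_def sum_2 v_def s21[OF x] a_def[symmetric] b_def[symmetric]
          d_def[symmetric] algebra_simps)
    then show ?thesis using ap[OF x] by (simp add: zero_less_mult_iff)
  qed
  define \<delta> where "\<delta> x = sqrt (a x * d x - b x * b x)" for x
  have \<delta>sm: "smooth_on Om \<delta>"
    unfolding \<delta>_def[abs_def] by (intro smooth_sqrt smooth_subtract smooth_mult op sm dp)
  have \<delta>2: "\<delta> x * \<delta> x = a x * d x - b x * b x" if "x \<in> Om" for x
    using dp[OF that] by (simp add: \<delta>_def)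
  have \<delta>p: "\<delta> x > 0" if "x \<in> Om" for x using dp[OF that] by (simp add: \<delta>_def)
  define z where "z x = complex_of_real (- b x) + \<i> * complex_of_real (\<delta> x)" for x
  define z' where "z' x = complex_of_real (- b x) - \<i> * complex_of_real (\<delta> x)" for x
  define s where "s x = complex_of_real (inverse (a x * (\<delta> x * \<delta> x)))" for x
  define H where "H = (\<lambda>j (i::2) x. case j of Pls \<Rightarrow> (if i = 1 then z x else of_real (a x))
     | Mns \<Rightarrow> s x * (if i = 1 then z' x else of_real (a x)))"
  have zs: "smooth_on Om z" "smooth_on Om z'" "smooth_on Om s"
    unfolding z_def[abs_def] z'_def[abs_def] s_def[abs_def]
    by (intro smooth_add smooth_subtract smooth_of_real smooth_minus smooth_mult smooth_const smooth_inverse op sm \<delta>sm;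
        use ap \<delta>p in fastforce)+
  have "smooth_on Om (H j i)" for j i
    unfolding H_def by (cases j; cases "i = 1") (auto intro!: smooth_mult smooth_of_real op sm zs)
  moreover have "(\<Sum>i\<in>UNIV. \<Sum>j\<in>UNIV. complex_of_real (g x $ i $ j) * H e i x * H e' j x) = (if e = e' then 0 else 2)"
    if x: "x \<in> Om" for x e e'
  proof -
    define A B D \<Delta> where "A = complex_of_real (a x)" and "B = complex_of_real (b x)"
      and "D = complex_of_real (d x)" and "\<Delta> = complex_of_real (\<delta> x)"
    have gx: "complex_of_real (g x $ 1 $ 1) = A" "complex_of_real (g x $ 1 $ 2) = B"
      "complex_of_real (g x $ 2 $ 1) = B" "complex_of_real (g x $ 2 $ 2) = D"
      by (simp_all add: A_def B_def D_def s21[OF x]) (simp_all add: a_def b_def d_def)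
    have AD: "A * D = \<Delta> * \<Delta> + B * B"
      unfolding A_def B_def D_def \<Delta>_def of_real_mult[symmetric] of_real_add[symmetric] using \<delta>2[OF x] by simp
    have nz: "A \<noteq> 0" "\<Delta> \<noteq> 0" using ap[OF x] \<delta>p[OF x] by (auto simp: A_def \<Delta>_def)
    have ss: "s x * (A * (\<Delta> * \<Delta>)) = 1" using nz by (simp add: s_def A_def \<Delta>_def field_simps)
    have zx: "z x = - B + \<i> * \<Delta>" "z' x = - B - \<i> * \<Delta>" by (simp_all add: z_def z'_def B_def \<Delta>_def)
    have q: "(\<Sum>i\<in>UNIV. \<Sum>j\<in>UNIV. complex_of_real (g x $ i $ j) * (if i = 1 then y else A) * (if j = 1 then y' else A))
       = A * (y * y' + B * (y + y') + A * D)" for y y'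
      by (simp add: sum_2 gx algebra_simps)
    have q2: "A * (z x * z x + B * (z x + z x) + A * D) = 0" "A * (z' x * z' x + B * (z' x + z' x) + A * D) = 0"
      "A * (z x * z' x + B * (z x + z' x) + A * D) = 2 * (A * (\<Delta> * \<Delta>))" "A * (z' x * z x + B * (z' x + z x) + A * D) = 2 * (A * (\<Delta> * \<Delta>))"
      unfolding AD zx by (simp_all add: algebra_simps)
    have r: "(\<Sum>i\<in>UNIV. \<Sum>j\<in>UNIV. complex_of_real (g x $ i $ j) * (t * (if i = 1 then y else A)) * (t' * (if j = 1 then y' else A)))
       = t * t' * (A * (y * y' + B * (y + y') + A * D))" for y y' t t'
      unfolding q[symmetric] by (simp add: sum_2 algebra_simps)
    define t where "t e = (case e of Pls \<Rightarrow> 1 | Mns \<Rightarrow> s x)" for e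
    define y where "y e = (case e of Pls \<Rightarrow> z x | Mns \<Rightarrow> z' x)" for e
    have Hx: "H e i x = t e * (if i = 1 then y e else A)" for e i
      by (cases e) (simp_all add: H_def A_def t_def y_def)
    have "(\<Sum>i\<in>UNIV. \<Sum>j\<in>UNIV. complex_of_real (g x $ i $ j) * H e i x * H e' j x)
        = t e * t e' * (A * (y e * y e' + B * (y e + y e') + A * D))"
      unfolding Hx by (rule r)
    also have "\<dots> = (if e = e' then 0 else 2)"
      using ss by (cases e; cases e') (simp_all only: t_def y_def q2 charge.case, simp_all add: mult_ac)
    finally show ?thesis .
  qed
  ultimately have "null_frame Om g H" using op gsm sym by (simp add: null_frame_def)
  then show ?thesis by blast
qed

lemma null_frame_subset:
  assumes "null_frame Om g H" "open T" "T \<subseteq> Om"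
  shows "null_frame T g H"
proof -
  interpret null_frame Om g H by fact
  show ?thesis
    using assms(2,3) gsm Hsm gsym Hn by (auto simp: null_frame_def intro: smooth_subset)
qed

lemma const_frame_subset:
  assumes "const_frame Om g H K" "open T" "T \<subseteq> Om"
  shows "const_frame T g H K"
proof -
  interpret const_frame Om g H K by fact
  show ?thesis
    using null_frame_subset[OF null_frame_axioms assms(2,3)] curv assms(3)
    by (auto simp: const_frame_def const_frame_axioms_def)
qed

lemma jacobian_nth: "jacobian f (at y) $ i $ j = pd j f y $ i"
  by (simp add: jacobian_def matrix_def pd_def)

text \<open>The connection form is determined by the frame: the two expressions \<open>lapl_def\<close> and
  \<open>lapl_opp\<close> for the Laplacian agree on the coordinate functions. Hence it is carried along with
  the frame, and so is the Laplacian.\<close>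

lemma laplace_transport:
  fixes \<sigma> \<tau> :: "real^2 \<Rightarrow> real^2"
  assumes N: "null_frame Od gd Hd" and Oc: "open Oc"
    and tau: "\<And>x. x \<in> Oc \<Longrightarrow> \<tau> x \<in> Od \<and> \<sigma> (\<tau> x) = x" and sig: "\<And>y. y \<in> Od \<Longrightarrow> \<sigma> y \<in> Oc \<and> \<tau> (\<sigma> y) = y"
    and ts: "smooth_on Oc \<tau>" and ss: "smooth_on Od \<sigma>"
    and gs: "smooth_on Oc gc" and gsym: "\<And>x. x \<in> Oc \<Longrightarrow> transpose (gc x) = gc x"
    and gt: "\<And>y. y \<in> Od \<Longrightarrow> gd y = transpose (jacobian \<sigma> (at y)) ** gc (\<sigma> y) ** jacobian \<sigma> (at y)"
    and F: "smooth_on Oc F" and y: "y \<in> Od"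
  shows "laplace gc F (\<sigma> y) = laplace gd (\<lambda>y. F (\<sigma> y)) y"
proof -
  interpret D: null_frame Od gd Hd by fact
  \<comment> \<open>The frame on \<open>Od\<close>, pushed forward by \<sigma>, is a null frame on
    \<open>Oc\<close>.\<close>
  define Hc where "Hc a i x = (\<Sum>j\<in>UNIV. complex_of_real (pd j \<sigma> (\<tau> x) $ i) * Hd a j (\<tau> x))" for a i x
  have sc: "smooth_on Oc (\<lambda>x. f (\<tau> x))" if "smooth_on Od f" for f :: "real^2 \<Rightarrow> complex"
    by (rule smooth_compose[OF Oc D.op _ ts that]) (use tau in blast)
  have "smooth_on Oc (Hc a i)" for a i
  proof -
    have "smooth_on Oc (\<lambda>x. complex_of_real (pd j \<sigma> (\<tau> x) $ i))" for j
      by (rule sc) (intro smooth_of_real[OF D.op] smooth_nth[OF D.op] smooth_pd ss)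
    then show ?thesis unfolding Hc_def[abs_def]
      by (intro smooth_sum[OF Oc] smooth_mult[OF Oc] sc[OF D.Hsm]) simp
  qed
  moreover have "(\<Sum>i\<in>UNIV. \<Sum>k\<in>UNIV. complex_of_real (gc x $ i $ k) * Hc a i x * Hc b k x) = (if a = b then 0 else 2)"
    if x: "x \<in> Oc" for x a b
  proof -
    let ?J = "\<lambda>i j. complex_of_real (pd j \<sigma> (\<tau> x) $ i)" and ?G = "\<lambda>i k. complex_of_real (gc x $ i $ k)"
    have ty: "\<tau> x \<in> Od" "\<sigma> (\<tau> x) = x" using tau x by auto
    have "complex_of_real (gd (\<tau> x) $ j $ m) = (\<Sum>k\<in>UNIV. (\<Sum>i\<in>UNIV. ?J i j * ?G i k) * ?J k m)" for j m
      unfolding gt[OF ty(1)] ty(2) by (simp add: matrix_matrix_mult_def transpose_def jacobian_nth)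
    note gd = this
    have "(\<Sum>i\<in>UNIV. \<Sum>k\<in>UNIV. ?G i k * Hc a i x * Hc b k x) =
      (\<Sum>j\<in>UNIV. \<Sum>m\<in>UNIV. (\<Sum>k\<in>UNIV. (\<Sum>i\<in>UNIV. ?J i j * ?G i k) * ?J k m) * Hd a j (\<tau> x) * Hd b m (\<tau> x))"
      unfolding Hc_def by (simp add: sum_2 algebra_simps)
    then show ?thesis unfolding gd[symmetric] D.Hn[OF ty(1)] .
  qed
  ultimately interpret C: null_frame Oc gc Hc
    using Oc gs gsym by (simp add: null_frame_def)
  have smF: "smooth_on Od (\<lambda>y. f (\<sigma> y))" if "smooth_on Oc f" for f :: "real^2 \<Rightarrow> complex"
    by (rule smooth_compose[OF D.op Oc _ ss that]) (use sig in blast)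
  have T1: "C.st a 0 f (\<sigma> y) = D.st a 0 (\<lambda>y. f (\<sigma> y)) y" if f: "smooth_on Oc f" and y: "y \<in> Od" for f a y
  proof -
    have sy: "\<sigma> y \<in> Oc" "\<tau> (\<sigma> y) = y" using sig y by auto
    show ?thesis
      unfolding C.st_def D.st_def Hc_def sy(2)
        pd_compose[OF smooth_diff[OF D.op ss y] smooth_diff[OF Oc f sy(1)]]
      by (simp add: sum_2 scaleR_conv_of_real algebra_simps)
  qed
  \<comment> \<open>The values of the connection forms on the frame fields at the given point; the
    Laplacian depends on the forms only through these.\<close>
  define tc td where "tc a = (\<Sum>i\<in>UNIV. Hc a i (\<sigma> y) * C.th i (\<sigma> y))" and "td a = (\<Sum>i\<in>UNIV. Hd a i y * D.th i y)" for a
  have sy: "\<sigma> y \<in> Oc" "\<tau> (\<sigma> y) = y" using sig y by auto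
  have cst: "C.st a c u (\<sigma> y) = C.st a 0 u (\<sigma> y) - of_int c * tc a * u (\<sigma> y)" for a c u
    by (simp add: C.st_def tc_def sum_2 algebra_simps)
  have dst: "D.st a c u y = D.st a 0 u y - of_int c * td a * u y" for a c u
    by (simp add: D.st_def td_def sum_2 algebra_simps)
  have T2: "C.st b 0 (C.st a 0 f) (\<sigma> y) = D.st b 0 (D.st a 0 (\<lambda>y. f (\<sigma> y))) y" if f: "smooth_on Oc f" for f a b
    unfolding T1[OF C.st_smooth[OF f] y] by (rule D.st_cong[OF T1[OF f] y])
  have lc: "C.lapl f (\<sigma> y) = D.st Pls 0 (D.st Mns 0 (\<lambda>y. f (\<sigma> y))) y + tc Pls * D.st Mns 0 (\<lambda>y. f (\<sigma> y)) y"
    "C.lapl f (\<sigma> y) = D.st Mns 0 (D.st Pls 0 (\<lambda>y. f (\<sigma> y))) y - tc Mns * D.st Pls 0 (\<lambda>y. f (\<sigma> y)) y"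
    if f: "smooth_on Oc f" for f
  proof -
    show "C.lapl f (\<sigma> y) = D.st Pls 0 (D.st Mns 0 (\<lambda>y. f (\<sigma> y))) y + tc Pls * D.st Mns 0 (\<lambda>y. f (\<sigma> y)) y"
      unfolding C.lapl_def cst[of Pls "- 1"] T2[OF f] T1[OF f y] by simp
    show "C.lapl f (\<sigma> y) = D.st Mns 0 (D.st Pls 0 (\<lambda>y. f (\<sigma> y))) y - tc Mns * D.st Pls 0 (\<lambda>y. f (\<sigma> y)) y"
      unfolding C.lapl_opp[OF f sy(1), symmetric] cst[of Mns 1] T2[OF f] T1[OF f y] by simp
  qed
  have ld: "D.lapl u y = D.st Pls 0 (D.st Mns 0 u) y + td Pls * D.st Mns 0 u y"
    "D.lapl u y = D.st Mns 0 (D.st Pls 0 u) y - td Mns * D.st Pls 0 u y" if "smooth_on Od u" for u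
    using dst[of Pls "- 1"] dst[of Mns 1] D.lapl_opp[OF that y] by (simp_all add: D.lapl_def)
  \<comment> \<open>Equating the two formulas for each Laplacian and subtracting leaves a linear
    relation between the differences of \<open>tc\<close> and \<open>td\<close>; for coordinate
    functions its coefficients are the frame components.\<close>
  have eq: "(tc Pls - td Pls) * Hc Mns k (\<sigma> y) + (tc Mns - td Mns) * Hc Pls k (\<sigma> y) = 0" for k
  proof -
    let ?f = "\<lambda>x :: real^2. complex_of_real (x $ k)"
    have f: "smooth_on Oc ?f"
    proof -
      have "bounded_linear (\<lambda>x :: real^2. complex_of_real (x $ k))"
        by (rule bounded_linear_compose[OF bounded_linear_of_real bounded_linear_vec_nth])
      moreover have "smooth_on Oc (\<lambda>x :: real^2. x)"
      proof -
        have "Ck_on n Oc (\<lambda>x :: real^2. x)" for n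
        proof (cases n)
          case (Suc m)
          have p: "pd i (\<lambda>x :: real^2. x) = (\<lambda>_. axis i 1)" for i
            by (rule ext) (simp add: pd_eqI[OF has_derivative_ident])
          show ?thesis unfolding Suc Ck_on.simps p by (simp add: Ck_const differentiable_on_def)
        qed simp
        then show ?thesis by (simp add: smooth_on_def)
      qed
      ultimately show ?thesis by (rule smooth_linear[OF Oc])
    qed
    have pk: "pd i ?f x = (if i = k then 1 else 0)" for i x
      by (subst pd_eqI[OF bounded_linear.has_derivative[OF bounded_linear_compose[OF bounded_linear_of_real bounded_linear_vec_nth] has_derivative_ident]])
        (simp add: axis_def)
    have s: "D.st a 0 (\<lambda>y. ?f (\<sigma> y)) y = Hc a k (\<sigma> y)" for a
      unfolding T1[OF f y, symmetric] C.st_def pk using exhaust_2[of k] by (auto simp: sum_2)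
    show ?thesis
      using lc[OF f] ld[OF smF[OF f]] unfolding s by (simp add: algebra_simps)
  qed
  have "(tc Pls - td Pls) * C.dt (\<sigma> y) = 0"
  proof -
    have "(tc Pls - td Pls) * C.dt (\<sigma> y) =
      Hc Pls 1 (\<sigma> y) * ((tc Pls - td Pls) * Hc Mns 2 (\<sigma> y) + (tc Mns - td Mns) * Hc Pls 2 (\<sigma> y))
      - Hc Pls 2 (\<sigma> y) * ((tc Pls - td Pls) * Hc Mns 1 (\<sigma> y) + (tc Mns - td Mns) * Hc Pls 1 (\<sigma> y))"
      by (simp add: C.dt_def algebra_simps)
    then show ?thesis unfolding eq by simp
  qed
  then have "tc Pls = td Pls" using C.dt_nz[OF sy(1)] by simp
  then have "C.lapl F (\<sigma> y) = D.lapl (\<lambda>y. F (\<sigma> y)) y"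
    unfolding lc(1)[OF F] ld(1)[OF smF[OF F]] by simp
  then show ?thesis
    unfolding C.laplace_lapl[OF F sy(1)] D.laplace_lapl[OF smF[OF F] y] .
qed

section \<open>Change of null coframes\<close>

text \<open>The pointwise version of \<open>con\<close>, which also admits a coframe that is given
  at a single point only.\<close>

definition pc :: "(charge \<Rightarrow> 2 \<Rightarrow> complex) \<Rightarrow> (2 list \<Rightarrow> complex) \<Rightarrow> charge list \<Rightarrow> complex" where
  "pc E T w = (\<Sum>idx | length idx = length w. T idx * (\<Prod>r<length w. E (w ! r) (idx ! r)))"

lemma con_pc: "con E T w x = pc (\<lambda>a i. E a i x) (\<lambda>idx. T idx x) w"
  by (simp add: con_closed pc_def)

lemma sum_list_prod:
  fixes f :: "nat \<Rightarrow> 'b::finite \<Rightarrow> complex"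
  shows "(\<Sum>idx | length idx = n. \<Prod>r<n. f r (idx ! r)) = (\<Prod>r<n. \<Sum>i\<in>UNIV. f r i)"
proof (induction n arbitrary: f)
  case (Suc n)
  show ?case
    using Suc[of "\<lambda>r. f (Suc r)"]
    by (simp add: sum_lists_Suc prod.lessThan_Suc_shift sum_distrib_left[symmetric] sum_distrib_right[symmetric]
        del: prod.lessThan_Suc)
qed simp

text \<open>The change of chart is moved from the tensor to the coframe, which is thereby pulled
  back; the sum over index lists factorises position by position.\<close>

lemma pc_transform:
  assumes "\<And>idx. length idx = length w \<Longrightarrow> T' idx = (\<Sum>jdx | length jdx = length w. (\<Prod>r<length w. J (idx ! r) (jdx ! r)) * T jdx)"
  shows "pc E T' w = pc (\<lambda>a j. \<Sum>i\<in>UNIV. E a i * J i j) T w"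
proof -
  have "pc E T' w = (\<Sum>idx | length idx = length w. \<Sum>jdx | length jdx = length w.
      T jdx * (\<Prod>r<length w. E (w ! r) (idx ! r) * J (idx ! r) (jdx ! r)))"
    unfolding pc_def
    by (intro sum.cong refl) (simp add: assms sum_distrib_left sum_distrib_right prod.distrib mult_ac)
  also have "\<dots> = (\<Sum>jdx | length jdx = length w. \<Sum>idx | length idx = length w.
      T jdx * (\<Prod>r<length w. E (w ! r) (idx ! r) * J (idx ! r) (jdx ! r)))"
    by (rule sum.swap)
  also have "\<dots> = pc (\<lambda>a j. \<Sum>i\<in>UNIV. E a i * J i j) T w"
    unfolding pc_def sum_distrib_left[symmetric]
    by (intro sum.cong refl) (simp add: sum_list_prod[where f = "\<lambda>r i. E (w ! r) i * J i (jdx ! r)" for jdx])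
  finally show ?thesis .
qed

lemma pc_dual:
  fixes E h :: "charge \<Rightarrow> 2 \<Rightarrow> complex"
  assumes dual: "\<And>a b. (\<Sum>i\<in>UNIV. h b i * E a i) = (if a = b then 1 else 0)"
    and T: "\<And>idx. length idx = length w \<Longrightarrow> T idx = (\<Sum>v | length v = length w. \<alpha> v * (\<Prod>r<length w. h (v ! r) (idx ! r)))"
  shows "pc E T w = \<alpha> w"
proof -
  have "pc E T w = (\<Sum>idx | length idx = length w. \<Sum>v | length v = length w.
      \<alpha> v * (\<Prod>r<length w. h (v ! r) (idx ! r) * E (w ! r) (idx ! r)))"
    unfolding pc_def
    by (intro sum.cong refl) (simp add: T sum_distrib_left sum_distrib_right prod.distrib mult_ac)
  also have "\<dots> = (\<Sum>v | length v = length w. \<Sum>idx | length idx = length w.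
      \<alpha> v * (\<Prod>r<length w. h (v ! r) (idx ! r) * E (w ! r) (idx ! r)))"
    by (rule sum.swap)
  also have "\<dots> = (\<Sum>v | length v = length w. \<alpha> v * (\<Prod>r<length w. if w ! r = v ! r then 1 else 0))"
    unfolding sum_distrib_left[symmetric]
    by (intro sum.cong refl) (simp add: sum_list_prod[where f = "\<lambda>r i. h (v ! r) i * E (w ! r) i" for v] dual)
  also have "\<dots> = (\<Sum>v | length v = length w. if v = w then \<alpha> v else 0)"
  proof (intro sum.cong refl)
    fix v :: "charge list" assume "v \<in> {v. length v = length w}"
    then have l: "length v = length w" by simp
    have "(\<Prod>r<length w. if w ! r = v ! r then 1 else 0 :: complex) = (if v = w then 1 else 0)"
    proof (cases "v = w")
      case False
      then obtain r where "r < length w" "w ! r \<noteq> v ! r" using l by (metis nth_equalityI)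
      then show ?thesis using False by (auto intro!: prod_zero)
    qed simp
    then show "\<alpha> v * (\<Prod>r<length w. if w ! r = v ! r then 1 else 0) = (if v = w then \<alpha> v else 0)" by simp
  qed
  also have "\<dots> = \<alpha> w"
  proof -
    have "finite (UNIV :: charge set)" by (simp add: UNIV_charge)
    from finite_lists_length_eq[OF this, of "length w"]
    have "finite {v :: charge list. length v = length w}" by simp
    then show ?thesis by (simp add: sum.delta)
  qed
  finally show ?thesis .
qed

lemma charge_prod:
  assumes "u Pls * u Mns = (1 :: complex)"
  shows "(\<Prod>r<length w. u (w ! r)) = u Pls powi charge_sum w"
proof (induction w)
  case (Cons a w)
  have "u Pls \<noteq> 0" using assms by auto
  moreover have "u a = u Pls powi cval a"
    using assms \<open>u Pls \<noteq> 0\<close> by (cases a) (simp_all add: power_int_minus field_simps)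
  ultimately show ?case
    using Cons by (simp add: prod.lessThan_Suc_shift power_int_add del: prod.lessThan_Suc)
qed simp

lemma charge_sum_map_opp: "charge_sum (map opp w) = - charge_sum w"
  by (induction w) auto

text \<open>The matrix \<open>M\<close> of the change preserves the null pairing. Its columns are
  again null, so it is diagonal or antidiagonal, and its two nonzero entries have product 1.\<close>

lemma coframe_change:
  fixes E E' h :: "charge \<Rightarrow> 2 \<Rightarrow> complex"
  assumes gram: "\<And>i j. (\<Sum>a\<in>UNIV. E' (opp a) i * E' a j) = (\<Sum>a\<in>UNIV. E (opp a) i * E a j)"
    and dual: "\<And>a b. (\<Sum>i\<in>UNIV. h b i * E a i) = (if a = b then 1 else 0)"
    and compl: "\<And>i j. (\<Sum>a\<in>UNIV. h a i * E a j) = (if i = j then 1 else (0::complex))"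
  obtains u \<rho> where "u Pls * u Mns = 1" "\<rho> = id \<or> \<rho> = opp" "\<And>a i. E' a i = u a * E (\<rho> a) i"
proof -
  define M where "M a b = (\<Sum>j\<in>UNIV. E' a j * h b j)" for a b
  have EM: "E' a i = (\<Sum>b\<in>UNIV. M a b * E b i)" for a i
  proof -
    have "(\<Sum>b\<in>UNIV. M a b * E b i) = (\<Sum>j\<in>UNIV. E' a j * (\<Sum>b\<in>UNIV. h b j * E b i))"
      by (simp add: M_def sum_2 sum_charge algebra_simps)
    also have "\<dots> = E' a i" unfolding compl using exhaust_2[of i] by (auto simp: sum_2)
    finally show ?thesis by simp
  qed
  have MM: "(\<Sum>a\<in>UNIV. M (opp a) b * M a e) = (if e = opp b then 1 else 0)" for b e
  proof -
    have "(\<Sum>a\<in>UNIV. M (opp a) b * M a e) = (\<Sum>i\<in>UNIV. \<Sum>j\<in>UNIV. h b i * h e j * (\<Sum>a\<in>UNIV. E' (opp a) i * E' a j))"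
      by (simp add: M_def sum_2 sum_charge algebra_simps)
    also have "\<dots> = (\<Sum>a\<in>UNIV. (\<Sum>i\<in>UNIV. h b i * E (opp a) i) * (\<Sum>j\<in>UNIV. h e j * E a j))"
      unfolding gram by (simp add: sum_2 sum_charge algebra_simps)
    also have "\<dots> = (if e = opp b then 1 else 0)"
      unfolding dual by (cases b; cases e) (simp_all add: sum_charge)
    finally show ?thesis .
  qed
  have m: "M Mns Pls * M Pls Pls = 0" "M Mns Mns * M Pls Mns = 0" "M Mns Pls * M Pls Mns + M Pls Pls * M Mns Mns = 1"
    using MM[of Pls Pls] MM[of Mns Mns] MM[of Pls Mns] by (simp_all add: sum_charge mult.commute)
  show ?thesis
  proof (cases "M Mns Pls = 0")
    case True
    then have 1: "M Pls Pls * M Mns Mns = 1" "M Pls Mns = 0" using m by auto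
    have "E' a i = M a a * E (id a) i" for a i
      unfolding EM[of a i] using 1 True by (cases a) (simp_all add: sum_charge)
    then show ?thesis by (intro that[of "\<lambda>a. M a a" id]) (use 1 in auto)
  next
    case False
    then have 1: "M Pls Pls = 0" "M Mns Pls * M Pls Mns = 1" "M Mns Mns = 0" using m by auto
    have "E' a i = M a (opp a) * E (opp a) i" for a i
      unfolding EM[of a i] using 1 by (cases a) (simp_all add: sum_charge)
    then show ?thesis by (intro that[of "\<lambda>a. M a (opp a)" opp]) (use 1 in \<open>auto simp: mult.commute\<close>)
  qed
qed

text \<open>The rescaling enters through its power to the charge and disappears where only charge 0
  contributes; the exchange of signs permutes the words and is absorbed by the symmetry of
  \<open>B\<close>.\<close>

lemma coframe_change_sum:
  assumes gram: "\<And>i j. (\<Sum>a\<in>UNIV. E' (opp a) i * E' a j) = (\<Sum>a\<in>UNIV. E (opp a) i * E a j)"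
    and dual: "\<And>a b. (\<Sum>i\<in>UNIV. h b i * E a i) = (if a = b then 1 else 0)"
    and compl: "\<And>i j. (\<Sum>a\<in>UNIV. h a i * E a j) = (if i = j then 1 else (0::complex))"
    and z: "\<And>w. length w = k \<Longrightarrow> charge_sum w \<noteq> 0 \<Longrightarrow> pc E T w = 0"
    and B: "\<And>w. B (map opp w) = B w"
  shows "length w = k \<Longrightarrow> charge_sum w \<noteq> 0 \<Longrightarrow> pc E' T w = 0"
    and "(\<Sum>w | length w = k. pc E' T w * B w) = (\<Sum>w | length w = k. pc E T w * B w)"
proof -
  obtain u \<rho> where u: "u Pls * u Mns = 1" "\<rho> = id \<or> \<rho> = opp" "\<And>a i. E' a i = u a * E (\<rho> a) i"
    using coframe_change[OF gram dual compl] by blast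
  have 1: "pc E' T w = u Pls powi charge_sum w * pc E T (map \<rho> w)" for w
    by (simp add: pc_def u(3) prod.distrib charge_prod[OF u(1)] sum_distrib_left mult_ac)
  have cr: "charge_sum (map \<rho> w) = 0 \<longleftrightarrow> charge_sum w = 0" for w
    using u(2) by (auto simp: charge_sum_map_opp)
  have 2: "pc E' T w = pc E T (map \<rho> w)" if "length w = k" for w
    using 1[of w] z[of "map \<rho> w"] that cr[of w] by (cases "charge_sum w = 0") auto
  show "length w = k \<Longrightarrow> charge_sum w \<noteq> 0 \<Longrightarrow> pc E' T w = 0"
    using 2[of w] z[of "map \<rho> w"] cr[of w] by simp
  have Br: "B (map \<rho> w) = B w" for w using u(2) B by auto
  have rr: "map \<rho> (map \<rho> w) = w" for w using u(2) by (auto simp: comp_def)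
  have "(\<Sum>w | length w = k. pc E' T w * B w) = (\<Sum>w | length w = k. pc E T (map \<rho> w) * B (map \<rho> w))"
    by (intro sum.cong refl) (simp add: 2 Br)
  also have "\<dots> = (\<Sum>w | length w = k. pc E T w * B w)"
    by (rule sum.reindex_bij_witness[of _ "map \<rho>" "map \<rho>"]) (auto simp: rr simp del: map_map)
  finally show "(\<Sum>w | length w = k. pc E' T w * B w) = (\<Sum>w | length w = k. pc E T w * B w)" .
qed

lemma opP_opp: "opP K L (map opp w) u = opP K L w u"
proof (induction w)
  case (Cons a w)
  have "\<bar>- cval a - charge_sum w\<bar> = \<bar>cval a + charge_sum w\<bar>" by linarith
  then show ?case by (simp add: Cons charge_sum_map_opp)
qed simp

text \<open>The right side contains the metric alone, which is what allows two null coframes of one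
  metric to be compared.\<close>

lemma (in null_frame) gram_eta:
  assumes x: "x \<in> Om"
  shows "(\<Sum>a\<in>UNIV. eta (opp a) i x * eta a j x) = (1/2) * gc i j x"
proof -
  have "(\<Sum>a\<in>UNIV. eta (opp a) i x * eta a j x) = (1/2) * (\<Sum>m\<in>UNIV. gc i m x * (\<Sum>a\<in>UNIV. H a m x * eta a j x))"
    by (simp add: eta_def[of "opp _" i] sum_2 sum_charge algebra_simps)
  also have "\<dots> = (1/2) * gc i j x" unfolding complete[OF x] using exhaust_2[of j] by (auto simp: sum_2)
  finally show ?thesis .
qed

section \<open>Parallel tensors in a chart\<close>

context const_frame
begin

lemma parallel_pd:
  assumes X: "\<And>idx. length idx = length w \<Longrightarrow> smooth_on Om (X idx)"
    and par: "\<And>idx. length idx = length w \<Longrightarrow> contra_deriv g i X idx x = 0" and x: "x \<in> Om"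
  shows "pd i (con eta X w) x = - of_int (charge_sum w) * th i x * con eta X w x"
proof -
  have "con eta (gD (\<lambda>k i m. Gam k i m) X i) w x = pd i (con eta X w) x - (- th i x) * of_int (charge_sum w) * con eta X w x"
    by (rule con_gD[OF op eta_smooth x _ X]) (simp_all add: pd_eta[OF x])
  moreover have "con eta (gD (\<lambda>k i m. Gam k i m) X i) w x = con eta (\<lambda>idx x. 0) w x"
    by (rule con_cong) (use par in \<open>simp add: contra_deriv_def gD_def Gam_def scaleR_conv_of_real\<close>)
  moreover have "con eta (\<lambda>idx x. 0) w x = 0" by (simp add: con_closed)
  ultimately show ?thesis by (simp add: eq_neg_iff_add_eq_0 mult_ac)
qed

text \<open>A parallel component \<open>a\<close> of charge \<open>c\<close> satisfies
  \<open>da = - c a th\<close>. Equality of its mixed second derivatives forces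
  \<open>c * Omega * a = 0\<close>, and \<open>Omega\<close> has no zeros as \<open>K\<close> is
  nonzero.\<close>

lemma parallel_charge:
  assumes X: "\<And>idx. length idx = length w \<Longrightarrow> smooth_on Om (X idx)"
    and par: "\<And>i idx x. x \<in> Om \<Longrightarrow> length idx = length w \<Longrightarrow> contra_deriv g i X idx x = 0" and x: "x \<in> Om"
    and K: "K \<noteq> 0" and c: "charge_sum w \<noteq> 0"
  shows "con eta X w x = 0"
proof -
  define a where "a = con eta X w"
  define c where "c = (of_int (charge_sum w) :: complex)"
  have as: "smooth_on Om a" unfolding a_def by (rule con_smooth[OF op eta_smooth X])
  have pa: "pd i a y = - c * (th i y * a y)" if "y \<in> Om" for i y
    using parallel_pd[OF X par[OF that] that] by (simp add: a_def c_def mult.assoc)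
  have d: "(\<lambda>y. th j y * a y) differentiable at x" for j
    by (rule sd[OF _ x], intro sm_rules th_smooth as)
  have pp: "pd i (pd j a) x = - c * (th j x * (- c * (th i x * a x)) + pd i (th j) x * a x)" for i j
  proof -
    have "pd i (pd j a) x = pd i (\<lambda>y. - c * (th j y * a y)) x" by (rule pd_cong[OF op x pa])
    also have "\<dots> = - c * pd i (\<lambda>y. th j y * a y) x" by (rule pd_cmult[OF d])
    finally show ?thesis by (simp only: pd_mult[OF sd[OF th_smooth x] sd[OF as x]] pa[OF x])
  qed
  have "pd 1 (pd 2 a) x = pd 2 (pd 1 a) x" by (rule pd_commute[OF op as x])
  then have "c * (Omega x * a x) = 0" unfolding pp Omega_def by (auto simp: algebra_simps)
  moreover have "Omega x \<noteq> 0" using curv[OF x] K by auto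
  moreover have "c \<noteq> 0" using assms(5) by (simp add: c_def)
  ultimately show ?thesis by (simp add: a_def)
qed

lemma parallel_local:
  assumes X: "\<And>idx. length idx = length w \<Longrightarrow> smooth_on Om (X idx)"
    and par: "\<And>i idx x. x \<in> Om \<Longrightarrow> length idx = length w \<Longrightarrow> contra_deriv g i X idx x = 0" and x: "x \<in> Om"
    and c: "charge_sum w = 0" and T: "ball x e \<subseteq> Om" and y: "y \<in> ball x e"
  shows "con eta X w y = con eta X w x"
proof -
  define a where "a = con eta X w"
  have as: "smooth_on Om a" unfolding a_def by (rule con_smooth[OF op eta_smooth X])
  have "(a has_derivative (\<lambda>h. 0)) (at z within ball x e)" if "z \<in> ball x e" for z
  proof -
    have z: "z \<in> Om" using T that by blast
    have "pd i a z = 0" for i using parallel_pd[OF X par[OF z] z] c by (simp add: a_def)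
    then show ?thesis using has_derivative_pd[OF sd[OF as z]] by (simp add: has_derivative_at_withinI)
  qed
  from has_derivative_zero_unique[OF convex_ball this, of y x] y
  show ?thesis unfolding a_def by (simp add: dist_norm) (metis centre_in_ball dist_norm le_less_trans norm_ge_zero)
qed

end

section \<open>Surfaces of constant curvature\<close>

locale surf = riemannian_surface A G
  for A :: "'m::{t2_space,second_countable_topology} chart set" and G +
  fixes K :: real
  assumes conn: "connected (UNIV :: 'm set)" and cc: "constant_curvature A G K" and K0: "K \<noteq> 0"
begin

lemma chart:
  assumes "c \<in> A"
  shows "open (cdom c)" "open (coord c ` cdom c)"
    "homeomorphism (cdom c) (coord c ` cdom c) (coord c) (cinv c)"
    "q \<in> cdom c \<Longrightarrow> cinv c (coord c q) = q"
    "open V \<Longrightarrow> open (coord c ` (cdom c \<inter> V))"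
proof -
  show o: "open (cdom c)" "open (coord c ` cdom c)"
    and h: "homeomorphism (cdom c) (coord c ` cdom c) (coord c) (cinv c)"
    using atlas assms by (auto simp: smooth_atlas_def)
  show "q \<in> cdom c \<Longrightarrow> cinv c (coord c q) = q" by (rule homeomorphism_apply1[OF h])
  assume "open V"
  then have "openin (top_of_set (cdom c)) (cdom c \<inter> V)" by (simp add: openin_open_Int)
  then have "openin (top_of_set (coord c ` cdom c)) (coord c ` (cdom c \<inter> V))"
    by (rule homeomorphism_imp_open_map[OF h])
  then show "open (coord c ` (cdom c \<inter> V))" using o(2) openin_open_trans by blast
qed

definition ch :: "'m \<Rightarrow> 'm chart" where
  "ch q = (SOME c. c \<in> A \<and> q \<in> cdom c)"

lemma ch: "ch q \<in> A" "q \<in> cdom (ch q)"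
proof -
  have "q \<in> (\<Union>c\<in>A. cdom c)" using atlas by (simp add: smooth_atlas_def)
  then have "\<exists>c. c \<in> A \<and> q \<in> cdom c" by blast
  from someI_ex[OF this] show "ch q \<in> A" "q \<in> cdom (ch q)" by (auto simp: ch_def)
qed

text \<open>Frames are fixed chart by chart; frames of overlapping charts are related only through
  their Gram matrices.\<close>

definition fr :: "'m chart \<Rightarrow> charge \<Rightarrow> 2 \<Rightarrow> real^2 \<Rightarrow> complex" where
  "fr c = (SOME H. null_frame (coord c ` cdom c) (G c) H)"

lemma fr:
  assumes c: "c \<in> A"
  shows "const_frame (coord c ` cdom c) (G c) (fr c) K"
proof -
  have "\<exists>H. null_frame (coord c ` cdom c) (G c) H"
    using chart(2)[OF c] metric_smooth[OF c] metric_sym[OF c] metric_pos[OF c] by (intro null_frame_exists) auto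
  then have n: "null_frame (coord c ` cdom c) (G c) (fr c)" unfolding fr_def by (rule someI_ex)
  interpret null_frame "coord c ` cdom c" "G c" "fr c" by (rule n)
  have ax: "(axis 1 1 :: real^2) \<noteq> axis 2 1" by (simp add: axis_eq_axis)
  have "independent {axis 1 1, axis 2 1 :: real^2}"
    by (rule independent_mono[OF independent_Basis]) (auto simp: axis_in_Basis_iff)
  then have "sectional_curvature (G c) x (axis 1 1) (axis 2 1) = K" if "x \<in> coord c ` cdom c" for x
    using cc c that ax unfolding constant_curvature_def by blast
  then show ?thesis
    using n curvature_Omega by (auto simp: const_frame_def const_frame_axioms_def)
qed

lemma fr_sub:
  assumes "c \<in> A" "open V"
  shows "const_frame (coord c ` (cdom c \<inter> V)) (G c) (fr c) K"
  by (rule const_frame_subset[OF fr[OF assms(1)] chart(5)[OF assms]]) auto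

lemma trans_apply: "c \<in> A \<Longrightarrow> q \<in> cdom c \<Longrightarrow> trans_map c d (coord c q) = coord d q"
  by (simp add: trans_map_def chart(4))

lemma trans_smooth: "c \<in> A \<Longrightarrow> d \<in> A \<Longrightarrow> smooth_on (coord c ` (cdom c \<inter> cdom d)) (trans_map c d)"
  using atlas by (auto simp: smooth_atlas_def)

lemma smooth_funD:
  "h \<in> smooth_fun A U \<Longrightarrow> c \<in> A \<Longrightarrow> smooth_on (coord c ` (cdom c \<inter> U)) (h \<circ> cinv c)"
  "h \<in> smooth_fun A U \<Longrightarrow> q \<notin> U \<Longrightarrow> h q = 0"
  by (auto simp: smooth_fun_def)

text \<open>On the overlap the transition map is an isometry between the two chart metrics, so
  \<open>laplace_transport\<close> applies.\<close>

lemma laplace_chart: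
  assumes U: "open U" and h: "h \<in> smooth_fun A U" and c: "c \<in> A" and d: "d \<in> A"
    and q: "q \<in> cdom c" "q \<in> cdom d" "q \<in> U"
  shows "laplace (G c) (h \<circ> cinv c) (coord c q) = laplace (G d) (h \<circ> cinv d) (coord d q)"
proof -
  define Oc Od where "Oc = coord c ` (cdom c \<inter> (cdom d \<inter> U))" and "Od = coord d ` (cdom d \<inter> (cdom c \<inter> U))"
  interpret D: const_frame Od "G d" "fr d" K
    unfolding Od_def by (intro fr_sub d open_Int chart(1) c U)
  have oc: "open Oc" unfolding Oc_def by (intro chart(5) c open_Int chart(1) d U)
  have y: "coord d q \<in> Od" using q by (auto simp: Od_def)
  have sub: "Oc \<subseteq> coord c ` (cdom c \<inter> cdom d)" "Od \<subseteq> coord d ` (cdom d \<inter> cdom c)"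
    "Oc \<subseteq> coord c ` (cdom c \<inter> U)" "Oc \<subseteq> coord c ` cdom c" "Od \<subseteq> coord d ` (cdom d \<inter> U)"
    by (auto simp: Oc_def Od_def)
  have "laplace (G c) (h \<circ> cinv c) (trans_map d c (coord d q))
      = laplace (G d) (\<lambda>y. (h \<circ> cinv c) (trans_map d c y)) (coord d q)"
  proof (rule laplace_transport[OF D.null_frame_axioms oc _ _ _ _ _ _ _ _ y, where \<tau> = "trans_map c d"])
    show "trans_map c d x \<in> Od \<and> trans_map d c (trans_map c d x) = x" if "x \<in> Oc" for x
      using that c d by (auto simp: Oc_def Od_def trans_apply)
    show "trans_map d c y \<in> Oc \<and> trans_map c d (trans_map d c y) = y" if "y \<in> Od" for y
      using that c d by (auto simp: Oc_def Od_def trans_apply)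
    show "smooth_on Oc (trans_map c d)" "smooth_on Od (trans_map d c)"
      using smooth_subset[OF trans_smooth] sub c d by blast+
    show "smooth_on Oc (G c)" by (rule smooth_subset[OF metric_smooth[OF c] sub(4)])
    show "transpose (G c x) = G c x" if "x \<in> Oc" for x using metric_sym[OF c] that sub(4) by blast
    show "G d y = transpose (jacobian (trans_map d c) (at y)) ** G c (trans_map d c y) ** jacobian (trans_map d c) (at y)"
      if "y \<in> Od" for y using metric_trans[OF d c] that sub(2) by blast
    show "smooth_on Oc (h \<circ> cinv c)" by (rule smooth_subset[OF smooth_funD(1)[OF h c] sub(3)])
  qed
  also have "trans_map d c (coord d q) = coord c q" by (rule trans_apply[OF d q(2)])
  also have "laplace (G d) (\<lambda>y. (h \<circ> cinv c) (trans_map d c y)) (coord d q) = laplace (G d) (h \<circ> cinv d) (coord d q)"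
  proof -
    have e: "(h \<circ> cinv c) (trans_map d c y) = (h \<circ> cinv d) y" if "y \<in> Od" for y
      using that by (auto simp: Od_def trans_apply[OF d] chart(4)[OF c] chart(4)[OF d])
    have s: "smooth_on Od (h \<circ> cinv d)" by (rule smooth_subset[OF smooth_funD(1)[OF h d] sub(5)])
    then have s': "smooth_on Od (\<lambda>y. (h \<circ> cinv c) (trans_map d c y))" using smooth_cong[OF D.op, of "\<lambda>y. (h \<circ> cinv c) (trans_map d c y)" "h \<circ> cinv d"] e by blast
    show ?thesis
      unfolding D.laplace_lapl[OF s y] D.laplace_lapl[OF s' y] unfolding D.lapl_def
      by (intro D.st_cong e y)
  qed
  finally show ?thesis .
qed

section \<open>The Laplacian and the operators C_w(\<Delta>) on functions on U\<close>

definition Lap :: "'m set \<Rightarrow> ('m \<Rightarrow> complex) \<Rightarrow> 'm \<Rightarrow> complex" where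
  "Lap U h q = (if q \<in> U then laplace (G (ch q)) (h \<circ> cinv (ch q)) (coord (ch q) q) else 0)"

context
  fixes U :: "'m set" assumes U: "open U"
begin

lemma Lap_chart:
  assumes "h \<in> smooth_fun A U" "c \<in> A" "q \<in> cdom c" "q \<in> U"
  shows "Lap U h q = laplace (G c) (h \<circ> cinv c) (coord c q)"
  using laplace_chart[OF U assms(1) ch(1) assms(2) ch(2) assms(3,4)] assms(4) by (simp add: Lap_def)

lemma Lap_lapl:
  assumes h: "h \<in> smooth_fun A U" and c: "c \<in> A" and x: "x \<in> coord c ` (cdom c \<inter> U)"
  shows "(Lap U h \<circ> cinv c) x = null_frame.lapl (G c) (fr c) (h \<circ> cinv c) x"
proof -
  interpret C: const_frame "coord c ` (cdom c \<inter> U)" "G c" "fr c" K by (rule fr_sub[OF c U])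
  show ?thesis
    using x C.laplace_lapl[OF smooth_funD(1)[OF h c] x] by (auto simp: chart(4)[OF c] Lap_chart[OF h c])
qed

lemma Lap_smooth:
  assumes h: "h \<in> smooth_fun A U"
  shows "Lap U h \<in> smooth_fun A U"
  unfolding smooth_fun_def
proof (intro CollectI conjI ballI allI impI)
  show "q \<notin> U \<Longrightarrow> Lap U h q = 0" for q by (simp add: Lap_def)
  fix c assume c: "c \<in> A"
  interpret C: const_frame "coord c ` (cdom c \<inter> U)" "G c" "fr c" K by (rule fr_sub[OF c U])
  show "smooth_on (coord c ` (cdom c \<inter> U)) (Lap U h \<circ> cinv c)"
    using smooth_cong[OF C.op, of "Lap U h \<circ> cinv c" "C.lapl (h \<circ> cinv c)"] Lap_lapl[OF h c]
      C.lapl_smooth[OF smooth_funD(1)[OF h c]] by blast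
qed

lemma smooth_fun_zero: "(\<lambda>_. 0) \<in> smooth_fun A U"
  by (auto simp: smooth_fun_def comp_def smooth_const)

lemma smooth_fun_add: "h \<in> smooth_fun A U \<Longrightarrow> k \<in> smooth_fun A U \<Longrightarrow> (\<lambda>q. h q + k q) \<in> smooth_fun A U"
proof (unfold smooth_fun_def, intro CollectI conjI ballI allI impI)
  assume h: "h \<in> {h. (\<forall>q. q \<notin> U \<longrightarrow> h q = 0) \<and> (\<forall>c\<in>A. smooth_on (coord c ` (cdom c \<inter> U)) (h \<circ> cinv c))}"
    "k \<in> {h. (\<forall>q. q \<notin> U \<longrightarrow> h q = 0) \<and> (\<forall>c\<in>A. smooth_on (coord c ` (cdom c \<inter> U)) (h \<circ> cinv c))}"
  show "q \<notin> U \<Longrightarrow> h q + k q = 0" for q using h by simp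
  fix c assume "c \<in> A"
  then show "smooth_on (coord c ` (cdom c \<inter> U)) ((\<lambda>q. h q + k q) \<circ> cinv c)"
    using smooth_add[OF chart(5)[OF _ U], of c "h \<circ> cinv c" "k \<circ> cinv c"] h by (simp add: comp_def)
qed

lemma smooth_fun_cmult: "h \<in> smooth_fun A U \<Longrightarrow> (\<lambda>q. z * h q) \<in> smooth_fun A U"
proof (unfold smooth_fun_def, intro CollectI conjI ballI allI impI)
  assume h: "h \<in> {h. (\<forall>q. q \<notin> U \<longrightarrow> h q = 0) \<and> (\<forall>c\<in>A. smooth_on (coord c ` (cdom c \<inter> U)) (h \<circ> cinv c))}"
  show "q \<notin> U \<Longrightarrow> z * h q = 0" for q using h by simp
  fix c assume "c \<in> A"
  then show "smooth_on (coord c ` (cdom c \<inter> U)) ((\<lambda>q. z * h q) \<circ> cinv c)"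
    using smooth_mult[OF chart(5)[OF _ U] smooth_const, of c "h \<circ> cinv c" z] h by (simp add: comp_def)
qed

lemma smooth_fun_sum: "(\<And>b. b \<in> B \<Longrightarrow> h b \<in> smooth_fun A U) \<Longrightarrow> (\<lambda>q. \<Sum>b\<in>B. h b q) \<in> smooth_fun A U"
  by (induction B rule: infinite_finite_induct) (auto intro: smooth_fun_add smooth_fun_zero)

lemma Lap_lincomb:
  assumes h: "h \<in> smooth_fun A U" and k: "k \<in> smooth_fun A U"
  shows "Lap U (\<lambda>q. h q + z * k q) = (\<lambda>q. Lap U h q + z * Lap U k q)"
proof
  fix q
  note hk = smooth_fun_add[OF h smooth_fun_cmult[OF k, of z]]
  show "Lap U (\<lambda>q. h q + z * k q) q = Lap U h q + z * Lap U k q"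
  proof (cases "q \<in> U")
    case True
    define c where "c = ch q"
    have c: "c \<in> A" "q \<in> cdom c" by (simp_all add: c_def ch)
    interpret C: const_frame "coord c ` (cdom c \<inter> U)" "G c" "fr c" K by (rule fr_sub[OF c(1) U])
    have x: "coord c q \<in> coord c ` (cdom c \<inter> U)" using True c by blast
    have "C.lapl ((\<lambda>q. h q + z * k q) \<circ> cinv c) (coord c q) =
        C.lapl (h \<circ> cinv c) (coord c q) + z * C.lapl (k \<circ> cinv c) (coord c q)"
      using C.act_lincomb[OF smooth_funD(1)[OF h c(1)] smooth_funD(1)[OF k c(1)] x, of "[Pls, Mns]" z]
      by (simp add: C.lapl_def comp_def)
    then show ?thesis
      using Lap_lapl[OF h c(1) x] Lap_lapl[OF k c(1) x] Lap_lapl[OF hk c(1) x] chart(4)[OF c] by (simp add: comp_def)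
  qed (simp add: Lap_def)
qed

lemma opP_smooth_fun: "h \<in> smooth_fun A U \<Longrightarrow> opP K (Lap U) w h \<in> smooth_fun A U"
  by (induction w) (auto intro!: smooth_fun_add smooth_fun_cmult Lap_smooth)

lemma opP_lincomb:
  assumes h: "h \<in> smooth_fun A U" and k: "k \<in> smooth_fun A U"
  shows "opP K (Lap U) w (\<lambda>q. h q + z * k q) = (\<lambda>q. opP K (Lap U) w h q + z * opP K (Lap U) w k q)"
proof (induction w)
  case (Cons a w)
  then show ?case
    by (simp add: Lap_lincomb[OF opP_smooth_fun[OF h] opP_smooth_fun[OF k]] algebra_simps)
qed simp

lemma opP_chart:
  assumes h: "h \<in> smooth_fun A U" and c: "c \<in> A"
  shows "x \<in> coord c ` (cdom c \<inter> U) \<Longrightarrow>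
    (opP K (Lap U) w h \<circ> cinv c) x = opP K (null_frame.lapl (G c) (fr c)) w (h \<circ> cinv c) x"
proof (induction w arbitrary: x)
  case (Cons a w)
  interpret C: const_frame "coord c ` (cdom c \<inter> U)" "G c" "fr c" K by (rule fr_sub[OF c U])
  have "(Lap U (opP K (Lap U) w h) \<circ> cinv c) x = C.lapl (opP K (Lap U) w h \<circ> cinv c) x"
    by (rule Lap_lapl[OF opP_smooth_fun[OF h] c Cons.prems])
  also have "\<dots> = C.lapl (opP K C.lapl w (h \<circ> cinv c)) x"
    unfolding C.lapl_def by (intro C.st_cong Cons.IH[unfolded C.lapl_def] Cons.prems)
  finally show ?case using Cons.IH[OF Cons.prems] by (simp add: comp_def)
qed simp

end

section \<open>Parallel sections and the action of their constant coefficients\<close>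

lemma parallel_sectionsD:
  assumes "X \<in> parallel_sections A G k" "c \<in> A"
  shows "length idx = k \<Longrightarrow> smooth_on (coord c ` cdom c) (X c idx)"
    "x \<in> coord c ` cdom c \<Longrightarrow> length idx = k \<Longrightarrow> contra_deriv (G c) i (X c) idx x = 0"
    "d \<in> A \<Longrightarrow> x \<in> coord c ` (cdom c \<inter> cdom d) \<Longrightarrow> length idx = k \<Longrightarrow>
       X d idx (trans_map c d x) = (\<Sum>jdx | length jdx = k.
             (\<Prod>r<k. jacobian (trans_map c d) (at x) $ (idx ! r) $ (jdx ! r)) *\<^sub>R X c jdx x)"
  using assms unfolding parallel_sections_def by blast+

definition cf :: "('m chart \<Rightarrow> tensor_comps) \<Rightarrow> 'm chart \<Rightarrow> charge list \<Rightarrow> 'm \<Rightarrow> complex" where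
  "cf X c w q = con (null_frame.eta (G c) (fr c)) (X c) w (coord c q)"

text \<open>For \<open>B\<close> invariant under exchanging signs no change of null frame affects
  this combination, since the components of nonzero charge vanish. It stands in for the components
  themselves, which are constant only within a frame.\<close>

definition JJ :: "('m chart \<Rightarrow> tensor_comps) \<Rightarrow> nat \<Rightarrow> (charge list \<Rightarrow> complex) \<Rightarrow> 'm chart \<Rightarrow> 'm \<Rightarrow> complex" where
  "JJ X k B c q = (\<Sum>w | length w = k. cf X c w q * B w)"

context
  fixes X k assumes X: "X \<in> parallel_sections A G k"
begin

lemma cf_charge:
  assumes "c \<in> A" "q \<in> cdom c" "length w = k" "charge_sum w \<noteq> 0"
  shows "cf X c w q = 0"
proof -
  interpret C: const_frame "coord c ` cdom c" "G c" "fr c" K by (rule fr[OF assms(1)])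
  show ?thesis
    unfolding cf_def
    by (rule C.parallel_charge[OF _ _ _ K0 assms(4)]) (use parallel_sectionsD[OF X assms(1)] assms in auto)
qed

context
  fixes B :: "charge list \<Rightarrow> complex" assumes B: "\<And>w. B (map opp w) = B w"
begin

lemma JJ_chart:
  assumes c: "c \<in> A" and d: "d \<in> A" and q: "q \<in> cdom c" "q \<in> cdom d"
  shows "JJ X k B d q = JJ X k B c q"
proof -
  interpret C: const_frame "coord c ` cdom c" "G c" "fr c" K by (rule fr[OF c])
  interpret D: const_frame "coord d ` cdom d" "G d" "fr d" K by (rule fr[OF d])
  define x y where "x = coord c q" and "y = coord d q"
  have x: "x \<in> coord c ` cdom c" "x \<in> coord c ` (cdom c \<inter> cdom d)" and y: "y \<in> coord d ` cdom d"
    using q by (auto simp: x_def y_def)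
  have t: "trans_map c d x = y" using trans_apply[OF c q(1)] by (simp add: x_def y_def)
  define J where "J i j = complex_of_real (jacobian (trans_map c d) (at x) $ i $ j)" for i j
  \<comment> \<open>The coframe of \<open>d\<close> pulled back to the chart \<open>c\<close>; its
    Gram matrix agrees with that of the coframe of \<open>c\<close> because both represent the
    metric.\<close>
  define E' where "E' a j = (\<Sum>i\<in>UNIV. D.eta a i y * J i j)" for a j
  have d1: "cf X d w q = pc E' (\<lambda>idx. X c idx x) w" if "length w = k" for w
    unfolding cf_def con_pc y_def[symmetric] E'_def
  proof (rule pc_transform)
    fix idx :: "2 list" assume "length idx = length w"
    then show "X d idx y = (\<Sum>jdx | length jdx = length w. (\<Prod>r<length w. J (idx ! r) (jdx ! r)) * X c jdx x)"
      using parallel_sectionsD(3)[OF X c d x(2), of idx] that t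
      by (simp add: J_def scaleR_conv_of_real)
  qed
  have c1: "cf X c w q = pc (\<lambda>a i. C.eta a i x) (\<lambda>idx. X c idx x) w" for w
    unfolding cf_def con_pc x_def ..
  have "C.gc i j x = (\<Sum>n\<in>UNIV. (\<Sum>m\<in>UNIV. J m i * D.gc m n y) * J n j)" for i j
    unfolding C.gc_def D.gc_def J_def metric_trans[OF c d x(2)] t
    by (simp add: matrix_matrix_mult_def transpose_def)
  note gg = this
  have "(\<Sum>a\<in>UNIV. E' (opp a) i * E' a j) = (\<Sum>n\<in>UNIV. \<Sum>m\<in>UNIV. J m i * J n j * (\<Sum>a\<in>UNIV. D.eta (opp a) m y * D.eta a n y))" for i j
    by (simp add: E'_def sum_2 sum_charge algebra_simps)
  then have gram: "(\<Sum>a\<in>UNIV. E' (opp a) i * E' a j) = (\<Sum>a\<in>UNIV. C.eta (opp a) i x * C.eta a j x)" for i j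
    unfolding D.gram_eta[OF y] C.gram_eta[OF x(1)] gg by (simp add: sum_2 algebra_simps)
  have z: "pc (\<lambda>a i. C.eta a i x) (\<lambda>idx. X c idx x) w = 0" if "length w = k" "charge_sum w \<noteq> 0" for w
    using cf_charge[OF c q(1) that] by (simp add: c1)
  from coframe_change_sum(2)[where B = B and h = "\<lambda>a i. fr c a i x", OF gram C.dual[OF x(1)] C.complete[OF x(1)] z B]
  show ?thesis by (simp add: JJ_def d1 c1)
qed

text \<open>Near a point, in one chart, the components of charge 0 are constant and the others
  vanish. Independence of the chart and connectedness of the surface do the rest.\<close>

lemma JJ_const:
  assumes c: "c \<in> A" and d: "d \<in> A" and q: "q \<in> cdom c" "q' \<in> cdom d"
  shows "JJ X k B c q = JJ X k B d q'"
proof -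
  have loc: "eventually (\<lambda>b. JJ X k B (ch q) q = JJ X k B (ch b) b) (at q)" for q
  proof -
    define c where "c = ch q"
    have c: "c \<in> A" "q \<in> cdom c" by (simp_all add: c_def ch)
    interpret C: const_frame "coord c ` cdom c" "G c" "fr c" K by (rule fr[OF c(1)])
    have xq: "coord c q \<in> coord c ` cdom c" using c by blast
    obtain e where e: "e > 0" "ball (coord c q) e \<subseteq> coord c ` cdom c"
      using C.op xq by (meson openE)
    define N where "N = cdom c \<inter> coord c -` ball (coord c q) e"
    have "open N"
      unfolding N_def
      using continuous_open_preimage[OF homeomorphism_cont1[OF chart(3)[OF c(1)]] chart(1)[OF c(1)] open_ball] .
    moreover have "q \<in> N" using c e by (simp add: N_def)
    moreover have "JJ X k B (ch q) q = JJ X k B (ch b) b" if b: "b \<in> N" for b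
    proof -
      have bc: "b \<in> cdom c" "coord c b \<in> ball (coord c q) e" using b by (auto simp: N_def)
      have "cf X c w b = cf X c w q" if w: "length w = k" for w
      proof (cases "charge_sum w = 0")
        case True
        show ?thesis unfolding cf_def
          by (rule C.parallel_local[OF _ _ xq True e(2) bc(2)]) (use parallel_sectionsD[OF X c(1)] w in auto)
      qed (use cf_charge[OF c(1)] bc c w in simp)
      then have "JJ X k B c b = JJ X k B c q" by (simp add: JJ_def)
      then show ?thesis using JJ_chart[OF ch(1) c(1) ch(2) bc(1)] by (simp add: c_def[symmetric])
    qed
    ultimately show ?thesis unfolding eventually_at_topological by blast
  qed
  have "JJ X k B (ch q) q = JJ X k B (ch q') q'"
    by (rule connected_local_const[OF conn]) (use loc in auto)
  then show ?thesis using JJ_chart[OF c ch(1) q(1) ch(2)] JJ_chart[OF d ch(1) q(2) ch(2)] by simp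
qed

end

end

text \<open>In the frame around \<open>q\<close> a word of charge 0 acts as \<open>opP\<close>,
  weighted with the component of the section at \<open>q\<close>. \<open>JJ_const\<close>, with
  \<open>B w\<close> the value of that operator at \<open>q\<close>, replaces these components by
  those at \<open>p\<close>, and a last change of coframe turns them into \<open>a\<close>.\<close>

lemma section_act_eq:
  assumes U: "open U" and X: "X \<in> parallel_sections A G k" and h: "h \<in> smooth_fun A U"
    and c0: "c0 \<in> A" "p \<in> cdom c0"
    and on: "gdot (G c0) (coord c0 p) e1 e1 = 1" "gdot (G c0) (coord c0 p) e2 e2 = 1"
      "gdot (G c0) (coord c0 p) e1 e2 = 0"
    and a: "\<And>idx. length idx = k \<Longrightarrow> X c0 idx (coord c0 p) =
             (\<Sum>w | length w = k. a w * (\<Prod>r<k. hvec e1 e2 (w ! r) $ (idx ! r)))"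
  shows "length w = k \<Longrightarrow> charge_sum w \<noteq> 0 \<Longrightarrow> a w = 0"
    and "section_act A G U k X h =
      (\<lambda>q. \<Sum>w | length w = k. a w * (if charge_sum w = 0 then opP K (Lap U) w h q else 0))"
proof -
  interpret C: const_frame "coord c0 ` cdom c0" "G c0" "fr c0" K by (rule fr[OF c0(1)])
  define x where "x = coord c0 p"
  have x: "x \<in> coord c0 ` cdom c0" using c0 by (simp add: x_def)
  define hh where "hh a i = hvec e1 e2 a $ i" for a i
  have sy: "G c0 x $ 2 $ 1 = G c0 x $ 1 $ 2" by (rule C.g_sym[OF x])
  \<comment> \<open>The metric is frozen at \<open>p\<close>: the vectors \<open>h_+\<close> and
    \<open>h_-\<close>, extended by constants, then form a null frame, and the general theory
    supplies their dual coframe.\<close>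
  have nf: "null_frame UNIV (\<lambda>_. G c0 x) (\<lambda>a i _. hh a i)"
  proof
    show "transpose (G c0 x) = G c0 x" by (rule C.gsym[OF x])
    fix b b'
    define g1 g2 g3 where "g1 = complex_of_real (gdot (G c0) x e1 e1)" and "g2 = complex_of_real (gdot (G c0) x e2 e2)"
      and "g3 = complex_of_real (gdot (G c0) x e1 e2)"
    have g: "g1 = 1" "g2 = 1" "g3 = 0" using on by (simp_all add: g1_def g2_def g3_def x_def)
    have "(\<Sum>i\<in>UNIV. \<Sum>j\<in>UNIV. complex_of_real (G c0 x $ i $ j) * hh b i * hh b' j) =
      g1 - of_int (cval b * cval b') * g2 - \<i> * of_int (cval b + cval b') * g3"
      unfolding g1_def g2_def g3_def hh_def hvec_def gdot_def
      by (simp add: inner_vec_def matrix_vector_mult_def sum_2 sy algebra_simps)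
    also have "\<dots> = (if b = b' then 0 else 2)" unfolding g by (cases b; cases b') simp_all
    finally show "(\<Sum>i\<in>UNIV. \<Sum>j\<in>UNIV. complex_of_real (G c0 x $ i $ j) * hh b i * hh b' j) = (if b = b' then 0 else 2)" .
  qed (simp_all add: smooth_const)
  interpret P: null_frame UNIV "\<lambda>_. G c0 x" "\<lambda>a i _. hh a i" by (rule nf)
  define E' where "E' a j = P.eta a j x" for a j
  have aw: "pc E' (\<lambda>idx. X c0 idx x) w = a w" if "length w = k" for w
    by (rule pc_dual[where h = hh]) (use P.dual[of x] a that in \<open>auto simp: E'_def x_def hh_def\<close>)
  have gram: "(\<Sum>a\<in>UNIV. E' (opp a) i * E' a j) = (\<Sum>a\<in>UNIV. C.eta (opp a) i x * C.eta a j x)" for i j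
    unfolding C.gram_eta[OF x] E'_def using P.gram_eta[of x i j] by (simp add: P.gc_def C.gc_def)
  have c1: "cf X c0 w p = pc (\<lambda>a i. C.eta a i x) (\<lambda>idx. X c0 idx x) w" for w
    unfolding cf_def con_pc x_def ..
  have z: "pc (\<lambda>a i. C.eta a i x) (\<lambda>idx. X c0 idx x) w = 0" if "length w = k" "charge_sum w \<noteq> 0" for w
    using cf_charge[OF X c0 that] by (simp add: c1)

  show "a w = 0" if w: "length w = k" "charge_sum w \<noteq> 0"
  proof -
    have "pc E' (\<lambda>idx. X c0 idx x) w = 0"
      by (rule coframe_change_sum(1)[where B = "\<lambda>_. 0", OF gram C.dual[OF x] C.complete[OF x] z _ w]) auto
    then show ?thesis using aw[OF w(1)] by simp
  qed
  show "section_act A G U k X h =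
      (\<lambda>q. \<Sum>w | length w = k. a w * (if charge_sum w = 0 then opP K (Lap U) w h q else 0))"
  proof
    fix q
    show "section_act A G U k X h q = (\<Sum>w | length w = k. a w * (if charge_sum w = 0 then opP K (Lap U) w h q else 0))"
    proof (cases "q \<in> U")
      case False
      then have "(\<Sum>w | length w = k. a w * (if charge_sum w = 0 then opP K (Lap U) w h q else 0)) = 0"
        by (intro sum.neutral) (use smooth_funD(2)[OF opP_smooth_fun[OF U h]] in auto)
      then show ?thesis using False by (simp add: section_act_def)
    next
      case True
      define B where "B w = (if charge_sum w = 0 then opP K (Lap U) w h q else 0)" for w
      have B: "B (map opp w) = B w" for w by (simp add: B_def charge_sum_map_opp opP_opp)
      define c where "c = ch q"
      have c: "c \<in> A" "q \<in> cdom c" by (simp_all add: c_def ch)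
      interpret Q: const_frame "coord c ` cdom c" "G c" "fr c" K by (rule fr[OF c(1)])
      interpret QU: const_frame "coord c ` (cdom c \<inter> U)" "G c" "fr c" K by (rule fr_sub[OF c(1) U])
      have y: "coord c q \<in> coord c ` cdom c" "coord c q \<in> coord c ` (cdom c \<inter> U)" using c True by auto
      have "section_act A G U k X h q =
          (\<Sum>idx | length idx = k. nabla (G c) k (h \<circ> cinv c) idx (coord c q) * X c idx (coord c q))"
        using True by (simp add: section_act_def Let_def c_def ch_def)
      also have "\<dots> = (\<Sum>w | length w = k. con (fr c) (nabla (G c) k (h \<circ> cinv c)) w (coord c q) * cf X c w q)"
        unfolding cf_def by (rule pairing) (rule Q.complete[OF y(1)])
      also have "\<dots> = (\<Sum>w | length w = k. cf X c w q * B w)"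
      proof (intro sum.cong refl)
        fix w :: "charge list" assume "w \<in> {w. length w = k}"
        then have w: "length w = k" by simp
        show "con (fr c) (nabla (G c) k (h \<circ> cinv c)) w (coord c q) * cf X c w q = cf X c w q * B w"
        proof (cases "charge_sum w = 0")
          case True
          have "con (fr c) (nabla (G c) k (h \<circ> cinv c)) w (coord c q) = QU.act w (h \<circ> cinv c) (coord c q)"
            using QU.con_nabla[OF smooth_funD(1)[OF h c(1)] y(2), of w] w by simp
          also have "\<dots> = opP K QU.lapl w (h \<circ> cinv c) (coord c q)"
            by (rule QU.act_zero[OF smooth_funD(1)[OF h c(1)] y(2) True])
          also have "\<dots> = opP K (Lap U) w h q"
            using opP_chart[OF U h c(1) y(2), of w] chart(4)[OF c] by simp
          finally show ?thesis using True by (simp add: B_def)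
        qed (use cf_charge[OF X c w] in simp)
      qed
      also have "\<dots> = (\<Sum>w | length w = k. cf X c0 w p * B w)"
        using JJ_const[OF X, of B c c0 q p] B c c0 by (simp add: JJ_def)
      also have "\<dots> = (\<Sum>w | length w = k. a w * B w)"
      proof -
        have "(\<Sum>w | length w = k. pc E' (\<lambda>idx. X c0 idx x) w * B w) =
            (\<Sum>w | length w = k. pc (\<lambda>a i. C.eta a i x) (\<lambda>idx. X c0 idx x) w * B w)"
          by (rule coframe_change_sum(2)[where B = B, OF gram C.dual[OF x] C.complete[OF x] z B])
        then show ?thesis using aw by (simp add: c1)
      qed
      finally show ?thesis by (simp add: B_def)
    qed
  qed
qed

end

section \<open>The tensor module\<close>

text \<open>A suffix of charge 0 leaves the partial charges of the prefix unchanged. This makes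
  \<open>rho\<close> compatible with the balancing over parallel sections.\<close>

lemma opP_append: "charge_sum w = 0 \<Longrightarrow> opP K L (u @ w) h = opP K L u (opP K L w h)"
  by (induction u) auto

text \<open>Along a normal word, read from the right, the absolute charge only grows, so no factor
  arises.\<close>

lemma opP_nw: "opP K L (nw c) h = h"
proof -
  have cr: "charge_sum (replicate n b) = int n * cval b" for n b by (induction n) (simp_all add: algebra_simps)
  have "opP K L (replicate n b) h = h" for n b
    by (induction n) (cases b; simp add: cr)+
  then show ?thesis by (simp add: nw_def)
qed

lemma Ccoef_Cons:
  "Ccoef K lam (a # w) = (if \<bar>cval a + charge_sum w\<bar> < \<bar>charge_sum w\<bar>
     then (- lam + of_int (\<bar>charge_sum w\<bar> * (\<bar>charge_sum w\<bar> - 1)) * of_real K) * Ccoef K lam w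
     else Ccoef K lam w)"
proof -
  let ?P = "\<lambda>js q. q < length js \<and> \<bar>charge_sum (drop q js)\<bar> < \<bar>charge_sum (drop (Suc q) js)\<bar>"
  let ?t = "\<lambda>js q. - lam + of_int (\<bar>charge_sum (drop (Suc q) js)\<bar> * (\<bar>charge_sum (drop (Suc q) js)\<bar> - 1)) * complex_of_real K"
  have eq: "{q. ?P (a # w) q} = (if ?P (a # w) 0 then {0} else {}) \<union> Suc ` {q. ?P w q}"
    by (auto simp: image_iff less_Suc_eq_0_disj split: nat.splits elim: less_natE)
  have fin: "finite {q. ?P w q}" by (rule finite_subset[of _ "{..<length w}"]) auto
  have "Ccoef K lam (a # w) = (\<Prod>q\<in>(if ?P (a # w) 0 then {0} else {}). ?t (a # w) q) * (\<Prod>q\<in>Suc ` {q. ?P w q}. ?t (a # w) q)"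
    unfolding Ccoef_def eq using fin by (intro prod.union_disjoint) auto
  also have "(\<Prod>q\<in>Suc ` {q. ?P w q}. ?t (a # w) q) = Ccoef K lam w"
    unfolding Ccoef_def by (subst prod.reindex) auto
  finally show ?thesis by auto
qed

lemma opP_eigen:
  assumes "\<And>z. L (\<lambda>q. z * f q) = (\<lambda>q. z * (- lam * f q))"
  shows "opP K L w f = (\<lambda>q. Ccoef K lam w * f q)"
proof (induction w)
  case Nil then show ?case by (simp add: Ccoef_def)
next
  case (Cons a w)
  show ?case
  proof (cases "\<bar>cval a + charge_sum w\<bar> < \<bar>charge_sum w\<bar>")
    case True
    then have eq: "opP K L (a # w) f = (\<lambda>x. Ccoef K lam w * (- lam * f x) +
        of_int (\<bar>charge_sum w\<bar> * (\<bar>charge_sum w\<bar> - 1)) * of_real K * (Ccoef K lam w * f x))"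
      by (simp only: opP.simps if_True Cons assms)
    show ?thesis unfolding eq Ccoef_Cons if_P[OF True] by (rule ext) (simp add: algebra_simps)
  qed (simp add: Cons Ccoef_Cons)
qed

lemma pretensor_simps:
  "carrier (pretensor A U) = {\<xi>. finite {w. \<xi> w \<noteq> (\<lambda>_. 0)} \<and> (\<forall>w. \<xi> w \<in> smooth_fun A U)}"
  "\<zero>\<^bsub>pretensor A U\<^esub> = (\<lambda>w q. 0)" "\<xi> \<oplus>\<^bsub>pretensor A U\<^esub> \<eta> = (\<lambda>w q. \<xi> w q + \<eta> w q)"
  "z \<odot>\<^bsub>pretensor A U\<^esub> \<xi> = (\<lambda>w q. z * \<xi> w q)"
  "hmul (pretensor A U) j \<xi> = (\<lambda>w. case w of [] \<Rightarrow> (\<lambda>_. 0) | i # w' \<Rightarrow> if i = j then \<xi> w' else (\<lambda>_. 0))"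
  by (simp_all add: pretensor_def)

lemma hmul_tens: "hmul (pretensor A U) j (tens w h) = tens (j # w) h"
  by (auto simp: pretensor_simps tens_def fun_eq_iff split: list.splits)

locale surf_base = surf A G K
  for A :: "'m::{t2_space,second_countable_topology} chart set" and G K +
  fixes c0 :: "'m chart" and p :: 'm and e1 e2 :: "real^2" and U :: "'m set"
  assumes c0: "c0 \<in> A" "p \<in> cdom c0"
    and on: "gdot (G c0) (coord c0 p) e1 e1 = 1" "gdot (G c0) (coord c0 p) e2 e2 = 1"
      "gdot (G c0) (coord c0 p) e1 e2 = 0"
    and U: "open U"
begin

abbreviation "T \<equiv> pretensor A U"
abbreviation "P \<equiv> opP K (Lap U)"
abbreviation "Rel \<equiv> balance_rels A G c0 p e1 e2 U"
abbreviation "R \<equiv> balance_null A G c0 p e1 e2 U"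
abbreviation "S \<equiv> tensor_module A G c0 p e1 e2 U"

lemma T_I:
  assumes "finite B" "\<And>w. \<xi> w \<noteq> (\<lambda>_. 0) \<Longrightarrow> w \<in> B" "\<And>w. \<xi> w \<in> smooth_fun A U"
  shows "\<xi> \<in> carrier T"
  using assms finite_subset[of "{w. \<xi> w \<noteq> (\<lambda>_. 0)}" B] by (auto simp: pretensor_simps)

lemma T_D: "\<xi> \<in> carrier T \<Longrightarrow> finite {w. \<xi> w \<noteq> (\<lambda>_. 0)}" "\<xi> \<in> carrier T \<Longrightarrow> \<xi> w \<in> smooth_fun A U"
  by (auto simp: pretensor_simps)

lemmas sf = smooth_fun_zero[OF U] smooth_fun_add[OF U] smooth_fun_cmult[OF U] smooth_fun_sum[OF U]

lemma vT: "vspace T"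
proof (rule vspaceI)
  show "\<zero>\<^bsub>T\<^esub> \<in> carrier T" by (rule T_I[of "{}"]) (auto simp: pretensor_simps sf)
  fix x y :: "charge list \<Rightarrow> 'm \<Rightarrow> complex" and a :: complex
  assume x: "x \<in> carrier T"
  show "a \<odot>\<^bsub>T\<^esub> x \<in> carrier T"
    by (rule T_I[OF T_D(1)[OF x]]) (auto simp: pretensor_simps(4) intro!: sf(3) T_D(2)[OF x])
  assume y: "y \<in> carrier T"
  show "x \<oplus>\<^bsub>T\<^esub> y \<in> carrier T"
    by (rule T_I[OF finite_UnI[OF T_D(1)[OF x] T_D(1)[OF y]]])
      (auto simp: pretensor_simps(3) intro!: sf(2) T_D(2)[OF x] T_D(2)[OF y])
qed (auto simp: pretensor_simps(2-4) algebra_simps)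

lemma linop_hmul_T: "linop T (hmul T j)"
  unfolding linop_def
proof (intro conjI ballI allI)
  fix x assume x: "x \<in> carrier T"
  show "hmul T j x \<in> carrier T"
    by (rule T_I[OF finite_imageI[OF T_D(1)[OF x], of "\<lambda>w. j # w"]])
      (use T_D(2)[OF x] sf(1) in \<open>auto simp: pretensor_simps(5) split: list.splits if_splits\<close>)
qed (auto simp: pretensor_simps(3-5) fun_eq_iff split: list.splits)

lemma tens_T: "h \<in> smooth_fun A U \<Longrightarrow> tens w h \<in> carrier T"
proof (rule T_I[of "{w}"])
  fix v assume "h \<in> smooth_fun A U"
  moreover have "tens w h v = (if v = w then h else (\<lambda>_. 0))" by (auto simp: tens_def)
  ultimately show "tens w h v \<in> smooth_fun A U" using sf(1) by simp
qed (auto simp: tens_def fun_eq_iff split: if_splits)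

lemma P_zero: "P w (\<lambda>_. 0) = (\<lambda>_. 0)"
  using opP_lincomb[OF U sf(1) sf(1), of w "- 1"] by simp

lemma P_sum:
  assumes "finite B" "\<And>b. b \<in> B \<Longrightarrow> h b \<in> smooth_fun A U"
  shows "P w (\<lambda>q. \<Sum>b\<in>B. z b * h b q) = (\<lambda>q. \<Sum>b\<in>B. z b * P w (h b) q)"
  using assms
proof (induction B)
  case (insert b B)
  have "P w (\<lambda>q. (\<Sum>b\<in>B. z b * h b q) + z b * h b q) =
      (\<lambda>q. P w (\<lambda>q. \<Sum>b\<in>B. z b * h b q) q + z b * P w (h b) q)"
    using insert by (intro opP_lincomb[OF U] sf) auto
  then show ?case using insert by (simp add: add.commute)
qed (simp add: P_zero)

text \<open>\<open>rho \<xi> N\<close> is the component at \<open>N\<close> of the image of \<open>\<xi>\<close> in the module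
  \<open>\<Oplus>\<^sub>N C\<^sup>\<infinity>(U)\<close>, on which \<open>h\<^sub>\<plusminus>\<close> shifts \<open>N\<close> by \<open>\<plusminus>1\<close>, trivially away
  from \<open>0\<close> and by \<open>Lap + \<bar>N\<bar>(\<bar>N\<bar> - 1)K\<close> towards \<open>0\<close>.\<close>

definition rho :: "(charge list \<Rightarrow> 'm \<Rightarrow> complex) \<Rightarrow> int \<Rightarrow> 'm \<Rightarrow> complex" where
  "rho \<xi> N q = (\<Sum>w | \<xi> w \<noteq> (\<lambda>_. 0). if charge_sum w = N then P w (\<xi> w) q else 0)"

lemma rho_eq:
  assumes "finite B" "\<And>w. \<xi> w \<noteq> (\<lambda>_. 0) \<Longrightarrow> w \<in> B"
  shows "rho \<xi> N q = (\<Sum>w\<in>B. if charge_sum w = N then P w (\<xi> w) q else 0)"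
  unfolding rho_def
proof (rule sum.mono_neutral_left[OF assms(1)])
  show "\<forall>w\<in>B - {w. \<xi> w \<noteq> (\<lambda>_. 0)}. (if charge_sum w = N then P w (\<xi> w) q else 0) = 0"
  proof
    fix w assume "w \<in> B - {w. \<xi> w \<noteq> (\<lambda>_. 0)}"
    then have "\<xi> w = (\<lambda>_. 0)" by simp
    then show "(if charge_sum w = N then P w (\<xi> w) q else 0) = 0" by (simp add: P_zero)
  qed
qed (use assms(2) in auto)

lemma rho_lincomb:
  assumes x: "\<xi> \<in> carrier T" and y: "\<eta> \<in> carrier T"
  shows "rho (\<lambda>w q. \<xi> w q + z * \<eta> w q) N q = rho \<xi> N q + z * rho \<eta> N q"
proof -
  let ?B = "{w. \<xi> w \<noteq> (\<lambda>_. 0)} \<union> {w. \<eta> w \<noteq> (\<lambda>_. 0)}"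
  have B: "finite ?B" using T_D(1) x y by blast
  have "rho (\<lambda>w q. \<xi> w q + z * \<eta> w q) N q =
      (\<Sum>w\<in>?B. if charge_sum w = N then P w (\<lambda>q. \<xi> w q + z * \<eta> w q) q else 0)"
    by (rule rho_eq[OF B]) auto
  also have "\<dots> = (\<Sum>w\<in>?B. (if charge_sum w = N then P w (\<xi> w) q else 0) +
      z * (if charge_sum w = N then P w (\<eta> w) q else 0))"
    by (intro sum.cong refl) (simp add: opP_lincomb[OF U T_D(2)[OF x] T_D(2)[OF y]])
  also have "\<dots> = rho \<xi> N q + z * rho \<eta> N q"
    by (simp add: sum.distrib sum_distrib_left rho_eq[OF B, of \<xi>] rho_eq[OF B, of \<eta>])
  finally show ?thesis .
qed

lemma rho_zero: "rho (\<lambda>w q. 0) N q = 0"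
  by (simp add: rho_def)

lemma rho_tens: "rho (tens w h) N q = (if charge_sum w = N then P w h q else 0)"
proof -
  have t: "tens w h v = (if v = w then h else (\<lambda>_. 0))" for v by (simp add: tens_def)
  have "rho (tens w h) N q = (\<Sum>v\<in>{w}. if charge_sum v = N then P v (tens w h v) q else 0)"
    by (rule rho_eq) (auto simp: t split: if_splits)
  then show ?thesis by (simp add: t)
qed

lemma rho_sum:
  assumes "finite B" "\<And>b. b \<in> B \<Longrightarrow> \<xi> b \<in> carrier T"
  shows "(\<lambda>w q. \<Sum>b\<in>B. z b * \<xi> b w q) \<in> carrier T"
    "rho (\<lambda>w q. \<Sum>b\<in>B. z b * \<xi> b w q) N q = (\<Sum>b\<in>B. z b * rho (\<xi> b) N q)"
  using assms
proof (induction B)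
  case empty
  { case 1 show ?case using lsubD(2)[OF vT lsub_carrier[OF vT]] by (simp add: pretensor_simps(2)) }
  { case 2 show ?case by (simp add: rho_zero) }
next
  case (insert b B)
  note D = lsubD[OF vT lsub_carrier[OF vT]]
  have eq: "(\<lambda>w q. \<Sum>b\<in>insert b B. z b * \<xi> b w q) = (\<lambda>w q. (\<Sum>b\<in>B. z b * \<xi> b w q) + z b * \<xi> b w q)"
    using insert.hyps by (simp add: add.commute)
  { case 1
    then show ?case
      unfolding eq using D(3)[OF insert.IH(1) D(4), of "\<xi> b" "z b"] by (simp add: pretensor_simps(3,4)) }
  { case 2
    then show ?case
      unfolding eq using insert rho_lincomb[OF insert.IH(1), of "\<xi> b" "z b" N q] by (simp add: add.commute) }
qed

definition kerT :: "(charge list \<Rightarrow> 'm \<Rightarrow> complex) set" where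
  "kerT = {\<xi> \<in> carrier T. \<forall>N q. rho \<xi> N q = 0}"

lemma lsub_kerT: "lsub kerT T"
proof (rule lsubI[OF vT])
  note D = lsubD[OF vT lsub_carrier[OF vT]]
  show "\<zero>\<^bsub>T\<^esub> \<in> kerT" using D(2) by (simp add: kerT_def pretensor_simps(2) rho_zero)
  fix x y a assume x: "x \<in> kerT"
  have xc: "x \<in> carrier T" using x by (simp add: kerT_def)
  show "a \<odot>\<^bsub>T\<^esub> x \<in> kerT"
    using x D(4)[OF xc, of a] rho_lincomb[OF D(2) xc, of a]
    by (simp add: kerT_def pretensor_simps(2,4) rho_zero)
  assume y: "y \<in> kerT"
  then have yc: "y \<in> carrier T" by (simp add: kerT_def)
  show "x \<oplus>\<^bsub>T\<^esub> y \<in> kerT"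
    using x y D(3)[OF xc yc] rho_lincomb[OF xc yc, of 1] by (simp add: kerT_def pretensor_simps(3))
qed (auto simp: kerT_def)

text \<open>A prefixed sign acts on the component of charge \<open>M\<close> either trivially or by
  \<open>Lap\<close> plus a constant, in both cases linearly, so vanishing components stay
  zero.\<close>

lemma hmul_kerT:
  assumes "\<xi> \<in> kerT"
  shows "hmul T j \<xi> \<in> kerT"
proof -
  have x: "\<xi> \<in> carrier T" and z: "\<And>N q. rho \<xi> N q = 0" using assms by (auto simp: kerT_def)
  let ?B = "{w. \<xi> w \<noteq> (\<lambda>_. 0)}"
  have B: "finite ?B" by (rule T_D(1)[OF x])
  have sm: "P w (\<xi> w) \<in> smooth_fun A U" for w by (rule opP_smooth_fun[OF U T_D(2)[OF x]])
  have "rho (hmul T j \<xi>) N q = 0" for N q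
  proof -
    define M where "M = N - cval j"
    have "rho (hmul T j \<xi>) N q = (\<Sum>w\<in>(\<lambda>w. j # w) ` ?B. if charge_sum w = N then P w (hmul T j \<xi> w) q else 0)"
      by (rule rho_eq) (use B in \<open>auto simp: pretensor_simps(5) split: list.splits if_splits\<close>)
    also have "\<dots> = (\<Sum>w\<in>?B. if charge_sum w = M then P (j # w) (\<xi> w) q else 0)"
      by (subst sum.reindex) (auto simp: pretensor_simps(5) M_def intro!: sum.cong)
    also have "\<dots> = 0"
    proof (cases "\<bar>cval j + M\<bar> < \<bar>M\<bar>")
      case False
      then have "(\<Sum>w\<in>?B. if charge_sum w = M then P (j # w) (\<xi> w) q else 0) = rho \<xi> M q"
        unfolding rho_def by (intro sum.cong) auto
      then show ?thesis using z by simp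
    next
      case True
      define B' where "B' = {w \<in> ?B. charge_sum w = M}"
      have B': "finite B'" using B by (simp add: B'_def)
      have r: "(\<Sum>w\<in>B'. 1 * P w (\<xi> w) q) = 0" for q
        using z[of M q] B by (simp add: rho_def B'_def sum.If_cases Int_def)
      have L0: "Lap U (\<lambda>_. 0) = (\<lambda>_. 0)" using Lap_lincomb[OF U sf(1) sf(1), of "- 1"] by simp
      have ls: "Lap U (\<lambda>q. \<Sum>w\<in>C. 1 * h w q) = (\<lambda>q. \<Sum>w\<in>C. Lap U (h w) q)"
        if "finite C" "\<And>w. h w \<in> smooth_fun A U" for C and h :: "charge list \<Rightarrow> 'm \<Rightarrow> complex"
        using that(1)
      proof (induction C)
        case (insert c C)
        have "Lap U (\<lambda>q. (\<Sum>w\<in>C. 1 * h w q) + 1 * h c q) = (\<lambda>q. Lap U (\<lambda>q. \<Sum>w\<in>C. 1 * h w q) q + 1 * Lap U (h c) q)"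
          using that(2) by (intro Lap_lincomb[OF U] sf) auto
        then show ?case using insert by (simp add: add.commute)
      qed (simp add: L0)
      have e: "(\<lambda>q. \<Sum>w\<in>B'. 1 * P w (\<xi> w) q) = (\<lambda>_. 0)" using r by (rule ext)
      have "(\<lambda>q. \<Sum>w\<in>B'. Lap U (P w (\<xi> w)) q) = (\<lambda>_. 0)"
        unfolding ls[of B' "\<lambda>w. P w (\<xi> w)", OF B' sm, symmetric] e by (rule L0)
      then have l: "(\<Sum>w\<in>B'. Lap U (P w (\<xi> w)) q) = 0" by (rule fun_cong)
      have "(\<Sum>w\<in>?B. if charge_sum w = M then P (j # w) (\<xi> w) q else 0) =
          (\<Sum>w\<in>B'. Lap U (P w (\<xi> w)) q + of_int (\<bar>M\<bar> * (\<bar>M\<bar> - 1)) * of_real K * P w (\<xi> w) q)"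
        unfolding B'_def using B True by (subst sum.inter_filter) (auto intro!: sum.cong)
      also have "\<dots> = (\<Sum>w\<in>B'. Lap U (P w (\<xi> w)) q) + of_int (\<bar>M\<bar> * (\<bar>M\<bar> - 1)) * of_real K * (\<Sum>w\<in>B'. 1 * P w (\<xi> w) q)"
        by (simp add: sum.distrib sum_distrib_left)
      finally show ?thesis unfolding l r by simp
    qed
    finally show ?thesis .
  qed
  then show ?thesis using linopD(1)[OF linop_hmul_T x] by (simp add: kerT_def)
qed

lemma fin_lists: "finite {w :: charge list. length w = k}"
proof -
  have "finite (UNIV :: charge set)" by (simp add: UNIV_charge)
  from finite_lists_length_eq[OF this, of k] show ?thesis by simp
qed

text \<open>By \<open>section_act_eq\<close> words of nonzero charge have coefficient 0, and a word
  of charge 0 moves from the tensor factor to the function by \<open>opP_append\<close>.\<close>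

lemma Rel_kerT: "Rel \<subseteq> kerT"
proof
  fix \<zeta> assume "\<zeta> \<in> Rel"
  then obtain u k X a h where X: "X \<in> parallel_sections A G k" and h: "h \<in> smooth_fun A U"
    and a: "\<And>idx. length idx = k \<Longrightarrow> X c0 idx (coord c0 p) =
             (\<Sum>w | length w = k. a w * (\<Prod>r<k. hvec e1 e2 (w ! r) $ (idx ! r)))"
    and \<zeta>: "\<zeta> = (\<lambda>w' q. (\<Sum>w | length w = k. a w * tens (u @ w) h w' q) - tens u (section_act A G U k X h) w' q)"
    unfolding balance_rels_def by blast
  note sa = section_act_eq[OF U X h c0 on a]
  define Xh where "Xh = section_act A G U k X h"
  define P0 where "P0 w = (if charge_sum w = 0 then P w h else (\<lambda>_. 0))" for w
  have P0s: "P0 w \<in> smooth_fun A U" for w using opP_smooth_fun[OF U h] sf(1) by (simp add: P0_def)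
  have Xh: "Xh = (\<lambda>q. \<Sum>w | length w = k. a w * P0 w q)"
  proof -
    have "section_act A G U k X h = (\<lambda>q. \<Sum>w | length w = k. a w * (if charge_sum w = 0 then P w h q else 0))"
      by (rule section_act_eq(2)[OF U X h c0 on a])
    also have "\<dots> = (\<lambda>q. \<Sum>w | length w = k. a w * P0 w q)"
      by (intro ext sum.cong) (auto simp: P0_def)
    finally show ?thesis by (simp add: Xh_def)
  qed
  have Xs: "Xh \<in> smooth_fun A U" unfolding Xh by (intro sf P0s)
  note rs = rho_sum[OF fin_lists[of k], of "\<lambda>w. tens (u @ w) h" a, OF tens_T[OF h]]
  have z: "\<zeta> = (\<lambda>w' q. (\<Sum>w | length w = k. a w * tens (u @ w) h w' q) + (- 1) * tens u Xh w' q)"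
    unfolding \<zeta> Xh_def by simp
  have "\<zeta> \<in> carrier T"
    unfolding z using lsubD(3)[OF vT lsub_carrier[OF vT] rs(1) lsubD(4)[OF vT lsub_carrier[OF vT] tens_T[OF Xs]], of "- 1" u]
    by (simp add: pretensor_simps(3,4))
  moreover have "rho \<zeta> N q = 0" for N q
  proof -
    have "rho \<zeta> N q = (\<Sum>w | length w = k. a w * rho (tens (u @ w) h) N q) + (- 1) * rho (tens u Xh) N q"
      unfolding z rho_lincomb[OF rs(1) tens_T[OF Xs]] rs(2) ..
    also have "(\<Sum>w | length w = k. a w * rho (tens (u @ w) h) N q) =
        (\<Sum>w | length w = k. a w * (if charge_sum u = N then P u (P0 w) q else 0))"
    proof (intro sum.cong refl)
      fix w :: "charge list" assume "w \<in> {w. length w = k}"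
      then show "a w * rho (tens (u @ w) h) N q = a w * (if charge_sum u = N then P u (P0 w) q else 0)"
        using sa(1)[of w] by (cases "charge_sum w = 0") (auto simp: rho_tens P0_def opP_append)
    qed
    also have "\<dots> = rho (tens u Xh) N q"
      unfolding rho_tens Xh by (simp add: P_sum[OF fin_lists P0s])
    finally show ?thesis by simp
  qed
  ultimately show "\<zeta> \<in> kerT" by (simp add: kerT_def)
qed

lemma Rel_carrier: "Rel \<subseteq> carrier T"
  using Rel_kerT by (auto simp: kerT_def)

lemma lsub_R: "lsub R T"
  unfolding balance_null_def by (rule lsub_lspan[OF vT Rel_carrier])

lemma R_kerT: "R \<subseteq> kerT"
  unfolding balance_null_def by (rule lspan_least[OF lsub_kerT Rel_kerT])

text \<open>Left multiplication prolongs the prefix \<open>u\<close> of a relation and thus gives a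
  relation again.\<close>

lemma hmul_R: "x \<in> R \<Longrightarrow> hmul T j x \<in> R"
proof -
  have "R \<subseteq> {x \<in> carrier T. hmul T j x \<in> R}"
    unfolding balance_null_def
  proof (rule lspan_least[OF linop_preimage[OF vT linop_hmul_T lsub_R[unfolded balance_null_def]]], intro subsetI CollectI conjI)
    fix \<zeta> assume z: "\<zeta> \<in> Rel"
    then show "\<zeta> \<in> carrier T" using Rel_carrier by blast
    obtain u k X a h where X: "X \<in> parallel_sections A G k" and h: "h \<in> smooth_fun A U"
      and a: "\<forall>idx. length idx = k \<longrightarrow> X c0 idx (coord c0 p) =
             (\<Sum>w | length w = k. a w * (\<Prod>r<k. hvec e1 e2 (w ! r) $ (idx ! r)))"
      and \<zeta>: "\<zeta> = (\<lambda>w' q. (\<Sum>w | length w = k. a w * tens (u @ w) h w' q) - tens u (section_act A G U k X h) w' q)"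
      using z unfolding balance_rels_def by blast
    have "hmul T j \<zeta> = (\<lambda>w' q. (\<Sum>w | length w = k. a w * tens ((j # u) @ w) h w' q) - tens (j # u) (section_act A G U k X h) w' q)"
      unfolding \<zeta> by (auto simp: pretensor_simps(5) tens_def fun_eq_iff split: list.splits)
    then have "hmul T j \<zeta> \<in> Rel" unfolding balance_rels_def using X h a by blast
    then show "hmul T j \<zeta> \<in> lspan T Rel" by (rule subsetD[OF lspan_superset])
  qed
  then show "x \<in> R \<Longrightarrow> hmul T j x \<in> R" by blast
qed

abbreviation "cs x \<equiv> R +>\<^bsub>T\<^esub> x"

lemma S_simps:
  "carrier S = cs ` carrier T" "\<zero>\<^bsub>S\<^esub> = cs \<zero>\<^bsub>T\<^esub>"
  "x \<in> carrier T \<Longrightarrow> y \<in> carrier T \<Longrightarrow> cs x \<oplus>\<^bsub>S\<^esub> cs y = cs (x \<oplus>\<^bsub>T\<^esub> y)"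
  "x \<in> carrier T \<Longrightarrow> z \<odot>\<^bsub>S\<^esub> cs x = cs (z \<odot>\<^bsub>T\<^esub> x)"
  "x \<in> carrier T \<Longrightarrow> hmul S j (cs x) = cs (hmul T j x)"
  using quot_space_simps[OF vT lsub_R] quot_space_add[OF vT lsub_R] quot_space_smult[OF vT lsub_R]
    quot_map_coset[OF vT lsub_R linop_hmul_T hmul_R]
  by (simp_all add: tensor_module_def Let_def module.extend_def tmodule.fields_def)

lemma tmod_S: "tmod S"
proof -
  have q: "carrier S = carrier (quot_space T R)" "zero S = zero (quot_space T R)" "add S = add (quot_space T R)"
    "smult S = smult (quot_space T R)" "hmul S j = quot_map T R (hmul T j)" for j
    by (simp_all add: tensor_module_def Let_def module.extend_def tmodule.fields_def)
  have "vspace S" by (rule vspace_cong[OF vspace_quot_space[OF vT lsub_R] q(1-4)])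
  moreover have "linop S (hmul S j)" for j
    using linop_quot_map[OF vT lsub_R linop_hmul_T hmul_R, of j] unfolding q(5) linop_cong[OF q(1,3,4)] .
  ultimately show ?thesis by (simp add: tmod_def)
qed

text \<open>The kernel of the map that \<open>rho\<close> induces on the tensor product; as
  \<open>R\<close> lies in \<open>kerT\<close>, membership can be tested on representatives.\<close>

definition "Z = cs ` kerT"

lemma kerT_carrier: "x \<in> kerT \<Longrightarrow> x \<in> carrier T"
  by (simp add: kerT_def)

lemma lsub_Z: "lsub Z S"
proof (rule lsubI)
  show "vspace S" using tmod_S by (simp add: tmod_def)
  note D = lsubD[OF vT lsub_kerT]
  show "Z \<subseteq> carrier S" using kerT_carrier by (auto simp: Z_def S_simps(1))
  show "\<zero>\<^bsub>S\<^esub> \<in> Z" using D(2) by (auto simp: Z_def S_simps(2))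
  fix x y a assume "x \<in> Z"
  then obtain \<xi> where x: "\<xi> \<in> kerT" "x = cs \<xi>" by (auto simp: Z_def)
  show "a \<odot>\<^bsub>S\<^esub> x \<in> Z" using D(4)[OF x(1), of a] by (auto simp: Z_def x(2) S_simps(4)[OF kerT_carrier[OF x(1)]])
  assume "y \<in> Z"
  then obtain \<eta> where y: "\<eta> \<in> kerT" "y = cs \<eta>" by (auto simp: Z_def)
  show "x \<oplus>\<^bsub>S\<^esub> y \<in> Z"
    using D(3)[OF x(1) y(1)]
    by (auto simp: Z_def x(2) y(2) S_simps(3)[OF kerT_carrier[OF x(1)] kerT_carrier[OF y(1)]])
qed

lemma hmul_Z: "x \<in> Z \<Longrightarrow> hmul S j x \<in> Z"
  using hmul_kerT by (auto simp: Z_def S_simps(5)[OF kerT_carrier])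

lemma cs_Z:
  assumes "x \<in> carrier T"
  shows "cs x \<in> Z \<longleftrightarrow> x \<in> kerT"
proof
  assume "cs x \<in> Z"
  then obtain y where y: "y \<in> kerT" "cs x = cs y" by (auto simp: Z_def)
  then have "eqm T R x y" using assms kerT_carrier by (simp add: eqm_coset[OF vT lsub_R])
  then show "x \<in> kerT" using eqm_mem[OF vT lsub_R _ lsub_kerT R_kerT] y(1) by blast
qed (auto simp: Z_def)

context
  fixes f lam l
  assumes f: "eigenfunction A G U lam f" and l: "l \<noteq> (0 :: complex)"
    and gen: "\<And>q::nat. q \<ge> 1 \<Longrightarrow> lam \<noteq> of_nat q * (of_nat q - 1) * complex_of_real K"
begin

lemma f_smooth: "f \<in> smooth_fun A U"
  using f by (simp add: eigenfunction_def)

lemma P_f: "P w f = (\<lambda>q. Ccoef K lam w * f q)"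
proof (rule opP_eigen)
  have "Lap U f q = - lam * f q" for q
  proof (cases "q \<in> U")
    case True
    then have "- laplace (G (ch q)) (f \<circ> cinv (ch q)) (coord (ch q) q) = lam * f q"
      using f ch[of q] unfolding eigenfunction_def by blast
    then show ?thesis using True by (simp add: Lap_def minus_equation_iff)
  next
    case False
    then show ?thesis using smooth_funD(2)[OF f_smooth] by (simp add: Lap_def)
  qed
  moreover have "Lap U (\<lambda>q. z * f q) = (\<lambda>q. z * Lap U f q)" for z
    using Lap_lincomb[OF U sf(1) f_smooth, of z] Lap_lincomb[OF U sf(1) sf(1), of "- 1"] by simp
  ultimately show "Lap U (\<lambda>q. z * f q) = (\<lambda>q. z * (- lam * f q))" for z by simp
qed

lemma zact_S: "zact S (one_tensor A G c0 p e1 e2 U f) z = cs (tens z f)"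
proof (induction z)
  case Nil then show ?case by (simp add: zact_def one_tensor_def)
next
  case (Cons j z)
  then show ?case by (simp add: zact_def S_simps(5)[OF tens_T[OF f_smooth]] hmul_tens)
qed

text \<open>What remains are the conditions on \<open>Z\<close>: the image of \<open>s\<close> at
  charge 0 is \<open>f\<close> itself, which is nonzero, and the image of a word applied to
  \<open>f\<close> is \<open>Ccoef K lam z\<close> times that of its normal word, since
  \<open>f\<close> is an eigenfunction.\<close>

lemma irreducible: "irreducible_module (VU2 l S (one_tensor A G c0 p e1 e2 U f) K lam)"
proof (rule irr.irreducible_VU2, intro irr.intro fock.intro irr_axioms.intro)
  let ?s = "one_tensor A G c0 p e1 e2 U f"
  have s: "?s = cs (tens [] f)" by (simp add: one_tensor_def)
  show "tmod S" by (rule tmod_S)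
  show "?s \<in> carrier S" unfolding s S_simps(1) using tens_T[OF f_smooth] by blast
  show "lsub Z S" "\<And>j x. x \<in> Z \<Longrightarrow> hmul S j x \<in> Z" by (rule lsub_Z hmul_Z; assumption)+
  obtain q where q: "f q \<noteq> 0" using f by (auto simp: eigenfunction_def)
  have "rho (tens [] f) 0 q \<noteq> 0" using q by (simp add: rho_tens)
  then show "?s \<notin> Z" unfolding s cs_Z[OF tens_T[OF f_smooth]] by (auto simp: kerT_def)
  show "l \<noteq> 0" by (rule l)
  show "\<And>q::nat. q \<ge> 1 \<Longrightarrow> lam \<noteq> of_nat q * (of_nat q - 1) * complex_of_real K" by (rule gen)
  fix z
  note D = lsubD[OF vT lsub_carrier[OF vT]]
  have vS: "vspace S" using tmod_S by (simp add: tmod_def)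
  have t: "tens w f \<in> carrier T" for w by (rule tens_T[OF f_smooth])
  let ?\<xi> = "tens z f \<oplus>\<^bsub>T\<^esub> (- Ccoef K lam z) \<odot>\<^bsub>T\<^esub> tens (normal_word z) f"
  have c: "Ccoef K lam z \<odot>\<^bsub>T\<^esub> tens (normal_word z) f \<in> carrier T" by (rule D(4)[OF t])
  have "zact S ?s z \<ominus>\<^bsub>S\<^esub> Ccoef K lam z \<odot>\<^bsub>S\<^esub> zact S ?s (normal_word z) =
      cs (tens z f) \<oplus>\<^bsub>S\<^esub> (- 1) \<odot>\<^bsub>S\<^esub> cs (Ccoef K lam z \<odot>\<^bsub>T\<^esub> tens (normal_word z) f)"
    unfolding zact_S S_simps(4)[OF t] using c by (simp add: a_minus_def vspace_uminus[OF vS] S_simps(1))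
  also have "\<dots> = cs ?\<xi>"
    unfolding S_simps(4)[OF c] S_simps(3)[OF t D(4)[OF c]] by (simp add: pretensor_simps(4) mult.assoc)
  finally have 1: "zact S ?s z \<ominus>\<^bsub>S\<^esub> Ccoef K lam z \<odot>\<^bsub>S\<^esub> zact S ?s (normal_word z) = cs ?\<xi>" .
  have xc: "?\<xi> \<in> carrier T" by (rule D(3)[OF t D(4)[OF t]])
  have "rho ?\<xi> N q = 0" for N q
    using rho_lincomb[OF t t, of z "- Ccoef K lam z" "normal_word z" N q]
    by (simp add: pretensor_simps(3,4) rho_tens P_f[of z] opP_nw normal_word_nw)
  then have "?\<xi> \<in> kerT" using xc by (simp add: kerT_def)
  then show "zact S ?s z \<ominus>\<^bsub>S\<^esub> Ccoef K lam z \<odot>\<^bsub>S\<^esub> zact S ?s (normal_word z) \<in> Z"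
    unfolding 1 cs_Z[OF xc] .
qed

end

end

theorem theorem5p16:
  fixes A :: "'m::{t2_space,second_countable_topology} chart set"
    and G :: "'m chart \<Rightarrow> real^2 \<Rightarrow> real^2^2"
    and K :: real and c0 :: "'m chart" and p :: 'm and e1 e2 :: "real^2"
    and U :: "'m set" and l lam :: complex and f :: "'m \<Rightarrow> complex"
  assumes "riemannian_surface A G"
    and "connected (UNIV :: 'm set)"
    and "complete_surface A G"
    and "orientable A"
    and "constant_curvature A G K" and "K \<noteq> 0"
    and "c0 \<in> A" and "p \<in> cdom c0"
    and "gdot (G c0) (coord c0 p) e1 e1 = 1"
    and "gdot (G c0) (coord c0 p) e2 e2 = 1"
    and "gdot (G c0) (coord c0 p) e1 e2 = 0"
    and "open U" and "l \<noteq> 0"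
    and "eigenfunction A G U lam f"
    and "\<And>q::nat. q \<ge> 1 \<Longrightarrow> lam \<noteq> of_nat q * (of_nat q - 1) * complex_of_real K"
  shows "irreducible_module
    (VU2 l (tensor_module A G c0 p e1 e2 U) (one_tensor A G c0 p e1 e2 U f) K lam)"
proof -
  interpret surf_base A G K c0 p e1 e2 U
    using assms by (simp add: surf_base_def surf_base_axioms_def surf_def surf_axioms_def)
  show ?thesis by (rule irreducible) (use assms in auto)
qed

end
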